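(* Let $\lambda>0$ be any positive constant and let $a(x,t)$, $x\in[0,1]$, $t\in[0,1)$, be continuous in $x$ and analytic in $t$ uniformly in $x$. Let $\Omega=\{(x,y):0\le y\le x\le 1\}$ and let $k=k(x,y,t)$, $(x,y)\in\Omega$, $t\in[0,1)$, be the solution, twice continuously differentiable in $x,y$ and analytic in $t$, of the kernel problem $$\begin{cases} k_{xx}(x,y,t)-k_{yy}(x,y,t)-k_t(x,y,t)=(a(y,t)+\lambda)\,k(x,y,t), & (x,y)\in\Omega,\\ k(x,0,t)=0, & x\in[0,1],\\ k_x(x,x,t)+k_y(x,x,t)+\frac{d}{dx}\big(k(x,x,t)\big)=a(x,t)+\lambda, & x\in[0,1].\end{cases}$$ Consider the system $$u_t(x,t)=u_{xx}(x,t)+a(x,t)u(x,t),\qquad u(0,t)=0,\qquad u(x,0)=u^0(x),\qquad x\in(0,1),$$ closed by one of the two boundary feedback laws (D) $\ u(1,t)=-\int_0^1 k(1,y,t)\,u(y,t)\,dy$, or (N) $\ u_x(1,t)=-k(1,1,t)\,u(1,t)-\int_0^1 k_x(1,y,t)\,u(y,t)\,dy$. Let $t_0<1$, $t_0>0$. Then there is a constant $M>0$, independent of $u^0$, such that for every $u^0\in H^1(0,1)$ satisfying the corresponding compatibility condition, namely for (D): $\ u^0(0)=0$ and $u^0(1)=-\int_0^1 k(1,y,0)\,u^0(y)\,dy$, for (N): $\ u^0(0)=0$ and $u^0_x(1)=-k(1,1,0)\,u^0(1)-\int_0^1 k_x(1,y,0)\,u^0(y)\,dy$, the system with the feedback law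 (D), respectively (N), has a unique solution $u$ on $(0,t_0)$, and it satisfies $$\|u(t)\|_{H^1}\le M\,\|u^0\|_{H^1}\,e^{-\lambda t},\qquad t\in(0,t_0).$$
   Context: "Analytic in $t$ uniformly in $x$" means: $a(x,t)=\sum_{n\ge 0}a_n(x)t^n$ for $t\in[0,1)$, with $a_n$ continuous on $[0,1]$ and a constant $C$ such that $|a_n(x)|\le C$ for all $n$ and all $x\in[0,1]$. The kernel problem is posed for all $t\in[0,1)$. The paper quotes from Colton that it has a unique solution $k$ twice continuously differentiable in $x,y$; the solution is understood to be of the form $k(x,y,t)=\sum_{n\ge0}k_n(x,y)t^n$ with $k_n\in C^2(\Omega)$ and the series converging in $C^2(\Omega)$ for every $t\in[0,1)$. The kernel may be unbounded as $t\to1^-$. $\|u(t)\|_{H^1}$ is the $H^1(0,1)$ norm in the space variable $x$ of $u(\cdot,t)$. A solution on $(0,t_0)$ is understood in the standard strong parabolic sense: $u\in C([0,t_0];H^1(0,1))\cap L^2(0,t_0;H^2(0,1))\cap H^1(0,t_0;L^2(0,1))$, with the equation holding a.e. and the boundary conditions for a.e. $t$ in the sense of traces. A compatibility condition involving $u^0_x$ at an endpoint includes the requirement that this derivative exists. *)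

theory Defs
  imports "HOL-Analysis.Analysis"
begin

section \<open>Lebesgue and Sobolev spaces on an interval\<close>

abbreviation leb :: "real \<Rightarrow> real \<Rightarrow> real measure" where
  "leb c d \<equiv> lebesgue_on {c<..<d}"

definition L2_space :: "(real \<Rightarrow> real) set" where
  "L2_space = {f. f \<in> borel_measurable (leb 0 1) \<and> integrable (leb 0 1) (\<lambda>x. (f x)\<^sup>2)}"

definition L2_norm :: "(real \<Rightarrow> real) \<Rightarrow> real" where
  "L2_norm f = sqrt (\<integral>x. (f x)\<^sup>2 \<partial>leb 0 1)"

text \<open>A test function of class \<open>C\<^sup>1\<close> with compact support in \<open>(c, d)\<close>, together with its derivative.\<close>

definition test_function :: "real \<Rightarrow> real \<Rightarrow> (real \<Rightarrow> real) \<Rightarrow> (real \<Rightarrow> real) \<Rightarrow> bool" where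
  "test_function c d \<phi> \<phi>' \<longleftrightarrow>
     (\<forall>x. (\<phi> has_real_derivative \<phi>' x) (at x)) \<and> continuous_on UNIV \<phi>' \<and>
     (\<exists>p q. c < p \<and> q < d \<and> (\<forall>x. x \<notin> {p..q} \<longrightarrow> \<phi> x = 0))"

definition weak_deriv :: "(real \<Rightarrow> real) \<Rightarrow> (real \<Rightarrow> real) \<Rightarrow> bool" where
  "weak_deriv f g \<longleftrightarrow> f \<in> L2_space \<and> g \<in> L2_space \<and>
     (\<forall>\<phi> \<phi>'. test_function 0 1 \<phi> \<phi>' \<longrightarrow>
        (\<integral>x. f x * \<phi>' x \<partial>leb 0 1) = - (\<integral>x. g x * \<phi> x \<partial>leb 0 1))"

text \<open>The weak derivative is determined up to a null set only; \<open>wderiv f\<close> is some version of it.\<close>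

definition wderiv :: "(real \<Rightarrow> real) \<Rightarrow> (real \<Rightarrow> real)" where
  "wderiv f = (SOME g. weak_deriv f g)"

text \<open>
  An element of \<open>H\<^sup>1(0,1)\<close> is identified with its continuous representative on \<open>[0,1]\<close>, so that
  \<open>f 0\<close> and \<open>f 1\<close> are its traces. Values outside \<open>[0,1]\<close> are irrelevant.
\<close>

definition H1_space :: "(real \<Rightarrow> real) set" where
  "H1_space = {f. continuous_on {0..1} f \<and> (\<exists>g. weak_deriv f g)}"

definition H1_norm :: "(real \<Rightarrow> real) \<Rightarrow> real" where
  "H1_norm f = sqrt ((L2_norm f)\<^sup>2 + (L2_norm (wderiv f))\<^sup>2)"

definition H2_space :: "(real \<Rightarrow> real) set" where
  "H2_space = {f \<in> H1_space. \<exists>g \<in> H1_space. weak_deriv f g}"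

definition H2_norm :: "(real \<Rightarrow> real) \<Rightarrow> real" where
  "H2_norm f = sqrt ((L2_norm f)\<^sup>2 + (L2_norm (wderiv f))\<^sup>2 + (L2_norm (wderiv (wderiv f)))\<^sup>2)"

text \<open>
  Trace at an end point \<open>e\<close> of a function known only up to null sets (used for the version
  \<open>wderiv f\<close> of the derivative of some \<open>f\<close> in \<open>H\<^sup>2(0,1)\<close>): the value of its continuous representative.
\<close>

definition has_trace :: "(real \<Rightarrow> real) \<Rightarrow> real \<Rightarrow> real \<Rightarrow> bool" where
  "has_trace f e v \<longleftrightarrow>
     (\<exists>g. continuous_on {0..1} g \<and> (AE x in leb 0 1. f x = g x) \<and> g e = v)"

section \<open>Functions of time with values in a space of functions of \<open>x\<close>\<close>

text \<open>
  \<open>X\<close> is one of the spaces above and \<open>N\<close> its norm. These are not types, so the library's Bochner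
  integral, whose definition is followed here, does not apply.
\<close>

definition strongly_measurable ::
  "real measure \<Rightarrow> (real \<Rightarrow> real) set \<Rightarrow> ((real \<Rightarrow> real) \<Rightarrow> real) \<Rightarrow> (real \<Rightarrow> real \<Rightarrow> real) \<Rightarrow> bool" where
  "strongly_measurable M X N f \<longleftrightarrow>
     (\<exists>s. (\<forall>n::nat. simple_function M (s n) \<and> s n ` space M \<subseteq> X) \<and>
          (AE t in M. f t \<in> X \<and> (\<lambda>n. N (\<lambda>x. f t x - s n t x)) \<longlonglongrightarrow> 0))"

definition Bochner_L2 ::
  "real measure \<Rightarrow> (real \<Rightarrow> real) set \<Rightarrow> ((real \<Rightarrow> real) \<Rightarrow> real) \<Rightarrow> (real \<Rightarrow> real \<Rightarrow> real) \<Rightarrow> bool" where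
  "Bochner_L2 M X N f \<longleftrightarrow> strongly_measurable M X N f \<and> integrable M (\<lambda>t. (N (f t))\<^sup>2)"

definition simple_integral_in :: "real measure \<Rightarrow> (real \<Rightarrow> real \<Rightarrow> real) \<Rightarrow> (real \<Rightarrow> real)" where
  "simple_integral_in M s = (\<lambda>x. \<Sum>y\<in>s ` space M. measure M (s -` {y} \<inter> space M) * y x)"

text \<open>Only used for finite measures \<open>M\<close>, for which all simple functions are integrable.\<close>

definition has_Bochner_integral_in ::
  "real measure \<Rightarrow> (real \<Rightarrow> real) set \<Rightarrow> ((real \<Rightarrow> real) \<Rightarrow> real) \<Rightarrow> (real \<Rightarrow> real \<Rightarrow> real) \<Rightarrow>
   (real \<Rightarrow> real) \<Rightarrow> bool" where
  "has_Bochner_integral_in M X N f w \<longleftrightarrow> strongly_measurable M X N f \<and> w \<in> X \<and>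
     (\<exists>s. (\<forall>n::nat. simple_function M (s n) \<and> s n ` space M \<subseteq> X) \<and>
          (\<lambda>n. \<integral>\<^sup>+t. ennreal (N (\<lambda>x. f t x - s n t x)) \<partial>M) \<longlonglongrightarrow> 0 \<and>
          (\<lambda>n. N (\<lambda>x. simple_integral_in M (s n) x - w x)) \<longlonglongrightarrow> 0)"

definition C_H1 :: "real \<Rightarrow> (real \<Rightarrow> real \<Rightarrow> real) \<Rightarrow> bool" where
  "C_H1 t\<^sub>0 u \<longleftrightarrow> (\<forall>t\<in>{0..t\<^sub>0}. u t \<in> H1_space) \<and>
     (\<forall>s\<in>{0..t\<^sub>0}. ((\<lambda>t. H1_norm (\<lambda>x. u t x - u s x)) \<longlongrightarrow> 0) (at s within {0..t\<^sub>0}))"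

definition L2_H2 :: "real \<Rightarrow> (real \<Rightarrow> real \<Rightarrow> real) \<Rightarrow> bool" where
  "L2_H2 t\<^sub>0 u \<longleftrightarrow> Bochner_L2 (leb 0 t\<^sub>0) H2_space H2_norm u"

definition L2_L2 :: "real \<Rightarrow> (real \<Rightarrow> real \<Rightarrow> real) \<Rightarrow> bool" where
  "L2_L2 t\<^sub>0 u \<longleftrightarrow> Bochner_L2 (leb 0 t\<^sub>0) L2_space L2_norm u"

text \<open>\<open>u\<close> is in \<open>H\<^sup>1(0,t\<^sub>0;L\<^sup>2(0,1))\<close>, with derivative \<open>v\<close>.\<close>

definition time_weak_deriv ::
  "real \<Rightarrow> (real \<Rightarrow> real \<Rightarrow> real) \<Rightarrow> (real \<Rightarrow> real \<Rightarrow> real) \<Rightarrow> bool" where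
  "time_weak_deriv t\<^sub>0 u v \<longleftrightarrow> L2_L2 t\<^sub>0 u \<and> L2_L2 t\<^sub>0 v \<and>
     (\<forall>\<phi> \<phi>'. test_function 0 t\<^sub>0 \<phi> \<phi>' \<longrightarrow>
        (\<exists>w. has_Bochner_integral_in (leb 0 t\<^sub>0) L2_space L2_norm (\<lambda>t x. \<phi>' t * u t x) w \<and>
             has_Bochner_integral_in (leb 0 t\<^sub>0) L2_space L2_norm (\<lambda>t x. \<phi> t * v t x) (\<lambda>x. - w x)))"

section \<open>The kernel problem\<close>

definition \<Omega> :: "(real \<times> real) set" where
  "\<Omega> = {(x, y). 0 \<le> y \<and> y \<le> x \<and> x \<le> 1}"

text \<open>
  Partial derivatives relative to the closed set \<open>S\<close>. On \<open>\<Omega>\<close>, which is convex with nonempty interior,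
  the derivative within \<open>\<Omega>\<close> is unique also at boundary points and corners, although a corner need
  not be approachable within \<open>\<Omega>\<close> along the coordinate directions.
\<close>

definition D1 :: "(real \<times> real) set \<Rightarrow> (real \<times> real \<Rightarrow> real) \<Rightarrow> (real \<times> real \<Rightarrow> real)" where
  "D1 S f = (\<lambda>p. frechet_derivative f (at p within S) (1, 0))"

definition D2 :: "(real \<times> real) set \<Rightarrow> (real \<times> real \<Rightarrow> real) \<Rightarrow> (real \<times> real \<Rightarrow> real)" where
  "D2 S f = (\<lambda>p. frechet_derivative f (at p within S) (0, 1))"

definition C1_on :: "(real \<times> real) set \<Rightarrow> (real \<times> real \<Rightarrow> real) \<Rightarrow> bool" where
  "C1_on S f \<longleftrightarrow> f differentiable_on S \<and> continuous_on S (D1 S f) \<and> continuous_on S (D2 S f)"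

definition C2_on :: "(real \<times> real) set \<Rightarrow> (real \<times> real \<Rightarrow> real) \<Rightarrow> bool" where
  "C2_on S f \<longleftrightarrow> C1_on S f \<and> C1_on S (D1 S f) \<and> C1_on S (D2 S f)"

definition C2_tendsto ::
  "(real \<times> real) set \<Rightarrow> (nat \<Rightarrow> real \<times> real \<Rightarrow> real) \<Rightarrow> (real \<times> real \<Rightarrow> real) \<Rightarrow> bool" where
  "C2_tendsto S F f \<longleftrightarrow> (\<forall>n. C2_on S (F n)) \<and> C2_on S f \<and>
     (\<forall>D\<in>{id, D1 S, D2 S, D1 S \<circ> D1 S, D1 S \<circ> D2 S, D2 S \<circ> D1 S, D2 S \<circ> D2 S}.
        uniform_limit S (\<lambda>n. D (F n)) (D f) sequentially)"

definition analytic_coefficient :: "(real \<Rightarrow> real \<Rightarrow> real) \<Rightarrow> bool" where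
  "analytic_coefficient a \<longleftrightarrow>
     (\<forall>t\<in>{0..<1}. continuous_on {0..1} (\<lambda>x. a x t)) \<and>
     (\<exists>A C. (\<forall>n::nat. continuous_on {0..1} (A n)) \<and>
            (\<forall>n. \<forall>x\<in>{0..1}. \<bar>A n x\<bar> \<le> C) \<and>
            (\<forall>x\<in>{0..1}. \<forall>t\<in>{0..<1}. (\<lambda>n. A n x * t ^ n) sums a x t))"

definition kernel_at :: "(real \<Rightarrow> real \<Rightarrow> real \<Rightarrow> real) \<Rightarrow> real \<Rightarrow> (real \<times> real \<Rightarrow> real)" where
  "kernel_at k t = (\<lambda>(x, y). k x y t)"

definition analytic_C2_kernel :: "(real \<Rightarrow> real \<Rightarrow> real \<Rightarrow> real) \<Rightarrow> bool" where
  "analytic_C2_kernel k \<longleftrightarrow>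
     (\<exists>K. (\<forall>n::nat. C2_on \<Omega> (K n)) \<and>
          (\<forall>t\<in>{0..<1}. C2_tendsto \<Omega> (\<lambda>m p. \<Sum>n<m. K n p * t ^ n) (kernel_at k t)))"

definition kernel_solution ::
  "real \<Rightarrow> (real \<Rightarrow> real \<Rightarrow> real) \<Rightarrow> (real \<Rightarrow> real \<Rightarrow> real \<Rightarrow> real) \<Rightarrow> bool" where
  "kernel_solution lam a k \<longleftrightarrow> analytic_C2_kernel k \<and>
     (\<forall>t\<in>{0..<1}. \<forall>(x, y)\<in>\<Omega>. \<exists>k_t.
        ((\<lambda>s. k x y s) has_real_derivative k_t) (at t within {0..<1}) \<and>
        D1 \<Omega> (D1 \<Omega> (kernel_at k t)) (x, y) - D2 \<Omega> (D2 \<Omega> (kernel_at k t)) (x, y) - k_t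
          = (a y t + lam) * k x y t) \<and>
     (\<forall>t\<in>{0..<1}. \<forall>x\<in>{0..1}. k x 0 t = 0) \<and>
     (\<forall>t\<in>{0..<1}. \<forall>x\<in>{0..1}. \<exists>d.
        ((\<lambda>z. k z z t) has_real_derivative d) (at x within {0..1}) \<and>
        D1 \<Omega> (kernel_at k t) (x, x) + D2 \<Omega> (kernel_at k t) (x, x) + d = a x t + lam)"

section \<open>The closed-loop system\<close>

datatype feedback = Dirichlet | Neumann

definition dirichlet_feedback ::
  "(real \<Rightarrow> real \<Rightarrow> real \<Rightarrow> real) \<Rightarrow> real \<Rightarrow> (real \<Rightarrow> real) \<Rightarrow> real" where
  "dirichlet_feedback k t f = - integral {0..1} (\<lambda>y. k 1 y t * f y)"

definition neumann_feedback ::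
  "(real \<Rightarrow> real \<Rightarrow> real \<Rightarrow> real) \<Rightarrow> real \<Rightarrow> (real \<Rightarrow> real) \<Rightarrow> real" where
  "neumann_feedback k t f =
     - k 1 1 t * f 1 - integral {0..1} (\<lambda>y. D1 \<Omega> (kernel_at k t) (1, y) * f y)"

fun feedback_law ::
  "feedback \<Rightarrow> (real \<Rightarrow> real \<Rightarrow> real \<Rightarrow> real) \<Rightarrow> real \<Rightarrow> (real \<Rightarrow> real) \<Rightarrow> bool" where
  "feedback_law Dirichlet k t f \<longleftrightarrow> f 1 = dirichlet_feedback k t f"
| "feedback_law Neumann k t f \<longleftrightarrow> has_trace (wderiv f) 1 (neumann_feedback k t f)"

text \<open>
  For Neumann feedback the initial value need not be in \<open>H\<^sup>2(0,1)\<close>; the compatibility condition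
  asks for the existence of its classical (one-sided) derivative at \<open>1\<close>.
\<close>

fun compatible ::
  "feedback \<Rightarrow> (real \<Rightarrow> real \<Rightarrow> real \<Rightarrow> real) \<Rightarrow> (real \<Rightarrow> real) \<Rightarrow> bool" where
  "compatible Dirichlet k f \<longleftrightarrow> f 0 = 0 \<and> f 1 = dirichlet_feedback k 0 f"
| "compatible Neumann k f \<longleftrightarrow> f 0 = 0 \<and>
     (f has_real_derivative neumann_feedback k 0 f) (at 1 within {0..1})"

text \<open>The unknown is written with the time argument first: \<open>u t x\<close> is \<open>u(x,t)\<close>.\<close>

definition closed_loop_solution ::
  "feedback \<Rightarrow> (real \<Rightarrow> real \<Rightarrow> real) \<Rightarrow> (real \<Rightarrow> real \<Rightarrow> real \<Rightarrow> real) \<Rightarrow> real \<Rightarrow>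
   (real \<Rightarrow> real) \<Rightarrow> (real \<Rightarrow> real \<Rightarrow> real) \<Rightarrow> bool" where
  "closed_loop_solution law a k t\<^sub>0 u\<^sub>0 u \<longleftrightarrow>
     C_H1 t\<^sub>0 u \<and> L2_H2 t\<^sub>0 u \<and>
     (\<exists>u_t. time_weak_deriv t\<^sub>0 u u_t \<and>
        (AE t in leb 0 t\<^sub>0. AE x in leb 0 1.
           u_t t x = wderiv (wderiv (u t)) x + a x t * u t x)) \<and>
     (AE t in leb 0 t\<^sub>0. u t 0 = 0 \<and> feedback_law law k t (u t)) \<and>
     (\<forall>x\<in>{0..1}. u 0 x = u\<^sub>0 x)"

end

theory Submission
  imports Defs
begin

text \<open>
  The Volterra transformation \<open>w = u + \<integral>\<^sub>0\<^sup>x k(x,y,t) u(y,t) dy\<close> turns the closed loop into the damped heat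
  equation \<open>w\<^sub>t = w\<^sub>x\<^sub>x - \<lambda> w\<close> with \<open>w(0,t) = 0\<close> and \<open>w(1,t) = 0\<close> (or \<open>w\<^sub>x(1,t) = 0\<close>): the kernel problem makes
  all other terms cancel. The target system is solved by its sine series, which gives the decay
  \<open>exp (- \<lambda> t)\<close> of \<open>w\<^sub>x\<close> in \<open>L\<^sup>2\<close>, and \<open>u\<close> is recovered from \<open>w\<close> by solving the Volterra equation, with
  bounds that are uniform on \<open>[0,t\<^sub>0]\<close>. Uniqueness is by duality: testing a strong solution with the
  adjoint transform \<open>\<psi>(y,t) = \<phi>(y) + \<integral>\<^sub>y\<^sup>1 k(x,y,t) \<phi>(x) dx\<close> of an eigenfunction \<open>\<phi>\<close> of the target system
  yields a scalar equation for \<open>\<integral> u \<psi>\<close>, so the initial value determines these moments. They are the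
  sine coefficients of \<open>w\<close>, hence they determine \<open>w\<close> and \<open>u\<close>. Expanding \<open>k\<close> in powers of \<open>t\<close> reduces the
  time-dependent test function to products of functions of \<open>t\<close> and of \<open>y\<close>.
\<close>

section \<open>Square integrable functions on the unit interval\<close>

text \<open>The final constant is built from a single bound \<open>B\<close> for the kernel and its
  derivatives on \<open>[0,t0]\<close> and from the Gronwall factor \<open>exp B\<close>. Such a
  bound exists by compactness because \<open>t0 < 1\<close>, and it does not see the initial value.
  The target system is expanded through the cosine coefficients of the derivative w_x. For data in
  H^1 this derivative is merely in L^2 at time 0, and working with it yields at once the decay in
  H^1, the strong continuity at t = 0 and the square integrability of w_xx in time. No inverse
  kernel is constructed: u is the solution of a Volterra equation at each time, its space
  derivatives are identified by Leibniz's rule, and its time derivative by a Gronwall estimate for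
  difference quotients. Transforming an arbitrary strong solution would mean differentiating the
  integral of k u although u_t is only an L^2-valued weak derivative. This is why uniqueness goes
  through the adjoint, which puts all derivatives on smooth functions.\<close>

lemma emeasure_leb_space: "emeasure (leb c d) (space (leb c d)) \<noteq> \<infinity>"
proof -
  have "emeasure (leb c d) (space (leb c d)) = emeasure lborel {c<..<d}"
    by (simp add: emeasure_restrict_space)
  also have "\<dots> \<noteq> \<infinity>"
    by (cases "c \<le> d") auto
  finally show ?thesis .
qed

lemma finite_leb: "finite_measure (leb c d)"
  by (rule finite_measureI) (rule emeasure_leb_space)

lemma measure_leb_space: "c \<le> d \<Longrightarrow> measure (leb c d) {c<..<d} = d - c"
  by (simp add: measure_restrict_space)

lemma leb_const_integrable [simp]: "integrable (leb c d) (\<lambda>_. b :: real)"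
  by (rule finite_measure.integrable_const[OF finite_leb])

lemma leb_const_integral: "c \<le> d \<Longrightarrow> integral\<^sup>L (leb c d) (\<lambda>_. b :: real) = b * (d - c)"
  by (simp add: measure_leb_space del: measure_restrict_space)

lemma continuous_leb_integrable:
  assumes "continuous_on {c..d} (f::real \<Rightarrow> real)"
  shows "integrable (leb c d) f"
proof -
  have "f absolutely_integrable_on {c..d}"
    by (rule absolutely_integrable_continuous_real[OF assms])
  then have "f absolutely_integrable_on {c<..<d}"
    by (rule set_integrable_subset) auto
  then show ?thesis
    by (simp add: set_integrable_def integrable_restrict_space)
qed

lemma continuous_leb_integral:
  assumes "continuous_on {c..d} (f::real \<Rightarrow> real)"
  shows "integral\<^sup>L (leb c d) f = integral {c..d} f"
  using lebesgue_integral_eq_integral[OF continuous_leb_integrable[OF assms]]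
  by (simp add: integral_open_interval_real)

lemma continuous_leb_measurable:
  assumes "continuous_on {c<..<d} (f::real \<Rightarrow> real)"
  shows "f \<in> borel_measurable (leb c d)"
  by (rule continuous_imp_measurable_on_sets_lebesgue[OF assms]) simp

text \<open>Lebesgue measure is complete, so a change on a null set keeps measurability. The detour
  through \<open>measurable_on\<close> is there for its rule about changes on negligible
  sets.\<close>

lemma AE_leb_measurable:
  assumes "f \<in> borel_measurable (leb c d)" and "AE x in leb c d. f x = g x"
  shows "(g :: real \<Rightarrow> real) \<in> borel_measurable (leb c d)"
proof -
  obtain N where N: "{x \<in> space (leb c d). f x \<noteq> g x} \<subseteq> N" "N \<in> null_sets (leb c d)"
    using assms(2) by (auto elim!: AE_E3 simp: eventually_ae_filter)
  have "N \<in> null_sets lebesgue"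
    using N(2) by (simp add: null_sets_restrict_space)
  then have neg: "negligible N"
    by (simp add: negligible_iff_null_sets)
  have "f measurable_on {c<..<d}"
    using assms(1) by (simp add: measurable_on_iff_borel_measurable)
  then have "g measurable_on {c<..<d}"
    by (rule measurable_on_spike[OF _ neg]) (use N(1) in auto)
  then show ?thesis
    by (simp add: measurable_on_iff_borel_measurable)
qed

text \<open>The bare integral, which is 0 by convention when the product is not integrable.
  Additivity therefore asks for \<open>L2_space\<close>, while scaling and symmetry hold without
  assumptions.\<close>

definition ip :: "(real \<Rightarrow> real) \<Rightarrow> (real \<Rightarrow> real) \<Rightarrow> real" where
  "ip f g = (\<integral>x. f x * g x \<partial>leb 0 1)"

section \<open>Algebra and inequalities of L2\<close>

lemma L2_measurable: "f \<in> L2_space \<Longrightarrow> f \<in> borel_measurable (leb 0 1)"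
  and L2_square_integrable: "f \<in> L2_space \<Longrightarrow> integrable (leb 0 1) (\<lambda>x. (f x)\<^sup>2)"
  by (auto simp: L2_space_def)

lemma L2_spaceI_bound:
  assumes "f \<in> borel_measurable (leb 0 1)" and "integrable (leb 0 1) g"
    and "\<And>x. x \<in> {0<..<1} \<Longrightarrow> (f x)\<^sup>2 \<le> g x"
  shows "f \<in> L2_space"
proof -
  note assms(1)[measurable]
  have "integrable (leb 0 1) (\<lambda>x. (f x)\<^sup>2)"
    by (rule Bochner_Integration.integrable_bound[OF assms(2)])
       (use assms(3) in \<open>auto intro!: AE_I2 order_trans[OF assms(3)]\<close>)
  then show ?thesis
    using assms(1) by (simp add: L2_space_def)
qed

lemma ip_integrable:
  assumes "f \<in> L2_space" and "g \<in> L2_space"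
  shows "integrable (leb 0 1) (\<lambda>x. f x * g x)"
proof -
  note [measurable] = assms[THEN L2_measurable]
  have "integrable (leb 0 1) (\<lambda>x. (f x)\<^sup>2 + (g x)\<^sup>2)"
    using assms by (simp add: L2_square_integrable)
  then show ?thesis
  proof (rule Bochner_Integration.integrable_bound)
    have "\<bar>f x * g x\<bar> \<le> (f x)\<^sup>2 + (g x)\<^sup>2" for x
    proof -
      have "0 \<le> (\<bar>f x\<bar> - \<bar>g x\<bar>)\<^sup>2 + (\<bar>f x\<bar>\<^sup>2 + \<bar>g x\<bar>\<^sup>2)" by simp
      then show ?thesis by (simp add: power2_diff abs_mult)
    qed
    then show "AE x in leb 0 1. norm (f x * g x) \<le> norm ((f x)\<^sup>2 + (g x)\<^sup>2)"
      by auto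
  qed measurable
qed

lemma L2_add:
  assumes "f \<in> L2_space" and "g \<in> L2_space"
  shows "(\<lambda>x. f x + g x) \<in> L2_space"
proof -
  note [measurable] = assms[THEN L2_measurable]
  have "integrable (leb 0 1) (\<lambda>x. (f x)\<^sup>2 + 2 * (f x * g x) + (g x)\<^sup>2)"
    using assms by (simp add: L2_square_integrable ip_integrable)
  then have "integrable (leb 0 1) (\<lambda>x. (f x + g x)\<^sup>2)"
    by (simp add: power2_sum algebra_simps)
  then show ?thesis
    by (simp add: L2_space_def)
qed

lemma L2_cmult:
  assumes "f \<in> L2_space"
  shows "(\<lambda>x. c * f x) \<in> L2_space"
  using assms by (auto simp: L2_space_def power_mult_distrib)

lemma L2_diff:
  assumes "f \<in> L2_space" and "g \<in> L2_space"
  shows "(\<lambda>x. f x - g x) \<in> L2_space"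
  using L2_add[OF assms(1) L2_cmult[OF assms(2), of "-1"]] by simp

lemma L2_bounded_mult:
  assumes "f \<in> L2_space" and "g \<in> borel_measurable (leb 0 1)" "\<And>x. x \<in> {0<..<1} \<Longrightarrow> \<bar>g x\<bar> \<le> c"
  shows "(\<lambda>x. g x * f x) \<in> L2_space"
proof (rule L2_spaceI_bound)
  note [measurable] = L2_measurable[OF assms(1)] assms(2)
  show "(\<lambda>x. g x * f x) \<in> borel_measurable (leb 0 1)" by measurable
  show "integrable (leb 0 1) (\<lambda>x. c\<^sup>2 * (f x)\<^sup>2)"
    using assms(1) by (simp add: L2_square_integrable)
  fix x :: real assume "x \<in> {0<..<1}"
  then have "(g x)\<^sup>2 \<le> c\<^sup>2"
    using assms(3) by (metis abs_ge_zero power2_abs power_mono)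
  then show "(g x * f x)\<^sup>2 \<le> c\<^sup>2 * (f x)\<^sup>2"
    by (simp add: power_mult_distrib mult_right_mono)
qed

lemma continuous_L2:
  assumes "continuous_on {0..1} f"
  shows "f \<in> L2_space"
proof -
  have "continuous_on {0..1} (\<lambda>x. (f x)\<^sup>2)"
    by (intro continuous_intros assms)
  moreover have "f \<in> borel_measurable (leb 0 1)"
    by (rule continuous_leb_measurable) (rule continuous_on_subset[OF assms], auto)
  ultimately show ?thesis
    by (simp add: L2_space_def continuous_leb_integrable)
qed

lemma L2_continuous_mult:
  assumes "f \<in> L2_space" and "continuous_on {0..1} g"
  shows "(\<lambda>x. g x * f x) \<in> L2_space"
proof -
  have "compact (g ` {0..1})"
    by (rule compact_continuous_image[OF assms(2)]) simp
  then obtain c where "\<forall>y\<in>g ` {0..1}. \<bar>y\<bar> \<le> c"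
    using compact_imp_bounded bounded_real by metis
  then show ?thesis
    by (intro L2_bounded_mult[OF assms(1), where c = c] L2_measurable continuous_L2 assms(2)) auto
qed

lemma L2_sum:
  assumes "\<And>i. i \<in> I \<Longrightarrow> f i \<in> L2_space"
  shows "(\<lambda>x. \<Sum>i\<in>I. f i x) \<in> L2_space"
  using assms
proof (induction I rule: infinite_finite_induct)
  case (insert i I)
  then show ?case using L2_add[of "f i" "\<lambda>x. \<Sum>i\<in>I. f i x"] by simp
qed (auto simp: continuous_L2)

lemma L2_AE_cong:
  assumes "f \<in> L2_space" and "AE x in leb 0 1. f x = g x"
  shows "g \<in> L2_space"
proof -
  have m: "g \<in> borel_measurable (leb 0 1)"
    by (rule AE_leb_measurable[OF L2_measurable assms(2)]) fact
  note [measurable] = m L2_measurable[OF assms(1)]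
  have "integrable (leb 0 1) (\<lambda>x. (g x)\<^sup>2)"
    by (rule integrable_cong_AE_imp[OF L2_square_integrable[OF assms(1)]])
       (use assms(2) in auto)
  then show ?thesis using m by (simp add: L2_space_def)
qed

lemma L2_norm_nonneg [simp]: "0 \<le> L2_norm f"
  by (simp add: L2_norm_def)

lemma L2_norm_eq: "(L2_norm f)\<^sup>2 = ip f f"
  by (simp add: L2_norm_def ip_def power2_eq_square[symmetric])

lemma ip_commute: "ip f g = ip g f"
  by (simp add: ip_def mult.commute)

lemma ip_add_left:
  "f \<in> L2_space \<Longrightarrow> g \<in> L2_space \<Longrightarrow> h \<in> L2_space \<Longrightarrow> ip (\<lambda>x. f x + g x) h = ip f h + ip g h"
  by (simp add: ip_def algebra_simps ip_integrable)

lemma ip_diff_left: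
  "f \<in> L2_space \<Longrightarrow> g \<in> L2_space \<Longrightarrow> h \<in> L2_space \<Longrightarrow> ip (\<lambda>x. f x - g x) h = ip f h - ip g h"
  by (simp add: ip_def algebra_simps ip_integrable)

lemma ip_add_right:
  "f \<in> L2_space \<Longrightarrow> g \<in> L2_space \<Longrightarrow> h \<in> L2_space \<Longrightarrow> ip h (\<lambda>x. f x + g x) = ip h f + ip h g"
  by (simp add: ip_def algebra_simps ip_integrable)

lemma ip_diff_right:
  "f \<in> L2_space \<Longrightarrow> g \<in> L2_space \<Longrightarrow> h \<in> L2_space \<Longrightarrow> ip h (\<lambda>x. f x - g x) = ip h f - ip h g"
  by (simp add: ip_def algebra_simps ip_integrable)

lemma ip_cmult_left [simp]: "ip (\<lambda>x. c * f x) g = c * ip f g"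
  by (simp add: ip_def mult.assoc)

lemma ip_cmult_right [simp]: "ip f (\<lambda>x. c * g x) = c * ip f g"
  by (simp add: ip_def mult.left_commute)

lemma ip_sum_right:
  assumes "h \<in> L2_space" and "\<And>i. i \<in> I \<Longrightarrow> f i \<in> L2_space"
  shows "ip h (\<lambda>x. \<Sum>i\<in>I. f i x) = (\<Sum>i\<in>I. ip h (f i))"
  using assms by (simp add: ip_def sum_distrib_left ip_integrable)

lemma ip_sum_left:
  assumes "h \<in> L2_space" and "\<And>i. i \<in> I \<Longrightarrow> f i \<in> L2_space"
  shows "ip (\<lambda>x. \<Sum>i\<in>I. f i x) h = (\<Sum>i\<in>I. ip (f i) h)"
  using assms by (simp add: ip_def sum_distrib_right ip_integrable)

lemma ip_AE_cong:
  assumes "f \<in> L2_space" "h \<in> L2_space" "AE x in leb 0 1. f x = g x"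
  shows "ip f h = ip g h"
proof -
  note [measurable] = L2_measurable[OF assms(1)] L2_measurable[OF assms(2)]
     L2_measurable[OF L2_AE_cong[OF assms(1,3)]]
  show ?thesis unfolding ip_def
    by (rule integral_cong_AE) (use assms(3) in auto)
qed

lemma L2_norm_AE_cong:
  assumes "f \<in> L2_space" "AE x in leb 0 1. f x = g x"
  shows "L2_norm f = L2_norm g"
proof -
  note [measurable] = L2_measurable[OF assms(1)] L2_measurable[OF L2_AE_cong[OF assms]]
  have "(\<integral>x. (f x)\<^sup>2 \<partial>leb 0 1) = (\<integral>x. (g x)\<^sup>2 \<partial>leb 0 1)"
    by (rule integral_cong_AE) (use assms(2) in auto)
  then show ?thesis by (simp add: L2_norm_def)
qed

lemma L2_norm_cmult: "L2_norm (\<lambda>x. c * f x) = \<bar>c\<bar> * L2_norm f"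
  by (simp add: L2_norm_def power_mult_distrib real_sqrt_mult)

lemma L2_norm_minus_commute: "L2_norm (\<lambda>x. f x - g x) = L2_norm (\<lambda>x. g x - f x)"
  by (simp add: L2_norm_def power2_commute)

lemma ip_Cauchy_Schwarz:
  assumes f: "f \<in> L2_space" and g: "g \<in> L2_space"
  shows "\<bar>ip f g\<bar> \<le> L2_norm f * L2_norm g"
proof -
  have expand: "ip (\<lambda>x. c * f x - d * g x) (\<lambda>x. c * f x - d * g x)
      = c * (c * ip f f - d * ip f g) - d * (c * ip f g - d * ip g g)" for c d
    using f g by (simp add: ip_diff_left ip_diff_right L2_diff L2_cmult ip_commute[of g f])
  \<comment> \<open>The component of \<open>f\<close> orthogonal to \<open>g\<close>, multiplied by
    the squared norm of \<open>g\<close> so that nothing is divided by zero.\<close>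
  have "0 \<le> ip (\<lambda>x. (L2_norm g)\<^sup>2 * f x - ip f g * g x) (\<lambda>x. (L2_norm g)\<^sup>2 * f x - ip f g * g x)"
    unfolding L2_norm_eq[of "\<lambda>x. (L2_norm g)\<^sup>2 * f x - ip f g * g x", symmetric] by simp
  also have "\<dots> = (L2_norm g)^2 * ((L2_norm g)\<^sup>2 * (L2_norm f)\<^sup>2 - (ip f g)\<^sup>2)"
    unfolding expand L2_norm_eq[symmetric] by (simp add: power2_eq_square algebra_simps)
  finally have *: "0 \<le> (L2_norm g)^2 * ((L2_norm g)\<^sup>2 * (L2_norm f)\<^sup>2 - (ip f g)\<^sup>2)" .
  show ?thesis
  proof (cases "L2_norm g = 0")
    case True
    then have "integral\<^sup>L (leb 0 1) (\<lambda>x. (g x)\<^sup>2) = 0"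
      by (simp add: L2_norm_def)
    then have "AE x in leb 0 1. (g x)\<^sup>2 = 0"
      by (subst (asm) integral_nonneg_eq_0_iff_AE) (auto simp: L2_square_integrable g)
    then have "ip f g = 0"
      unfolding ip_def by (intro integral_eq_zero_AE) auto
    then show ?thesis by simp
  next
    case False
    then have "0 < (L2_norm g)\<^sup>2" by simp
    with * have "0 \<le> (L2_norm g)\<^sup>2 * (L2_norm f)\<^sup>2 - (ip f g)\<^sup>2"
      by (simp add: zero_le_mult_iff)
    then have "\<bar>ip f g\<bar>\<^sup>2 \<le> (L2_norm f * L2_norm g)\<^sup>2"
      by (simp add: power_mult_distrib mult.commute)
    then show ?thesis
      by (rule power2_le_imp_le) simp
  qed
qed

lemma L2_norm_triangle:
  assumes f: "f \<in> L2_space" and g: "g \<in> L2_space"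
  shows "L2_norm (\<lambda>x. f x + g x) \<le> L2_norm f + L2_norm g"
proof (rule power2_le_imp_le)
  have "(L2_norm (\<lambda>x. f x + g x))\<^sup>2 = (L2_norm f)\<^sup>2 + 2 * ip f g + (L2_norm g)\<^sup>2"
    using f g by (simp add: L2_norm_eq ip_add_left ip_add_right L2_add ip_commute[of g f])
  also have "\<dots> \<le> (L2_norm f + L2_norm g)\<^sup>2"
    using ip_Cauchy_Schwarz[OF f g] by (simp add: power2_sum)
  finally show "(L2_norm (\<lambda>x. f x + g x))\<^sup>2 \<le> (L2_norm f + L2_norm g)\<^sup>2" .
qed simp

lemma L2_norm_triangle_diff:
  assumes f: "f \<in> L2_space" and g: "g \<in> L2_space"
  shows "L2_norm (\<lambda>x. f x - g x) \<le> L2_norm f + L2_norm g"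
  using L2_norm_triangle[OF f L2_cmult[OF g, of "-1"]] L2_norm_cmult[of "-1" g] by simp

lemma L2_norm_mono:
  assumes "f \<in> L2_space" "g \<in> L2_space" "\<And>x. x \<in> {0<..<1} \<Longrightarrow> \<bar>f x\<bar> \<le> \<bar>g x\<bar>"
  shows "L2_norm f \<le> L2_norm g"
  unfolding L2_norm_def real_sqrt_le_iff
  using assms by (intro integral_mono L2_square_integrable) (auto simp: abs_le_square_iff)

lemma L2_norm_const: "L2_norm (\<lambda>_. c) = \<bar>c\<bar>"
  by (simp add: L2_norm_def leb_const_integral del: lebesgue_integral_const)

lemma L2_norm_bound:
  assumes "f \<in> L2_space" "\<And>x. x \<in> {0<..<1} \<Longrightarrow> \<bar>f x\<bar> \<le> c"
  shows "L2_norm f \<le> c"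
proof -
  have c: "0 \<le> c" using assms(2)[of "1/2"] by auto
  have "L2_norm f \<le> L2_norm (\<lambda>_. c)"
    using assms c by (intro L2_norm_mono) (auto simp: continuous_L2)
  then show ?thesis using c by (simp add: L2_norm_const)
qed

lemma L2_norm_zero_AE:
  assumes "f \<in> L2_space" "L2_norm f = 0"
  shows "AE x in leb 0 1. f x = 0"
proof -
  have "integral\<^sup>L (leb 0 1) (\<lambda>x. (f x)\<^sup>2) = 0"
    using assms(2) by (simp add: L2_norm_def)
  then have "AE x in leb 0 1. (f x)\<^sup>2 = 0"
    by (subst (asm) integral_nonneg_eq_0_iff_AE) (auto simp: L2_square_integrable assms)
  then show ?thesis by simp
qed

text \<open>Continuous functions that differ at \<open>x\<close> differ on an interval around
  \<open>x\<close>. Cut down to \<open>(0,1)\<close> this interval is still open and nonempty, hence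
  not negligible. The end points are covered as well, which makes traces well defined.\<close>

lemma AE_continuous_eq:
  assumes f: "continuous_on {0..1} f" and g: "continuous_on {0..1} g"
    and "AE x in leb 0 1. f x = g x" and "x \<in> {0..1}"
  shows "f x = (g x :: real)"
proof (rule ccontr)
  assume ne: "f x \<noteq> g x"
  obtain N where N: "{x \<in> space (leb 0 1). f x \<noteq> g x} \<subseteq> N" "N \<in> null_sets (leb 0 1)"
    using assms(3) by (auto elim!: AE_E3 simp: eventually_ae_filter)
  have "N \<in> null_sets lebesgue"
    using N(2) by (simp add: null_sets_restrict_space)
  then have neg: "negligible N"
    by (simp add: negligible_iff_null_sets)
  have "continuous_on {0..1} (\<lambda>x. \<bar>f x - g x\<bar>)"
    by (intro continuous_intros f g)
  then obtain d where d: "d > 0" "\<And>y. y \<in> {0..1} \<Longrightarrow> dist y x < d \<Longrightarrow> dist \<bar>f y - g y\<bar> \<bar>f x - g x\<bar> < \<bar>f x - g x\<bar>"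
    using ne assms(4) unfolding continuous_on_iff by (metis abs_ge_zero abs_le_zero_iff linorder_not_le right_minus_eq)
  have sub: "{max 0 (x - d)<..<min 1 (x + d)} \<subseteq> N"
  proof
    fix y assume "y \<in> {max 0 (x - d)<..<min 1 (x + d)}"
    then have "y \<in> {0<..<1}" "dist y x < d" by (auto simp: dist_real_def)
    then show "y \<in> N" using d(2)[of y] N(1) by (auto simp: dist_real_def)
  qed
  have "negligible {max 0 (x - d)<..<min 1 (x + d)}"
    by (rule negligible_subset[OF neg sub])
  moreover have "max 0 (x - d) < min 1 (x + d)"
    using d(1) assms(4) by auto
  ultimately show False
    using negligible_iff_measure0 open_not_negligible by (metis greaterThanLessThan_empty_iff linorder_not_le open_greaterThanLessThan)
qed

section \<open>Completeness of the cosines\<close>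

text \<open>Integer frequencies for \<open>\<theta> = 0\<close>, half-integer ones for
  \<open>\<theta> = 1/2\<close>. Up to factors, and apart from the constant function, these are the
  x-derivatives of the sine eigenfunctions that belong to the Dirichlet and to the Neumann
  law.\<close>

inductive_set cos_span :: "real \<Rightarrow> (real \<Rightarrow> real) set" for \<theta> :: real where
  base: "(\<lambda>x. cos ((real n + \<theta>) * pi * x)) \<in> cos_span \<theta>"
| add: "f \<in> cos_span \<theta> \<Longrightarrow> g \<in> cos_span \<theta> \<Longrightarrow> (\<lambda>x. f x + g x) \<in> cos_span \<theta>"
| scale: "f \<in> cos_span \<theta> \<Longrightarrow> (\<lambda>x. c * f x) \<in> cos_span \<theta>"

lemma cos_span_continuous: "f \<in> cos_span \<theta> \<Longrightarrow> continuous_on S f"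
  by (induction rule: cos_span.induct) (auto intro!: continuous_intros)

lemma cos_span_L2: "f \<in> cos_span \<theta> \<Longrightarrow> f \<in> L2_space"
  by (intro continuous_L2 cos_span_continuous)

lemma cos_span_sum: "finite I \<Longrightarrow> (\<And>i. i \<in> I \<Longrightarrow> f i \<in> cos_span \<theta>) \<Longrightarrow> (\<lambda>x. \<Sum>i\<in>I. f i x) \<in> cos_span \<theta>"
proof (induction I rule: finite_induct)
  case empty
  show ?case using cos_span.scale[OF cos_span.base, of 0] by simp
next
  case (insert i I)
  then show ?case using cos_span.add[of "f i"] by simp
qed

text \<open>Product to sum: cos(\<pi> x) cos(n \<pi> x) is the mean of the two neighbouring cosines;
  \<open>n = 0\<close> has no lower neighbour and is treated apart. Iterating this puts every
  polynomial in cos(\<pi> x) into the span.\<close>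

lemma cos_span_mult_cos:
  assumes "f \<in> cos_span 0"
  shows "(\<lambda>x. cos (pi * x) * f x) \<in> cos_span 0"
  using assms
proof (induction rule: cos_span.induct)
  case (base n)
  show ?case
  proof (cases n)
    case 0
    then show ?thesis using cos_span.base[of 1 0] by simp
  next
    case (Suc m)
    have "(\<lambda>x. (1/2) * (cos ((real (Suc n) + 0) * pi * x) + cos ((real m + 0) * pi * x))) \<in> cos_span 0"
      by (intro cos_span.intros)
    moreover have "(1/2) * (cos ((real (Suc n) + 0) * pi * x) + cos ((real m + 0) * pi * x))
        = cos (pi * x) * cos ((real n + 0) * pi * x)" for x
      by (simp add: cos_times_cos Suc algebra_simps)
    ultimately show ?thesis by simp
  qed
next
  case (add f g)
  then show ?case using cos_span.add by (fastforce simp: distrib_left)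
next
  case (scale f c)
  then show ?case using cos_span.scale[of _ 0 c] by (fastforce simp: mult.left_commute)
qed

text \<open>Multiplication by cos(\<pi> x / 2) turns integer frequencies into half-integer ones, so
  density for \<open>\<theta> = 1/2\<close> can be reduced to \<open>\<theta> = 0\<close>.\<close>

lemma cos_span_shift:
  assumes "f \<in> cos_span 0" and "\<theta> = 0 \<or> \<theta> = 1/2"
  shows "(\<lambda>x. cos (\<theta> * pi * x) * f x) \<in> cos_span \<theta>"
  using assms(1)
proof (induction rule: cos_span.induct)
  case (base n)
  show ?case
  proof (cases "\<theta> = 0")
    case True
    then show ?thesis using cos_span.base[of n 0] by simp
  next
    case False
    then have th: "\<theta> = 1/2" using assms(2) by simp
    show ?thesis
    proof (cases n)
      case 0
      then show ?thesis using cos_span.base[of 0 \<theta>] by simp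
    next
      case (Suc m)
      have "(\<lambda>x. (1/2) * (cos ((real n + \<theta>) * pi * x) + cos ((real m + \<theta>) * pi * x))) \<in> cos_span \<theta>"
        by (intro cos_span.intros)
      moreover have "(1/2) * (cos ((real n + \<theta>) * pi * x) + cos ((real m + \<theta>) * pi * x))
          = cos (\<theta> * pi * x) * cos ((real n + 0) * pi * x)" for x
      proof -
        \<comment> \<open>The lower of the two frequencies is 1/2 - n, which is negative. Since cos
          is even it counts as m + 1/2 with m = n - 1.\<close>
        have "cos ((real m + \<theta>) * pi * x) = cos (- ((real m + \<theta>) * pi * x))"
          by (rule cos_minus[symmetric])
        also have "- ((real m + \<theta>) * pi * x) = \<theta> * pi * x - real n * pi * x"
          by (simp add: th Suc field_simps)
        finally show ?thesis
          by (simp add: cos_times_cos algebra_simps)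
      qed
      ultimately show ?thesis by simp
    qed
  qed
next
  case (add f g)
  then show ?case using cos_span.add by (fastforce simp: distrib_left)
next
  case (scale f c)
  then show ?case using cos_span.scale[of _ \<theta> c] by (fastforce simp: mult.left_commute)
qed

text \<open>The substitution y = (1 + cos(\<pi> x)) / 2 maps \<open>[0,1]\<close> homeomorphically
  onto itself, so \<open>f\<close> becomes a continuous function \<open>h\<close> of y. A Bernstein
  polynomial of \<open>h\<close> is a polynomial in cos(\<pi> x), hence a cosine sum.\<close>

lemma cos_span_uniform_dense_0:
  assumes f: "continuous_on {0..1} f" and e: "0 < e"
  shows "\<exists>q\<in>cos_span 0. \<forall>x\<in>{0..1}. \<bar>f x - q x\<bar> < e"
proof -
  define h where "h y = f (arccos (2 * y - 1) / pi)" for y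
  have "continuous_on {0..1} h"
    unfolding h_def
  proof (rule continuous_on_compose2[OF f])
    show "continuous_on {0..1::real} (\<lambda>y. arccos (2 * y - 1) / pi)"
      by (intro continuous_intros) auto
    show "(\<lambda>y. arccos (2 * y - 1) / pi) ` {0..1::real} \<subseteq> {0..1}"
      using arccos_lbound arccos_ubound by (auto simp: field_simps)
  qed
  from Bernstein_Weierstrass[OF this e] obtain n
    where n: "\<And>y. y \<in> {0..1} \<Longrightarrow> \<bar>h y - (\<Sum>k\<le>n. h (k/n) * Bernstein n k y)\<bar> < e"
    by blast
  define c where "c x = (1 + cos (pi * x)) / 2" for x
  have pow1: "(\<lambda>x. c x ^ j * f x) \<in> cos_span 0" if "f \<in> cos_span 0" for j f
  proof (induction j)
    case (Suc j)
    have "(\<lambda>x. (1/2) * ((c x ^ j * f x) + cos (pi * x) * (c x ^ j * f x))) \<in> cos_span 0"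
      by (intro cos_span.add cos_span.scale Suc cos_span_mult_cos)
    moreover have "(\<lambda>x. (1/2) * ((c x ^ j * f x) + cos (pi * x) * (c x ^ j * f x))) = (\<lambda>x. c x ^ Suc j * f x)"
      by (auto simp: c_def field_simps)
    ultimately show ?case by simp
  qed (use that in simp)
  have pow2: "(\<lambda>x. (1 - c x) ^ j * f x) \<in> cos_span 0" if "f \<in> cos_span 0" for j f
  proof (induction j)
    case (Suc j)
    have "(\<lambda>x. (1/2) * (((1 - c x) ^ j * f x) + (-1) * (cos (pi * x) * ((1 - c x) ^ j * f x)))) \<in> cos_span 0"
      by (intro cos_span.add cos_span.scale Suc cos_span_mult_cos)
    moreover have "(\<lambda>x. (1/2) * (((1 - c x) ^ j * f x) + (-1) * (cos (pi * x) * ((1 - c x) ^ j * f x))))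
        = (\<lambda>x. (1 - c x) ^ Suc j * f x)"
      by (auto simp: c_def field_simps)
    ultimately show ?case by simp
  qed (use that in simp)
  have one: "(\<lambda>x. 1) \<in> cos_span 0"
    using cos_span.base[of 0 0] by simp
  define q where "q x = (\<Sum>k\<le>n. (h (k/n) * (n choose k)) * (c x ^ k * ((1 - c x) ^ (n - k) * 1)))" for x
  have "q \<in> cos_span 0"
    unfolding q_def[abs_def]
    by (intro cos_span_sum finite_atMost cos_span.scale pow1 pow2 one)
  moreover have "\<bar>f x - q x\<bar> < e" if x: "x \<in> {0..1}" for x
  proof -
    have "(1 + u) / 2 \<in> {0..1}" if "- 1 \<le> u" "u \<le> 1" for u :: real
      using that by simp
    from this[OF cos_ge_minus_one cos_le_one] have c: "c x \<in> {0..1}"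
      by (simp only: c_def)
    have "arccos (cos (pi * x)) = pi * x"
      using x by (intro arccos_cos) auto
    moreover have "2 * c x - 1 = cos (pi * x)"
      unfolding c_def by (simp only: times_divide_eq_right nonzero_mult_div_cancel_left)
    ultimately have "h (c x) = f x"
      by (simp only: h_def) simp
    moreover have "q x = (\<Sum>k\<le>n. h (k/n) * Bernstein n k (c x))"
      by (simp add: q_def Bernstein_def mult.assoc)
    ultimately show ?thesis using n[OF c] by simp
  qed
  ultimately show ?thesis by blast
qed

text \<open>For \<open>\<theta> = 1/2\<close> every element of the span vanishes at 1, so the
  functions to be approximated are taken to vanish near 1. Their quotient by cos(\<theta> \<pi> x)
  is continuous; it is approximated by integer cosines and multiplied back, which does not enlarge
  the error.\<close>

lemma cos_span_uniform_dense:
  assumes f: "continuous_on {0..1} f" and b: "b < 1" "\<And>x. b \<le> x \<Longrightarrow> f x = 0"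
    and \<theta>: "\<theta> = 0 \<or> \<theta> = 1/2" and e: "0 < e"
  shows "\<exists>q\<in>cos_span \<theta>. \<forall>x\<in>{0..1}. \<bar>f x - q x\<bar> < e"
proof -
  define g where "g x = (if x < b then f x / cos (\<theta> * pi * x) else 0)" for x
  have c: "cos (\<theta> * pi * x) > 0" if "0 \<le> x" "x < 1" for x
  proof (cases "\<theta> = 0")
    case False
    then have "\<theta> = 1/2" using \<theta> by simp
    then have eq: "\<theta> * pi * x = (pi / 2) * x" by simp
    have "(pi / 2) * x < (pi / 2) * 1" "0 \<le> (pi / 2) * x"
      using that by (auto simp del: mult_1_right)
    moreover have "- (pi / 2) < 0" by simp
    ultimately have "- (pi / 2) < (pi / 2) * x" "(pi / 2) * x < pi / 2"
      by linarith+
    then show ?thesis unfolding eq by (rule cos_gt_zero_pi)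
  qed simp
  \<comment> \<open>A positive point strictly between \<open>b\<close> and 1: on
    \<open>[0,m]\<close> the divisor has no zero, on \<open>[m,1]\<close> the quotient is
    zero.\<close>
  define m where "m = (1 + max 0 b) / 2"
  have m: "0 < m" "m < 1" "b < m" using b(1) by (auto simp: m_def)
  have g1: "g x = f x / cos (\<theta> * pi * x)" if "x < 1" for x
    using that b(2)[of x] by (auto simp: g_def)
  have cm: "\<forall>x\<in>{0..m}. cos (\<theta> * pi * x) \<noteq> 0"
  proof
    fix x assume "x \<in> {0..m}"
    then have "0 < cos (\<theta> * pi * x)" using m(2) by (intro c) auto
    then show "cos (\<theta> * pi * x) \<noteq> 0" by simp
  qed
  have "continuous_on {0..m} (\<lambda>x. cos (\<theta> * pi * x))" "continuous_on {0..m} f"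
    using m by (auto intro!: continuous_intros continuous_on_subset[OF f])
  then have "continuous_on {0..m} (\<lambda>x. f x / cos (\<theta> * pi * x))"
    using cm by (intro continuous_on_divide)
  then have "continuous_on {0..m} g"
    by (rule continuous_on_eq) (use m g1 in auto)
  moreover have "continuous_on {m..1} g"
    using m by (intro continuous_on_eq[OF continuous_on_const[of _ 0]]) (auto simp: g_def)
  ultimately have "continuous_on ({0..m} \<union> {m..1}) g"
    by (intro continuous_on_closed_Un) auto
  also have "{0..m} \<union> {m..1} = {0..1}" using m by auto
  finally have "continuous_on {0..1} g" .
  from cos_span_uniform_dense_0[OF this e]
  obtain q where q: "q \<in> cos_span 0" "\<And>x. x \<in> {0..1} \<Longrightarrow> \<bar>g x - q x\<bar> < e"
    by blast
  have "\<bar>f x - cos (\<theta> * pi * x) * q x\<bar> < e" if x: "x \<in> {0..1}" for x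
  proof -
    have "f x = cos (\<theta> * pi * x) * g x"
    proof (cases "x = 1")
      case True then show ?thesis using b by (simp add: g_def)
    next
      case False
      then have "0 < cos (\<theta> * pi * x)" "g x = f x / cos (\<theta> * pi * x)"
        using x c[of x] g1[of x] by auto
      then show ?thesis by simp
    qed
    then have "\<bar>f x - cos (\<theta> * pi * x) * q x\<bar> = \<bar>cos (\<theta> * pi * x) * (g x - q x)\<bar>"
      by (simp only: right_diff_distrib)
    also have "\<dots> = \<bar>cos (\<theta> * pi * x)\<bar> * \<bar>g x - q x\<bar>"
      by (rule abs_mult)
    also have "\<dots> \<le> 1 * \<bar>g x - q x\<bar>"
      by (intro mult_right_mono) auto
    also have "\<dots> = \<bar>g x - q x\<bar>" by simp
    also have "\<dots> < e" by (rule q(2)[OF x])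
    finally show ?thesis .
  qed
  then show ?thesis by (intro bexI[OF _ cos_span_shift[OF q(1) \<theta>]] ballI)
qed

lemma L2_norm_LIMSEQ_0:
  assumes s: "\<And>n. s n \<in> borel_measurable (leb 0 1)" and f: "f \<in> borel_measurable (leb 0 1)"
    and w: "integrable (leb 0 1) w" and bd: "\<And>n x. x \<in> {0<..<1} \<Longrightarrow> (f x - s n x)\<^sup>2 \<le> w x"
    and lim: "AE x in leb 0 1. (\<lambda>n. s n x) \<longlonglongrightarrow> f x"
  shows "(\<lambda>n. L2_norm (\<lambda>x. f x - s n x)) \<longlonglongrightarrow> 0"
proof -
  note [measurable] = s f
  have "(\<lambda>n. \<integral>x. (f x - s n x)\<^sup>2 \<partial>leb 0 1) \<longlonglongrightarrow> (\<integral>x. 0 \<partial>leb 0 1)"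
  proof (rule integral_dominated_convergence[OF _ _ w])
    show "AE x in leb 0 1. (\<lambda>n. (f x - s n x)\<^sup>2) \<longlonglongrightarrow> 0"
      using lim
    proof eventually_elim
      case (elim x)
      have "(\<lambda>n. (f x - s n x)\<^sup>2) \<longlonglongrightarrow> (f x - f x)\<^sup>2"
        by (intro tendsto_intros elim)
      then show ?case by simp
    qed
    show "AE x in leb 0 1. norm ((f x - s n x)\<^sup>2) \<le> w x" for n
      using bd by (intro AE_I2) simp
  qed measurable
  then have "(\<lambda>n. sqrt (\<integral>x. (f x - s n x)\<^sup>2 \<partial>leb 0 1)) \<longlonglongrightarrow> sqrt 0"
    by (intro tendsto_real_sqrt) simp
  then show ?thesis by (simp add: L2_norm_def)
qed

text \<open>Three approximations with error e/3 each: truncate \<open>g\<close> to a bounded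
  function, replace that by a continuous function vanishing near 1, and approximate the latter
  uniformly. The continuous functions come from \<open>measurable_on\<close>, which provides a
  sequence of them converging off a negligible set.\<close>

lemma cos_span_dense:
  assumes g: "g \<in> L2_space" and \<theta>: "\<theta> = 0 \<or> \<theta> = 1/2" and e: "0 < e"
  shows "\<exists>q\<in>cos_span \<theta>. L2_norm (\<lambda>x. g x - q x) < e"
proof -
  note [measurable] = L2_measurable[OF g]
  define clip where "clip B y = max (- B) (min B y)" for B y :: real
  have clip_abs: "\<bar>clip B y\<bar> \<le> B" if "0 \<le> B" for B y
    using that by (auto simp: clip_def)
  have clip_meas: "(\<lambda>x. clip B (g x)) \<in> borel_measurable (leb 0 1)" for B
    unfolding clip_def by measurable
  have "(\<lambda>n. L2_norm (\<lambda>x. g x - clip (real n) (g x))) \<longlonglongrightarrow> 0"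
  proof (rule L2_norm_LIMSEQ_0[OF clip_meas L2_measurable[OF g] L2_square_integrable[OF g]])
    fix n x
    have "\<bar>g x - clip (real n) (g x)\<bar> \<le> \<bar>g x\<bar>"
      by (auto simp: clip_def)
    then show "(g x - clip (real n) (g x))\<^sup>2 \<le> (g x)\<^sup>2"
      by (simp add: abs_le_square_iff)
  next
    show "AE x in leb 0 1. (\<lambda>n. clip (real n) (g x)) \<longlonglongrightarrow> g x"
    proof (intro AE_I2)
      fix x
      obtain N where N: "\<bar>g x\<bar> \<le> real N" using real_arch_simple by blast
      have "eventually (\<lambda>n. clip (real n) (g x) = g x) sequentially"
        using eventually_ge_at_top[of N]
      proof eventually_elim
        case (elim n)
        then have "\<bar>g x\<bar> \<le> real n" using N by (meson of_nat_le_iff order_trans)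
        then show ?case by (auto simp: clip_def)
      qed
      then show "(\<lambda>n. clip (real n) (g x)) \<longlonglongrightarrow> g x"
        by (rule tendsto_eventually)
    qed
  qed
  then have "eventually (\<lambda>n. L2_norm (\<lambda>x. g x - clip (real n) (g x)) < e/3) sequentially"
    using e by (intro order_tendstoD) auto
  then obtain B where B: "L2_norm (\<lambda>x. g x - clip (real B) (g x)) < e/3"
    by (auto simp: eventually_sequentially)
  define h where "h x = clip (real B) (g x)" for x
  have h_meas[measurable]: "h \<in> borel_measurable (leb 0 1)"
    unfolding h_def[abs_def] by (rule clip_meas)
  have hB: "\<bar>h x\<bar> \<le> real B" for x by (simp add: h_def clip_abs)
  have h_L2: "h \<in> L2_space"
    by (rule L2_spaceI_bound[OF h_meas, where g = "\<lambda>_. (real B)\<^sup>2"]) (use hB in \<open>auto simp: abs_le_square_iff[symmetric]\<close>)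
  have "h measurable_on {0<..<1}"
    by (simp add: measurable_on_iff_borel_measurable)
  then obtain N c where N: "negligible N" and cc: "\<And>n::nat. continuous_on UNIV (c n)"
    and clim: "\<And>x. x \<notin> N \<Longrightarrow> (\<lambda>n. c n x) \<longlonglongrightarrow> (if x \<in> {0<..<1} then h x else 0)"
    unfolding measurable_on_def by blast
  \<comment> \<open>Equal to 1 up to \<open>1 - 2/n\<close> and to 0 from \<open>1 - 1/n\<close> on.
    The factor makes the approximants vanish near 1 and tends to 1 at every point of
    \<open>(0,1)\<close>.\<close>
  define chi where "chi n x = max 0 (min 1 (real n * (1 - x) - 1))" for n :: nat and x :: real
  define s where "s n x = chi n x * clip (real B) (c n x)" for n x
  have chi01: "0 \<le> chi n x" "chi n x \<le> 1" for n x by (auto simp: chi_def)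
  have s_cont: "continuous_on S (s n)" for n S
  proof -
    have "continuous_on UNIV (s n)"
      unfolding s_def[abs_def] chi_def clip_def by (intro continuous_intros cc)
    then show ?thesis by (rule continuous_on_subset) simp
  qed
  have s_abs: "\<bar>s n x\<bar> \<le> real B" for n x
  proof -
    have "\<bar>s n x\<bar> = chi n x * \<bar>clip (real B) (c n x)\<bar>" using chi01 by (simp add: s_def abs_mult)
    also have "\<dots> \<le> 1 * real B" using chi01 by (intro mult_mono clip_abs) auto
    finally show ?thesis by simp
  qed
  have "(\<lambda>n. L2_norm (\<lambda>x. h x - s n x)) \<longlonglongrightarrow> 0"
  proof (rule L2_norm_LIMSEQ_0[where w = "\<lambda>_. (2 * real B)\<^sup>2"])
    show "s n \<in> borel_measurable (leb 0 1)" for n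
      by (rule continuous_leb_measurable[OF s_cont])
    fix n x
    have "\<bar>h x - s n x\<bar> \<le> 2 * real B" using hB[of x] s_abs[of n x] by linarith
    then show "(h x - s n x)\<^sup>2 \<le> (2 * real B)\<^sup>2"
      by (metis abs_ge_zero power2_abs power_mono)
  next
    have "N \<in> null_sets lebesgue" using N by (simp add: negligible_iff_null_sets)
    then have "AE x in lebesgue. x \<notin> N" by (rule AE_not_in)
    then have "AE x in leb 0 1. x \<notin> N"
      by (subst AE_restrict_space_iff) auto
    then show "AE x in leb 0 1. (\<lambda>n. s n x) \<longlonglongrightarrow> h x"
    proof (rule AE_mp, intro AE_I2 impI)
      fix x assume x: "x \<in> space (leb 0 1)" and "x \<notin> N"
      then have "(\<lambda>n. c n x) \<longlonglongrightarrow> h x" using clim[of x] by simp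
      then have "(\<lambda>n. clip (real B) (c n x)) \<longlonglongrightarrow> clip (real B) (h x)"
        unfolding clip_def by (intro tendsto_intros)
      moreover have "clip (real B) (h x) = h x"
        using hB[of x] by (auto simp: clip_def)
      moreover have "(\<lambda>n. chi n x) \<longlonglongrightarrow> 1"
      proof -
        obtain M where M: "2 / (1 - x) \<le> real M" using real_arch_simple by blast
        have "eventually (\<lambda>n. chi n x = 1) sequentially"
          using eventually_ge_at_top[of M]
        proof eventually_elim
          case (elim n)
          then have "2 / (1 - x) \<le> real n" using M by (meson of_nat_le_iff order_trans)
          then have "2 \<le> real n * (1 - x)" using x by (simp add: field_simps)
          then show ?case by (simp add: chi_def)
        qed
        then show ?thesis by (rule tendsto_eventually)
      qed
      ultimately have "(\<lambda>n. chi n x * clip (real B) (c n x)) \<longlonglongrightarrow> 1 * h x"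
        by (intro tendsto_mult) auto
      then show "(\<lambda>n. s n x) \<longlonglongrightarrow> h x" by (simp add: s_def)
    qed
  qed auto
  then have "eventually (\<lambda>n. L2_norm (\<lambda>x. h x - s n x) < e/3) sequentially"
    using e by (intro order_tendstoD) auto
  then have "eventually (\<lambda>n. L2_norm (\<lambda>x. h x - s n x) < e/3 \<and> n > 0) sequentially"
    using eventually_gt_at_top[of 0] by eventually_elim auto
  then obtain n where n: "L2_norm (\<lambda>x. h x - s n x) < e/3" "n > 0"
    by (auto simp: eventually_sequentially)
  have "\<exists>q\<in>cos_span \<theta>. \<forall>x\<in>{0..1}. \<bar>s n x - q x\<bar> < e/3"
  proof (rule cos_span_uniform_dense[OF s_cont _ _ \<theta>])
    show "1 - 1 / real n < 1" using n by simp
    show "s n x = 0" if "1 - 1 / real n \<le> x" for x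
    proof -
      have "real n * (1 - x) \<le> 1" using that n(2) by (simp add: field_simps)
      then show ?thesis by (simp add: s_def chi_def)
    qed
  qed (use e in auto)
  then obtain q where q: "q \<in> cos_span \<theta>" "\<And>x. x \<in> {0..1} \<Longrightarrow> \<bar>s n x - q x\<bar> < e/3" by blast
  have s_L2: "s n \<in> L2_space" by (intro continuous_L2 s_cont)
  have q_L2: "q \<in> L2_space" by (rule cos_span_L2[OF q(1)])
  have "L2_norm (\<lambda>x. s n x - q x) \<le> e/3"
    using q(2) by (intro L2_norm_bound L2_diff s_L2 q_L2) (auto intro: less_imp_le)
  moreover have "L2_norm (\<lambda>x. (g x - h x) + ((h x - s n x) + (s n x - q x))) \<le>
      L2_norm (\<lambda>x. g x - h x) + L2_norm (\<lambda>x. (h x - s n x) + (s n x - q x))"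
    by (intro L2_norm_triangle L2_add L2_diff g h_L2 s_L2 q_L2)
  moreover have "L2_norm (\<lambda>x. (h x - s n x) + (s n x - q x)) \<le>
       L2_norm (\<lambda>x. h x - s n x) + L2_norm (\<lambda>x. s n x - q x)"
    by (intro L2_norm_triangle L2_add L2_diff g h_L2 s_L2 q_L2)
  ultimately have "L2_norm (\<lambda>x. g x - q x) < e"
    using n(1) B by (simp add: h_def[symmetric])
  then show ?thesis using q(1) by blast
qed

lemma ip_cos_span_zero:
  assumes "\<And>n::nat. ip h (\<lambda>x. cos ((real n + \<theta>) * pi * x)) = 0" and "h \<in> L2_space" and "q \<in> cos_span \<theta>"
  shows "ip h q = 0"
  using assms(3)
proof (induction rule: cos_span.induct)
  case (add f g)
  then show ?case using ip_add_right[of f g h] assms(2) by (simp add: cos_span_L2)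
qed (simp_all add: assms(1))

text \<open>An \<open>h\<close> orthogonal to the span satisfies |h|^2 = <h, h - q> for every
  \<open>q\<close> in it. Cauchy-Schwarz with a \<open>q\<close> at distance less than the norm of
  \<open>h\<close> gives a contradiction unless that norm is zero.\<close>

theorem cos_complete:
  assumes h: "h \<in> L2_space" and \<theta>: "\<theta> = 0 \<or> \<theta> = 1/2"
    and orth: "\<And>n::nat. ip h (\<lambda>x. cos ((real n + \<theta>) * pi * x)) = 0"
  shows "AE x in leb 0 1. h x = 0"
proof (rule L2_norm_zero_AE[OF h], rule ccontr)
  assume "L2_norm h \<noteq> 0"
  then have pos: "0 < L2_norm h" using L2_norm_nonneg[of h] by linarith
  obtain q where q: "q \<in> cos_span \<theta>" "L2_norm (\<lambda>x. h x - q x) < L2_norm h"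
    using cos_span_dense[OF h \<theta> pos] by blast
  have "(L2_norm h)\<^sup>2 = ip h (\<lambda>x. h x - q x)"
    using ip_cos_span_zero[OF orth h q(1)] ip_diff_right[OF h cos_span_L2[OF q(1)] h] L2_norm_eq[of h] by simp
  also have "\<dots> \<le> L2_norm h * L2_norm (\<lambda>x. h x - q x)"
    using ip_Cauchy_Schwarz[OF h L2_diff[OF h cos_span_L2[OF q(1)]]] by linarith
  also have "\<dots> < L2_norm h * L2_norm h"
    using q(2) pos by simp
  finally show False by (simp add: power2_eq_square)
qed

section \<open>Weak derivatives\<close>

definition ramp :: "real \<Rightarrow> real" where
  "ramp x = (max 0 x)\<^sup>2 / 2 - (max 0 (x - 1))\<^sup>2 + (max 0 (x - 2))\<^sup>2 / 2"

text \<open>The derivative of \<open>ramp\<close>: a hat on \<open>[0,2]\<close> of height and area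
  1. The step itself is only piecewise quadratic, which is enough because a test function has to be
  continuously differentiable and no more.\<close>

definition tent :: "real \<Rightarrow> real" where
  "tent x = max 0 x - 2 * max 0 (x - 1) + max 0 (x - 2)"

lemma max_zero_square_deriv: "((\<lambda>x. (max 0 x)\<^sup>2) has_real_derivative 2 * max 0 x) (at (x::real))"
proof -
  consider "x < 0" | "x = 0" | "x > 0" by linarith
  then show ?thesis
  proof cases
    case 1
    have "((\<lambda>x. 0) has_real_derivative 2 * max 0 x) (at x)" using 1 by (auto intro!: derivative_eq_intros)
    then show ?thesis
      by (rule has_field_derivative_transform_within_open[where S = "{..<0}"]) (use 1 in auto)
  next
    case 3
    have "((\<lambda>x. x\<^sup>2) has_real_derivative 2 * max 0 x) (at x)" using 3 by (auto intro!: derivative_eq_intros)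
    then show ?thesis
      by (rule has_field_derivative_transform_within_open[where S = "{0<..}"]) (use 3 in auto)
  next
    case 2
    have "(max 0 (0 + h))\<^sup>2 / h = max 0 h" for h :: real
      by (auto simp: max_def power2_eq_square)
    moreover have "((\<lambda>h::real. max 0 h) \<longlongrightarrow> max 0 0) (at 0)" by (intro tendsto_intros)
    ultimately show ?thesis
      unfolding DERIV_def 2 by simp
  qed
qed

lemma ramp_deriv: "(ramp has_real_derivative tent x) (at x)"
proof -
  have "((\<lambda>x. (max 0 (x - c))\<^sup>2) has_real_derivative 2 * max 0 (x - c)) (at x)" for c
    using DERIV_shift[of "\<lambda>x. (max 0 x)\<^sup>2" "2 * max 0 (x - c)" x "- c"] max_zero_square_deriv[of "x - c"] by simp
  note d = this
  have "((\<lambda>x. (max 0 (x - 0))\<^sup>2 / 2 - (max 0 (x - 1))\<^sup>2 + (max 0 (x - 2))\<^sup>2 / 2)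
      has_real_derivative 2 * max 0 (x - 0) / 2 - 2 * max 0 (x - 1) + 2 * max 0 (x - 2) / 2) (at x)"
    by (intro DERIV_add DERIV_diff DERIV_cdivide d)
  then show ?thesis
    unfolding ramp_def[abs_def] tent_def by simp
qed

lemma tent_continuous: "continuous_on S tent"
  unfolding tent_def[abs_def] by (intro continuous_intros)

lemma tent_nonneg: "0 \<le> tent x" and tent_outside: "x \<notin> {0<..<2} \<Longrightarrow> tent x = 0"
  by (auto simp: tent_def max_def)

lemma ramp_0: "x \<le> 0 \<Longrightarrow> ramp x = 0" and ramp_1: "2 \<le> x \<Longrightarrow> ramp x = 1"
  by (auto simp: ramp_def max_def power2_eq_square field_simps)

lemma ramp_mono: "x \<le> y \<Longrightarrow> ramp x \<le> ramp y"
  by (rule DERIV_nonneg_imp_nondecreasing) (use ramp_deriv tent_nonneg in blast)+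

lemma ramp_bounds: "0 \<le> ramp x" "ramp x \<le> 1"
  using ramp_mono[of "min 0 x" x] ramp_0[of "min 0 x"] ramp_mono[of x "max 2 x"] ramp_1[of "max 2 x"] by auto

lemma ramp_scaled_deriv: "((\<lambda>x. ramp (n * x - b)) has_real_derivative n * tent (n * x - b)) (at x within S)"
proof -
  have "((\<lambda>x. n * x - b) has_real_derivative n) (at x within S)"
    by (auto intro!: derivative_eq_intros)
  from DERIV_chain2[OF ramp_deriv this] show ?thesis
    by (simp only: mult.commute)
qed

lemma tent_integral:
  assumes "0 < n" "c \<le> b / n" "(b + 2) / n \<le> d"
  shows "integral {c..d} (\<lambda>x. n * tent (n * x - b)) = 1"
proof -
  have "c \<le> d" using assms by (smt (verit) divide_right_mono)
  then have "((\<lambda>x. n * tent (n * x - b)) has_integral (ramp (n * d - b) - ramp (n * c - b))) {c..d}"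
    by (intro fundamental_theorem_of_calculus)
      (auto simp: has_real_derivative_iff_has_vector_derivative[symmetric] intro!: ramp_scaled_deriv)
  moreover have "ramp (n * d - b) = 1" "ramp (n * c - b) = 0"
    using assms by (auto intro!: ramp_1 ramp_0 simp: field_simps)
  ultimately show ?thesis by (simp only: integral_unique)
qed

text \<open>An approximate identity: the bumps have mass 1 and live on
  \<open>[b/n, (b+2)/n]\<close>, which shrinks to \<open>a\<close>. The offset \<open>b\<close> may
  vary with \<open>n\<close> so that the bumps can stay inside \<open>[c,d]\<close> even when
  \<open>a\<close> is an end point.\<close>

lemma tent_approx:
  assumes f: "continuous_on {c..d} f" and a: "a \<in> {c..d}"
    and ev: "eventually (\<lambda>n. c \<le> b n / real n \<and> (b n + 2) / real n \<le> d) sequentially"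
    and lim: "(\<lambda>n. b n / real n) \<longlonglongrightarrow> a"
  shows "(\<lambda>n. integral {c..d} (\<lambda>x. real n * tent (real n * x - b n) * f x)) \<longlonglongrightarrow> f a"
proof (rule LIMSEQ_I)
  fix e :: real assume e: "0 < e"
  obtain \<delta> where \<delta>: "\<delta> > 0" "\<And>x. x \<in> {c..d} \<Longrightarrow> dist x a < \<delta> \<Longrightarrow> dist (f x) (f a) < e/2"
    using f a e unfolding continuous_on_iff by (metis half_gt_zero)
  have "(\<lambda>n. 2 / real n) \<longlonglongrightarrow> 0" by (rule lim_const_over_n)
  then have "eventually (\<lambda>n. 2 / real n < \<delta>/2) sequentially"
    using \<delta>(1) by (intro order_tendstoD) auto
  moreover have "eventually (\<lambda>n. dist (b n / real n) a < \<delta>/2) sequentially"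
    using lim \<delta>(1) by (intro tendstoD) auto
  ultimately have "eventually (\<lambda>n. norm (integral {c..d} (\<lambda>x. real n * tent (real n * x - b n) * f x) - f a) < e) sequentially"
    using ev eventually_gt_at_top[of 0]
  proof eventually_elim
    case (elim n)
    then have n: "0 < real n" by simp
    let ?T = "\<lambda>x. real n * tent (real n * x - b n)"
    have Tc: "continuous_on {c..d} ?T"
      by (intro continuous_intros continuous_on_compose2[OF tent_continuous]) auto
    have T1: "integral {c..d} ?T = 1"
      using elim n by (intro tent_integral) auto
    have "integral {c..d} (\<lambda>x. ?T x * f x) - f a = integral {c..d} (\<lambda>x. ?T x * f x) - integral {c..d} ?T * f a"
      by (simp only: T1 mult_1)
    also have "integral {c..d} ?T * f a = integral {c..d} (\<lambda>x. ?T x * f a)"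
      by (rule integral_mult_left[symmetric])
    also have "integral {c..d} (\<lambda>x. ?T x * f x) - integral {c..d} (\<lambda>x. ?T x * f a) = integral {c..d} (\<lambda>x. ?T x * f x - ?T x * f a)"
      by (intro Henstock_Kurzweil_Integration.integral_diff[symmetric] integrable_continuous_interval continuous_intros Tc f)
    finally have eq: "integral {c..d} (\<lambda>x. ?T x * f x) - f a = integral {c..d} (\<lambda>x. ?T x * f x - ?T x * f a)" .
    have "norm (integral {c..d} (\<lambda>x. ?T x * f x - ?T x * f a)) \<le> integral {c..d} (\<lambda>x. ?T x * (e/2))"
    proof (rule integral_norm_bound_integral)
      fix x assume x: "x \<in> {c..d}"
      show "norm (?T x * f x - ?T x * f a) \<le> ?T x * (e/2)"
      proof (cases "real n * x - b n \<in> {0<..<2}")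
        case True
        then have "b n / real n < x" "x < b n / real n + 2 / real n"
          using n by (auto simp: field_simps)
        then have "dist x a < \<delta>" using elim unfolding dist_real_def by linarith
        then have "\<bar>f x - f a\<bar> \<le> e/2" using \<delta>(2)[OF x] by (simp add: dist_real_def)
        moreover have "norm (?T x * f x - ?T x * f a) = ?T x * \<bar>f x - f a\<bar>"
          using tent_nonneg[of "real n * x - b n"] n by (simp add: right_diff_distrib[symmetric] abs_mult)
        ultimately show ?thesis
          using tent_nonneg[of "real n * x - b n"] n by (auto intro!: mult_left_mono)
      qed (simp add: tent_outside)
    qed (intro integrable_continuous_interval continuous_intros Tc f)+
    also have "\<dots> = integral {c..d} ?T * (e/2)" by (rule integral_mult_left)
    also have "\<dots> = e/2" by (simp only: T1 mult_1)
    also have "\<dots> < e" using e by simp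
    finally show ?case unfolding eq .
  qed
  then show "\<exists>no. \<forall>n\<ge>no. norm (integral {c..d} (\<lambda>x. real n * tent (real n * x - b n) * f x) - f a) < e"
    by (simp add: eventually_sequentially)
qed

lemma test_function_continuous:
  assumes "test_function c d \<phi> \<phi>'"
  shows "continuous_on S \<phi>" "continuous_on S \<phi>'"
proof -
  have "\<And>x. isCont \<phi> x" using assms by (auto simp: test_function_def intro: DERIV_isCont)
  then show "continuous_on S \<phi>" by (simp add: continuous_at_imp_continuous_on)
  show "continuous_on S \<phi>'" using assms by (auto simp: test_function_def intro: continuous_on_subset)
qed

lemma test_function_outside:
  assumes "test_function c d \<phi> \<phi>'" and "x \<notin> {c<..<d}"
  shows "\<phi> x = 0"
  using assms by (fastforce simp: test_function_def)

text \<open>Rises from 0 to 1 on \<open>[1/n, 3/n]\<close> and falls back to 0 on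
  \<open>[1 - 3/n, 1 - 1/n]\<close>.\<close>

definition cutoff :: "nat \<Rightarrow> real \<Rightarrow> real" where
  "cutoff n x = ramp (real n * x - 1) - ramp (real n * x - (real n - 3))"

definition cutoff' :: "nat \<Rightarrow> real \<Rightarrow> real" where
  "cutoff' n x = real n * tent (real n * x - 1) - real n * tent (real n * x - (real n - 3))"

lemma cutoff_deriv: "(cutoff n has_real_derivative cutoff' n x) (at x)"
  unfolding cutoff_def[abs_def] cutoff'_def by (intro DERIV_diff ramp_scaled_deriv)

lemma cutoff_continuous: "continuous_on S (cutoff n)" "continuous_on S (cutoff' n)"
proof -
  show "continuous_on S (cutoff n)"
    using DERIV_isCont[OF cutoff_deriv] by (simp add: continuous_at_imp_continuous_on)
  show "continuous_on S (cutoff' n)"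
    unfolding cutoff'_def[abs_def]
    by (intro continuous_intros continuous_on_compose2[OF tent_continuous[of UNIV]]) auto
qed

text \<open>\<open>4 \<le> n\<close> is what keeps the descent from starting before
  \<open>1/n\<close> and completes the ascent by \<open>1 - 1/n\<close>.\<close>

lemma cutoff_outside:
  assumes "x \<notin> {1 / real n<..<1 - 1 / real n}" "4 \<le> n"
  shows "cutoff n x = 0" "cutoff' n x = 0"
proof -
  have n: "4 \<le> real n" using assms(2) by simp
  consider "real n * x \<le> 1" | "real n * x \<ge> real n - 1"
    using assms(1) n by (fastforce simp: field_simps)
  then have "cutoff n x = 0 \<and> cutoff' n x = 0"
  proof cases
    case 1
    then show ?thesis using n by (auto simp: cutoff_def cutoff'_def ramp_0 tent_outside)
  next
    case 2
    then show ?thesis using n by (auto simp: cutoff_def cutoff'_def ramp_1 tent_outside)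
  qed
  then show "cutoff n x = 0" "cutoff' n x = 0" by auto
qed

lemma cutoff_abs: "\<bar>cutoff n x\<bar> \<le> 1"
  using ramp_bounds[of "real n * x - 1"] ramp_bounds[of "real n * x - (real n - 3)"] by (auto simp: cutoff_def)

lemma cutoff_limit:
  assumes "x \<in> {0<..<1}"
  shows "(\<lambda>n. cutoff n x) \<longlonglongrightarrow> 1"
proof -
  obtain M where M: "3 / x + 3 / (1 - x) \<le> real M" using real_arch_simple by blast
  have "eventually (\<lambda>n. cutoff n x = 1) sequentially"
    using eventually_ge_at_top[of M]
  proof eventually_elim
    case (elim n)
    then have "3 / x + 3 / (1 - x) \<le> real n" using M by (meson of_nat_le_iff order_trans)
    moreover have "0 < 3 / x" "0 < 3 / (1 - x)" using assms by auto
    ultimately have "3 / x \<le> real n" "3 / (1 - x) \<le> real n" by linarith+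
    then have "3 \<le> real n * x" "3 \<le> real n * (1 - x)" using assms by (auto simp: field_simps)
    then have "ramp (real n * x - 1) = 1" "ramp (real n * x - (real n - 3)) = 0"
      by (auto intro!: ramp_1 ramp_0 simp: algebra_simps)
    then show ?case by (simp add: cutoff_def)
  qed
  then show ?thesis by (rule tendsto_eventually)
qed

text \<open>\<open>\<psi>\<close> is controlled on \<open>[0,1]\<close> only, whereas test functions
  live on the whole line. The case distinction discards the values outside, and the transition is
  smooth because the cutoff vanishes near both end points.\<close>

lemma test_function_cutoff:
  assumes d: "\<And>x. x \<in> {0..1} \<Longrightarrow> (\<psi> has_real_derivative \<psi>' x) (at x within {0..1})"
    and c: "continuous_on {0..1} \<psi>'" and n: "4 \<le> n"
  shows "test_function 0 1 (\<lambda>x. if x \<in> {0<..<1} then cutoff n x * \<psi> x else 0)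
    (\<lambda>x. if x \<in> {0<..<1} then cutoff' n x * \<psi> x + cutoff n x * \<psi>' x else 0)" (is "test_function 0 1 ?\<phi> ?\<phi>'")
proof -
  have n0: "0 < 1 / real n" "1 / real n < 1 - 1 / real n" using n by (auto simp: field_simps)
  have n1: "1 - 1 / real n < 1" using n by simp
  have zero: "?\<phi> x = 0" "?\<phi>' x = 0" if "x \<notin> {1 / real n..1 - 1 / real n}" for x
    using cutoff_outside[OF _ n, of x] that by auto
  have out: "open (- {1 / real n..1 - 1 / real n})" by (intro open_Compl closed_atLeastAtMost)
  have "(?\<phi> has_real_derivative ?\<phi>' x) (at x)" for x
  proof (cases "x \<in> {0<..<1}")
    case True
    have "(\<psi> has_real_derivative \<psi>' x) (at x)"
      using d[of x] True by (simp add: at_within_Icc_at)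
    then have "((\<lambda>x. cutoff n x * \<psi> x) has_real_derivative ?\<phi>' x) (at x)"
      using DERIV_mult[OF cutoff_deriv[of n x], of \<psi> "\<psi>' x"] True by (simp add: add.commute mult.commute)
    then show ?thesis
      by (rule has_field_derivative_transform_within_open[where S = "{0<..<1}"]) (use True in auto)
  next
    case False
    have "x \<notin> {p..q}" if "0 < p" "q < 1" for p q :: real using that False by auto
    from this[OF n0(1) n1] have x: "x \<notin> {1 / real n..1 - 1 / real n}" .
    have "((\<lambda>_. 0) has_real_derivative ?\<phi>' x) (at x)" using zero(2)[OF x] by simp
    then show ?thesis
      by (rule has_field_derivative_transform_within_open[OF _ out]) (use x zero(1) in auto)
  qed
  moreover have "continuous_on UNIV ?\<phi>'"
  proof -
    have "continuous_on {0..1} \<psi>"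
      by (rule DERIV_continuous_on[OF d])
    then have "continuous_on {0<..<1} \<psi>" "continuous_on {0<..<1} \<psi>'"
      using c by (auto elim!: continuous_on_subset)
    then have "continuous_on {0<..<1} (\<lambda>x. cutoff' n x * \<psi> x + cutoff n x * \<psi>' x)"
      by (intro continuous_on_add continuous_on_mult cutoff_continuous)
    then have 1: "continuous_on {0<..<1} ?\<phi>'"
      by (rule continuous_on_eq) auto
    have "continuous_on (- {1 / real n..1 - 1 / real n}) (\<lambda>_. 0 :: real)" by simp
    then have 2: "continuous_on (- {1 / real n..1 - 1 / real n}) ?\<phi>'"
      by (rule continuous_on_eq) (use zero(2) in force)
    have "continuous_on ({0<..<1} \<union> - {1 / real n..1 - 1 / real n}) ?\<phi>'"
      by (intro continuous_on_open_Un 1 2 out open_greaterThanLessThan)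
    moreover have "{0<..<1} \<union> - {p..q} = UNIV" if "0 < p" "q < 1" for p q :: real using that by auto
    from this[OF n0(1) n1] have "{0<..<1} \<union> - {1 / real n..1 - 1 / real n} = UNIV" .
    ultimately show ?thesis by simp
  qed
  moreover have "\<exists>p q. 0 < p \<and> q < 1 \<and> (\<forall>x. x \<notin> {p..q} \<longrightarrow> ?\<phi> x = 0)"
  proof (intro exI conjI allI impI)
    show "0 < 1 / real n" "1 - 1 / real n < 1" using n0(1) by (simp_all del: zero_less_divide_1_iff)
    fix x assume "x \<notin> {1 / real n..1 - 1 / real n}"
    then show "?\<phi> x = 0" by (rule zero(1))
  qed
  ultimately show ?thesis
    unfolding test_function_def by (intro conjI allI)
qed

lemma cutoff_pairing_limit:
  assumes h: "integrable (leb 0 1) h"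
  shows "(\<lambda>n. \<integral>x. cutoff n x * h x \<partial>leb 0 1) \<longlonglongrightarrow> (\<integral>x. h x \<partial>leb 0 1)"
proof (rule integral_dominated_convergence[where w = "\<lambda>x. \<bar>h x\<bar>"])
  note [measurable] = borel_measurable_integrable[OF h]
  have [measurable]: "cutoff n \<in> borel_measurable (leb 0 1)" for n
    by (rule continuous_leb_measurable[OF cutoff_continuous(1)])
  show "h \<in> borel_measurable (leb 0 1)" "(\<lambda>x. cutoff n x * h x) \<in> borel_measurable (leb 0 1)" for n
    by measurable
  show "integrable (leb 0 1) (\<lambda>x. \<bar>h x\<bar>)" using h by simp
  show "AE x in leb 0 1. (\<lambda>n. cutoff n x * h x) \<longlonglongrightarrow> h x"
  proof (intro AE_I2)
    fix x assume "x \<in> space (leb 0 1)"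
    then have "(\<lambda>n. cutoff n x * h x) \<longlonglongrightarrow> 1 * h x" by (intro tendsto_intros cutoff_limit) simp
    then show "(\<lambda>n. cutoff n x * h x) \<longlonglongrightarrow> h x" by simp
  qed
  show "AE x in leb 0 1. norm (cutoff n x * h x) \<le> \<bar>h x\<bar>" for n
    using cutoff_abs[of n] by (intro AE_I2) (auto simp: abs_mult intro: mult_left_le_one_le)
qed

text \<open>Test with \<open>cutoff n * \<psi>\<close>. The derivative of the cutoff is a bump near
  0 minus a bump near 1, so in the limit it evaluates \<open>f * \<psi>\<close> at the end points
  and yields the boundary terms. The other terms converge by dominated convergence.\<close>

theorem weak_deriv_by_parts:
  assumes w: "weak_deriv f g" and f: "continuous_on {0..1} f"
    and d: "\<And>x. x \<in> {0..1} \<Longrightarrow> (\<psi> has_real_derivative \<psi>' x) (at x within {0..1})"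
    and c: "continuous_on {0..1} \<psi>'"
  shows "ip g \<psi> = f 1 * \<psi> 1 - f 0 * \<psi> 0 - ip f \<psi>'"
proof -
  have \<psi>: "continuous_on {0..1} \<psi>" by (rule DERIV_continuous_on[OF d])
  have g: "g \<in> L2_space" using w by (simp add: weak_deriv_def)
  have i1: "integrable (leb 0 1) (\<lambda>x. g x * \<psi> x)" by (intro ip_integrable g continuous_L2 \<psi>)
  have i2: "integrable (leb 0 1) (\<lambda>x. f x * \<psi>' x)" by (intro ip_integrable f continuous_L2 c)
  have cf\<psi>: "continuous_on {0..1} (\<lambda>x. f x * \<psi> x)" by (intro continuous_intros f \<psi>)
  have T1: "(\<lambda>n. integral {0..1} (\<lambda>x. real n * tent (real n * x - 1) * (f x * \<psi> x))) \<longlonglongrightarrow> f 0 * \<psi> 0"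
  proof (rule tent_approx[OF cf\<psi>])
    show "(\<lambda>n. 1 / real n) \<longlonglongrightarrow> 0" by (rule lim_const_over_n)
    show "\<forall>\<^sub>F n in sequentially. 0 \<le> 1 / real n \<and> (1 + 2) / real n \<le> 1"
      using eventually_ge_at_top[of 3] by eventually_elim (auto simp: field_simps)
  qed simp
  have T2: "(\<lambda>n. integral {0..1} (\<lambda>x. real n * tent (real n * x - (real n - 3)) * (f x * \<psi> x))) \<longlonglongrightarrow> f 1 * \<psi> 1"
  proof (rule tent_approx[OF cf\<psi>])
    have "(\<lambda>n. 1 - 3 / real n) \<longlonglongrightarrow> 1 - 0" by (intro tendsto_intros lim_const_over_n)
    moreover have "eventually (\<lambda>n. 1 - 3 / real n = (real n - 3) / real n) sequentially"
      using eventually_gt_at_top[of 0] by eventually_elim (auto simp: field_simps)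
    ultimately show "(\<lambda>n. (real n - 3) / real n) \<longlonglongrightarrow> 1"
      using Lim_transform_eventually by fastforce
    show "\<forall>\<^sub>F n in sequentially. 0 \<le> (real n - 3) / real n \<and> (real n - 3 + 2) / real n \<le> 1"
      using eventually_ge_at_top[of 3] by eventually_elim (auto simp: field_simps)
  qed simp
  \<comment> \<open>The part of the tested identity that contains the derivative of the
    cutoff.\<close>
  define A where "A n = integral {0..1} (\<lambda>x. real n * tent (real n * x - 1) * (f x * \<psi> x))
    - integral {0..1} (\<lambda>x. real n * tent (real n * x - (real n - 3)) * (f x * \<psi> x))" for n
  have ev: "eventually (\<lambda>n. A n + (\<integral>x. cutoff n x * (f x * \<psi>' x) \<partial>leb 0 1) = - (\<integral>x. cutoff n x * (g x * \<psi> x) \<partial>leb 0 1)) sequentially"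
    using eventually_ge_at_top[of 4]
  proof eventually_elim
    case (elim n)
    have tc: "continuous_on {0..1} (\<lambda>x. real n * tent (real n * x - b) * (f x * \<psi> x))" for b
      by (intro continuous_intros cf\<psi>[unfolded] f \<psi> continuous_on_compose2[OF tent_continuous]) auto
    have "A n = integral {0..1} (\<lambda>x. real n * tent (real n * x - 1) * (f x * \<psi> x) - real n * tent (real n * x - (real n - 3)) * (f x * \<psi> x))"
      unfolding A_def by (intro Henstock_Kurzweil_Integration.integral_diff[symmetric] integrable_continuous_interval tc)
    also have "\<dots> = integral {0..1} (\<lambda>x. f x * (cutoff' n x * \<psi> x))"
      by (rule arg_cong[of _ _ "integral {0..1}"]) (auto simp: cutoff'_def algebra_simps)
    also have "\<dots> = (\<integral>x. f x * (cutoff' n x * \<psi> x) \<partial>leb 0 1)"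
      by (intro continuous_leb_integral[symmetric] continuous_intros f \<psi> cutoff_continuous)
    finally have A: "A n = \<dots>" .
    have ia: "integrable (leb 0 1) (\<lambda>x. f x * (cutoff' n x * \<psi> x))"
      by (intro continuous_leb_integrable continuous_intros f \<psi> cutoff_continuous)
    have ib: "integrable (leb 0 1) (\<lambda>x. cutoff n x * (f x * \<psi>' x))"
      by (intro continuous_leb_integrable continuous_intros f c cutoff_continuous)
    have "(\<integral>x. f x * (if x \<in> {0<..<1} then cutoff' n x * \<psi> x + cutoff n x * \<psi>' x else 0) \<partial>leb 0 1) =
      - (\<integral>x. g x * (if x \<in> {0<..<1} then cutoff n x * \<psi> x else 0) \<partial>leb 0 1)"
      using w test_function_cutoff[OF d c elim] by (simp add: weak_deriv_def)
    also have "(\<integral>x. f x * (if x \<in> {0<..<1} then cutoff' n x * \<psi> x + cutoff n x * \<psi>' x else 0) \<partial>leb 0 1)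
        = (\<integral>x. f x * (cutoff' n x * \<psi> x) + cutoff n x * (f x * \<psi>' x) \<partial>leb 0 1)"
      by (rule Bochner_Integration.integral_cong) (auto simp: algebra_simps)
    also have "\<dots> = A n + (\<integral>x. cutoff n x * (f x * \<psi>' x) \<partial>leb 0 1)"
      unfolding A using ia ib by (rule Bochner_Integration.integral_add)
    also have "(\<integral>x. g x * (if x \<in> {0<..<1} then cutoff n x * \<psi> x else 0) \<partial>leb 0 1) = (\<integral>x. cutoff n x * (g x * \<psi> x) \<partial>leb 0 1)"
      by (rule Bochner_Integration.integral_cong) (auto simp: algebra_simps)
    finally show ?case .
  qed
  have lim: "(\<lambda>n. A n + (\<integral>x. cutoff n x * (f x * \<psi>' x) \<partial>leb 0 1)) \<longlonglongrightarrow> (f 0 * \<psi> 0 - f 1 * \<psi> 1) + ip f \<psi>'"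
    unfolding A_def ip_def by (intro tendsto_intros T1 T2 cutoff_pairing_limit i2)
  moreover have "(\<lambda>n. - (\<integral>x. cutoff n x * (g x * \<psi> x) \<partial>leb 0 1)) \<longlonglongrightarrow> - ip g \<psi>"
    unfolding ip_def by (intro tendsto_intros cutoff_pairing_limit i1)
  ultimately have "(f 0 * \<psi> 0 - f 1 * \<psi> 1) + ip f \<psi>' = - ip g \<psi>"
    using LIMSEQ_unique[OF Lim_transform_eventually[OF lim ev]] by simp
  then show ?thesis by linarith
qed

text \<open>Testing with cut-off cosines shows in the limit that \<open>g - h\<close> is orthogonal
  to all cosines of integer frequency, and these are complete.\<close>

theorem weak_deriv_unique:
  assumes "weak_deriv f g" "weak_deriv f h"
  shows "AE x in leb 0 1. g x = h x"
proof -
  have gh: "g \<in> L2_space" "h \<in> L2_space" using assms by (auto simp: weak_deriv_def)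
  have gh_L2: "(\<lambda>x. g x - h x) \<in> L2_space" by (intro L2_diff gh)
  have "AE x in leb 0 1. (\<lambda>x. g x - h x) x = 0"
  proof (rule cos_complete[OF gh_L2, of 0])
    fix m :: nat
    define \<psi> where "\<psi> x = cos ((real m + 0) * pi * x)" for x
    define \<psi>' where "\<psi>' x = - sin ((real m + 0) * pi * x) * ((real m + 0) * pi)" for x
    have d: "(\<psi> has_real_derivative \<psi>' x) (at x within {0..1})" for x
      unfolding \<psi>_def \<psi>'_def by (auto intro!: derivative_eq_intros)
    have c: "continuous_on {0..1} \<psi>'" "continuous_on {0..1} \<psi>"
      unfolding \<psi>_def \<psi>'_def by (auto intro!: continuous_intros)
    have i: "integrable (leb 0 1) (\<lambda>x. (g x - h x) * \<psi> x)"
      by (intro ip_integrable gh_L2 continuous_L2 c)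
    have "eventually (\<lambda>n. (\<integral>x. cutoff n x * ((g x - h x) * \<psi> x) \<partial>leb 0 1) = 0) sequentially"
      using eventually_ge_at_top[of 4]
    proof eventually_elim
      case (elim n)
      have k: "(\<integral>x. k x * (if x \<in> {0<..<1} then cutoff n x * \<psi> x else 0) \<partial>leb 0 1) = (\<integral>x. k x * (cutoff n x * \<psi> x) \<partial>leb 0 1)" for k
        by (rule Bochner_Integration.integral_cong) auto
      have "(\<integral>x. g x * (cutoff n x * \<psi> x) \<partial>leb 0 1) = (\<integral>x. h x * (cutoff n x * \<psi> x) \<partial>leb 0 1)"
        using assms test_function_cutoff[OF d c(1) elim] unfolding k[symmetric] weak_deriv_def by fastforce
      moreover have "integrable (leb 0 1) (\<lambda>x. g x * (cutoff n x * \<psi> x))" "integrable (leb 0 1) (\<lambda>x. h x * (cutoff n x * \<psi> x))"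
        by (intro ip_integrable gh continuous_L2 continuous_intros cutoff_continuous c)+
      ultimately have "(\<integral>x. g x * (cutoff n x * \<psi> x) - h x * (cutoff n x * \<psi> x) \<partial>leb 0 1) = 0" by simp
      then show ?case by (simp add: algebra_simps)
    qed
    then have "(\<lambda>n. \<integral>x. cutoff n x * ((g x - h x) * \<psi> x) \<partial>leb 0 1) \<longlonglongrightarrow> 0"
      by (rule tendsto_eventually)
    from LIMSEQ_unique[OF this cutoff_pairing_limit[OF i]]
    show "ip (\<lambda>x. g x - h x) (\<lambda>x. cos ((real m + 0) * pi * x)) = 0"
      by (simp add: ip_def \<psi>_def)
  qed simp
  then show ?thesis by simp
qed

section \<open>Calculus of weak derivatives\<close>

lemma weak_deriv_L2: "weak_deriv f g \<Longrightarrow> f \<in> L2_space" "weak_deriv f g \<Longrightarrow> g \<in> L2_space"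
  by (auto simp: weak_deriv_def)

lemma test_function_L2: "test_function c d \<phi> \<phi>' \<Longrightarrow> \<phi> \<in> L2_space" "test_function c d \<phi> \<phi>' \<Longrightarrow> \<phi>' \<in> L2_space"
  using test_function_continuous by (auto intro: continuous_L2)

lemma weak_deriv_diff:
  assumes "weak_deriv f g" "weak_deriv p q"
  shows "weak_deriv (\<lambda>x. f x - p x) (\<lambda>x. g x - q x)"
  unfolding weak_deriv_def ip_def[symmetric]
  using assms ip_diff_left[OF weak_deriv_L2(1)[OF assms(1)] weak_deriv_L2(1)[OF assms(2)]]
    ip_diff_left[OF weak_deriv_L2(2)[OF assms(1)] weak_deriv_L2(2)[OF assms(2)]]
  by (auto simp: weak_deriv_def ip_def[symmetric] test_function_L2 intro!: L2_diff)

lemma weak_deriv_add: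
  assumes "weak_deriv f g" "weak_deriv p q"
  shows "weak_deriv (\<lambda>x. f x + p x) (\<lambda>x. g x + q x)"
  unfolding weak_deriv_def ip_def[symmetric]
  using assms ip_add_left[OF weak_deriv_L2(1)[OF assms(1)] weak_deriv_L2(1)[OF assms(2)]]
    ip_add_left[OF weak_deriv_L2(2)[OF assms(1)] weak_deriv_L2(2)[OF assms(2)]]
  by (auto simp: weak_deriv_def ip_def[symmetric] test_function_L2 intro!: L2_add)

lemma weak_deriv_AE_cong:
  assumes w: "weak_deriv f g" and f: "AE x in leb 0 1. f x = p x" and g: "AE x in leb 0 1. g x = q x"
  shows "weak_deriv p q"
  using w L2_AE_cong[OF weak_deriv_L2(1)[OF w] f] L2_AE_cong[OF weak_deriv_L2(2)[OF w] g]
    ip_AE_cong[OF weak_deriv_L2(1)[OF w] _ f] ip_AE_cong[OF weak_deriv_L2(2)[OF w] _ g]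
  by (auto simp: weak_deriv_def ip_def[symmetric] test_function_L2)

lemma integral_by_parts_real:
  fixes f g :: "real \<Rightarrow> real"
  assumes "a \<le> b"
    and f: "\<And>x. x \<in> {a..b} \<Longrightarrow> (f has_real_derivative f' x) (at x within {a..b})"
    and g: "\<And>x. x \<in> {a..b} \<Longrightarrow> (g has_real_derivative g' x) (at x within {a..b})"
    and c: "continuous_on {a..b} f'" "continuous_on {a..b} g'"
  shows "integral {a..b} (\<lambda>x. f x * g' x) = f b * g b - f a * g a - integral {a..b} (\<lambda>x. f' x * g x)"
proof -
  have cc: "continuous_on {a..b} f" "continuous_on {a..b} g"
    by (rule DERIV_continuous_on[OF f], assumption) (rule DERIV_continuous_on[OF g], assumption)
  have "((\<lambda>x. f x * g' x + f' x * g x) has_integral f b * g b - f a * g a) {a..b}"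
    using \<open>a \<le> b\<close> by (intro fundamental_theorem_of_calculus)
      (auto simp: has_real_derivative_iff_has_vector_derivative[symmetric] intro!: derivative_eq_intros f g)
  then have "integral {a..b} (\<lambda>x. f x * g' x + f' x * g x) = f b * g b - f a * g a"
    by (rule integral_unique)
  moreover have "integral {a..b} (\<lambda>x. f x * g' x + f' x * g x) = integral {a..b} (\<lambda>x. f x * g' x) + integral {a..b} (\<lambda>x. f' x * g x)"
    by (intro Henstock_Kurzweil_Integration.integral_add integrable_continuous_interval continuous_intros c cc)
  ultimately show ?thesis by linarith
qed

theorem weak_deriv_classical:
  assumes f: "\<And>x. x \<in> {0..1} \<Longrightarrow> (f has_real_derivative f' x) (at x within {0..1})"
    and c: "continuous_on {0..1} f'"
  shows "weak_deriv f f'"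
  unfolding weak_deriv_def
proof (intro conjI allI impI)
  have cf: "continuous_on {0..1} f" by (rule DERIV_continuous_on[OF f])
  show "f \<in> L2_space" "f' \<in> L2_space" by (intro continuous_L2 cf c)+
  fix \<phi> \<phi>' assume t: "test_function 0 1 \<phi> \<phi>'"
  have "integral {0..1} (\<lambda>x. f x * \<phi>' x) = f 1 * \<phi> 1 - f 0 * \<phi> 0 - integral {0..1} (\<lambda>x. f' x * \<phi> x)"
    using t by (intro integral_by_parts_real f c test_function_continuous[OF t])
      (auto simp: test_function_def intro: has_field_derivative_at_within)
  then show "(\<integral>x. f x * \<phi>' x \<partial>leb 0 1) = - (\<integral>x. f' x * \<phi> x \<partial>leb 0 1)"
    using test_function_outside[OF t, of 0] test_function_outside[OF t, of 1]
    by (simp add: continuous_leb_integral continuous_intros cf c test_function_continuous[OF t])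
qed

text \<open>By uniqueness the version chosen by \<open>wderiv\<close> agrees almost everywhere with
  any weak derivative at hand, so equations and norms can be computed from an explicit one.\<close>

lemma wderiv_eq:
  assumes "weak_deriv f g"
  shows "weak_deriv f (wderiv f)" "AE x in leb 0 1. wderiv f x = g x"
proof -
  show "weak_deriv f (wderiv f)"
    unfolding wderiv_def by (rule someI[of "weak_deriv f", OF assms])
  then show "AE x in leb 0 1. wderiv f x = g x"
    using weak_deriv_unique assms by blast
qed

lemma wderiv2_eq:
  assumes "weak_deriv f g" "weak_deriv g h"
  shows "AE x in leb 0 1. wderiv (wderiv f) x = h x"
proof -
  have "AE x in leb 0 1. g x = wderiv f x"
    using wderiv_eq(2)[OF assms(1)] by eventually_elim simp
  then have "weak_deriv (wderiv f) h"
    by (rule weak_deriv_AE_cong[OF assms(2)]) simp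
  then show ?thesis by (rule wderiv_eq(2))
qed

lemma H1_norm_eq:
  assumes "weak_deriv f g"
  shows "H1_norm f = sqrt ((L2_norm f)\<^sup>2 + (L2_norm g)\<^sup>2)"
  using L2_norm_AE_cong[OF weak_deriv_L2(2)[OF wderiv_eq(1)[OF assms]] wderiv_eq(2)[OF assms]]
  by (simp add: H1_norm_def)

lemma H2_norm_eq:
  assumes "weak_deriv f g" "weak_deriv g h"
  shows "H2_norm f = sqrt ((L2_norm f)\<^sup>2 + (L2_norm g)\<^sup>2 + (L2_norm h)\<^sup>2)"
proof -
  have "AE x in leb 0 1. h x = wderiv (wderiv f) x"
    using wderiv2_eq[OF assms] by eventually_elim simp
  from L2_norm_AE_cong[OF weak_deriv_L2(2)[OF assms(2)] this]
    L2_norm_AE_cong[OF weak_deriv_L2(2)[OF wderiv_eq(1)[OF assms(1)]] wderiv_eq(2)[OF assms(1)]]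
  show ?thesis by (simp add: H2_norm_def)
qed

section \<open>Volterra operators on the triangle\<close>

lemma Omega_iff: "(x, y) \<in> \<Omega> \<longleftrightarrow> 0 \<le> y \<and> y \<le> x \<and> x \<le> 1"
  by (simp add: \<Omega>_def)

text \<open>This reflection exchanges the roles of the two variables and turns integrals over
  \<open>[y,1]\<close> into integrals over \<open>[0,1 - y]\<close>. Rules for variable lower limits
  thereby follow from those for variable upper limits.\<close>

lemma Omega_reflect: "(x, y) \<in> \<Omega> \<longleftrightarrow> (1 - y, 1 - x) \<in> \<Omega>"
  by (auto simp: Omega_iff)

lemma compact_Omega: "compact \<Omega>"
proof -
  have "\<Omega> = ({0..1} \<times> {0..1}) \<inter> {p. snd p \<le> fst p}"
    by (auto simp: \<Omega>_def)
  moreover have "closed {p :: real \<times> real. snd p \<le> fst p}"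
    by (intro closed_Collect_le continuous_intros)
  moreover have "compact ({0..1::real} \<times> {0..1::real})"
    by (intro compact_Times compact_Icc)
  ultimately show ?thesis
    using compact_Int_closed by metis
qed

lemma integral_reflect_unit:
  fixes h :: "real \<Rightarrow> real"
  assumes "continuous_on {y..1} h" "y \<le> 1"
  shows "integral {0..1 - y} (\<lambda>s. h (1 - s)) = integral {y..1} h"
proof -
  have "((\<lambda>s. (-1) *\<^sub>R h (1 - s)) has_integral (integral {1 - 0..1 - (1 - y)} h - integral {1 - (1 - y)..1 - 0} h)) {0..1 - y}"
    by (rule has_integral_substitution_general[of "{}" 0 "1 - y" "\<lambda>s. 1 - s" y 1 h "\<lambda>_. -1"])
       (use assms in \<open>auto intro!: continuous_intros derivative_eq_intros\<close>)
  then have "((\<lambda>s. - ((-1) *\<^sub>R h (1 - s))) has_integral - (integral {1..y} h - integral {y..1} h)) {0..1 - y}"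
    by (intro has_integral_neg) simp
  moreover have "integral {1..y} h = 0" using assms(2) by (cases "y = 1") auto
  ultimately have "((\<lambda>s. h (1 - s)) has_integral integral {y..1} h) {0..1 - y}" by simp
  then show ?thesis by (rule integral_unique)
qed

text \<open>Moves the variable limit into the integrand, where continuity in a parameter is
  available.\<close>

lemma integral_scale_unit:
  fixes h :: "real \<Rightarrow> real"
  assumes "continuous_on {0..x} h" "0 \<le> x"
  shows "integral {0..x} h = x * integral {0..1} (\<lambda>s. h (x * s))"
proof -
  have "((\<lambda>s. x *\<^sub>R h (x * s)) has_integral (integral {x * 0..x * 1} h)) {0..1}"
    by (rule has_integral_substitution[of 0 1 "\<lambda>s. x * s" 0 x h "\<lambda>_. x"])
       (use assms in \<open>auto intro!: derivative_eq_intros mult_left_le\<close>)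
  then have "integral {0..1} (\<lambda>s. x * h (x * s)) = integral {0..x} h"
    by (intro integral_unique) simp
  then show ?thesis by simp
qed

lemma continuous_on_section:
  assumes "continuous_on (A \<times> B) (\<lambda>z. h (fst z) (snd z))" "a \<in> A" "T \<subseteq> B"
  shows "continuous_on T (h a)"
proof -
  have "continuous_on T (\<lambda>b. (\<lambda>z. h (fst z) (snd z)) (a, b))"
    by (rule continuous_on_compose2[OF assms(1)]) (use assms(2,3) in \<open>auto intro!: continuous_intros\<close>)
  then show ?thesis by simp
qed

text \<open>
  A kernel on the triangle is extended to the square by its tangent along the diagonal, which keeps it
  continuously differentiable in the first variable.
\<close>

lemma leibniz_lower:
  fixes p q :: "real \<times> real \<Rightarrow> real"
  assumes pc: "continuous_on \<Omega> p" and qc: "continuous_on \<Omega> q" and fc: "continuous_on {0..1} f"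
    and d: "\<And>x y. (x, y) \<in> \<Omega> \<Longrightarrow> ((\<lambda>x. p (x, y)) has_real_derivative q (x, y)) (at x within {y..1})"
    and x: "x \<in> {0..1}"
  shows "((\<lambda>x. integral {0..x} (\<lambda>y. p (x, y) * f y)) has_real_derivative
    p (x, x) * f x + integral {0..x} (\<lambda>y. q (x, y) * f y)) (at x within {0..1})"
proof -
  define P where "P x y = p (max x y, y) + min 0 (x - y) * q (y, y)" for x y
  define Q where "Q x y = q (max x y, y)" for x y
  have mc: "continuous_on ({0..1} \<times> {0..1}) (\<lambda>z. r (max (fst z) (snd z), snd z))" if "continuous_on \<Omega> r" for r :: "_ \<Rightarrow> real"
    by (rule continuous_on_compose2[OF that]) (auto intro!: continuous_intros simp: Omega_iff)
  have dc: "continuous_on ({0..1} \<times> {0..1}) (\<lambda>z :: real \<times> real. r (snd z, snd z))" if "continuous_on \<Omega> r" for r :: "_ \<Rightarrow> real"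
    by (rule continuous_on_compose2[OF that]) (auto intro!: continuous_intros simp: Omega_iff)
  have Pc: "continuous_on ({0..1} \<times> {0..1}) (\<lambda>z. P (fst z) (snd z))"
    unfolding P_def by (intro continuous_intros mc pc dc qc)
  have Qc: "continuous_on ({0..1} \<times> {0..1}) (\<lambda>z. Q (fst z) (snd z))"
    unfolding Q_def by (intro mc qc)
  have Pd: "((\<lambda>x. P x y) has_real_derivative Q x y) (at x within {0..1})" if x: "x \<in> {0..1}" and y: "y \<in> {0..1}" for x y
  proof -
    have lin: "((\<lambda>x. p (y, y) + (x - y) * q (y, y)) has_real_derivative q (y, y)) (at x within S)" for x S
      by (auto intro!: derivative_eq_intros)
    consider "x < y" | "x > y" | "x = y" by linarith
    then show ?thesis
    proof cases
      case 1
      then have "Q x y = q (y, y)" by (simp add: Q_def)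
      moreover have "((\<lambda>x. P x y) has_real_derivative q (y, y)) (at x within {0..1})"
        by (rule has_field_derivative_transform_within[OF lin, of "y - x"])
           (use 1 x in \<open>auto simp: P_def dist_real_def max_def min_def\<close>)
      ultimately show ?thesis by simp
    next
      case 2
      then have Q: "Q x y = q (x, y)" by (simp add: Q_def)
      have "((\<lambda>x. p (x, y)) has_real_derivative q (x, y)) (at x within {y..1})"
        using 2 x y by (intro d) (auto simp: Omega_iff)
      also have "at x within {y..1} = at x within {0..1}"
        by (rule at_within_nhd[of _ "{y<..}"]) (use 2 y in auto)
      finally have "((\<lambda>x. P x y) has_real_derivative q (x, y)) (at x within {0..1})"
        by (rule has_field_derivative_transform_within[of _ _ _ _ "x - y"])
           (use 2 x in \<open>auto simp: P_def dist_real_def max_def min_def\<close>)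
      then show ?thesis by (simp add: Q)
    next
      case 3
      have "((\<lambda>x. p (x, y)) has_real_derivative q (y, y)) (at y within {y..1})"
        using y by (intro d) (auto simp: Omega_iff)
      then have "((\<lambda>x. P x y) has_real_derivative q (y, y)) (at y within {y..1})"
        by (rule has_field_derivative_transform_within[of _ _ _ _ 1])
           (use y in \<open>auto simp: P_def max_def min_def\<close>)
      moreover have "((\<lambda>x. P x y) has_real_derivative q (y, y)) (at y within {0..y})"
        by (rule has_field_derivative_transform_within[OF lin, of 1])
           (use y in \<open>auto simp: P_def max_def min_def\<close>)
      ultimately have "((\<lambda>x. P x y) has_real_derivative q (y, y)) (at y within {0..y} \<union> {y..1})"
        by (simp add: has_field_derivative_iff Lim_within_Un)
      moreover have "{0..y} \<union> {y..1} = {0..1}" using y by auto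
      ultimately show ?thesis by (simp add: 3 Q_def)
    qed
  qed
  have Pyc: "continuous_on {0..1} (\<lambda>y. P x y)" if "x \<in> {0..1}" for x
    using that by (intro continuous_on_section[OF Pc]) auto
  \<comment> \<open>The two occurrences of \<open>x\<close>, in the integrand and in the limit, are
    separated. The derivative along the diagonal \<open>z = x\<close> then combines the two partial
    derivatives.\<close>
  define F where "F x z = integral {0..z} (\<lambda>y. P x y * f y)" for x z
  have fx: "((\<lambda>x. F x z) has_real_derivative integral {0..z} (\<lambda>y. Q x y * f y)) (at x within {0..1})"
    if z: "z \<in> {0..1}" and "x \<in> {0..1}" for x z
  proof -
    have "((\<lambda>x. integral (cbox 0 z) (\<lambda>y. P x y * f y)) has_real_derivative integral (cbox 0 z) (\<lambda>y. Q x y * f y)) (at x within {0..1})"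
    proof (rule leibniz_rule_field_derivative)
      show "((\<lambda>x. P x t * f t) has_real_derivative Q x t * f t) (at x within {0..1})" if "x \<in> {0..1}" "t \<in> cbox 0 z" for x t
        using that z by (intro DERIV_cmult_right Pd) auto
      show "(\<lambda>y. P x y * f y) integrable_on cbox 0 z" if "x \<in> {0..1}" for x
        unfolding cbox_interval
        by (intro integrable_continuous_interval continuous_intros continuous_on_subset[OF Pyc[OF that]] continuous_on_subset[OF fc]) (use z in auto)
      show "continuous_on ({0..1} \<times> cbox 0 z) (\<lambda>(x, t). Q x t * f t)"
        unfolding case_prod_beta cbox_interval
        by (intro continuous_intros continuous_on_subset[OF Qc] continuous_on_compose2[OF fc]) (use z in auto)
    qed (use that in \<open>auto simp: convex_real_interval\<close>)
    then show ?thesis by (simp add: F_def)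
  qed
  have fy: "((\<lambda>z. F x z) has_derivative blinfun_apply (blinfun_mult_right (P x z * f z))) (at z within {0..1})"
    if "x \<in> {0..1}" "z \<in> {0..1}" for x z
  proof -
    have "((\<lambda>z. F x z) has_real_derivative P x z * f z) (at z within {0..1})"
      unfolding F_def by (rule integral_has_real_derivative) (use that in \<open>auto intro!: continuous_intros Pyc fc\<close>)
    then show ?thesis by (simp add: has_field_derivative_def)
  qed
  \<comment> \<open>For joint differentiability only the partial derivative in \<open>z\<close> has
    to be continuous; the one in \<open>x\<close> is needed at a single point.\<close>
  have D: "((\<lambda>(x, z). F x z) has_derivative (\<lambda>(tx, tz). integral {0..x} (\<lambda>y. Q x y * f y) * tx + blinfun_apply (blinfun_mult_right (P x x * f x)) tz))
     (at (x, x) within {0..1} \<times> {0..1})"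
  proof (rule has_derivative_partialsI[OF _ fy])
    show "((\<lambda>xa. F xa x) has_derivative (*) (integral {0..x} (\<lambda>y. Q x y * f y))) (at x within {0..1})"
      using fx[OF x x] by (simp add: has_field_derivative_def)
    have "continuous_on ({0..1} \<times> {0..1}) (\<lambda>z. blinfun_mult_right (P (fst z) (snd z) * f (snd z)))"
      by (intro continuous_intros Pc continuous_on_compose2[OF fc]) auto
    then show "continuous (at (x, x) within {0..1} \<times> {0..1}) (\<lambda>(x, z). blinfun_mult_right (P x z * f z))"
      using x by (auto simp: case_prod_beta' continuous_on_eq_continuous_within)
  qed (use x in \<open>auto simp: convex_real_interval\<close>)
  have diag: "((\<lambda>x. (x, x)) has_derivative (\<lambda>h. (h, h))) (at x within {0..1})"
    by (auto intro!: derivative_eq_intros)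
  have "((\<lambda>x. case (x, x) of (x, z) \<Rightarrow> F x z) has_derivative
     (\<lambda>h. (case (h, h) of (tx, tz) \<Rightarrow> integral {0..x} (\<lambda>y. Q x y * f y) * tx + blinfun_apply (blinfun_mult_right (P x x * f x)) tz)))
     (at x within {0..1})"
    by (rule has_derivative_in_compose[OF diag has_derivative_subset[OF D]]) auto
  then have "((\<lambda>x. F x x) has_real_derivative P x x * f x + integral {0..x} (\<lambda>y. Q x y * f y)) (at x within {0..1})"
    unfolding has_field_derivative_def prod.case
    by (rule has_derivative_eq_rhs) (auto simp: fun_eq_iff algebra_simps)
  moreover have "F x x = integral {0..x} (\<lambda>y. p (x, y) * f y)" for x
    unfolding F_def by (rule integral_cong) (auto simp: P_def)
  moreover have "integral {0..x} (\<lambda>y. Q x y * f y) = integral {0..x} (\<lambda>y. q (x, y) * f y)"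
    by (rule integral_cong) (auto simp: Q_def)
  moreover have "P x x = p (x, x)" by (simp add: P_def)
  ultimately show ?thesis by simp
qed

lemma continuous_on_Omega_section_lower:
  assumes "continuous_on \<Omega> p" "x \<in> {0..1}"
  shows "continuous_on {0..x} (\<lambda>y. p (x, y))"
  by (rule continuous_on_compose2[OF assms(1)]) (use assms(2) in \<open>auto intro!: continuous_intros simp: Omega_iff\<close>)

lemma continuous_on_Omega_section_upper:
  assumes "continuous_on \<Omega> p" "y \<in> {0..1}"
  shows "continuous_on {y..1} (\<lambda>x. p (x, y))"
  by (rule continuous_on_compose2[OF assms(1)]) (use assms(2) in \<open>auto intro!: continuous_intros simp: Omega_iff\<close>)

lemma continuous_on_Omega_diagonal:
  assumes "continuous_on \<Omega> p"
  shows "continuous_on {0..1} (\<lambda>x. p (x, x))"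
  by (rule continuous_on_compose2[OF assms(1)]) (auto intro!: continuous_intros simp: Omega_iff)

text \<open>The reflection of the triangle reduces this to \<open>leibniz_lower\<close>. The sign of
  the boundary term and of \<open>q'\<close> comes from the inner derivative -1.\<close>

lemma leibniz_upper:
  fixes p q :: "real \<times> real \<Rightarrow> real"
  assumes pc: "continuous_on \<Omega> p" and qc: "continuous_on \<Omega> q" and fc: "continuous_on {0..1} f"
    and d: "\<And>x y. (x, y) \<in> \<Omega> \<Longrightarrow> ((\<lambda>y. p (x, y)) has_real_derivative q (x, y)) (at y within {0..x})"
    and y: "y \<in> {0..1}"
  shows "((\<lambda>y. integral {y..1} (\<lambda>x. p (x, y) * f x)) has_real_derivative
    - p (y, y) * f y + integral {y..1} (\<lambda>x. q (x, y) * f x)) (at y within {0..1})"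
proof -
  define p' where "p' z = p (1 - snd z, 1 - fst z)" for z
  define q' where "q' z = - q (1 - snd z, 1 - fst z)" for z
  define f' where "f' s = f (1 - s)" for s
  have rc: "continuous_on \<Omega> (\<lambda>z. r (1 - snd z, 1 - fst z))" if "continuous_on \<Omega> r" for r :: "_ \<Rightarrow> real"
    by (rule continuous_on_compose2[OF that]) (auto intro!: continuous_intros simp: \<Omega>_def)
  have G: "((\<lambda>x. integral {0..x} (\<lambda>y. p' (x, y) * f' y)) has_real_derivative
    p' (x, x) * f' x + integral {0..x} (\<lambda>y. q' (x, y) * f' y)) (at x within {0..1})" if "x \<in> {0..1}" for x
  proof (rule leibniz_lower)
    show "continuous_on \<Omega> p'" "continuous_on \<Omega> q'"
      unfolding p'_def[abs_def] q'_def[abs_def] by (intro continuous_intros rc pc qc)+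
    show "continuous_on {0..1} f'"
      unfolding f'_def[abs_def] by (rule continuous_on_compose2[OF fc]) (auto intro!: continuous_intros)
    fix x y assume "(x, y) \<in> \<Omega>"
    then have "((\<lambda>y'. p (1 - y, y')) has_real_derivative q (1 - y, 1 - x)) (at (1 - x) within {0..1 - y})"
      by (intro d) (simp add: Omega_reflect[of x y])
    then have "((\<lambda>y'. p (1 - y, y')) has_real_derivative q (1 - y, 1 - x)) (at (1 - x) within (\<lambda>x. 1 - x) ` {y..1})"
      by (rule DERIV_subset) auto
    then have "((\<lambda>x. p (1 - y, 1 - x)) has_real_derivative q (1 - y, 1 - x) * (-1)) (at x within {y..1})"
      by (rule DERIV_image_chain[unfolded o_def]) (auto intro!: derivative_eq_intros)
    then show "((\<lambda>x. p' (x, y)) has_real_derivative q' (x, y)) (at x within {y..1})"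
      by (simp add: p'_def q'_def)
  qed fact
  have refl: "integral {0..1 - y} (\<lambda>s. r (1 - s, y) * f' s) = integral {y..1} (\<lambda>x. r (x, y) * f x)"
    if "y \<in> {0..1}" "continuous_on \<Omega> r" for y and r :: "_ \<Rightarrow> real"
    unfolding f'_def using that
    by (intro integral_reflect_unit[of y "\<lambda>x. r (x, y) * f x"] continuous_intros continuous_on_Omega_section_upper continuous_on_subset[OF fc]) auto
  have "((\<lambda>x. integral {0..x} (\<lambda>y. p' (x, y) * f' y)) has_real_derivative
    p' (1 - y, 1 - y) * f' (1 - y) + integral {0..1 - y} (\<lambda>s. q' (1 - y, s) * f' s)) (at (1 - y) within (\<lambda>x. 1 - x) ` {0..1})"
    using G[of "1 - y"] y by (auto intro: DERIV_subset)
  then have "((\<lambda>y. integral {0..1 - y} (\<lambda>s. p' (1 - y, s) * f' s)) has_real_derivative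
    (p' (1 - y, 1 - y) * f' (1 - y) + integral {0..1 - y} (\<lambda>s. q' (1 - y, s) * f' s)) * (-1)) (at y within {0..1})"
    by (rule DERIV_image_chain[unfolded o_def]) (auto intro!: derivative_eq_intros)
  then have "((\<lambda>y. integral {y..1} (\<lambda>x. p (x, y) * f x)) has_real_derivative
    (p' (1 - y, 1 - y) * f' (1 - y) + integral {0..1 - y} (\<lambda>s. q' (1 - y, s) * f' s)) * (-1)) (at y within {0..1})"
    by (rule has_field_derivative_transform_within[of _ _ _ _ 1]) (use y refl[OF _ pc] in \<open>auto simp: p'_def\<close>)
  moreover have "p' (1 - y, 1 - y) * f' (1 - y) = p (y, y) * f y" by (simp add: p'_def f'_def)
  moreover have "integral {0..1 - y} (\<lambda>s. q' (1 - y, s) * f' s) = - integral {y..1} (\<lambda>x. q (x, y) * f x)"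
    using refl[OF y qc] by (simp add: q'_def)
  ultimately show ?thesis by simp
qed

text \<open>With y = x s the integral runs over the fixed interval \<open>[0,1]\<close>, and its
  integrand is jointly continuous because the point \<open>(x, x * s)\<close> stays in the
  triangle.\<close>

lemma continuous_on_lower_integral:
  fixes p :: "real \<Rightarrow> real \<times> real \<Rightarrow> real" and f :: "real \<Rightarrow> real \<Rightarrow> real"
  assumes p: "continuous_on (S \<times> \<Omega>) (\<lambda>(t, z). p t z)" and f: "continuous_on (S \<times> {0..1}) (\<lambda>(t, y). f t y)"
  shows "continuous_on (S \<times> {0..1}) (\<lambda>(t, x). integral {0..x} (\<lambda>y. p t (x, y) * f t y))"
proof -
  have "continuous_on (S \<times> {0..1}) (\<lambda>z. snd z * integral {0..1} (\<lambda>s. p (fst z) (snd z, snd z * s) * f (fst z) (snd z * s)))"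
  proof (intro continuous_intros)
    have "continuous_on ((S \<times> {0..1}) \<times> {0..1}) (\<lambda>w. (case (fst (fst w), (snd (fst w), snd (fst w) * snd w)) of (t, z) \<Rightarrow> p t z))"
      by (rule continuous_on_compose2[OF p]) (auto intro!: continuous_intros mult_left_le simp: Omega_iff)
    moreover have "continuous_on ((S \<times> {0..1}) \<times> {0..1}) (\<lambda>w. (case (fst (fst w), snd (fst w) * snd w) of (t, z) \<Rightarrow> f t z))"
      by (rule continuous_on_compose2[OF f]) (auto intro!: continuous_intros mult_le_one)
    ultimately have "continuous_on ((S \<times> {0..1}) \<times> cbox 0 1) (\<lambda>(z, s). p (fst z) (snd z, snd z * s) * f (fst z) (snd z * s))"
      unfolding interval_cbox[symmetric] case_prod_beta by (simp add: continuous_on_mult)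
    then show "continuous_on (S \<times> {0..1}) (\<lambda>z. integral {0..1} (\<lambda>s. p (fst z) (snd z, snd z * s) * f (fst z) (snd z * s)))"
      unfolding interval_cbox by (rule integral_continuous_on_param)
  qed
  then show ?thesis
  proof (rule continuous_on_eq)
    fix z assume z: "z \<in> S \<times> {0..1::real}"
    then obtain t x where zt: "z = (t, x)" "t \<in> S" "x \<in> {0..1}" by auto
    have "continuous_on {0..x} (\<lambda>y. (case (t, (x, y)) of (t, z) \<Rightarrow> p t z))"
      by (rule continuous_on_compose2[OF p]) (use zt in \<open>auto intro!: continuous_intros simp: Omega_iff\<close>)
    moreover have "continuous_on {0..x} (\<lambda>y. (case (t, y) of (t, z) \<Rightarrow> f t z))"
      by (rule continuous_on_compose2[OF f]) (use zt in \<open>auto intro!: continuous_intros\<close>)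
    ultimately have "continuous_on {0..x} (\<lambda>y. p t (x, y) * f t y)" by (simp add: continuous_on_mult)
    from integral_scale_unit[OF this] zt
    show "snd z * integral {0..1} (\<lambda>s. p (fst z) (snd z, snd z * s) * f (fst z) (snd z * s)) = (case z of (t, x) \<Rightarrow> integral {0..x} (\<lambda>y. p t (x, y) * f t y))"
      by simp
  qed
qed

text \<open>Gronwall: with \<open>m\<close> the integral of the modulus of \<open>e\<close>, the
  hypothesis gives \<open>\<bar>e x\<bar> \<le> \<epsilon> + B * m x\<close>, whence the exponential
  factor. For \<open>\<epsilon> = 0\<close> this is uniqueness for the Volterra equation.\<close>

lemma Volterra_sup_bound:
  fixes k :: "real \<times> real \<Rightarrow> real" and e :: "real \<Rightarrow> real"
  assumes k: "continuous_on \<Omega> k" and B: "\<And>z. z \<in> \<Omega> \<Longrightarrow> \<bar>k z\<bar> \<le> B"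
    and e: "continuous_on {0..1} e"
    and le: "\<And>x. x \<in> {0..1} \<Longrightarrow> \<bar>e x + integral {0..x} (\<lambda>y. k (x, y) * e y)\<bar> \<le> \<epsilon>"
    and x: "x \<in> {0..1}"
  shows "\<bar>e x\<bar> \<le> \<epsilon> * exp B"
proof -
  have "\<bar>k (0, 0)\<bar> \<le> B" by (rule B) (simp add: Omega_iff)
  then have B0: "0 \<le> B" by linarith
  have \<epsilon>0: "0 \<le> \<epsilon>" using le[of 0] by auto
  define m where "m x = integral {0..x} (\<lambda>y. \<bar>e y\<bar>)" for x
  have ec: "continuous_on {0..1} (\<lambda>y. \<bar>e y\<bar>)" by (intro continuous_intros e)
  have md: "(m has_real_derivative \<bar>e x\<bar>) (at x within {0..1})" if "x \<in> {0..1}" for x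
    unfolding m_def by (rule integral_has_real_derivative[OF ec that])
  have est: "\<bar>e x\<bar> \<le> \<epsilon> + B * m x" if x: "x \<in> {0..1}" for x
  proof -
    have sub: "continuous_on {0..x} e" by (rule continuous_on_subset[OF e]) (use x in auto)
    have kc: "continuous_on {0..x} (\<lambda>y. k (x, y) * e y)"
      by (intro continuous_intros continuous_on_Omega_section_lower[OF k x] sub)
    have "norm (integral {0..x} (\<lambda>y. k (x, y) * e y)) \<le> integral {0..x} (\<lambda>y. B * \<bar>e y\<bar>)"
      by (rule integral_norm_bound_integral)
         (use x B in \<open>auto intro!: integrable_continuous_interval kc continuous_intros sub mult_right_mono simp: abs_mult Omega_iff\<close>)
    then have "\<bar>integral {0..x} (\<lambda>y. k (x, y) * e y)\<bar> \<le> B * m x" by (simp add: m_def)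
    then show ?thesis using le[OF x] by linarith
  qed
  \<comment> \<open>Integrating factor: the derivative of \<open>m\<close> is at most
    \<open>\<epsilon> + B * m\<close>, so \<open>q\<close> does not increase.\<close>
  define q where "q x = (\<epsilon> + B * m x) * exp (- B * x)" for x
  have "q x \<le> q 0"
  proof (rule DERIV_nonpos_imp_decreasing_open[of 0 x q])
    show "0 \<le> x" using x by simp
    have "continuous_on {0..1} q"
      unfolding q_def by (intro continuous_intros DERIV_continuous_on[OF md])
    then show "continuous_on {0..x} q" by (rule continuous_on_subset) (use x in auto)
    fix s assume s: "0 < s" "s < x"
    have "(m has_real_derivative \<bar>e s\<bar>) (at s)"
      using md[of s] s x by (simp add: at_within_Icc_at)
    then have "(q has_real_derivative (B * \<bar>e s\<bar>) * exp (- B * s) + (\<epsilon> + B * m s) * (exp (- B * s) * (- B))) (at s)"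
      unfolding q_def by (auto intro!: derivative_eq_intros)
    moreover have "(B * \<bar>e s\<bar>) * exp (- B * s) + (\<epsilon> + B * m s) * (exp (- B * s) * (- B)) = B * exp (- B * s) * (\<bar>e s\<bar> - (\<epsilon> + B * m s))"
      by (simp add: algebra_simps)
    moreover have "\<dots> \<le> 0"
      using est[of s] s x B0 by (intro mult_nonneg_nonpos) auto
    ultimately show "\<exists>y. (q has_real_derivative y) (at s) \<and> y \<le> 0" by auto
  qed
  then have "\<epsilon> + B * m x \<le> \<epsilon> * exp (B * x)"
    by (simp add: q_def m_def exp_minus field_simps)
  also have "\<dots> \<le> \<epsilon> * exp B"
    using x B0 \<epsilon>0 by (intro mult_left_mono) (auto intro: mult_left_le)
  finally show ?thesis using est[OF x] by linarith
qed

text \<open>The solution is the Neumann series formed by the iterates of minus the integral operator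
  on \<open>f\<close>. The parameter \<open>t\<close> is carried along because the kernel depends on
  time and joint continuity of the solution is wanted.\<close>

theorem Volterra_exists:
  fixes k :: "real \<Rightarrow> real \<times> real \<Rightarrow> real"
  assumes S: "compact S" and k: "continuous_on (S \<times> \<Omega>) (\<lambda>(t, z). k t z)"
    and f: "continuous_on (S \<times> {0..1}) (\<lambda>(t, x). f t x)"
  obtains u where "continuous_on (S \<times> {0..1}) (\<lambda>(t, x). u t x)"
    and "\<And>t x. t \<in> S \<Longrightarrow> x \<in> {0..1} \<Longrightarrow> u t x + integral {0..x} (\<lambda>y. k t (x, y) * u t y) = f t x"
proof -
  obtain B where B: "B > 0" "\<And>t z. t \<in> S \<Longrightarrow> z \<in> \<Omega> \<Longrightarrow> \<bar>k t z\<bar> \<le> B"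
  proof -
    have "compact ((\<lambda>(t, z). k t z) ` (S \<times> \<Omega>))"
      by (intro compact_continuous_image k compact_Times S compact_Omega)
    then have "bounded ((\<lambda>(t, z). k t z) ` (S \<times> \<Omega>))" by (rule compact_imp_bounded)
    then obtain b where b: "\<forall>y\<in>(\<lambda>(t, z). k t z) ` (S \<times> \<Omega>). norm y \<le> b" unfolding bounded_iff by blast
    then have "\<bar>k t z\<bar> \<le> b" if "t \<in> S" "z \<in> \<Omega>" for t z
      using b[rule_format, of "k t z"] that by (force simp: image_iff)
    then show ?thesis by (intro that[of "max b 1"]) (auto intro: order_trans[OF _ max.cobounded1])
  qed
  obtain C where C: "\<And>t x. t \<in> S \<Longrightarrow> x \<in> {0..1} \<Longrightarrow> \<bar>f t x\<bar> \<le> C"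
  proof -
    have "compact ((\<lambda>(t, x). f t x) ` (S \<times> {0..1}))"
      by (intro compact_continuous_image f compact_Times S) auto
    then have "bounded ((\<lambda>(t, x). f t x) ` (S \<times> {0..1}))" by (rule compact_imp_bounded)
    then obtain b where b: "\<forall>y\<in>(\<lambda>(t, x). f t x) ` (S \<times> {0..1}). norm y \<le> b" unfolding bounded_iff by blast
    then have "\<bar>f t x\<bar> \<le> b" if "t \<in> S" "x \<in> {0..1}" for t x
      using b[rule_format, of "f t x"] that by (force simp: image_iff)
    then show ?thesis by (rule that)
  qed
  define T where "T g t x = - integral {0..x} (\<lambda>y. k t (x, y) * g t y)" for g :: "real \<Rightarrow> real \<Rightarrow> real" and t x
  define a where "a n = (T ^^ n) f" for n
  have aS: "a (Suc n) t x = - integral {0..x} (\<lambda>y. k t (x, y) * a n t y)" for n t x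
    by (simp add: a_def T_def)
  have ac: "continuous_on (S \<times> {0..1}) (\<lambda>(t, x). a n t x)" for n
  proof (induction n)
    case 0 then show ?case using f by (simp add: a_def)
  next
    case (Suc n)
    have "continuous_on (S \<times> {0..1}) (\<lambda>z. - (case z of (t, x) \<Rightarrow> integral {0..x} (\<lambda>y. k t (x, y) * a n t y)))"
      by (intro continuous_intros continuous_on_lower_integral k Suc)
    then show ?case by (simp add: aS case_prod_beta)
  qed
  have sec: "continuous_on {0..x} (\<lambda>y. g t y)" if "continuous_on (S \<times> {0..1}) (\<lambda>(t, x). g t x)" "t \<in> S" "x \<in> {0..1}"
    for g :: "real \<Rightarrow> real \<Rightarrow> real" and t x
    using that by (intro continuous_on_section[of S "{0..1}" g]) (auto simp: case_prod_beta)
  have ksec: "continuous_on {0..x} (\<lambda>y. k t (x, y))" if "t \<in> S" "x \<in> {0..1}" for t x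
    using that k by (intro continuous_on_Omega_section_lower continuous_on_section[of S \<Omega> k]) (auto simp: case_prod_beta)
  \<comment> \<open>Measured against the weight exp(2 B x), one application of the operator gains
    the factor B / (2 B) = 1/2. The series therefore converges geometrically however large
    \<open>B\<close> is.\<close>
  have bd: "\<bar>a n t x\<bar> \<le> C * (1/2)^n * exp (2 * B * x)" if t: "t \<in> S" and "x \<in> {0..1}" for n t x
    using that(2)
  proof (induction n arbitrary: x)
    case 0
    then have "\<bar>a 0 t x\<bar> \<le> C * 1" using C[OF t] by (simp add: a_def)
    also have "\<dots> \<le> C * exp (2 * B * x)"
      using B(1) 0 C[OF t 0] by (intro mult_left_mono) (auto intro: order_trans[OF abs_ge_zero])
    finally show ?case by simp
  next
    case (Suc n)
    let ?g = "\<lambda>y. B * (C * (1/2)^n * exp (2 * B * y))"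
    have "((\<lambda>y. C * (1/2)^n / 2 * exp (2 * B * y)) has_real_derivative ?g y) (at y within {0..x})" for y
      by (auto intro!: derivative_eq_intros)
    then have gi: "(?g has_integral (C * (1/2)^n / 2 * exp (2 * B * x) - C * (1/2)^n / 2 * exp (2 * B * 0))) {0..x}"
      using Suc.prems by (intro fundamental_theorem_of_calculus) (auto simp: has_real_derivative_iff_has_vector_derivative[symmetric])
    have C0: "0 \<le> C" using C[OF t Suc.prems] by linarith
    have "norm (integral {0..x} (\<lambda>y. k t (x, y) * a n t y)) \<le> integral {0..x} ?g"
    proof (rule integral_norm_bound_integral)
      show "(\<lambda>y. k t (x, y) * a n t y) integrable_on {0..x}"
        using Suc.prems t by (intro integrable_continuous_interval continuous_intros ksec sec[OF ac])
      show "?g integrable_on {0..x}" using gi by blast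
      fix y assume y: "y \<in> {0..x}"
      then show "norm (k t (x, y) * a n t y) \<le> ?g y"
        unfolding real_norm_def abs_mult using Suc.prems t B(1)
        by (intro mult_mono Suc.IH B(2)) (auto simp: Omega_iff)
    qed
    also have "integral {0..x} ?g = C * (1/2)^n / 2 * exp (2 * B * x) - C * (1/2)^n / 2 * exp (2 * B * 0)"
      by (rule integral_unique[OF gi])
    also have "\<dots> \<le> C * (1/2)^Suc n * exp (2 * B * x)"
      using C0 by simp
    finally show ?case by (simp add: aS)
  qed
  define U where "U N z = (\<Sum>n<N. a n (fst z) (snd z))" for N z
  define u where "u t x = (\<Sum>n. a n t x)" for t x
  have C0: "0 \<le> C \<or> S = {}" using C[of _ 0] by fastforce
  have lim: "uniform_limit (S \<times> {0..1}) (\<lambda>N z. \<Sum>n<N. a n (fst z) (snd z)) (\<lambda>z. \<Sum>n. a n (fst z) (snd z)) sequentially"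
  proof (rule Weierstrass_m_test[where M = "\<lambda>n. C * (1/2)^n * exp (2 * B)"])
    fix n z assume "z \<in> S \<times> {0..1::real}"
    then obtain t x where zt: "z = (t, x)" "t \<in> S" "x \<in> {0..1}" by auto
    have "\<bar>a n t x\<bar> \<le> C * (1/2)^n * exp (2 * B * x)" by (rule bd[OF zt(2,3)])
    also have "\<dots> \<le> C * (1/2)^n * exp (2 * B)"
      using zt B(1) C[OF zt(2,3)] by (intro mult_left_mono mult_nonneg_nonneg) (auto simp: mult_left_le)
    finally show "norm (a n (fst z) (snd z)) \<le> C * (1/2)^n * exp (2 * B)" by (simp add: zt)
  next
    show "summable (\<lambda>n. C * (1/2)^n * exp (2 * B))"
      by (intro summable_mult2 summable_mult summable_geometric) auto
  qed
  have Uc: "continuous_on (S \<times> {0..1}) (\<lambda>z. \<Sum>n<N. a n (fst z) (snd z))" for N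
    using ac by (intro continuous_on_sum) (simp add: case_prod_beta)
  have uc: "continuous_on (S \<times> {0..1}) (\<lambda>(t, x). u t x)"
    unfolding u_def case_prod_beta
    by (rule uniform_limit_theorem[OF _ lim]) (auto intro!: always_eventually Uc)
  \<comment> \<open>The partial sums are the Picard iterates; passing to the limit in this recursion
    gives the equation.\<close>
  have rec: "(\<Sum>n<Suc N. a n t x) = f t x - integral {0..x} (\<lambda>y. k t (x, y) * (\<Sum>n<N. a n t y))" if "t \<in> S" "x \<in> {0..1}" for N t x
  proof -
    have "(\<Sum>n<Suc N. a n t x) = a 0 t x + (\<Sum>n<N. a (Suc n) t x)"
      by (rule sum.lessThan_Suc_shift)
    also have "(\<Sum>n<N. a (Suc n) t x) = - (\<Sum>n<N. integral {0..x} (\<lambda>y. k t (x, y) * a n t y))"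
      by (simp add: aS sum_negf)
    also have "(\<Sum>n<N. integral {0..x} (\<lambda>y. k t (x, y) * a n t y)) = integral {0..x} (\<lambda>y. \<Sum>n<N. k t (x, y) * a n t y)"
      by (rule integral_sum[symmetric]) (use that in \<open>auto intro!: integrable_continuous_interval continuous_intros ksec sec[OF ac]\<close>)
    finally show ?thesis by (simp add: sum_distrib_left a_def)
  qed
  have "u t x + integral {0..x} (\<lambda>y. k t (x, y) * u t y) = f t x" if tx: "t \<in> S" "x \<in> {0..1}" for t x
  proof -
    have us: "continuous_on {0..x} (\<lambda>y. u t y)" by (rule sec[OF uc tx])
    have "uniform_limit {0..x} (\<lambda>N y. \<Sum>n<N. a n t y) (\<lambda>y. u t y) sequentially"
      using uniform_limit_on_subset[OF lim, of "{t} \<times> {0..x}"] tx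
      by (force simp: uniform_limit_iff u_def)
    then have "uniform_limit {0..x} (\<lambda>N y. k t (x, y) * (\<Sum>n<N. a n t y)) (\<lambda>y. k t (x, y) * u t y) sequentially"
      by (intro uniform_lim_mult uniform_limit_const compact_imp_bounded compact_continuous_image ksec us tx) auto
    then obtain I J where IJ: "\<And>N. ((\<lambda>y. k t (x, y) * (\<Sum>n<N. a n t y)) has_integral I N) {0..x}"
        "((\<lambda>y. k t (x, y) * u t y) has_integral J) {0..x}" "I \<longlonglongrightarrow> J"
    proof (rule uniform_limit_integral)
      show "continuous_on {0..x} (\<lambda>y. k t (x, y) * (\<Sum>n<N. a n t y))" for N
        by (intro continuous_intros ksec sec[OF ac] tx)
    qed auto
    have "(\<lambda>N. integral {0..x} (\<lambda>y. k t (x, y) * (\<Sum>n<N. a n t y))) \<longlonglongrightarrow> integral {0..x} (\<lambda>y. k t (x, y) * u t y)"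
      using IJ(3) by (simp only: integral_unique[OF IJ(1)] integral_unique[OF IJ(2)])
    then have "(\<lambda>N. f t x - integral {0..x} (\<lambda>y. k t (x, y) * (\<Sum>n<N. a n t y))) \<longlonglongrightarrow> f t x - integral {0..x} (\<lambda>y. k t (x, y) * u t y)"
      by (intro tendsto_intros)
    then have "(\<lambda>N. \<Sum>n<Suc N. a n t x) \<longlonglongrightarrow> f t x - integral {0..x} (\<lambda>y. k t (x, y) * u t y)"
      by (simp only: rec[OF tx])
    moreover have "(\<lambda>N. \<Sum>n<N. a n t x) \<longlonglongrightarrow> u t x"
      using tendsto_uniform_limitI[OF lim, of "(t, x)"] tx by (simp add: u_def)
    then have "(\<lambda>N. \<Sum>n<Suc N. a n t x) \<longlonglongrightarrow> u t x" by (rule LIMSEQ_Suc)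
    ultimately show ?thesis using LIMSEQ_unique by fastforce
  qed
  then show ?thesis by (rule that[OF uc])
qed

section \<open>The kernel\<close>

text \<open>The derivative within \<open>\<Omega>\<close> may be restricted to any segment in
  \<open>\<Omega>\<close>. Horizontal, vertical and diagonal segments give the one-variable
  derivatives of the kernel, one-sided at the boundary.\<close>

lemma C1_on_affine_path:
  assumes f: "C1_on \<Omega> f" and T: "\<And>s. s \<in> T \<Longrightarrow> (p + s * v, q + s * w) \<in> \<Omega>" and s: "s \<in> T"
  shows "((\<lambda>s. f (p + s * v, q + s * w)) has_real_derivative
    D1 \<Omega> f (p + s * v, q + s * w) * v + D2 \<Omega> f (p + s * v, q + s * w) * w) (at s within T)"
proof -
  define z where "z = (p + s * v, q + s * w)"
  define L where "L = frechet_derivative f (at z within \<Omega>)"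
  have "z \<in> \<Omega>" using T[OF s] by (simp add: z_def)
  then have "f differentiable (at z within \<Omega>)"
    using f by (simp add: C1_on_def differentiable_on_def)
  then have "(f has_derivative L) (at z within \<Omega>)"
    unfolding L_def by (simp add: frechet_derivative_works)
  then have "(f has_derivative L) (at z within (\<lambda>s. (p + s * v, q + s * w)) ` T)"
    by (rule has_derivative_subset) (use T in auto)
  then have L: "(f has_derivative L) (at (p + s * v, q + s * w) within (\<lambda>s. (p + s * v, q + s * w)) ` T)"
    by (simp only: z_def)
  have path: "((\<lambda>s. (p + s * v, q + s * w)) has_derivative (\<lambda>h. (h * v, h * w))) (at s within T)"
    by (auto intro!: derivative_eq_intros)
  have lin: "linear L"
    using has_derivative_linear L by blast
  have "((\<lambda>s. f (p + s * v, q + s * w)) has_derivative (\<lambda>h. L (h * v, h * w))) (at s within T)"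
    by (rule has_derivative_in_compose[OF path L])
  moreover have "L (h * v, h * w) = (L (1, 0) * v + L (0, 1) * w) * h" for h
  proof -
    have "(h * v, h * w) = (h * v) *\<^sub>R (1, 0) + (h * w) *\<^sub>R (0, 1)" by simp
    then have "L (h * v, h * w) = (h * v) *\<^sub>R L (1, 0) + (h * w) *\<^sub>R L (0, 1)"
      by (simp only: linear_add[OF lin] linear_scale[OF lin])
    then show ?thesis by (simp add: algebra_simps)
  qed
  ultimately show ?thesis
    by (simp add: has_field_derivative_def D1_def D2_def L_def z_def)
qed

lemma C1_on_deriv1:
  assumes f: "C1_on \<Omega> f" and "(x, y) \<in> \<Omega>"
  shows "((\<lambda>x. f (x, y)) has_real_derivative D1 \<Omega> f (x, y)) (at x within {y..1})"
  using C1_on_affine_path[OF f, of "{y..1}" 0 1 y 0 x] assms(2) by (auto simp: Omega_iff)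

lemma C1_on_deriv2:
  assumes f: "C1_on \<Omega> f" and "(x, y) \<in> \<Omega>"
  shows "((\<lambda>y. f (x, y)) has_real_derivative D2 \<Omega> f (x, y)) (at y within {0..x})"
  using C1_on_affine_path[OF f, of "{0..x}" x 0 0 1 y] assms(2) by (auto simp: Omega_iff)

lemma C1_on_deriv_diagonal:
  assumes f: "C1_on \<Omega> f" and "x \<in> {0..1}"
  shows "((\<lambda>x. f (x, x)) has_real_derivative D1 \<Omega> f (x, x) + D2 \<Omega> f (x, x)) (at x within {0..1})"
  using C1_on_affine_path[OF f, of "{0..1}" 0 1 0 1 x] assms(2) by (auto simp: Omega_iff)

lemma has_real_derivative_unique_Icc:
  assumes "(f has_real_derivative d) (at x within {a..b})" "(f has_real_derivative e) (at x within {a..b})"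
    and "a < b" "x \<in> {a..b}"
  shows "d = e"
  using vector_derivative_unique_within_closed_interval[of a b x f d e] assms
  by (simp add: has_real_derivative_iff_has_vector_derivative)

lemma continuous_on_eq_at_limit:
  fixes f g :: "'a::topological_space \<Rightarrow> 'b::t2_space"
  assumes "continuous_on S f" "continuous_on S g" "c \<in> S"
    and "s \<longlonglongrightarrow> c" "\<And>n::nat. s n \<in> S" "\<And>n. f (s n) = g (s n)"
  shows "f c = g c"
proof -
  have "(\<lambda>n. f (s n)) \<longlonglongrightarrow> f c" "(\<lambda>n. g (s n)) \<longlonglongrightarrow> g c"
    by (rule continuous_on_tendsto_compose[OF _ assms(4,3)]; simp add: assms)+
  then show ?thesis using assms(6) LIMSEQ_unique by auto
qed

text \<open>\<open>D1\<close> is a chosen derivative within \<open>\<Omega>\<close>; its linearity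
  is derived from uniqueness of the derivative along horizontal segments. At the corner (1,1) that
  segment is a single point, and there the identity follows by continuity along the edge
  \<open>x = 1\<close>.\<close>

lemma D1_sum:
  assumes K: "\<And>n. C1_on \<Omega> (K n)" and G: "C1_on \<Omega> G"
    and eq: "\<And>z. z \<in> \<Omega> \<Longrightarrow> G z = (\<Sum>n<m. K n z * c n)" and z: "z \<in> \<Omega>"
  shows "D1 \<Omega> G z = (\<Sum>n<m. D1 \<Omega> (K n) z * c n)"
proof -
  have main: "D1 \<Omega> G (x, y) = (\<Sum>n<m. D1 \<Omega> (K n) (x, y) * c n)" if xy: "(x, y) \<in> \<Omega>" "y < 1" for x y
  proof (rule has_real_derivative_unique_Icc)
    show "((\<lambda>x. G (x, y)) has_real_derivative D1 \<Omega> G (x, y)) (at x within {y..1})"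
      by (rule C1_on_deriv1[OF G xy(1)])
    have "((\<lambda>x. \<Sum>n<m. K n (x, y) * c n) has_real_derivative (\<Sum>n<m. D1 \<Omega> (K n) (x, y) * c n)) (at x within {y..1})"
      by (intro DERIV_sum DERIV_cmult_right C1_on_deriv1[OF K xy(1)])
    then show "((\<lambda>x. G (x, y)) has_real_derivative (\<Sum>n<m. D1 \<Omega> (K n) (x, y) * c n)) (at x within {y..1})"
      by (rule has_field_derivative_transform_within[of _ _ _ _ 1]) (use xy in \<open>auto simp: eq Omega_iff\<close>)
  qed (use xy in \<open>auto simp: Omega_iff\<close>)
  obtain x y where xy: "z = (x, y)" by (cases z)
  show ?thesis
  proof (cases "y < 1")
    case True then show ?thesis using main z xy by simp
  next
    case False
    then have z1: "z = (1, 1)" using z xy by (auto simp: Omega_iff)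
    define s where "s n = (1 :: real, 1 - inverse (real (Suc n)))" for n
    have "s \<longlonglongrightarrow> (1, 1 - 0)"
      unfolding s_def by (intro tendsto_Pair tendsto_const tendsto_diff LIMSEQ_inverse_real_of_nat)
    then have "s \<longlonglongrightarrow> z" by (simp add: z1)
    moreover have "s n \<in> \<Omega>" for n by (auto simp: s_def Omega_iff inverse_le_1_iff)
    moreover have "D1 \<Omega> G (s n) = (\<Sum>n'<m. D1 \<Omega> (K n') (s n) * c n')" for n
      using \<open>s n \<in> \<Omega>\<close> main unfolding s_def by simp
    ultimately show ?thesis
      using K G z by (intro continuous_on_eq_at_limit[of \<Omega> "D1 \<Omega> G" "\<lambda>z. \<Sum>n<m. D1 \<Omega> (K n) z * c n" z s])
        (auto simp: C1_on_def intro!: continuous_intros)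
  qed
qed

text \<open>The same with vertical segments. The degenerate one is now at the corner (0,0), which is
  approached along the edge \<open>y = 0\<close>.\<close>

lemma D2_sum:
  assumes K: "\<And>n. C1_on \<Omega> (K n)" and G: "C1_on \<Omega> G"
    and eq: "\<And>z. z \<in> \<Omega> \<Longrightarrow> G z = (\<Sum>n<m. K n z * c n)" and z: "z \<in> \<Omega>"
  shows "D2 \<Omega> G z = (\<Sum>n<m. D2 \<Omega> (K n) z * c n)"
proof -
  have main: "D2 \<Omega> G (x, y) = (\<Sum>n<m. D2 \<Omega> (K n) (x, y) * c n)" if xy: "(x, y) \<in> \<Omega>" "0 < x" for x y
  proof (rule has_real_derivative_unique_Icc)
    show "((\<lambda>y. G (x, y)) has_real_derivative D2 \<Omega> G (x, y)) (at y within {0..x})"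
      by (rule C1_on_deriv2[OF G xy(1)])
    have "((\<lambda>y. \<Sum>n<m. K n (x, y) * c n) has_real_derivative (\<Sum>n<m. D2 \<Omega> (K n) (x, y) * c n)) (at y within {0..x})"
      by (intro DERIV_sum DERIV_cmult_right C1_on_deriv2[OF K xy(1)])
    then show "((\<lambda>y. G (x, y)) has_real_derivative (\<Sum>n<m. D2 \<Omega> (K n) (x, y) * c n)) (at y within {0..x})"
      by (rule has_field_derivative_transform_within[of _ _ _ _ 1]) (use xy in \<open>auto simp: eq Omega_iff\<close>)
  qed (use xy in \<open>auto simp: Omega_iff\<close>)
  obtain x y where xy: "z = (x, y)" by (cases z)
  show ?thesis
  proof (cases "0 < x")
    case True then show ?thesis using main z xy by simp
  next
    case False
    then have z1: "z = (0, 0)" using z xy by (auto simp: Omega_iff)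
    define s where "s n = (inverse (real (Suc n)), 0 :: real)" for n
    have "s \<longlonglongrightarrow> (0, 0)"
      unfolding s_def by (intro tendsto_Pair tendsto_const LIMSEQ_inverse_real_of_nat)
    then have "s \<longlonglongrightarrow> z" by (simp add: z1)
    moreover have "s n \<in> \<Omega>" for n by (auto simp: s_def Omega_iff inverse_le_1_iff)
    moreover have "D2 \<Omega> G (s n) = (\<Sum>n'<m. D2 \<Omega> (K n') (s n) * c n')" for n
      using \<open>s n \<in> \<Omega>\<close> main unfolding s_def by simp
    ultimately show ?thesis
      using K G z by (intro continuous_on_eq_at_limit[of \<Omega> "D2 \<Omega> G" "\<lambda>z. \<Sum>n<m. D2 \<Omega> (K n) z * c n" z s])
        (auto simp: C1_on_def intro!: continuous_intros)
  qed
qed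

section \<open>Power series in time with continuous coefficients\<close>

lemma compact_abs_bound:
  assumes "compact S" "continuous_on S (f :: 'a::topological_space \<Rightarrow> real)"
  obtains b where "0 \<le> b" "\<And>z. z \<in> S \<Longrightarrow> \<bar>f z\<bar> \<le> b"
proof -
  have "bounded (f ` S)"
    by (intro compact_imp_bounded compact_continuous_image assms)
  then obtain b where b: "\<forall>y\<in>f ` S. norm y \<le> b" unfolding bounded_iff by blast
  show thesis by (rule that[of "max b 0"]) (use b in \<open>auto simp: le_max_iff_disj\<close>)
qed

lemma power_family_bound:
  fixes A :: "nat \<Rightarrow> 'a::topological_space \<Rightarrow> real"
  assumes S: "compact S" and A: "\<And>n. continuous_on S (A n)" and \<tau>: "0 \<le> \<tau>"
    and ul: "uniform_limit S (\<lambda>m z. \<Sum>n<m. A n z * \<tau> ^ n) F sequentially"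
  obtains B where "0 \<le> B" "\<And>n z. z \<in> S \<Longrightarrow> \<bar>A n z\<bar> * \<tau> ^ n \<le> B"
proof -
  obtain N where N: "\<And>m z. m \<ge> N \<Longrightarrow> z \<in> S \<Longrightarrow> dist (\<Sum>n<m. A n z * \<tau> ^ n) (F z) < 1"
    using uniform_limitD[OF ul, of 1] by (auto simp: eventually_sequentially)
  have "\<exists>b\<ge>0. \<forall>z\<in>S. \<bar>A n z\<bar> \<le> b" for n
    using compact_abs_bound[OF S A] by metis
  then obtain b where b: "\<And>n. 0 \<le> b n" "\<And>n z. z \<in> S \<Longrightarrow> \<bar>A n z\<bar> \<le> b n" by metis
  \<comment> \<open>Terms of index at least \<open>N\<close> are differences of partial sums that
    both lie within 1 of the limit, hence at most 2. The sum covers the finitely many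
    others.\<close>
  define B where "B = 2 + (\<Sum>n<N. b n * \<tau> ^ n)"
  have B2: "2 \<le> B" unfolding B_def using b(1) \<tau> by (simp add: sum_nonneg)
  have "\<bar>A n z\<bar> * \<tau> ^ n \<le> B" if z: "z \<in> S" for n z
  proof (cases "n < N")
    case True
    have "\<bar>A n z\<bar> * \<tau> ^ n \<le> b n * \<tau> ^ n" using b(2)[OF z] \<tau> by (intro mult_right_mono) auto
    also have "\<dots> \<le> (\<Sum>n<N. b n * \<tau> ^ n)"
      using True b(1) \<tau> by (intro member_le_sum) auto
    finally show ?thesis by (simp add: B_def)
  next
    case False
    have "\<bar>A n z * \<tau> ^ n\<bar> = dist (\<Sum>n<Suc n. A n z * \<tau> ^ n) (\<Sum>n<n. A n z * \<tau> ^ n)"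
      by (simp add: dist_real_def)
    also have "\<dots> \<le> dist (\<Sum>n<Suc n. A n z * \<tau> ^ n) (F z) + dist (\<Sum>n<n. A n z * \<tau> ^ n) (F z)"
      by (rule dist_triangle2)
    also have "\<dots> \<le> 2"
      using N[of n z] N[of "Suc n" z] False z by simp
    finally show ?thesis using B2 \<tau> by (simp add: abs_mult)
  qed
  then show thesis using that[of B] B2 by auto
qed

text \<open>Convergence at one time \<open>\<tau>\<close> between \<open>t0\<close> and 1 bounds the
  coefficients by \<open>B / \<tau> ^ n\<close>. On \<open>[0,t0]\<close> the series then has a
  geometric majorant of ratio \<open>t0 / \<tau>\<close>, and the termwise derivative one with an
  additional factor n. Both limits are uniform in time and space, although convergence is assumed at
  each time separately.\<close>

lemma power_family:
  fixes A :: "nat \<Rightarrow> 'a::topological_space \<Rightarrow> real" and F :: "real \<Rightarrow> 'a \<Rightarrow> real"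
  assumes S: "compact S" and A: "\<And>n. continuous_on S (A n)" and t0: "0 < t0" "t0 < 1"
    and ul: "\<And>t. t \<in> {0..<1} \<Longrightarrow> uniform_limit S (\<lambda>m z. \<Sum>n<m. A n z * t ^ n) (F t) sequentially"
  shows power_family_uniform: "uniform_limit ({0..t0} \<times> S) (\<lambda>m w. \<Sum>n<m. A n (snd w) * fst w ^ n) (\<lambda>w. F (fst w) (snd w)) sequentially" (is ?A)
    and power_family_continuous: "continuous_on ({0..t0} \<times> S) (\<lambda>w. F (fst w) (snd w))" (is ?B)
    and power_family_deriv: "\<exists>G. uniform_limit ({0..t0} \<times> S) (\<lambda>m w. \<Sum>n<m. A n (snd w) * (real n * fst w ^ (n - 1))) (\<lambda>w. G (fst w) (snd w)) sequentially \<and>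
      continuous_on ({0..t0} \<times> S) (\<lambda>w. G (fst w) (snd w)) \<and>
      (\<forall>z\<in>S. \<forall>t\<in>{0..t0}. ((\<lambda>t. F t z) has_real_derivative G t z) (at t within {0..t0}))" (is ?C)
proof -
  define \<tau> where "\<tau> = (1 + t0) / 2"
  have \<tau>: "t0 < \<tau>" "0 < \<tau>" "\<tau> < 1" using t0 by (auto simp: \<tau>_def)
  obtain B where B: "0 \<le> B" "\<And>n z. z \<in> S \<Longrightarrow> \<bar>A n z\<bar> * \<tau> ^ n \<le> B"
    by (rule power_family_bound[OF S A _ ul[of \<tau>]]) (use \<tau> in auto)
  have AB: "\<bar>A n z\<bar> \<le> B / \<tau> ^ n" if "z \<in> S" for n z
    using B(2)[OF that, of n] \<tau>(2) by (simp add: field_simps)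
  define \<rho> where "\<rho> = t0 / \<tau>"
  have \<rho>: "0 < \<rho>" "\<rho> < 1" using \<tau> t0 by (auto simp: \<rho>_def)
  have Sc: "continuous_on ({0..t0} \<times> S) (\<lambda>w. A n (snd w))" for n
    by (rule continuous_on_compose2[OF A]) (auto intro!: continuous_intros)
  have lim1: "uniform_limit ({0..t0} \<times> S) (\<lambda>m w. \<Sum>n<m. A n (snd w) * fst w ^ n) (\<lambda>w. \<Sum>n. A n (snd w) * fst w ^ n) sequentially"
  proof (rule Weierstrass_m_test[where M = "\<lambda>n. B * \<rho> ^ n"])
    fix n w assume w: "w \<in> {0..t0} \<times> S"
    have "norm (A n (snd w) * fst w ^ n) = \<bar>A n (snd w)\<bar> * fst w ^ n"
      using w by (auto simp: abs_mult)
    also have "\<dots> \<le> (B / \<tau> ^ n) * t0 ^ n"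
      using w by (intro mult_mono AB power_mono) (use B \<tau> in auto)
    also have "\<dots> = B * \<rho> ^ n" by (simp add: \<rho>_def power_divide)
    finally show "norm (A n (snd w) * fst w ^ n) \<le> B * \<rho> ^ n" .
  qed (use \<rho> in \<open>auto intro!: summable_mult summable_geometric\<close>)
  have Feq: "F t z = (\<Sum>n. A n z * t ^ n)" if "t \<in> {0..t0}" "z \<in> S" for t z
  proof -
    have "(\<lambda>m. \<Sum>n<m. A n z * t ^ n) \<longlonglongrightarrow> F t z"
      using tendsto_uniform_limitI[OF ul that(2)] that(1) t0 by auto
    moreover have "(\<lambda>m. \<Sum>n<m. A n z * t ^ n) \<longlonglongrightarrow> (\<Sum>n. A n z * t ^ n)"
      using tendsto_uniform_limitI[OF lim1, of "(t, z)"] that by auto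
    ultimately show ?thesis by (rule LIMSEQ_unique)
  qed
  show U: ?A
    by (rule uniform_limit_cong'[THEN iffD1, OF _ _ lim1]) (auto simp: Feq)
  show ?B
    by (rule uniform_limit_theorem[OF _ U]) (auto intro!: always_eventually continuous_intros Sc)
  define G where "G t z = (\<Sum>n. A n z * (real n * t ^ (n - 1)))" for t z
  have summ: "summable (\<lambda>n. (B / t0) * (real n * \<rho> ^ n))"
  proof (rule summable_mult)
    have "summable (\<lambda>n. diffs (\<lambda>n. 1) n * \<rho> ^ n)"
      by (rule termdiff_converges[of _ 1]) (use \<rho> in \<open>auto intro!: summable_geometric\<close>)
    then have "summable (\<lambda>n. \<rho> * (real (Suc n) * \<rho> ^ n))"
      by (intro summable_mult) (simp add: diffs_def)
    then have "summable (\<lambda>n. real (Suc n) * \<rho> ^ Suc n)"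
      by (simp add: mult_ac)
    then show "summable (\<lambda>n. real n * \<rho> ^ n)"
      by (subst summable_Suc_iff[symmetric])
  qed
  have lim2: "uniform_limit ({0..t0} \<times> S) (\<lambda>m w. \<Sum>n<m. A n (snd w) * (real n * fst w ^ (n - 1))) (\<lambda>w. G (fst w) (snd w)) sequentially"
    unfolding G_def
  proof (rule Weierstrass_m_test[OF _ summ])
    fix n w assume w: "w \<in> {0..t0} \<times> S"
    have "norm (A n (snd w) * (real n * fst w ^ (n - 1))) = \<bar>A n (snd w)\<bar> * (real n * fst w ^ (n - 1))"
      using w by (auto simp: abs_mult)
    also have "\<dots> \<le> (B / \<tau> ^ n) * (real n * t0 ^ (n - 1))"
      using w by (intro mult_mono AB power_mono) (use B \<tau> t0 in auto)
    also have "\<dots> = (B / t0) * (real n * \<rho> ^ n)"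
      using t0 by (cases n) (auto simp: \<rho>_def power_divide field_simps simp del: of_nat_Suc)
    finally show "norm (A n (snd w) * (real n * fst w ^ (n - 1))) \<le> (B / t0) * (real n * \<rho> ^ n)" .
  qed
  have "((\<lambda>t. F t z) has_real_derivative G t z) (at t within {0..t0})" if z: "z \<in> S" and t: "t \<in> {0..t0}" for z t
  proof -
    have "\<exists>g. \<forall>t\<in>{0..t0}. (\<lambda>n. A n z * t ^ n) sums g t \<and> (g has_field_derivative G t z) (at t within {0..t0})"
    proof (rule has_field_derivative_series)
      show "((\<lambda>t. A n z * t ^ n) has_real_derivative A n z * (real n * t ^ (n - 1))) (at t within {0..t0})" for n t
        by (auto intro!: derivative_eq_intros)
      show "uniform_limit {0..t0} (\<lambda>m t. \<Sum>n<m. A n z * (real n * t ^ (n - 1))) (\<lambda>t. G t z) sequentially"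
        unfolding uniform_limit_iff
      proof safe
        fix e :: real assume "0 < e"
        from uniform_limitD[OF lim2 this]
        show "\<forall>\<^sub>F m in sequentially. \<forall>t\<in>{0..t0}. dist (\<Sum>n<m. A n z * (real n * t ^ (n - 1))) (G t z) < e"
          by eventually_elim (use z in auto)
      qed
      show "summable (\<lambda>n. A n z * 0 ^ n)"
        by (rule summable_finite[of "{0}"]) auto
      show "0 \<in> {0..t0}" using t0 by auto
    qed (auto simp: convex_real_interval)
    then obtain g where g: "\<And>t. t \<in> {0..t0} \<Longrightarrow> (\<lambda>n. A n z * t ^ n) sums g t"
      "\<And>t. t \<in> {0..t0} \<Longrightarrow> (g has_field_derivative G t z) (at t within {0..t0})" by blast
    show ?thesis
      by (rule has_field_derivative_transform_within[OF g(2)[OF t], of 1])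
         (use t z in \<open>auto simp: Feq sums_unique[OF g(1)]\<close>)
  qed
  moreover have "continuous_on ({0..t0} \<times> S) (\<lambda>w. G (fst w) (snd w))"
    by (rule uniform_limit_theorem[OF _ lim2]) (auto intro!: always_eventually continuous_intros Sc)
  ultimately show ?C using lim2 by (intro exI[of _ G] conjI ballI) auto
qed

text \<open>
  The time argument comes first: \<open>K t (x, y)\<close> is \<open>k(x,y,t)\<close>. The \<open>Kn n\<close> are the coefficients of its
  power series in \<open>t\<close>.
\<close>

locale backstepping_kernel =
  fixes lam t0 :: real and a :: "real \<Rightarrow> real \<Rightarrow> real"
    and K Kx Ky Kxx Kyy Kt :: "real \<Rightarrow> real \<times> real \<Rightarrow> real" and Kn :: "nat \<Rightarrow> real \<times> real \<Rightarrow> real"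
  assumes lam: "0 < lam" and t0: "0 < t0"
    and a_cont: "continuous_on ({0..t0} \<times> {0..1}) (\<lambda>w. a (snd w) (fst w))"
    and K_cont: "continuous_on ({0..t0} \<times> \<Omega>) (\<lambda>w. K (fst w) (snd w))"
    and Kx_cont: "continuous_on ({0..t0} \<times> \<Omega>) (\<lambda>w. Kx (fst w) (snd w))"
    and Ky_cont: "continuous_on ({0..t0} \<times> \<Omega>) (\<lambda>w. Ky (fst w) (snd w))"
    and Kxx_cont: "continuous_on ({0..t0} \<times> \<Omega>) (\<lambda>w. Kxx (fst w) (snd w))"
    and Kt_cont: "continuous_on ({0..t0} \<times> \<Omega>) (\<lambda>w. Kt (fst w) (snd w))"
    and Kyy_cont: "\<And>t. t \<in> {0..t0} \<Longrightarrow> continuous_on \<Omega> (Kyy t)"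
    and K_x: "\<And>t x y. t \<in> {0..t0} \<Longrightarrow> (x, y) \<in> \<Omega> \<Longrightarrow> ((\<lambda>x. K t (x, y)) has_real_derivative Kx t (x, y)) (at x within {y..1})"
    and K_y: "\<And>t x y. t \<in> {0..t0} \<Longrightarrow> (x, y) \<in> \<Omega> \<Longrightarrow> ((\<lambda>y. K t (x, y)) has_real_derivative Ky t (x, y)) (at y within {0..x})"
    and K_xx: "\<And>t x y. t \<in> {0..t0} \<Longrightarrow> (x, y) \<in> \<Omega> \<Longrightarrow> ((\<lambda>x. Kx t (x, y)) has_real_derivative Kxx t (x, y)) (at x within {y..1})"
    and K_yy: "\<And>t x y. t \<in> {0..t0} \<Longrightarrow> (x, y) \<in> \<Omega> \<Longrightarrow> ((\<lambda>y. Ky t (x, y)) has_real_derivative Kyy t (x, y)) (at y within {0..x})"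
    and K_diag: "\<And>t x. t \<in> {0..t0} \<Longrightarrow> x \<in> {0..1} \<Longrightarrow> ((\<lambda>x. K t (x, x)) has_real_derivative Kx t (x, x) + Ky t (x, x)) (at x within {0..1})"
    and K_t: "\<And>t z. t \<in> {0..t0} \<Longrightarrow> z \<in> \<Omega> \<Longrightarrow> ((\<lambda>t. K t z) has_real_derivative Kt t z) (at t within {0..t0})"
    and K_pde: "\<And>t x y. t \<in> {0..t0} \<Longrightarrow> (x, y) \<in> \<Omega> \<Longrightarrow> Kxx t (x, y) - Kyy t (x, y) - Kt t (x, y) = (a y t + lam) * K t (x, y)"
    and K_zero: "\<And>t x. t \<in> {0..t0} \<Longrightarrow> x \<in> {0..1} \<Longrightarrow> K t (x, 0) = 0"
    and K_diag_pde: "\<And>t x. t \<in> {0..t0} \<Longrightarrow> x \<in> {0..1} \<Longrightarrow> 2 * (Kx t (x, x) + Ky t (x, x)) = a x t + lam"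
    and Kn_cont: "\<And>n. continuous_on \<Omega> (Kn n)"
    and Kn_K: "uniform_limit ({0..t0} \<times> \<Omega>) (\<lambda>m w. \<Sum>n<m. Kn n (snd w) * fst w ^ n) (\<lambda>w. K (fst w) (snd w)) sequentially"
    and Kn_Kt: "uniform_limit ({0..t0} \<times> \<Omega>) (\<lambda>m w. \<Sum>n<m. Kn n (snd w) * (real n * fst w ^ (n - 1))) (\<lambda>w. Kt (fst w) (snd w)) sequentially"

text \<open>Passage from the C^2 convergence at each single time to joint continuity on
  \<open>[0,t0]\<close>: \<open>power_family\<close> is applied to the coefficients of the kernel
  and to their derivatives. The time derivative is taken from the series and identified with the one
  in the kernel equation by uniqueness of derivatives. On the diagonal d/dx k(x,x) equals
  \<open>Kx + Ky\<close>, whence the factor 2 in the diagonal condition.\<close>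

theorem kernel_solution_backstepping_kernel:
  assumes lam: "lam > 0" and a: "analytic_coefficient a" and k: "kernel_solution lam a k" and t0: "0 < t0" "t0 < 1"
  obtains Kt Kn where "backstepping_kernel lam t0 a (kernel_at k) (\<lambda>t. D1 \<Omega> (kernel_at k t)) (\<lambda>t. D2 \<Omega> (kernel_at k t))
    (\<lambda>t. D1 \<Omega> (D1 \<Omega> (kernel_at k t))) (\<lambda>t. D2 \<Omega> (D2 \<Omega> (kernel_at k t))) Kt Kn"
proof -
  have "analytic_C2_kernel k" using k by (simp add: kernel_solution_def)
  then obtain Kn where C2n: "\<And>n. C2_on \<Omega> (Kn n)"
    and tend: "\<And>t. t \<in> {0..<1} \<Longrightarrow> C2_tendsto \<Omega> (\<lambda>m p. \<Sum>n<m. Kn n p * t ^ n) (kernel_at k t)"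
    unfolding analytic_C2_kernel_def by blast
  have C1n: "C1_on \<Omega> (Kn n)" "C1_on \<Omega> (D1 \<Omega> (Kn n))" "C1_on \<Omega> (D2 \<Omega> (Kn n))" for n
    using C2n by (auto simp: C2_on_def)
  have C2k: "C2_on \<Omega> (kernel_at k t)" if "t \<in> {0..<1}" for t
    using tend[OF that] by (simp add: C2_tendsto_def)
  have C1k: "C1_on \<Omega> (kernel_at k t)" "C1_on \<Omega> (D1 \<Omega> (kernel_at k t))" "C1_on \<Omega> (D2 \<Omega> (kernel_at k t))" if "t \<in> {0..<1}" for t
    using C2k[OF that] by (auto simp: C2_on_def)
  have C2s: "C2_on \<Omega> (\<lambda>p. \<Sum>n<m. Kn n p * t ^ n)" if "t \<in> {0..<1}" for m t
    using tend[OF that] by (simp add: C2_tendsto_def)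
  have C1s: "C1_on \<Omega> (\<lambda>p. \<Sum>n<m. Kn n p * t ^ n)" "C1_on \<Omega> (D1 \<Omega> (\<lambda>p. \<Sum>n<m. Kn n p * t ^ n))" if "t \<in> {0..<1}" for m t
    using C2s[OF that] by (auto simp: C2_on_def)
  have D1s: "D1 \<Omega> (\<lambda>p. \<Sum>n<m. Kn n p * t ^ n) z = (\<Sum>n<m. D1 \<Omega> (Kn n) z * t ^ n)" if "t \<in> {0..<1}" "z \<in> \<Omega>" for m t z
    by (rule D1_sum[OF C1n(1) C1s(1)[OF that(1)] refl that(2)])
  have D2s: "D2 \<Omega> (\<lambda>p. \<Sum>n<m. Kn n p * t ^ n) z = (\<Sum>n<m. D2 \<Omega> (Kn n) z * t ^ n)" if "t \<in> {0..<1}" "z \<in> \<Omega>" for m t z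
    by (rule D2_sum[OF C1n(1) C1s(1)[OF that(1)] refl that(2)])
  have D11s: "D1 \<Omega> (D1 \<Omega> (\<lambda>p. \<Sum>n<m. Kn n p * t ^ n)) z = (\<Sum>n<m. D1 \<Omega> (D1 \<Omega> (Kn n)) z * t ^ n)" if "t \<in> {0..<1}" "z \<in> \<Omega>" for m t z
    by (rule D1_sum[OF C1n(2) C1s(2)[OF that(1)] D1s[OF that(1)] that(2)])
  have ul0: "uniform_limit \<Omega> (\<lambda>m z. \<Sum>n<m. Kn n z * t ^ n) (kernel_at k t) sequentially" if "t \<in> {0..<1}" for t
    using tend[OF that] by (simp add: C2_tendsto_def)
  have ul1: "uniform_limit \<Omega> (\<lambda>m z. \<Sum>n<m. D1 \<Omega> (Kn n) z * t ^ n) (D1 \<Omega> (kernel_at k t)) sequentially" if "t \<in> {0..<1}" for t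
  proof -
    have "uniform_limit \<Omega> (\<lambda>m. D1 \<Omega> (\<lambda>p. \<Sum>n<m. Kn n p * t ^ n)) (D1 \<Omega> (kernel_at k t)) sequentially"
      using tend[OF that] by (simp add: C2_tendsto_def)
    then show ?thesis by (rule uniform_limit_cong'[THEN iffD1, rotated -1]) (auto simp: D1s[OF that])
  qed
  have ul2: "uniform_limit \<Omega> (\<lambda>m z. \<Sum>n<m. D2 \<Omega> (Kn n) z * t ^ n) (D2 \<Omega> (kernel_at k t)) sequentially" if "t \<in> {0..<1}" for t
  proof -
    have "uniform_limit \<Omega> (\<lambda>m. D2 \<Omega> (\<lambda>p. \<Sum>n<m. Kn n p * t ^ n)) (D2 \<Omega> (kernel_at k t)) sequentially"
      using tend[OF that] by (simp add: C2_tendsto_def)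
    then show ?thesis by (rule uniform_limit_cong'[THEN iffD1, rotated -1]) (auto simp: D2s[OF that])
  qed
  have ul11: "uniform_limit \<Omega> (\<lambda>m z. \<Sum>n<m. D1 \<Omega> (D1 \<Omega> (Kn n)) z * t ^ n) (D1 \<Omega> (D1 \<Omega> (kernel_at k t))) sequentially" if "t \<in> {0..<1}" for t
  proof -
    have "uniform_limit \<Omega> (\<lambda>m. D1 \<Omega> (D1 \<Omega> (\<lambda>p. \<Sum>n<m. Kn n p * t ^ n))) (D1 \<Omega> (D1 \<Omega> (kernel_at k t))) sequentially"
      using tend[OF that] by (simp add: C2_tendsto_def o_def)
    then show ?thesis by (rule uniform_limit_cong'[THEN iffD1, rotated -1]) (auto simp: D11s[OF that])
  qed
  have cn: "continuous_on \<Omega> (Kn n)" "continuous_on \<Omega> (D1 \<Omega> (Kn n))" "continuous_on \<Omega> (D2 \<Omega> (Kn n))"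
    "continuous_on \<Omega> (D1 \<Omega> (D1 \<Omega> (Kn n)))" for n
    using C1n[of n] by (auto simp: C1_on_def differentiable_imp_continuous_on)
  obtain Kt where Kt: "uniform_limit ({0..t0} \<times> \<Omega>) (\<lambda>m w. \<Sum>n<m. Kn n (snd w) * (real n * fst w ^ (n - 1))) (\<lambda>w. Kt (fst w) (snd w)) sequentially"
      "continuous_on ({0..t0} \<times> \<Omega>) (\<lambda>w. Kt (fst w) (snd w))"
      "\<And>z t. z \<in> \<Omega> \<Longrightarrow> t \<in> {0..t0} \<Longrightarrow> ((\<lambda>t. kernel_at k t z) has_real_derivative Kt t z) (at t within {0..t0})"
    using power_family_deriv[OF compact_Omega cn(1) t0 ul0] by blast
  have t01: "t \<in> {0..<1}" if "t \<in> {0..t0}" for t using that t0 by auto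
  obtain A C where A: "\<And>n::nat. continuous_on {0..1} (A n)" "\<And>n x. x \<in> {0..1} \<Longrightarrow> \<bar>A n x\<bar> \<le> C"
      "\<And>x t. x \<in> {0..1} \<Longrightarrow> t \<in> {0..<1} \<Longrightarrow> (\<lambda>n. A n x * t ^ n) sums a x t"
    using a unfolding analytic_coefficient_def by blast
  \<comment> \<open>The bound \<open>C\<close> on the coefficients gives the majorant
    \<open>C * t ^ n\<close>, which brings \<open>a\<close> under the same lemma as the
    kernel.\<close>
  have ula: "uniform_limit {0..1} (\<lambda>m x. \<Sum>n<m. A n x * t ^ n) (\<lambda>x. a x t) sequentially" if t: "t \<in> {0..<1}" for t
  proof -
    have "uniform_limit {0..1} (\<lambda>m x. \<Sum>n<m. A n x * t ^ n) (\<lambda>x. \<Sum>n. A n x * t ^ n) sequentially"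
    proof (rule Weierstrass_m_test[where M = "\<lambda>n. C * t ^ n"])
      show "norm (A n x * t ^ n) \<le> C * t ^ n" if "x \<in> {0..1}" for n x
        using A(2)[OF that, of n] t by (auto simp: abs_mult intro!: mult_right_mono)
      show "summable (\<lambda>n. C * t ^ n)" using t by (intro summable_mult summable_geometric) auto
    qed
    then show ?thesis
      by (rule uniform_limit_cong'[THEN iffD1, rotated -1]) (auto intro!: sums_unique[OF A(3)[OF _ t], symmetric])
  qed
  have "backstepping_kernel lam t0 a (kernel_at k) (\<lambda>t. D1 \<Omega> (kernel_at k t)) (\<lambda>t. D2 \<Omega> (kernel_at k t))
    (\<lambda>t. D1 \<Omega> (D1 \<Omega> (kernel_at k t))) (\<lambda>t. D2 \<Omega> (D2 \<Omega> (kernel_at k t))) Kt Kn"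
  proof
    show "continuous_on ({0..t0} \<times> {0..1}) (\<lambda>w. a (snd w) (fst w))"
      using power_family_continuous[OF _ A(1) t0 ula] by simp
    show "continuous_on ({0..t0} \<times> \<Omega>) (\<lambda>w. kernel_at k (fst w) (snd w))"
      by (rule power_family_continuous[OF compact_Omega cn(1) t0 ul0])
    show "continuous_on ({0..t0} \<times> \<Omega>) (\<lambda>w. D1 \<Omega> (kernel_at k (fst w)) (snd w))"
      by (rule power_family_continuous[OF compact_Omega cn(2) t0 ul1])
    show "continuous_on ({0..t0} \<times> \<Omega>) (\<lambda>w. D2 \<Omega> (kernel_at k (fst w)) (snd w))"
      by (rule power_family_continuous[OF compact_Omega cn(3) t0 ul2])
    show "continuous_on ({0..t0} \<times> \<Omega>) (\<lambda>w. D1 \<Omega> (D1 \<Omega> (kernel_at k (fst w))) (snd w))"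
      by (rule power_family_continuous[OF compact_Omega cn(4) t0 ul11])
    show "uniform_limit ({0..t0} \<times> \<Omega>) (\<lambda>m w. \<Sum>n<m. Kn n (snd w) * fst w ^ n) (\<lambda>w. kernel_at k (fst w) (snd w)) sequentially"
      by (rule power_family_uniform[OF compact_Omega cn(1) t0 ul0])
    fix t assume t: "t \<in> {0..t0}"
    note t1 = t01[OF t]
    show "continuous_on \<Omega> (D2 \<Omega> (D2 \<Omega> (kernel_at k t)))"
      using C1k(3)[OF t1] by (simp add: C1_on_def)
    show "((\<lambda>x. kernel_at k t (x, y)) has_real_derivative D1 \<Omega> (kernel_at k t) (x, y)) (at x within {y..1})"
      "((\<lambda>y. kernel_at k t (x, y)) has_real_derivative D2 \<Omega> (kernel_at k t) (x, y)) (at y within {0..x})"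
      "((\<lambda>x. D1 \<Omega> (kernel_at k t) (x, y)) has_real_derivative D1 \<Omega> (D1 \<Omega> (kernel_at k t)) (x, y)) (at x within {y..1})"
      "((\<lambda>y. D2 \<Omega> (kernel_at k t) (x, y)) has_real_derivative D2 \<Omega> (D2 \<Omega> (kernel_at k t)) (x, y)) (at y within {0..x})"
      if "(x, y) \<in> \<Omega>" for x y
      using C1k[OF t1] that by (blast intro: C1_on_deriv1 C1_on_deriv2)+
    show "kernel_at k t (x, 0) = 0" if "x \<in> {0..1}" for x
      using k t1 that by (auto simp: kernel_solution_def kernel_at_def)
    show "((\<lambda>t. kernel_at k t z) has_real_derivative Kt t z) (at t within {0..t0})" if "z \<in> \<Omega>" for z
      by (rule Kt(3)[OF that t])
    show dg: "((\<lambda>x. kernel_at k t (x, x)) has_real_derivative D1 \<Omega> (kernel_at k t) (x, x) + D2 \<Omega> (kernel_at k t) (x, x)) (at x within {0..1})"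
      if "x \<in> {0..1}" for x
      by (rule C1_on_deriv_diagonal[OF C1k(1)[OF t1] that])
    show "2 * (D1 \<Omega> (kernel_at k t) (x, x) + D2 \<Omega> (kernel_at k t) (x, x)) = a x t + lam" if x: "x \<in> {0..1}" for x
    proof -
      obtain d where d: "((\<lambda>z. k z z t) has_real_derivative d) (at x within {0..1})"
        "D1 \<Omega> (kernel_at k t) (x, x) + D2 \<Omega> (kernel_at k t) (x, x) + d = a x t + lam"
        using k t1 x unfolding kernel_solution_def by blast
      have "d = D1 \<Omega> (kernel_at k t) (x, x) + D2 \<Omega> (kernel_at k t) (x, x)"
        by (rule has_real_derivative_unique_Icc[OF d(1)]) (use dg[OF x] x in \<open>auto simp: kernel_at_def\<close>)
      then show ?thesis using d(2) by simp
    qed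
    show "D1 \<Omega> (D1 \<Omega> (kernel_at k t)) (x, y) - D2 \<Omega> (D2 \<Omega> (kernel_at k t)) (x, y) - Kt t (x, y) = (a y t + lam) * kernel_at k t (x, y)"
      if xy: "(x, y) \<in> \<Omega>" for x y
    proof -
      have "\<forall>(x, y)\<in>\<Omega>. \<exists>k_t.
        ((\<lambda>s. k x y s) has_real_derivative k_t) (at t within {0..<1}) \<and>
        D1 \<Omega> (D1 \<Omega> (kernel_at k t)) (x, y) - D2 \<Omega> (D2 \<Omega> (kernel_at k t)) (x, y) - k_t
          = (a y t + lam) * k x y t"
        using k t1 unfolding kernel_solution_def by blast
      then obtain k_t where kt: "((\<lambda>s. k x y s) has_real_derivative k_t) (at t within {0..<1})"
        "D1 \<Omega> (D1 \<Omega> (kernel_at k t)) (x, y) - D2 \<Omega> (D2 \<Omega> (kernel_at k t)) (x, y) - k_t = (a y t + lam) * k x y t"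
        using xy by blast
      have "((\<lambda>s. k x y s) has_real_derivative k_t) (at t within {0..t0})"
        by (rule DERIV_subset[OF kt(1)]) (use t01 in auto)
      then have "k_t = Kt t (x, y)"
        by (rule has_real_derivative_unique_Icc) (use Kt(3)[OF xy t] t0 t in \<open>auto simp: kernel_at_def\<close>)
      then show ?thesis using kt(2) by (simp add: kernel_at_def)
    qed
  qed (use lam t0 Kt cn in auto)
  then show thesis by (rule that)
qed

section \<open>The damped heat equation\<close>

lemma integral_cos_pi_int:
  "integral {0..1} (\<lambda>x. cos (of_int j * pi * x)) = (if j = 0 then 1 else 0)"
proof (cases "j = 0")
  case False
  have "((\<lambda>x. cos (of_int j * pi * x)) has_integral (sin (of_int j * pi * 1) / (of_int j * pi) - sin (of_int j * pi * 0) / (of_int j * pi))) {0..1}"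
    using False
    by (intro fundamental_theorem_of_calculus)
       (auto simp: has_real_derivative_iff_has_vector_derivative[symmetric] intro!: derivative_eq_intros)
  then have "integral {0..1} (\<lambda>x. cos (of_int j * pi * x)) = sin (of_int j * pi * 1) / (of_int j * pi)"
    by (simp add: integral_unique)
  moreover have "sin (of_int j * pi * 1) = 0"
    using sin_npi_int[of j] by (simp add: mult.commute)
  ultimately show ?thesis using False by simp
qed simp

lemma L2_norm_orthogonal_sum:
  fixes e :: "nat \<Rightarrow> real \<Rightarrow> real"
  assumes e: "\<And>n. e n \<in> L2_space" and orth: "\<And>n m. n \<noteq> m \<Longrightarrow> ip (e n) (e m) = 0"
  shows "(L2_norm (\<lambda>x. \<Sum>n<M. \<beta> n * e n x))\<^sup>2 = (\<Sum>n<M. (\<beta> n)\<^sup>2 * ip (e n) (e n))"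
proof -
  have L: "(\<lambda>x. \<beta> n * e n x) \<in> L2_space" for n by (intro L2_cmult e)
  have "(L2_norm (\<lambda>x. \<Sum>n<M. \<beta> n * e n x))\<^sup>2 = (\<Sum>n<M. \<Sum>m<M. \<beta> n * (\<beta> m * ip (e n) (e m)))"
    by (simp add: L2_norm_eq ip_sum_left ip_sum_right L2_sum L e sum_distrib_left)
  also have "\<dots> = (\<Sum>n<M. \<Sum>m<M. if m = n then (\<beta> n)\<^sup>2 * ip (e n) (e n) else 0)"
    using orth by (intro sum.cong refl) (auto simp: power2_eq_square)
  also have "\<dots> = (\<Sum>n<M. (\<beta> n)\<^sup>2 * ip (e n) (e n))"
    by simp
  finally show ?thesis .
qed

text \<open>The squared distance from \<open>f\<close> to its partial sum is nonnegative. The system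
  is orthogonal but not normalised, and the equation for \<open>\<beta>\<close> stands in for a
  division by the squared norm.\<close>

lemma Bessel_inequality:
  fixes e :: "nat \<Rightarrow> real \<Rightarrow> real"
  assumes e: "\<And>n. e n \<in> L2_space" and orth: "\<And>n m. n \<noteq> m \<Longrightarrow> ip (e n) (e m) = 0"
    and f: "f \<in> L2_space" and \<beta>: "\<And>n. \<beta> n * ip (e n) (e n) = ip f (e n)"
  shows "(\<Sum>n<M. (\<beta> n)\<^sup>2 * ip (e n) (e n)) \<le> (L2_norm f)\<^sup>2"
proof -
  have L: "(\<lambda>x. \<beta> n * e n x) \<in> L2_space" for n by (intro L2_cmult e)
  define s where "s x = (\<Sum>n<M. \<beta> n * e n x)" for x
  have s: "s \<in> L2_space" unfolding s_def[abs_def] by (intro L2_sum L)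
  have fs: "ip f s = (\<Sum>n<M. (\<beta> n)\<^sup>2 * ip (e n) (e n))"
    unfolding s_def[abs_def] by (simp add: ip_sum_right f L \<beta>[symmetric] power2_eq_square mult.assoc)
  have ss: "ip s s = (\<Sum>n<M. (\<beta> n)\<^sup>2 * ip (e n) (e n))"
    using L2_norm_orthogonal_sum[OF e orth, where M = M and \<beta> = \<beta>] by (simp add: L2_norm_eq s_def[abs_def])
  have "0 \<le> ip (\<lambda>x. f x - s x) (\<lambda>x. f x - s x)"
    unfolding L2_norm_eq[of "\<lambda>x. f x - s x", symmetric] by simp
  also have "\<dots> = (L2_norm f)\<^sup>2 - ip f s"
    using f s by (simp add: ip_diff_left ip_diff_right L2_diff ip_commute[of s f] fs ss L2_norm_eq)
  finally show ?thesis by (simp add: fs)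
qed

lemma L2_norm_uniform_limit_le:
  assumes ul: "uniform_limit {0..1} s f sequentially" and s: "\<And>M. continuous_on {0..1} (s M)"
    and le: "\<And>M. L2_norm (s M) \<le> B"
  shows "L2_norm f \<le> B"
proof (rule field_le_epsilon)
  fix e :: real assume e: "0 < e"
  have f: "continuous_on {0..1} f"
    by (rule uniform_limit_theorem[OF _ ul]) (auto intro!: always_eventually s)
  obtain M where M: "\<forall>x\<in>{0..1}. dist (s M x) (f x) < e"
    using uniform_limitD[OF ul e] by (auto simp: eventually_sequentially)
  have "L2_norm (\<lambda>x. f x - s M x) \<le> e"
  proof (rule L2_norm_bound)
    show "\<bar>f x - s M x\<bar> \<le> e" if "x \<in> {0<..<1}" for x
      using bspec[OF M, of x] that by (simp add: dist_real_def)
  qed (intro L2_diff continuous_L2 f s)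
  moreover have "L2_norm (\<lambda>x. (f x - s M x) + s M x) \<le> L2_norm (\<lambda>x. f x - s M x) + L2_norm (s M)"
    by (intro L2_norm_triangle L2_diff continuous_L2 f s)
  ultimately show "L2_norm f \<le> B + e" using le[of M] by simp
qed

lemma ip_uniform_limit:
  assumes ul: "uniform_limit {0..1} s f sequentially" and s: "\<And>M. continuous_on {0..1} (s M)"
    and h: "h \<in> L2_space"
  shows "(\<lambda>M. ip (s M) h) \<longlonglongrightarrow> ip f h"
proof (rule LIMSEQ_I)
  fix e :: real assume e: "0 < e"
  have f: "continuous_on {0..1} f"
    by (rule uniform_limit_theorem[OF _ ul]) (auto intro!: always_eventually s)
  define e' where "e' = e / (1 + L2_norm h)"
  have e': "0 < e'" "e' * L2_norm h < e"
    using e by (auto simp: e'_def field_simps add_pos_nonneg add_nonneg_pos)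
  obtain N where N: "\<And>M. M \<ge> N \<Longrightarrow> \<forall>x\<in>{0..1}. dist (s M x) (f x) < e'"
    using uniform_limitD[OF ul e'(1)] by (auto simp: eventually_sequentially)
  have "norm (ip (s M) h - ip f h) < e" if "M \<ge> N" for M
  proof -
    have "L2_norm (\<lambda>x. s M x - f x) \<le> e'"
    proof (rule L2_norm_bound)
      show "\<bar>s M x - f x\<bar> \<le> e'" if "x \<in> {0<..<1}" for x
        using bspec[OF N[OF \<open>M \<ge> N\<close>], of x] that by (simp add: dist_real_def)
    qed (intro L2_diff continuous_L2 f s)
    moreover have "ip (s M) h - ip f h = ip (\<lambda>x. s M x - f x) h"
      by (rule ip_diff_left[symmetric]) (intro continuous_L2 s f h)+
    moreover have "\<bar>ip (\<lambda>x. s M x - f x) h\<bar> \<le> L2_norm (\<lambda>x. s M x - f x) * L2_norm h"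
      by (intro ip_Cauchy_Schwarz L2_diff continuous_L2 f s h)
    moreover have "L2_norm (\<lambda>x. s M x - f x) * L2_norm h \<le> e' * L2_norm h"
      by (rule mult_right_mono) (use calculation in auto)
    ultimately have "\<bar>ip (s M) h - ip f h\<bar> \<le> e' * L2_norm h" by linarith
    then show ?thesis using e'(2) by simp
  qed
  then show "\<exists>N. \<forall>M\<ge>N. norm (ip (s M) h - ip f h) < e" by blast
qed

text \<open>Sine series, with a Dirichlet (\<open>\<theta> = 0\<close>) or a Neumann condition (\<open>\<theta> = 1/2\<close>) at \<open>x = 1\<close>.\<close>

locale heat =
  fixes \<theta> lam :: real
  assumes \<theta>: "\<theta> = 0 \<or> \<theta> = 1/2" and lam: "0 < lam"
begin

section \<open>Frequencies, rates and eigenfunctions\<close>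

definition nu :: "nat \<Rightarrow> real" where "nu n = (real n + \<theta>) * pi"
text \<open>The decay rate of mode \<open>n\<close> under the damped heat equation.\<close>

definition gam :: "nat \<Rightarrow> real" where "gam n = lam + (nu n)\<^sup>2"
definition Cs :: "nat \<Rightarrow> real \<Rightarrow> real" where "Cs n x = cos (nu n * x)"
definition Sn :: "nat \<Rightarrow> real \<Rightarrow> real" where "Sn n x = sin (nu n * x)"

lemma nu_nonneg: "0 \<le> nu n" using \<theta> by (auto simp: nu_def)

lemma nu_ge: "real n \<le> nu n"
proof -
  have "real n * 1 \<le> (real n + \<theta>) * pi"
    using \<theta> pi_gt3 by (intro mult_mono) auto
  then show ?thesis by (simp add: nu_def)
qed

lemma nu_le: "nu n \<le> 4 * real (Suc n)"
proof -
  have "(real n + \<theta>) * pi \<le> real (Suc n) * 4"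
    using \<theta> pi_less_4 by (intro mult_mono) auto
  then show ?thesis by (simp add: nu_def mult.commute)
qed

lemma nu_pos_ge_1: "nu n \<noteq> 0 \<Longrightarrow> 1 \<le> nu n"
proof -
  assume "nu n \<noteq> 0"
  then have "1/2 \<le> real n + \<theta>" using \<theta> by (cases n) (auto simp: nu_def)
  then have "(1/2) * 2 \<le> (real n + \<theta>) * pi" using pi_ge_two by (intro mult_mono) auto
  then show "1 \<le> nu n" by (simp add: nu_def)
qed

lemma gam_ge: "lam \<le> gam n" "(nu n)\<^sup>2 \<le> gam n" "real n \<le> gam n"
proof -
  show "lam \<le> gam n" "(nu n)\<^sup>2 \<le> gam n" using lam by (auto simp: gam_def)
  have "real n \<le> real n * real n" by (cases n) auto
  also have "\<dots> \<le> nu n * nu n" by (intro mult_mono nu_ge) (auto simp: nu_nonneg)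
  finally show "real n \<le> gam n" using lam by (simp add: gam_def power2_eq_square)
qed

lemma Cs_continuous: "continuous_on S (Cs n)" and Sn_continuous: "continuous_on S (Sn n)"
  by (auto simp: Cs_def[abs_def] Sn_def[abs_def] intro!: continuous_intros)

lemma Cs_L2: "Cs n \<in> L2_space" and Sn_L2: "Sn n \<in> L2_space"
  by (intro continuous_L2 Cs_continuous Sn_continuous)+

lemma Cs_abs: "\<bar>Cs n x\<bar> \<le> 1" and Sn_abs: "\<bar>Sn n x\<bar> \<le> 1"
  by (auto simp: Cs_def Sn_def)

lemma Cs_deriv: "(Cs n has_real_derivative - nu n * Sn n x) (at x within S)"
  and Sn_deriv: "(Sn n has_real_derivative nu n * Cs n x) (at x within S)"
  unfolding Cs_def[abs_def] Sn_def[abs_def] by (auto intro!: derivative_eq_intros)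

lemma Cs_one: "\<theta> = 1/2 \<Longrightarrow> Cs n 1 = 0"
proof -
  assume "\<theta> = 1/2"
  then have "nu n * 1 = pi / 2 + real n * pi" by (simp add: nu_def algebra_simps)
  then show "Cs n 1 = 0" by (simp add: Cs_def cos_add)
qed

lemma Sn_one: "Sn n 1 = 0" if t: "\<theta> = 0"
proof -
  have "nu n * 1 = real n * pi" unfolding nu_def unfolding t by simp
  then show ?thesis by (simp only: Sn_def sin_npi)
qed

text \<open>Prepares the product-to-sum formulas. For \<open>\<theta> = 1/2\<close> the two
  half-integers add up to the integer n + m + 1, so only cosines of integer frequency have to be
  integrated, and those vanish unless the frequency is 0.\<close>

lemma nu_diff_sum:
  obtains j :: int where "nu n + nu m = of_int j * pi" "nu n - nu m = of_int (int n - int m) * pi"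
    "j = 0 \<longleftrightarrow> nu n = 0 \<and> nu m = 0"
proof -
  define j where "j = int n + int m + (if \<theta> = 0 then 0 else 1)"
  have 1: "nu n + nu m = of_int j * pi" "nu n - nu m = of_int (int n - int m) * pi"
    using \<theta> by (auto simp: nu_def j_def algebra_simps)
  moreover have "j = 0 \<longleftrightarrow> nu n = 0 \<and> nu m = 0"
    using \<theta> by (auto simp: nu_def j_def)
  ultimately show thesis by (rule that)
qed

lemma ip_Cs_Cs: "ip (Cs n) (Cs m) = (if n = m then (if nu n = 0 then 1 else 1/2) else 0)"
  and ip_Sn_Sn: "ip (Sn n) (Sn m) = (if n = m \<and> nu n \<noteq> 0 then 1/2 else 0)"
proof -
  obtain j :: int where j: "nu n + nu m = of_int j * pi" "nu n - nu m = of_int (int n - int m) * pi"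
    "j = 0 \<longleftrightarrow> nu n = 0 \<and> nu m = 0" by (rule nu_diff_sum)
  have p: "Cs n x * Cs m x = 1/2 * cos (of_int (int n - int m) * pi * x) + 1/2 * cos (of_int j * pi * x)"
    "Sn n x * Sn m x = 1/2 * cos (of_int (int n - int m) * pi * x) - 1/2 * cos (of_int j * pi * x)" for x
  proof -
    have a: "of_int j * pi * x = nu n * x + nu m * x" "of_int (int n - int m) * pi * x = nu n * x - nu m * x"
      unfolding j(1,2)[symmetric] by (simp_all add: algebra_simps)
    show "Cs n x * Cs m x = 1/2 * cos (of_int (int n - int m) * pi * x) + 1/2 * cos (of_int j * pi * x)"
      "Sn n x * Sn m x = 1/2 * cos (of_int (int n - int m) * pi * x) - 1/2 * cos (of_int j * pi * x)"
      unfolding a Cs_def Sn_def by (simp_all add: cos_add cos_diff field_simps)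
  qed
  have i: "(\<lambda>x. 1/2 * cos (of_int i * pi * x)) integrable_on {0..1}" for i
    by (intro integrable_continuous_interval continuous_intros)
  have "ip (Cs n) (Cs m) = integral {0..1} (\<lambda>x. 1/2 * cos (of_int (int n - int m) * pi * x) + 1/2 * cos (of_int j * pi * x))"
    unfolding ip_def p by (rule continuous_leb_integral) (intro continuous_intros)
  also have "\<dots> = integral {0..1} (\<lambda>x. 1/2 * cos (of_int (int n - int m) * pi * x)) + integral {0..1} (\<lambda>x. 1/2 * cos (of_int j * pi * x))"
    by (rule Henstock_Kurzweil_Integration.integral_add[OF i i])
  also have "\<dots> = 1/2 * (if int n - int m = 0 then 1 else 0) + 1/2 * (if j = 0 then 1 else 0)"
    by (simp only: Henstock_Kurzweil_Integration.integral_mult_right integral_cos_pi_int)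
  also have "\<dots> = (if n = m then (if nu n = 0 then 1 else 1/2) else 0)"
  proof (cases "n = m")
    case False
    then have "j \<noteq> 0" using j by (auto simp: nu_def)
    then show ?thesis using False by simp
  qed (use j in auto)
  finally show "ip (Cs n) (Cs m) = (if n = m then (if nu n = 0 then 1 else 1/2) else 0)" .
  have "ip (Sn n) (Sn m) = integral {0..1} (\<lambda>x. 1/2 * cos (of_int (int n - int m) * pi * x) - 1/2 * cos (of_int j * pi * x))"
    unfolding ip_def p by (rule continuous_leb_integral) (intro continuous_intros)
  also have "\<dots> = integral {0..1} (\<lambda>x. 1/2 * cos (of_int (int n - int m) * pi * x)) - integral {0..1} (\<lambda>x. 1/2 * cos (of_int j * pi * x))"
    by (rule Henstock_Kurzweil_Integration.integral_diff[OF i i])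
  also have "\<dots> = 1/2 * (if int n - int m = 0 then 1 else 0) - 1/2 * (if j = 0 then 1 else 0)"
    by (simp only: Henstock_Kurzweil_Integration.integral_mult_right integral_cos_pi_int)
  also have "\<dots> = (if n = m \<and> nu n \<noteq> 0 then 1/2 else 0)"
  proof (cases "n = m")
    case False
    then have "j \<noteq> 0" using j by (auto simp: nu_def)
    then show ?thesis using False by simp
  qed (use j in auto)
  finally show "ip (Sn n) (Sn m) = (if n = m \<and> nu n \<noteq> 0 then 1/2 else 0)" .
qed

lemma Cs_orth: "n \<noteq> m \<Longrightarrow> ip (Cs n) (Cs m) = 0" and Sn_orth: "n \<noteq> m \<Longrightarrow> ip (Sn n) (Sn m) = 0"
  by (simp_all add: ip_Cs_Cs ip_Sn_Sn)

lemma Cs_complete: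
  assumes "h \<in> L2_space" "\<And>n. ip h (Cs n) = 0"
  shows "AE x in leb 0 1. h x = 0"
  by (rule cos_complete[OF assms(1) \<theta>]) (use assms(2) in \<open>simp add: Cs_def[abs_def] nu_def\<close>)

text \<open>Integration by parts with an antiderivative \<open>H\<close> turns orthogonality of
  \<open>h\<close> to the sines into orthogonality of \<open>H\<close> to the cosines, whose
  completeness is known. Thus \<open>H\<close> is constant and its derivative \<open>h\<close> is
  zero.\<close>

theorem Sn_complete:
  assumes h: "continuous_on {0..1} h" and orth: "\<And>n. ip h (Sn n) = 0" and x: "x \<in> {0..1}"
  shows "h x = 0"
proof -
  \<comment> \<open>Normalised to vanish at 1, where for \<open>\<theta> = 1/2\<close> the sines do
    not vanish; at 0 the sines vanish themselves.\<close>
  define H where "H x = integral {0..x} h - integral {0..1} h" for x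
  have Hd: "(H has_real_derivative h x) (at x within {0..1})" if "x \<in> {0..1}" for x
    unfolding H_def by (auto intro!: derivative_eq_intros integral_has_real_derivative[OF h that])
  have Hc: "continuous_on {0..1} H" by (rule DERIV_continuous_on[OF Hd])
  have HC: "nu n * ip H (Cs n) = 0" for n
  proof -
    have "ip h (Sn n) = H 1 * Sn n 1 - H 0 * Sn n 0 - ip H (\<lambda>x. nu n * Cs n x)"
      by (rule weak_deriv_by_parts[OF weak_deriv_classical[OF Hd h] Hc Sn_deriv])
         (auto intro!: continuous_intros Cs_continuous)
    then show ?thesis using orth[of n] by (simp add: H_def Sn_def)
  qed
  \<comment> \<open>For \<open>\<theta> = 0\<close> the identity \<open>HC\<close> says nothing
    about the constant cosine, whose frequency is 0, so the mean of \<open>H\<close> is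
    subtracted.\<close>
  define m where "m = (if \<theta> = 0 then ip H (Cs 0) else 0)"
  have "AE x in leb 0 1. H x - m = 0"
  proof (rule Cs_complete)
    show "(\<lambda>x. H x - m) \<in> L2_space" by (intro continuous_L2 continuous_intros Hc)
    fix n
    have "ip (\<lambda>x. H x - m) (Cs n) = ip H (Cs n) - ip (\<lambda>x. m * 1) (Cs n)"
      using ip_diff_left[of H "\<lambda>_. m" "Cs n"] by (simp add: continuous_L2 Hc Cs_L2)
    also have "ip (\<lambda>x. m * 1) (Cs n) = m * ip (\<lambda>x. 1) (Cs n)" by (rule ip_cmult_left)
    finally have eq: "ip (\<lambda>x. H x - m) (Cs n) = ip H (Cs n) - m * ip (\<lambda>x. 1) (Cs n)" .
    show "ip (\<lambda>x. H x - m) (Cs n) = 0"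
    proof (cases "\<theta> = 0")
      case True
      have C0: "(\<lambda>x. 1) = Cs 0"
        unfolding Cs_def[abs_def] nu_def unfolding True by simp
      show ?thesis
      proof (cases "n = 0")
        case n0: True
        have "nu 0 = 0" unfolding nu_def unfolding True by simp
        moreover have "m = ip H (Cs 0)" unfolding m_def by (rule if_P[OF True])
        ultimately show ?thesis unfolding eq unfolding n0 C0 by (simp add: ip_Cs_Cs)
      next
        case False
        then have "nu n \<noteq> 0" using nu_ge[of n] by simp
        then show ?thesis using HC[of n] False by (simp add: eq C0 ip_Cs_Cs)
      qed
    next
      case False
      then have "nu n \<noteq> 0" "m = 0" using \<theta> by (auto simp: nu_def m_def add_eq_0_iff)
      then show ?thesis using HC[of n] by (simp add: eq)
    qed
  qed
  then have "AE x in leb 0 1. H x = m" by simp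
  then have Hm: "H x = m" if "x \<in> {0..1}" for x
    using AE_continuous_eq[OF Hc, of "\<lambda>_. m" x] that by simp
  have "(H has_real_derivative 0) (at x within {0..1})"
    by (rule has_field_derivative_transform_within[of "\<lambda>_. m" _ _ _ 1]) (use x Hm in auto)
  then show ?thesis
    using has_real_derivative_unique_Icc[OF Hd[OF x]] x by auto
qed

section \<open>Exponentially damped series\<close>

definition ser :: "(nat \<Rightarrow> real) \<Rightarrow> (nat \<Rightarrow> real \<Rightarrow> real) \<Rightarrow> real \<Rightarrow> real \<Rightarrow> real" where
  "ser p T t x = (\<Sum>n. p n * exp (- gam n * t) * T n x)"

text \<open>One majorant for all series that occur: the coefficients of \<open>w\<close>, of its
  space derivatives and of its time derivative grow at most quadratically in the index.\<close>

lemma summable_quadratic_geometric: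
  assumes "0 \<le> r" "r < (1::real)"
  shows "summable (\<lambda>n. P * (real (Suc n))\<^sup>2 * r ^ n)"
proof -
  have "summable (\<lambda>n. diffs (diffs (\<lambda>n. 1)) n * r ^ n)"
    by (rule termdiff_converges[of _ 1], use assms in simp, rule termdiff_converges[of _ 1])
       (auto intro!: summable_geometric)
  then have s: "summable (\<lambda>n. \<bar>P\<bar> * (real (Suc n) * real (Suc (Suc n)) * r ^ n))"
    by (intro summable_mult) (simp add: diffs_def mult_ac)
  show ?thesis
  proof (rule summable_comparison_test'[OF s])
    fix n
    have "norm (P * (real (Suc n))\<^sup>2 * r ^ n) = \<bar>P\<bar> * (real (Suc n) * real (Suc n) * r ^ n)"
      using assms by (simp add: abs_mult power2_eq_square del: of_nat_Suc)
    also have "\<dots> \<le> \<bar>P\<bar> * (real (Suc n) * real (Suc (Suc n)) * r ^ n)"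
      using assms by (intro mult_left_mono mult_right_mono) auto
    finally show "norm (P * (real (Suc n))\<^sup>2 * r ^ n) \<le> \<bar>P\<bar> * (real (Suc n) * real (Suc (Suc n)) * r ^ n)" .
  qed
qed

text \<open>The crude bound \<open>real n \<le> gam n\<close> is enough and yields a geometric
  majorant.\<close>

lemma exp_gam_le:
  assumes "\<delta> \<le> t" "0 \<le> \<delta>"
  shows "exp (- gam n * t) \<le> exp (- \<delta>) ^ n"
proof -
  have "real n * \<delta> \<le> gam n * t"
    using gam_ge(3)[of n] assms by (intro mult_mono) auto
  then have "exp (- gam n * t) \<le> exp (- (real n * \<delta>))" by simp
  also have "\<dots> = exp (- \<delta>) ^ n" by (simp add: exp_of_nat_mult[symmetric])
  finally show ?thesis .
qed

lemma ser_term_bound: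
  assumes p: "\<bar>p n\<bar> \<le> P * (real (Suc n))\<^sup>2" and T: "\<bar>T n x\<bar> \<le> 1" and t: "\<delta> \<le> t" "0 \<le> \<delta>"
  shows "norm (p n * exp (- gam n * t) * T n x) \<le> P * (real (Suc n))\<^sup>2 * exp (- \<delta>) ^ n"
proof -
  have "norm (p n * exp (- gam n * t) * T n x) = \<bar>p n\<bar> * exp (- gam n * t) * \<bar>T n x\<bar>"
    by (simp add: abs_mult)
  also have "\<dots> \<le> (P * (real (Suc n))\<^sup>2 * exp (- \<delta>) ^ n) * 1"
    using p T order_trans[OF abs_ge_zero p]
    by (intro mult_mono exp_gam_le[OF t]) auto
  finally show ?thesis by simp
qed

context
  fixes p :: "nat \<Rightarrow> real" and P :: real and T :: "nat \<Rightarrow> real \<Rightarrow> real"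
  assumes p: "\<And>n. \<bar>p n\<bar> \<le> P * (real (Suc n))\<^sup>2" and T: "\<And>n x. \<bar>T n x\<bar> \<le> 1"
begin

lemma ser_uniform:
  assumes "0 < \<delta>"
  shows "uniform_limit ({\<delta>..} \<times> UNIV) (\<lambda>M w. \<Sum>n<M. p n * exp (- gam n * fst w) * T n (snd w)) (\<lambda>w. ser p T (fst w) (snd w)) sequentially"
  unfolding ser_def
proof (rule Weierstrass_m_test[where M = "\<lambda>n. P * (real (Suc n))\<^sup>2 * exp (- \<delta>) ^ n"])
  show "norm (p n * exp (- gam n * fst w) * T n (snd w)) \<le> P * (real (Suc n))\<^sup>2 * exp (- \<delta>) ^ n"
    if "w \<in> {\<delta>..} \<times> UNIV" for n w
    by (rule ser_term_bound[where p = p and T = T, OF p T]) (use that assms in auto)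
  show "summable (\<lambda>n. P * (real (Suc n))\<^sup>2 * exp (- \<delta>) ^ n)"
    by (rule summable_quadratic_geometric) (use assms in auto)
qed

lemma ser_summable: "0 < t \<Longrightarrow> summable (\<lambda>n. p n * exp (- gam n * t) * T n x)"
  by (rule summable_comparison_test'[OF summable_quadratic_geometric[of "exp (- t)" P] ser_term_bound[where \<delta> = t and p = p and T = T]])
     (use p T in auto)

lemma ser_uniform_x:
  assumes "0 < t"
  shows "uniform_limit X (\<lambda>M x. \<Sum>n<M. p n * exp (- gam n * t) * T n x) (\<lambda>x. ser p T t x) sequentially"
  unfolding uniform_limit_iff
proof safe
  fix e :: real assume "0 < e"
  from uniform_limitD[OF ser_uniform[OF assms] this]
  show "\<forall>\<^sub>F M in sequentially. \<forall>x\<in>X. dist (\<Sum>n<M. p n * exp (- gam n * t) * T n x) (ser p T t x) < e"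
    by eventually_elim auto
qed

text \<open>Convergence is uniform only away from \<open>t = 0\<close>; the open sets of times
  greater than some \<delta> > 0 cover all positive times.\<close>

lemma ser_continuous:
  assumes Tc: "\<And>n. continuous_on UNIV (T n)"
  shows "continuous_on ({0<..} \<times> UNIV) (\<lambda>w. ser p T (fst w) (snd w))"
proof -
  have "continuous_on ({\<delta><..} \<times> UNIV) (\<lambda>w. ser p T (fst w) (snd w))" if "0 < \<delta>" for \<delta>
  proof -
    have "continuous_on ({\<delta>..} \<times> UNIV) (\<lambda>w. ser p T (fst w) (snd w))"
      by (rule uniform_limit_theorem[OF _ ser_uniform[OF that]])
         (auto intro!: always_eventually continuous_intros continuous_on_compose2[OF Tc])
    then show ?thesis by (rule continuous_on_subset) auto
  qed
  then have "continuous_on (\<Union>\<delta>\<in>{0<..}. {\<delta><..} \<times> UNIV) (\<lambda>w. ser p T (fst w) (snd w))"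
    by (intro continuous_on_open_UN open_Times) auto
  moreover have "(\<Union>\<delta>\<in>{0<..}. {\<delta><..} \<times> (UNIV :: real set)) = {0::real<..} \<times> UNIV"
  proof (intro equalityI subsetI)
    fix w :: "real \<times> real" assume "w \<in> {0<..} \<times> UNIV"
    then show "w \<in> (\<Union>\<delta>\<in>{0<..}. {\<delta><..} \<times> UNIV)"
      by (intro UN_I[of "fst w / 2"]) (auto simp: mem_Times_iff)
  qed (auto intro: less_trans)
  ultimately show ?thesis by simp
qed

end

lemma ser_deriv_x:
  assumes p: "\<And>n. \<bar>p n\<bar> \<le> P * (real (Suc n))\<^sup>2" and T: "\<And>n x. \<bar>T n x\<bar> \<le> 1"
    and q: "\<And>n. \<bar>q n\<bar> \<le> Q * (real (Suc n))\<^sup>2" and R: "\<And>n x. \<bar>R n x\<bar> \<le> 1"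
    and d: "\<And>n x. ((\<lambda>x. p n * T n x) has_real_derivative q n * R n x) (at x)" and t: "0 < t"
  shows "((\<lambda>x. ser p T t x) has_real_derivative ser q R t x) (at x within S)"
proof -
  have "\<exists>g. \<forall>x\<in>UNIV. (\<lambda>n. p n * exp (- gam n * t) * T n x) sums g x \<and> (g has_field_derivative ser q R t x) (at x within UNIV)"
  proof (rule has_field_derivative_series)
    show "((\<lambda>x. p n * exp (- gam n * t) * T n x) has_real_derivative q n * exp (- gam n * t) * R n x) (at x within UNIV)" for n x
      using DERIV_cmult[OF d[of n x], of "exp (- gam n * t)"] by (simp add: mult_ac)
    show "uniform_limit UNIV (\<lambda>M x. \<Sum>n<M. q n * exp (- gam n * t) * R n x) (ser q R t) sequentially"
      by (rule ser_uniform_x[OF q R t])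
    show "summable (\<lambda>n. p n * exp (- gam n * t) * T n 0)" by (rule ser_summable[OF p T t])
  qed auto
  then obtain g where g: "\<And>x. (\<lambda>n. p n * exp (- gam n * t) * T n x) sums g x" "\<And>x. (g has_field_derivative ser q R t x) (at x)" by auto
  have "ser p T t = g" by (rule ext) (simp add: ser_def sums_unique[OF g(1)])
  then show ?thesis using g(2)[of x] has_field_derivative_at_within by blast
qed

lemma ser_deriv_t:
  assumes p: "\<And>n. \<bar>p n\<bar> \<le> P * (real (Suc n))\<^sup>2" and T: "\<And>n x. \<bar>T n x\<bar> \<le> 1"
    and q: "\<And>n. \<bar>gam n * p n\<bar> \<le> Q * (real (Suc n))\<^sup>2" and t: "0 < t"
  shows "((\<lambda>t. ser p T t x) has_real_derivative ser (\<lambda>n. - (gam n * p n)) T t x) (at t)"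
  unfolding ser_def
proof (rule has_field_derivative_series'(2)[where S = "{t / 2..}"])
  have q': "\<bar>- (gam n * p n)\<bar> \<le> Q * (real (Suc n))\<^sup>2" for n using q[of n] by simp
  show "((\<lambda>t. p n * exp (- gam n * t) * T n x) has_real_derivative - (gam n * p n) * exp (- gam n * s) * T n x) (at s within {t / 2..})" for n s
    by (auto intro!: derivative_eq_intros)
  have "uniform_limit {t/2..} (\<lambda>M s. \<Sum>n<M. - (gam n * p n) * exp (- gam n * s) * T n x) (\<lambda>s. ser (\<lambda>n. - (gam n * p n)) T s x) sequentially"
    unfolding uniform_limit_iff
  proof safe
    fix e :: real assume e: "0 < e"
    have "0 < t / 2" using t by simp
    from uniform_limitD[OF ser_uniform[OF q' T this] e]
    show "\<forall>\<^sub>F M in sequentially. \<forall>s\<in>{t/2..}. dist (\<Sum>n<M. - (gam n * p n) * exp (- gam n * s) * T n x) (ser (\<lambda>n. - (gam n * p n)) T s x) < e"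
      by eventually_elim auto
  qed
  then show "uniformly_convergent_on {t/2..} (\<lambda>M s. \<Sum>n<M. - (gam n * p n) * exp (- gam n * s) * T n x)"
    by (rule uniformly_convergentI)
  show "summable (\<lambda>n. p n * exp (- gam n * t) * T n x)" by (rule ser_summable[OF p T t])
qed (use t in auto)

lemma L2_norm_ser_le:
  assumes p: "\<And>n. \<bar>p n\<bar> \<le> P * (real (Suc n))\<^sup>2" and e: "\<And>n x. \<bar>e n x\<bar> \<le> 1"
    and c: "\<And>n. continuous_on UNIV (e n)" and orth: "\<And>n m. n \<noteq> m \<Longrightarrow> ip (e n) (e m) = 0"
    and t: "0 < t" and le: "\<And>M. (\<Sum>n<M. (p n * exp (- gam n * t))\<^sup>2 * ip (e n) (e n)) \<le> B\<^sup>2" and B: "0 \<le> B"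
  shows "L2_norm (ser p e t) \<le> B"
proof (rule L2_norm_uniform_limit_le[OF ser_uniform_x[OF p e t]])
  have c': "continuous_on S (e n)" for n S using continuous_on_subset[OF c] by simp
  show "continuous_on {0..1} (\<lambda>x. \<Sum>n<M. p n * exp (- gam n * t) * e n x)" for M
    by (intro continuous_intros c')
  show "L2_norm (\<lambda>x. \<Sum>n<M. p n * exp (- gam n * t) * e n x) \<le> B" for M
  proof (rule power2_le_imp_le[OF _ B])
    show "(L2_norm (\<lambda>x. \<Sum>n<M. p n * exp (- gam n * t) * e n x))\<^sup>2 \<le> B\<^sup>2"
      using le[of M] by (simp add: L2_norm_orthogonal_sum orth continuous_L2 c')
  qed
qed

text \<open>The cosine coefficients of \<open>f\<close>; the constant function, which occurs for \<open>\<theta> = 0\<close> only, has norm \<open>1\<close>.\<close>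

definition coef :: "(real \<Rightarrow> real) \<Rightarrow> nat \<Rightarrow> real" where
  "coef f n = ip f (Cs n) / ip (Cs n) (Cs n)"

section \<open>The flow on L2\<close>

lemma coef_bound:
  assumes f: "f \<in> L2_space"
  shows "\<bar>coef f n\<bar> \<le> (2 * L2_norm f) * (real (Suc n))\<^sup>2"
proof -
  have "L2_norm (Cs n) \<le> 1" by (rule L2_norm_bound[OF Cs_L2]) (rule Cs_abs)
  then have "\<bar>ip f (Cs n)\<bar> \<le> L2_norm f * 1"
    using ip_Cauchy_Schwarz[OF f Cs_L2, of n] mult_left_mono[of "L2_norm (Cs n)" 1 "L2_norm f"] by simp
  then have "\<bar>coef f n\<bar> \<le> 2 * L2_norm f"
    by (auto simp: coef_def ip_Cs_Cs)
  also have "\<dots> = (2 * L2_norm f) * 1" by simp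
  also have "\<dots> \<le> (2 * L2_norm f) * (real (Suc n))\<^sup>2"
    by (intro mult_left_mono) auto
  finally show ?thesis .
qed

lemma coef_Bessel:
  assumes f: "f \<in> L2_space"
  shows "(\<Sum>n<M. (coef f n)\<^sup>2 * ip (Cs n) (Cs n)) \<le> (L2_norm f)\<^sup>2"
  by (rule Bessel_inequality[OF Cs_L2 Cs_orth f]) (auto simp: coef_def ip_Cs_Cs)

text \<open>Meant for the derivative: if w solves the target system, then w_x solves the same
  equation with the cosines as eigenfunctions.\<close>

definition flow :: "(real \<Rightarrow> real) \<Rightarrow> real \<Rightarrow> real \<Rightarrow> real" where
  "flow f = ser (coef f) Cs"

lemma flow_continuous: "f \<in> L2_space \<Longrightarrow> 0 < t \<Longrightarrow> continuous_on X (flow f t)"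
  unfolding flow_def
  by (rule uniform_limit_theorem[OF _ ser_uniform_x[OF coef_bound Cs_abs]])
     (auto intro!: always_eventually continuous_intros Cs_continuous)

text \<open>All rates are at least \<open>lam\<close>, and Bessel's inequality bounds the undamped
  sum.\<close>

lemma flow_contraction:
  assumes f: "f \<in> L2_space" and t: "0 < t"
  shows "L2_norm (flow f t) \<le> exp (- lam * t) * L2_norm f"
  unfolding flow_def
proof (rule L2_norm_ser_le[OF coef_bound[OF f] Cs_abs Cs_continuous Cs_orth t])
  fix M
  have "(\<Sum>n<M. (coef f n * exp (- gam n * t))\<^sup>2 * ip (Cs n) (Cs n)) \<le> (\<Sum>n<M. (exp (- lam * t))\<^sup>2 * ((coef f n)\<^sup>2 * ip (Cs n) (Cs n)))"
  proof (rule sum_mono)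
    fix n
    have "(exp (- gam n * t))\<^sup>2 \<le> (exp (- lam * t))\<^sup>2"
      using gam_ge(1)[of n] t by (intro power_mono) auto
    then have "(coef f n)\<^sup>2 * (exp (- gam n * t))\<^sup>2 * ip (Cs n) (Cs n) \<le> (coef f n)\<^sup>2 * (exp (- lam * t))\<^sup>2 * ip (Cs n) (Cs n)"
      by (intro mult_right_mono mult_left_mono) (auto simp: ip_Cs_Cs)
    then show "(coef f n * exp (- gam n * t))\<^sup>2 * ip (Cs n) (Cs n) \<le> (exp (- lam * t))\<^sup>2 * ((coef f n)\<^sup>2 * ip (Cs n) (Cs n))"
      by (simp add: power_mult_distrib mult_ac)
  qed
  also have "\<dots> = (exp (- lam * t))\<^sup>2 * (\<Sum>n<M. (coef f n)\<^sup>2 * ip (Cs n) (Cs n))"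
    by (rule sum_distrib_left[symmetric])
  also have "\<dots> \<le> (exp (- lam * t))\<^sup>2 * (L2_norm f)\<^sup>2"
    by (intro mult_left_mono coef_Bessel f) auto
  finally show "(\<Sum>n<M. (coef f n * exp (- gam n * t))\<^sup>2 * ip (Cs n) (Cs n)) \<le> (exp (- lam * t) * L2_norm f)\<^sup>2"
    by (simp add: power_mult_distrib)
qed auto

lemma flow_contraction': "f \<in> L2_space \<Longrightarrow> 0 < t \<Longrightarrow> L2_norm (flow f t) \<le> L2_norm f"
proof -
  assume f: "f \<in> L2_space" and t: "0 < t"
  have "exp (- lam * t) * L2_norm f \<le> 1 * L2_norm f"
    using lam t by (intro mult_right_mono) auto
  then show ?thesis using flow_contraction[OF f t] by simp
qed

lemma flow_add:
  assumes "f \<in> L2_space" "g \<in> L2_space" "0 < t"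
  shows "flow (\<lambda>x. f x + g x) t x = flow f t x + flow g t x"
proof -
  have "coef (\<lambda>x. f x + g x) n * exp (- gam n * t) * Cs n x = coef f n * exp (- gam n * t) * Cs n x + coef g n * exp (- gam n * t) * Cs n x" for n
    using assms by (simp add: coef_def ip_add_left Cs_L2 add_divide_distrib distrib_right)
  then have "flow (\<lambda>x. f x + g x) t x = (\<Sum>n. coef f n * exp (- gam n * t) * Cs n x + coef g n * exp (- gam n * t) * Cs n x)"
    by (simp only: flow_def ser_def)
  also have "\<dots> = flow f t x + flow g t x"
    unfolding flow_def ser_def
    by (rule suminf_add[symmetric]; rule ser_summable[where T = Cs, OF coef_bound Cs_abs]) (use assms in auto)
  finally show ?thesis .
qed

lemma flow_cmult:
  assumes "f \<in> L2_space" "0 < t"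
  shows "flow (\<lambda>x. c * f x) t x = c * flow f t x"
proof -
  have "coef (\<lambda>x. c * f x) n * exp (- gam n * t) * Cs n x = c * (coef f n * exp (- gam n * t) * Cs n x)" for n
    by (simp add: coef_def)
  then have "flow (\<lambda>x. c * f x) t x = (\<Sum>n. c * (coef f n * exp (- gam n * t) * Cs n x))"
    by (simp only: flow_def ser_def)
  also have "\<dots> = c * flow f t x"
    unfolding flow_def ser_def
    by (rule suminf_mult; rule ser_summable[where T = Cs, OF coef_bound Cs_abs]) (use assms in auto)
  finally show ?thesis .
qed

lemma flow_Cs: "flow (Cs m) t x = exp (- gam m * t) * Cs m x"
proof -
  have "(\<lambda>n. coef (Cs m) n * exp (- gam n * t) * Cs n x) sums (\<Sum>n\<in>{m}. coef (Cs m) n * exp (- gam n * t) * Cs n x)"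
    by (rule sums_finite) (auto simp: coef_def Cs_orth)
  then show ?thesis
    by (simp add: flow_def ser_def sums_iff coef_def ip_Cs_Cs)
qed

lemma flow_tendsto_span:
  assumes "q \<in> cos_span \<theta>"
  shows "((\<lambda>t. L2_norm (\<lambda>x. flow q t x - q x)) \<longlongrightarrow> 0) (at_right 0)"
  using assms
proof (induction rule: cos_span.induct)
  case (base n)
  have cs: "cos ((real n + \<theta>) * pi * x) = Cs n x" for x by (simp only: Cs_def nu_def)
  have "L2_norm (\<lambda>x. flow (Cs n) t x - Cs n x) = \<bar>exp (- gam n * t) - 1\<bar> * L2_norm (Cs n)" for t
    using L2_norm_cmult[of "exp (- gam n * t) - 1" "Cs n"] by (simp add: flow_Cs algebra_simps)
  moreover have "((\<lambda>t. \<bar>exp (- gam n * t) - 1\<bar> * L2_norm (Cs n)) \<longlongrightarrow> \<bar>exp (- gam n * 0) - 1\<bar> * L2_norm (Cs n)) (at_right 0)"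
    by (intro tendsto_intros)
  ultimately show ?case by (simp add: cs)
next
  case (add f g)
  have L: "f \<in> L2_space" "g \<in> L2_space" using add by (auto intro: cos_span_L2)
  have "((\<lambda>t. L2_norm (\<lambda>x. flow f t x - f x) + L2_norm (\<lambda>x. flow g t x - g x)) \<longlongrightarrow> 0 + 0) (at_right 0)"
    by (intro tendsto_add add)
  then have lim: "((\<lambda>t. L2_norm (\<lambda>x. flow f t x - f x) + L2_norm (\<lambda>x. flow g t x - g x)) \<longlongrightarrow> 0) (at_right 0)"
    by simp
  show ?case
  proof (rule Lim_null_comparison[OF _ lim])
    show "\<forall>\<^sub>F t in at_right 0. norm (L2_norm (\<lambda>x. flow (\<lambda>x. f x + g x) t x - (f x + g x)))
        \<le> L2_norm (\<lambda>x. flow f t x - f x) + L2_norm (\<lambda>x. flow g t x - g x)"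
      using eventually_at_right_less[of "0::real"]
    proof eventually_elim
      case (elim t)
      have "L2_norm (\<lambda>x. flow (\<lambda>x. f x + g x) t x - (f x + g x)) = L2_norm (\<lambda>x. (flow f t x - f x) + (flow g t x - g x))"
        using elim L by (simp add: flow_add algebra_simps)
      also have "\<dots> \<le> L2_norm (\<lambda>x. flow f t x - f x) + L2_norm (\<lambda>x. flow g t x - g x)"
        by (intro L2_norm_triangle L2_diff L continuous_L2 flow_continuous elim)
      finally show ?case by simp
    qed
  qed
next
  case (scale f c)
  have L: "f \<in> L2_space" using scale by (auto intro: cos_span_L2)
  have "((\<lambda>t. \<bar>c\<bar> * L2_norm (\<lambda>x. flow f t x - f x)) \<longlongrightarrow> \<bar>c\<bar> * 0) (at_right 0)"
    by (intro tendsto_mult tendsto_const scale)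
  moreover have "\<forall>\<^sub>F t in at_right 0. \<bar>c\<bar> * L2_norm (\<lambda>x. flow f t x - f x) = L2_norm (\<lambda>x. flow (\<lambda>x. c * f x) t x - c * f x)"
    using eventually_at_right_less[of "0::real"]
  proof eventually_elim
    case (elim t)
    show ?case using elim L L2_norm_cmult[of c "\<lambda>x. flow f t x - f x"] by (simp add: flow_cmult algebra_simps)
  qed
  ultimately show ?case by (simp add: Lim_transform_eventually)
qed

text \<open>Strong continuity at time 0. It is explicit on finite cosine sums, and contractivity of
  the flow carries it over to the L2 closure, which is all of \<open>L2_space\<close>.\<close>

theorem flow_tendsto:
  assumes f: "f \<in> L2_space"
  shows "((\<lambda>t. L2_norm (\<lambda>x. flow f t x - f x)) \<longlongrightarrow> 0) (at_right 0)"
proof (rule tendstoI)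
  fix e :: real assume e: "0 < e"
  obtain q where q: "q \<in> cos_span \<theta>" "L2_norm (\<lambda>x. f x - q x) < e/3"
    using cos_span_dense[OF f \<theta>, of "e/3"] e by auto
  have qL: "q \<in> L2_space" by (rule cos_span_L2[OF q(1)])
  have dL: "(\<lambda>x. f x - q x) \<in> L2_space" by (intro L2_diff f qL)
  have "0 < e/3" using e by simp
  from order_tendstoD(2)[OF flow_tendsto_span[OF q(1)] this]
  have ev: "\<forall>\<^sub>F t in at_right 0. L2_norm (\<lambda>x. flow q t x - q x) < e/3" .
  show "\<forall>\<^sub>F t in at_right 0. dist (L2_norm (\<lambda>x. flow f t x - f x)) 0 < e"
    using ev eventually_at_right_less[of "0::real"]
  proof eventually_elim
    case (elim t)
    have c: "flow f t \<in> L2_space" "flow q t \<in> L2_space" "flow (\<lambda>x. f x - q x) t \<in> L2_space"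
      using elim by (auto intro!: continuous_L2 flow_continuous f qL dL)
    have "flow f t x = flow (\<lambda>x. f x - q x) t x + flow q t x" for x
      using flow_add[OF dL qL elim(2), of x] by simp
    then have "L2_norm (\<lambda>x. flow f t x - f x) = L2_norm (\<lambda>x. flow (\<lambda>x. f x - q x) t x + ((flow q t x - q x) - (f x - q x)))"
      by (simp add: algebra_simps)
    also have "\<dots> \<le> L2_norm (flow (\<lambda>x. f x - q x) t) + L2_norm (\<lambda>x. (flow q t x - q x) - (f x - q x))"
      by (intro L2_norm_triangle L2_diff c f qL)
    also have "L2_norm (\<lambda>x. (flow q t x - q x) - (f x - q x)) \<le> L2_norm (\<lambda>x. flow q t x - q x) + L2_norm (\<lambda>x. f x - q x)"
      by (intro L2_norm_triangle_diff L2_diff c f qL)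
    finally show ?case
      using flow_contraction'[OF dL elim(2)] q(2) elim(1) by simp
  qed
qed

text \<open>The damped heat flow of \<open>w0\<close>, given through the cosine coefficients of its derivative \<open>g\<close>.\<close>

theorem heat_solution:
  assumes w0: "continuous_on {0..1} w0" and wg: "weak_deriv w0 g" and z0: "w0 0 = 0" and z1: "\<theta> = 0 \<Longrightarrow> w0 1 = 0"
    and T: "0 < T"
  obtains w wx wxx E where
    "continuous_on ({0..} \<times> {0..1}) (\<lambda>z. w (fst z) (snd z))"
    "continuous_on ({0<..} \<times> {0..1}) (\<lambda>z. wx (fst z) (snd z))"
    "continuous_on ({0<..} \<times> {0..1}) (\<lambda>z. wxx (fst z) (snd z))"
    "\<And>t x. 0 < t \<Longrightarrow> x \<in> {0..1} \<Longrightarrow> (w t has_real_derivative wx t x) (at x within {0..1})"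
    "\<And>t x. 0 < t \<Longrightarrow> x \<in> {0..1} \<Longrightarrow> (wx t has_real_derivative wxx t x) (at x within {0..1})"
    "\<And>t x. 0 < t \<Longrightarrow> x \<in> {0..1} \<Longrightarrow> ((\<lambda>t. w t x) has_real_derivative wxx t x - lam * w t x) (at t)"
    "\<And>x. x \<in> {0..1} \<Longrightarrow> w 0 x = w0 x"
    "\<And>t. 0 \<le> t \<Longrightarrow> w t 0 = 0" "\<And>t. \<theta> = 0 \<Longrightarrow> 0 \<le> t \<Longrightarrow> w t 1 = 0" "\<And>t. \<theta> = 1/2 \<Longrightarrow> 0 < t \<Longrightarrow> wx t 1 = 0"
    "\<And>t. 0 < t \<Longrightarrow> L2_norm (wx t) \<le> exp (- lam * t) * L2_norm g"
    "((\<lambda>t. L2_norm (\<lambda>x. wx t x - g x)) \<longlongrightarrow> 0) (at_right 0)"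
    "integrable (leb 0 T) E" "\<And>t. 0 < t \<Longrightarrow> (L2_norm (wxx t))\<^sup>2 \<le> E t"
proof -
  have g: "g \<in> L2_space" by (rule weak_deriv_L2(2)[OF wg])
  \<comment> \<open>No boundary terms remain: at 0 because \<open>w0\<close> vanishes, at 1 because
    either \<open>w0\<close> or the cosine does.\<close>
  have gC: "ip g (Cs n) = nu n * ip w0 (Sn n)" for n
  proof -
    have "ip g (Cs n) = w0 1 * Cs n 1 - w0 0 * Cs n 0 - ip w0 (\<lambda>x. - nu n * Sn n x)"
      by (rule weak_deriv_by_parts[OF wg w0 Cs_deriv]) (auto intro!: continuous_intros Sn_continuous)
    also have "ip w0 (\<lambda>x. - nu n * Sn n x) = - nu n * ip w0 (Sn n)" by (rule ip_cmult_right)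
    also have "w0 1 * Cs n 1 = 0" using \<theta> z1 Cs_one[of n] by auto
    finally show ?thesis using z0 by simp
  qed
  define d where "d = coef g"
  \<comment> \<open>At frequency 0 this is 0, as division by zero yields 0. That is consistent,
    since then \<open>d n = 0\<close> and \<open>Sn n\<close> is the zero function.\<close>
  define c where "c n = d n / nu n" for n
  have d0: "nu n = 0 \<Longrightarrow> d n = 0" for n by (simp add: d_def coef_def gC)
  have cd: "nu n * c n = d n" for n using d0 by (simp add: c_def)
  have c_ip: "c n * ip (Sn n) (Sn n) = ip w0 (Sn n)" for n
  proof (cases "nu n = 0")
    case True
    then have "Sn n = (\<lambda>x. 0)" by (auto simp: Sn_def)
    then show ?thesis by (simp add: ip_def)
  qed (simp add: c_def d_def coef_def gC ip_Cs_Cs ip_Sn_Sn)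
  \<comment> \<open>The 2 compensates for the squared norm 1/2 of the cosines.\<close>
  define D where "D = 2 * L2_norm g"
  have D0: "0 \<le> D" by (simp add: D_def)
  have dB: "\<bar>d n\<bar> \<le> D" for n
  proof -
    have "L2_norm (Cs n) \<le> 1" by (rule L2_norm_bound[OF Cs_L2]) (rule Cs_abs)
    then have "\<bar>ip g (Cs n)\<bar> \<le> L2_norm g * 1"
      using ip_Cauchy_Schwarz[OF g Cs_L2, of n] mult_left_mono[of "L2_norm (Cs n)" 1 "L2_norm g"] by simp
    then show ?thesis by (auto simp: d_def coef_def ip_Cs_Cs D_def)
  qed
  have cB: "\<bar>c n\<bar> \<le> D" for n
  proof (cases "nu n = 0")
    case False
    then have "\<bar>d n\<bar> / nu n \<le> D / 1"
      using nu_pos_ge_1[OF False] dB[of n] D0 by (intro frac_le) auto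
    then show ?thesis using nu_nonneg[of n] by (simp add: c_def)
  qed (simp add: c_def D0)
  have one: "1 \<le> (real (Suc n))\<^sup>2" "real (Suc n) \<le> (real (Suc n))\<^sup>2" for n
    by (auto intro!: one_le_power self_le_power)
  have pc: "\<bar>c n\<bar> \<le> D * (real (Suc n))\<^sup>2" for n
    using cB[of n] mult_left_mono[OF one(1)[of n] D0] by simp
  have pd: "\<bar>d n\<bar> \<le> D * (real (Suc n))\<^sup>2" for n
    using dB[of n] mult_left_mono[OF one(1)[of n] D0] by simp
  have nu2: "(nu n)\<^sup>2 \<le> 16 * (real (Suc n))\<^sup>2" for n
    using power_mono[OF nu_le[of n] nu_nonneg, of 2] by (simp add: power_mult_distrib del: of_nat_Suc)
  define b where "b n = - (nu n * d n)" for n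
  have pb: "\<bar>b n\<bar> \<le> (4 * D) * (real (Suc n))\<^sup>2" for n
  proof -
    have "\<bar>b n\<bar> = nu n * \<bar>d n\<bar>" using nu_nonneg[of n] by (simp add: b_def abs_mult)
    also have "\<dots> \<le> (4 * real (Suc n)) * D" by (intro mult_mono nu_le dB) auto
    also have "\<dots> = (4 * D) * real (Suc n)" by simp
    also have "\<dots> \<le> (4 * D) * (real (Suc n))\<^sup>2" using D0 by (intro mult_left_mono one(2)) auto
    finally show ?thesis .
  qed
  have bd: "b n = - ((nu n)\<^sup>2 * c n)" for n by (simp add: b_def cd[symmetric] power2_eq_square)
  have pg: "\<bar>gam n * c n\<bar> \<le> ((lam + 16) * D) * (real (Suc n))\<^sup>2" for n
  proof -
    have "\<bar>gam n * c n\<bar> = gam n * \<bar>c n\<bar>" using lam by (simp add: gam_def abs_mult)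
    also have "\<dots> \<le> ((lam + 16) * (real (Suc n))\<^sup>2) * D"
    proof (intro mult_mono cB)
      have "lam * 1 \<le> lam * (real (Suc n))\<^sup>2" using lam by (intro mult_left_mono one(1)) auto
      then show "gam n \<le> (lam + 16) * (real (Suc n))\<^sup>2"
        using nu2[of n] by (simp add: gam_def distrib_right del: of_nat_Suc)
    qed (use lam in auto)
    finally show ?thesis by (simp add: mult_ac)
  qed
    have bes: "(\<Sum>n<M. (d n)\<^sup>2) \<le> 2 * (L2_norm g)\<^sup>2" for M
    proof -
      have "(\<Sum>n<M. (d n)\<^sup>2) \<le> (\<Sum>n<M. 2 * ((d n)\<^sup>2 * ip (Cs n) (Cs n)))"
        by (intro sum_mono) (auto simp: ip_Cs_Cs)
      also have "\<dots> = 2 * (\<Sum>n<M. (d n)\<^sup>2 * ip (Cs n) (Cs n))" by (rule sum_distrib_left[symmetric])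
      also have "\<dots> \<le> 2 * (L2_norm g)\<^sup>2" using coef_Bessel[OF g] by (simp add: d_def)
      finally show ?thesis .
    qed
    have sd: "summable (\<lambda>n. (d n)\<^sup>2)"
      by (rule summableI_nonneg_bounded[OF _ bes]) simp
  define w where "w = ser c Sn"
  define wx where "wx = ser d Cs"
  define wxx where "wxx = ser b Sn"
  \<comment> \<open>At \<open>t = 0\<close> no exponential helps, so the coefficients themselves
    have to be summable. They are, because \<open>\<bar>d n\<bar> / nu n\<close> is at most the sum
    of the squares of \<open>d n\<close> and of \<open>1 / nu n\<close>, and \<open>nu n\<close> is
    at least \<open>n\<close>.\<close>
  have cunif: "uniform_limit ({0..} \<times> UNIV) (\<lambda>M z. \<Sum>n<M. c n * exp (- gam n * fst z) * Sn n (snd z)) (\<lambda>z. w (fst z) (snd z)) sequentially"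
    unfolding w_def ser_def
  proof (rule Weierstrass_m_test)
    have "summable (\<lambda>n. (d n)\<^sup>2 + inverse (real n ^ 2))"
      by (intro summable_add sd inverse_power_summable) simp
    then show "summable (\<lambda>n. \<bar>c n\<bar>)"
    proof (rule summable_comparison_test'[where N = 1])
      fix n :: nat assume n: "1 \<le> n"
      then have n1: "0 < real n" "real n \<le> nu n" using nu_ge by auto
      have "inverse (nu n) \<le> inverse (real n)" using n1 by (intro le_imp_inverse_le) auto
      then have "(inverse (nu n))\<^sup>2 \<le> (inverse (real n))\<^sup>2" using n1 by (intro power_mono) auto
      moreover have "0 \<le> (\<bar>d n\<bar> - inverse (nu n))\<^sup>2 + (\<bar>d n\<bar>\<^sup>2 + (inverse (nu n))\<^sup>2)" by simp
      then have "\<bar>d n\<bar> * inverse (nu n) \<le> (d n)\<^sup>2 + (inverse (nu n))\<^sup>2" by (simp add: power2_diff)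
      moreover have "norm \<bar>c n\<bar> = \<bar>d n\<bar> * inverse (nu n)"
        using n1 by (simp add: c_def abs_mult divide_inverse)
      ultimately show "norm \<bar>c n\<bar> \<le> (d n)\<^sup>2 + inverse (real n ^ 2)"
        unfolding power_inverse by linarith
    qed
    show "norm (c n * exp (- gam n * fst z) * Sn n (snd z)) \<le> \<bar>c n\<bar>" if "z \<in> {0..} \<times> UNIV" for n z
    proof -
      have "gam n * fst z \<ge> 0" using that gam_ge(3)[of n] by (intro mult_nonneg_nonneg) auto
      then have "\<bar>c n\<bar> * exp (- gam n * fst z) * \<bar>Sn n (snd z)\<bar> \<le> \<bar>c n\<bar> * 1 * 1"
        by (intro mult_mono Sn_abs) auto
      then show ?thesis by (simp add: abs_mult)
    qed
  qed
  show thesis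
  proof (rule that)
    have "continuous_on ({0..} \<times> UNIV) (\<lambda>z. w (fst z) (snd z))"
      by (rule uniform_limit_theorem[OF _ cunif])
         (auto intro!: always_eventually continuous_intros continuous_on_compose2[OF Sn_continuous[of UNIV]])
    then show wc: "continuous_on ({0..} \<times> {0..1}) (\<lambda>z. w (fst z) (snd z))"
      by (rule continuous_on_subset) auto
    have "continuous_on ({0<..} \<times> UNIV) (\<lambda>z. wx (fst z) (snd z))"
      unfolding wx_def by (rule ser_continuous[OF pd Cs_abs Cs_continuous])
    then show "continuous_on ({0<..} \<times> {0..1}) (\<lambda>z. wx (fst z) (snd z))"
      by (rule continuous_on_subset) auto
    have "continuous_on ({0<..} \<times> UNIV) (\<lambda>z. wxx (fst z) (snd z))"
      unfolding wxx_def by (rule ser_continuous[OF pb Sn_abs Sn_continuous])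
    then show "continuous_on ({0<..} \<times> {0..1}) (\<lambda>z. wxx (fst z) (snd z))"
      by (rule continuous_on_subset) auto
    show "(w t has_real_derivative wx t x) (at x within {0..1})" if "0 < t" for t x
      unfolding w_def wx_def
    proof (rule ser_deriv_x[OF pc Sn_abs pd Cs_abs _ that])
      show "((\<lambda>x. c n * Sn n x) has_real_derivative d n * Cs n x) (at x)" for n x
        using DERIV_cmult[OF Sn_deriv[of n x UNIV], of "c n"] by (simp add: cd[symmetric] mult_ac)
    qed
    show "(wx t has_real_derivative wxx t x) (at x within {0..1})" if "0 < t" for t x
      unfolding wx_def wxx_def
    proof (rule ser_deriv_x[OF pd Cs_abs pb Sn_abs _ that])
      show "((\<lambda>x. d n * Cs n x) has_real_derivative b n * Sn n x) (at x)" for n x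
        using DERIV_cmult[OF Cs_deriv[of n x UNIV], of "d n"] by (simp add: b_def mult_ac)
    qed
    show "((\<lambda>t. w t x) has_real_derivative wxx t x - lam * w t x) (at t)" if t: "0 < t" for t x
    proof -
      have s1: "summable (\<lambda>n. b n * exp (- gam n * t) * Sn n x)" by (rule ser_summable[OF pb Sn_abs t])
      have s2: "summable (\<lambda>n. c n * exp (- gam n * t) * Sn n x)" by (rule ser_summable[OF pc Sn_abs t])
      have "- (gam n * c n) * exp (- gam n * t) * Sn n x = b n * exp (- gam n * t) * Sn n x - lam * (c n * exp (- gam n * t) * Sn n x)" for n
        by (simp add: bd gam_def algebra_simps)
      then have "ser (\<lambda>n. - (gam n * c n)) Sn t x = (\<Sum>n. b n * exp (- gam n * t) * Sn n x - lam * (c n * exp (- gam n * t) * Sn n x))"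
        by (simp only: ser_def)
      also have "\<dots> = (\<Sum>n. b n * exp (- gam n * t) * Sn n x) - (\<Sum>n. lam * (c n * exp (- gam n * t) * Sn n x))"
        by (rule suminf_diff[symmetric, OF s1 summable_mult[OF s2]])
      also have "(\<Sum>n. lam * (c n * exp (- gam n * t) * Sn n x)) = lam * w t x"
        by (simp only: suminf_mult[OF s2] w_def ser_def)
      finally have "ser (\<lambda>n. - (gam n * c n)) Sn t x = wxx t x - lam * w t x" by (simp only: wxx_def ser_def)
      then show ?thesis
        using ser_deriv_t[where T = Sn and x = x, OF pc Sn_abs pg t] by (simp add: w_def)
    qed
    \<comment> \<open>Both sides are continuous with the same sine coefficients, so completeness of
      the sines applies.\<close>
    show "w 0 x = w0 x" if x: "x \<in> {0..1}" for x
    proof -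
      have w0c: "continuous_on {0..1} (w 0)"
        by (rule continuous_on_section[OF wc]) auto
      have ul: "uniform_limit {0..1} (\<lambda>M x. \<Sum>n<M. c n * Sn n x) (w 0) sequentially"
        unfolding uniform_limit_iff
      proof safe
        fix e :: real assume "0 < e"
        from uniform_limitD[OF cunif this]
        show "\<forall>\<^sub>F M in sequentially. \<forall>x\<in>{0..1}. dist (\<Sum>n<M. c n * Sn n x) (w 0 x) < e"
        proof eventually_elim
          case (elim M)
          show ?case using bspec[OF elim, of "(0, _)"] by simp
        qed
      qed
      have "ip (\<lambda>x. w 0 x - w0 x) (Sn m) = 0" for m
      proof -
        have L: "(\<lambda>x. c n * Sn n x) \<in> L2_space" for n by (intro L2_cmult Sn_L2)
        have "(\<lambda>M. ip (\<lambda>x. \<Sum>n<M. c n * Sn n x) (Sn m)) \<longlonglongrightarrow> ip (w 0) (Sn m)"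
          by (rule ip_uniform_limit[OF ul _ Sn_L2]) (intro continuous_intros Sn_continuous)
        moreover have "\<forall>\<^sub>F M in sequentially. ip (\<lambda>x. \<Sum>n<M. c n * Sn n x) (Sn m) = ip w0 (Sn m)"
          using eventually_gt_at_top[of m]
        proof eventually_elim
          case (elim M)
          have "ip (\<lambda>x. \<Sum>n<M. c n * Sn n x) (Sn m) = (\<Sum>n<M. c n * ip (Sn n) (Sn m))"
            by (simp add: ip_sum_left Sn_L2 L)
          also have "\<dots> = (\<Sum>n<M. if n = m then c m * ip (Sn m) (Sn m) else 0)"
            by (rule sum.cong) (auto simp: Sn_orth)
          also have "\<dots> = ip w0 (Sn m)" using elim by (simp add: c_ip)
          finally show ?case .
        qed
        ultimately have "ip (w 0) (Sn m) = ip w0 (Sn m)"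
          using LIMSEQ_unique[OF _ tendsto_eventually] by blast
        then show ?thesis
          by (simp add: ip_diff_left continuous_L2 w0c w0 Sn_L2)
      qed
      then have "w 0 x - w0 x = 0"
        by (intro Sn_complete[of "\<lambda>x. w 0 x - w0 x"] continuous_intros w0c w0 x)
      then show ?thesis by simp
    qed
    show "w t 0 = 0" for t by (simp add: w_def ser_def Sn_def)
    show "w t 1 = 0" if "\<theta> = 0" for t by (simp add: w_def ser_def Sn_one[OF that])
    show "wx t 1 = 0" if "\<theta> = 1/2" for t by (simp add: wx_def ser_def Cs_one[OF that])
    show "L2_norm (wx t) \<le> exp (- lam * t) * L2_norm g" if "0 < t" for t
      using flow_contraction[OF g that] by (simp add: wx_def d_def flow_def)
    show "((\<lambda>t. L2_norm (\<lambda>x. wx t x - g x)) \<longlongrightarrow> 0) (at_right 0)"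
      using flow_tendsto[OF g] by (simp add: wx_def d_def flow_def)
    \<comment> \<open>The sum over \<open>n\<close> dominates the squared L2 norm of w_xx at time
      \<open>t\<close>. It may blow up as t tends to 0, but integrating the exponential over time
      gains \<open>1 / (2 * gam n)\<close>, which absorbs the square of \<open>nu n\<close>; the
      time integral is bounded by the sum of the squares of the \<open>d n\<close>.\<close>
    define f where "f n t = (b n)\<^sup>2 * exp (- 2 * gam n * t)" for n t
    have gp: "0 < gam n" for n using lam gam_ge(1)[of n] by linarith
    have f0: "0 \<le> f n t" for n t by (simp add: f_def)
    have fs: "summable (\<lambda>n. f n t)" if t: "0 < t" for t
    proof (rule summable_comparison_test'[OF summable_divide[OF sd, of "2 * t"]])
      fix n
      \<comment> \<open>At a fixed positive time the square of \<open>nu n\<close> is absorbed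
        through s exp(-s) \<le> 1.\<close>
      define s where "s = 2 * t * (nu n)\<^sup>2"
      have "1 + s \<le> exp s" by (rule exp_ge_add_one_self)
      then have "s \<le> exp s" by linarith
      then have "s * exp (- s) \<le> 1" by (simp add: exp_minus field_simps)
      moreover have "exp (- 2 * gam n * t) \<le> exp (- s)"
        using gam_ge(2)[of n] t by (simp add: s_def mult.commute)
      then have "s * exp (- 2 * gam n * t) \<le> s * exp (- s)"
        using t by (intro mult_left_mono) (auto simp: s_def)
      ultimately have "s * exp (- 2 * gam n * t) \<le> 1" by linarith
      then have "(nu n)\<^sup>2 * exp (- 2 * gam n * t) \<le> 1 / (2 * t)"
        using t by (simp add: s_def field_simps)
      then have "(d n)\<^sup>2 * ((nu n)\<^sup>2 * exp (- 2 * gam n * t)) \<le> (d n)\<^sup>2 * (1 / (2 * t))"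
        by (rule mult_left_mono) simp
      then show "norm (f n t) \<le> (d n)\<^sup>2 / (2 * t)"
        by (simp add: f_def b_def power_mult_distrib mult_ac)
    qed
    have fi: "integrable (leb 0 T) (f n)" for n
      unfolding f_def[abs_def] by (intro continuous_leb_integrable continuous_intros)
    have fI: "(\<integral>t. f n t \<partial>leb 0 T) \<le> (d n)\<^sup>2" for n
    proof -
      have "((\<lambda>t. f n t) has_integral (- (b n)\<^sup>2 / (2 * gam n) * exp (- 2 * gam n * T) - (- (b n)\<^sup>2 / (2 * gam n) * exp (- 2 * gam n * 0)))) {0..T}"
        using T gp[of n] unfolding f_def
        by (intro fundamental_theorem_of_calculus)
           (auto simp: has_real_derivative_iff_has_vector_derivative[symmetric] intro!: derivative_eq_intros)
      then have "integral {0..T} (f n) = (b n)\<^sup>2 / (2 * gam n) - (b n)\<^sup>2 / (2 * gam n) * exp (- 2 * gam n * T)"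
        by (simp add: integral_unique)
      also have "\<dots> \<le> (b n)\<^sup>2 / (2 * gam n)"
        using gp[of n] by simp
      also have "\<dots> = (d n)\<^sup>2 * ((nu n)\<^sup>2 / (2 * gam n))" by (simp add: b_def power_mult_distrib)
      also have "\<dots> \<le> (d n)\<^sup>2 * 1"
        using gam_ge(2)[of n] gp[of n] by (intro mult_left_mono) (auto simp: field_simps)
      finally have "integral {0..T} (f n) \<le> (d n)\<^sup>2" by simp
      moreover have "(\<integral>t. f n t \<partial>leb 0 T) = integral {0..T} (f n)"
        unfolding f_def[abs_def] by (intro continuous_leb_integral continuous_intros)
      ultimately show ?thesis by simp
    qed
    show "integrable (leb 0 T) (\<lambda>t. \<Sum>n. f n t)"
    proof (rule integrable_suminf[OF fi])
      show "AE t in leb 0 T. summable (\<lambda>n. norm (f n t))"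
        using fs f0 by (intro AE_I2) simp
      show "summable (\<lambda>n. \<integral>t. norm (f n t) \<partial>leb 0 T)"
        by (rule summable_comparison_test'[OF sd]) (use fI f0 in \<open>simp\<close>)
    qed
    show "(L2_norm (wxx t))\<^sup>2 \<le> (\<Sum>n. f n t)" if t: "0 < t" for t
    proof -
      have E0: "0 \<le> (\<Sum>n. f n t)" by (rule suminf_nonneg[OF fs[OF t] f0])
      have "L2_norm (wxx t) \<le> sqrt (\<Sum>n. f n t)"
        unfolding wxx_def
      proof (rule L2_norm_ser_le[OF pb Sn_abs Sn_continuous Sn_orth t])
        fix M
        have "(\<Sum>n<M. (b n * exp (- gam n * t))\<^sup>2 * ip (Sn n) (Sn n)) \<le> (\<Sum>n<M. f n t)"
        proof (rule sum_mono)
          fix n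
          have "(b n * exp (- gam n * t))\<^sup>2 = f n t"
            by (simp add: f_def power_mult_distrib exp_double[symmetric] mult_ac)
          then show "(b n * exp (- gam n * t))\<^sup>2 * ip (Sn n) (Sn n) \<le> f n t"
            using f0[of n t] by (auto simp: ip_Sn_Sn)
        qed
        also have "\<dots> \<le> (\<Sum>n. f n t)" by (rule sum_le_suminf[OF fs[OF t]]) (auto simp: f0)
        finally show "(\<Sum>n<M. (b n * exp (- gam n * t))\<^sup>2 * ip (Sn n) (Sn n)) \<le> (sqrt (\<Sum>n. f n t))\<^sup>2"
          using E0 by simp
      qed (use E0 in auto)
      then have "(L2_norm (wxx t))\<^sup>2 \<le> (sqrt (\<Sum>n. f n t))\<^sup>2" by (intro power_mono) auto
      then show ?thesis using E0 by simp
    qed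
  qed
qed

end

section \<open>Existence and decay\<close>

lemma compact_abs_bound_ex:
  assumes "compact S" "continuous_on S (f :: 'a::topological_space \<Rightarrow> real)"
  shows "\<exists>b\<ge>0. \<forall>z\<in>S. \<bar>f z\<bar> \<le> b"
  by (rule compact_abs_bound[OF assms]) blast

text \<open>The mean value theorem writes the quotient as \<open>f'\<close> at an intermediate time,
  and uniform continuity of \<open>f'\<close> on the compact product makes the error small for all
  \<open>x\<close> at once.\<close>

lemma difference_quotient_uniform:
  fixes f f' :: "real \<Rightarrow> 'a::metric_space \<Rightarrow> real"
  assumes X: "compact X" and f': "continuous_on ({c..d} \<times> X) (\<lambda>w. f' (fst w) (snd w))"
    and d: "\<And>s x. s \<in> {c..d} \<Longrightarrow> x \<in> X \<Longrightarrow> ((\<lambda>s. f s x) has_real_derivative f' s x) (at s within {c..d})"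
    and t: "t \<in> {c..d}" and e: "0 < e"
  shows "\<exists>\<delta>>0. \<forall>s\<in>{c..d}. \<bar>s - t\<bar> < \<delta> \<longrightarrow> s \<noteq> t \<longrightarrow> (\<forall>x\<in>X. \<bar>(f s x - f t x) / (s - t) - f' t x\<bar> < e)"
proof -
  have uc: "uniformly_continuous_on ({c..d} \<times> X) (\<lambda>w. f' (fst w) (snd w))"
    by (intro compact_uniformly_continuous f' compact_Times X) auto
  then obtain \<delta> where \<delta>: "\<delta> > 0" "\<And>w w'. w \<in> {c..d} \<times> X \<Longrightarrow> w' \<in> {c..d} \<times> X \<Longrightarrow> dist w' w < \<delta> \<Longrightarrow> dist (f' (fst w') (snd w')) (f' (fst w) (snd w)) < e"
    using uc[unfolded uniformly_continuous_on_def, THEN spec, THEN mp, OF e] by blast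
  have "\<bar>(f s x - f t x) / (s - t) - f' t x\<bar> < e" if s: "s \<in> {c..d}" "\<bar>s - t\<bar> < \<delta>" "s \<noteq> t" and x: "x \<in> X" for s x
  proof -
    define lo hi where "lo = min s t" and "hi = max s t"
    have lh: "lo < hi" "{lo..hi} \<subseteq> {c..d}" using s t by (auto simp: lo_def hi_def)
    have dl: "((\<lambda>s. f s x) has_real_derivative f' \<xi> x) (at \<xi> within {lo..hi})" if "\<xi> \<in> {lo..hi}" for \<xi>
      using d[of \<xi> x] lh(2) x that by (auto intro: DERIV_subset)
    obtain \<xi> where "lo < \<xi>" "\<xi> < hi" "f hi x - f lo x = f' \<xi> x * (hi - lo)"
    proof (rule mvt[OF lh(1), of "\<lambda>s. f s x" "\<lambda>\<xi>. (*) (f' \<xi> x)"])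
      show "continuous_on {lo..hi} (\<lambda>s. f s x)" by (rule DERIV_continuous_on[OF dl])
      fix \<xi> assume "lo < \<xi>" "\<xi> < hi"
      then show "((\<lambda>s. f s x) has_derivative (*) (f' \<xi> x)) (at \<xi>)"
        using dl[of \<xi>] by (simp add: at_within_Icc_at has_field_derivative_def)
    qed
    then have \<xi>: "lo < \<xi>" "\<xi> < hi" "f hi x - f lo x = (hi - lo) * f' \<xi> x" by (simp_all add: mult.commute)
    have "f s x - f t x = (s - t) * f' \<xi> x"
      using \<xi>(3) by (cases "s < t") (auto simp: lo_def hi_def algebra_simps)
    then have q: "(f s x - f t x) / (s - t) = f' \<xi> x" using s(3) by simp
    have "dist \<xi> t < \<delta>" using \<xi>(1,2) s(2) by (auto simp: lo_def hi_def dist_real_def)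
    then have "dist (\<xi>, x) (t, x) < \<delta>" by (simp add: dist_Pair_Pair)
    moreover have "\<xi> \<in> {c..d}" using \<xi> lh(2) by force
    ultimately have "dist (f' \<xi> x) (f' t x) < e"
      using \<delta>(2)[of "(t, x)" "(\<xi>, x)"] t x by simp
    then show ?thesis by (simp add: q dist_real_def)
  qed
  then show ?thesis using \<delta>(1) by blast
qed

lemma continuous_on_uniform_in_time:
  fixes f :: "real \<Rightarrow> 'a::metric_space \<Rightarrow> real"
  assumes X: "compact X" and f: "continuous_on ({c..d} \<times> X) (\<lambda>w. f (fst w) (snd w))"
    and t: "t \<in> {c..d}" and e: "0 < e"
  shows "\<exists>\<delta>>0. \<forall>s\<in>{c..d}. \<bar>s - t\<bar> < \<delta> \<longrightarrow> (\<forall>x\<in>X. \<bar>f s x - f t x\<bar> < e)"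
proof -
  have uc: "uniformly_continuous_on ({c..d} \<times> X) (\<lambda>w. f (fst w) (snd w))"
    by (intro compact_uniformly_continuous f compact_Times X) auto
  then obtain \<delta> where \<delta>: "\<delta> > 0" "\<And>w w'. w \<in> {c..d} \<times> X \<Longrightarrow> w' \<in> {c..d} \<times> X \<Longrightarrow> dist w' w < \<delta> \<Longrightarrow> dist (f (fst w') (snd w')) (f (fst w) (snd w)) < e"
    using uc[unfolded uniformly_continuous_on_def, THEN spec, THEN mp, OF e] by blast
  have "\<bar>f s x - f t x\<bar> < e" if "s \<in> {c..d}" "\<bar>s - t\<bar> < \<delta>" "x \<in> X" for s x
    using \<delta>(2)[of "(t, x)" "(s, x)"] that t by (simp add: dist_Pair_Pair dist_real_def)
  then show ?thesis using \<delta>(1) by blast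
qed

lemma lower_integral_abs_le:
  fixes p f :: "real \<Rightarrow> real"
  assumes "continuous_on {0..x} p" "continuous_on {0..x} f" "0 \<le> x" "x \<le> 1" "0 \<le> B" "0 \<le> m"
    and "\<And>y. y \<in> {0..x} \<Longrightarrow> \<bar>p y\<bar> \<le> B" "\<And>y. y \<in> {0..x} \<Longrightarrow> \<bar>f y\<bar> \<le> m"
  shows "\<bar>integral {0..x} (\<lambda>y. p y * f y)\<bar> \<le> B * m"
proof -
  have "norm (integral {0..x} (\<lambda>y. p y * f y)) \<le> (B * m) * (x - 0)"
    by (rule integral_bound) (use assms in \<open>auto intro!: continuous_intros mult_mono simp: abs_mult\<close>)
  also have "\<dots> \<le> (B * m) * 1" using assms by (intro mult_left_mono) auto
  finally show ?thesis by simp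
qed

text \<open>The bridge from L2 decay of w_x to pointwise decay of w: since w vanishes at 0, it is
  the integral of its derivative, and Cauchy-Schwarz on the unit interval costs nothing.\<close>

lemma abs_le_L2_norm_deriv:
  assumes f: "\<And>x. x \<in> {0..1} \<Longrightarrow> (f has_real_derivative f' x) (at x within {0..1})"
    and c: "continuous_on {0..1} f'" and "f 0 = 0" and x: "x \<in> {0..1}"
  shows "\<bar>f x\<bar> \<le> L2_norm f'"
proof -
  have ca: "continuous_on {0..1} (\<lambda>y. \<bar>f' y\<bar>)" by (intro continuous_intros c)
  have "(f' has_integral f x - f 0) {0..x}"
    using x by (intro fundamental_theorem_of_calculus)
      (auto simp: has_real_derivative_iff_has_vector_derivative[symmetric] intro!: DERIV_subset[OF f])
  then have "f x = integral {0..x} f'" using assms(3) by (simp add: integral_unique)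
  moreover have "norm (integral {0..x} f') \<le> integral {0..x} (\<lambda>y. \<bar>f' y\<bar>)"
    by (rule integral_norm_bound_integral)
       (use x in \<open>auto intro!: integrable_continuous_interval continuous_on_subset[OF c] continuous_on_subset[OF ca]\<close>)
  ultimately have "\<bar>f x\<bar> \<le> integral {0..x} (\<lambda>y. \<bar>f' y\<bar>)" by simp
  also have "\<dots> \<le> integral {0..1} (\<lambda>y. \<bar>f' y\<bar>)"
    using x by (intro integral_subset_le integrable_continuous_interval continuous_on_subset[OF ca]) auto
  also have "\<dots> = ip (\<lambda>y. 1) (\<lambda>y. \<bar>f' y\<bar>)"
    using continuous_leb_integral[OF ca] by (simp add: ip_def)
  also have "\<dots> \<le> L2_norm (\<lambda>_. 1) * L2_norm (\<lambda>y. \<bar>f' y\<bar>)"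
    using ip_Cauchy_Schwarz[of "\<lambda>_. 1" "\<lambda>y. \<bar>f' y\<bar>"] by (simp add: continuous_L2 ca)
  also have "\<dots> = L2_norm f'" by (simp add: L2_norm_const) (simp add: L2_norm_def)
  finally show ?thesis .
qed

context backstepping_kernel
begin

definition low :: "(real \<Rightarrow> real \<times> real \<Rightarrow> real) \<Rightarrow> real \<Rightarrow> (real \<Rightarrow> real) \<Rightarrow> real \<Rightarrow> real" where
  "low p t f x = integral {0..x} (\<lambda>y. p t (x, y) * f y)"

text \<open>With initial data in H^1 the derivatives are continuous for positive times only. What
  survives at t = 0 is recorded in the last two clauses: convergence of \<open>ux\<close> to
  \<open>u0'\<close> in L2, and an integrable bound for the squared norm of \<open>uxx\<close>. The
  value of \<open>\<theta>\<close> selects the feedback law.\<close>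

definition classical_solution ::
  "real \<Rightarrow> (real \<Rightarrow> real) \<Rightarrow> (real \<Rightarrow> real) \<Rightarrow> (real \<Rightarrow> real \<Rightarrow> real) \<Rightarrow> (real \<Rightarrow> real \<Rightarrow> real) \<Rightarrow> (real \<Rightarrow> real \<Rightarrow> real) \<Rightarrow> bool" where
  "classical_solution \<theta> u0 u0' u ux uxx \<longleftrightarrow>
     continuous_on ({0..t0} \<times> {0..1}) (\<lambda>w. u (fst w) (snd w)) \<and>
     continuous_on ({0<..t0} \<times> {0..1}) (\<lambda>w. ux (fst w) (snd w)) \<and>
     continuous_on ({0<..t0} \<times> {0..1}) (\<lambda>w. uxx (fst w) (snd w)) \<and>
     (\<forall>t\<in>{0<..t0}. \<forall>x\<in>{0..1}. (u t has_real_derivative ux t x) (at x within {0..1}) \<and>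
        (ux t has_real_derivative uxx t x) (at x within {0..1})) \<and>
     (\<forall>t\<in>{0<..<t0}. \<forall>x\<in>{0..1}. ((\<lambda>t. u t x) has_real_derivative uxx t x + a x t * u t x) (at t)) \<and>
     (\<forall>x\<in>{0..1}. u 0 x = u0 x) \<and> (\<forall>t\<in>{0..t0}. u t 0 = 0) \<and>
     (\<theta> = 0 \<longrightarrow> (\<forall>t\<in>{0..t0}. u t 1 = - low K t (u t) 1)) \<and>
     (\<theta> = 1/2 \<longrightarrow> (\<forall>t\<in>{0<..t0}. ux t 1 = - K t (1, 1) * u t 1 - low Kx t (u t) 1)) \<and>
     ((\<lambda>t. L2_norm (\<lambda>x. ux t x - u0' x)) \<longlongrightarrow> 0) (at_right 0) \<and>
     (\<exists>E. integrable (leb 0 t0) E \<and> (\<forall>t\<in>{0<..t0}. (L2_norm (uxx t))\<^sup>2 \<le> E t))"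

lemma kernel_bound:
  "\<exists>B>0. \<forall>t\<in>{0..t0}. \<forall>z\<in>\<Omega>. \<bar>K t z\<bar> \<le> B \<and> \<bar>Kx t z\<bar> \<le> B \<and> \<bar>Ky t z\<bar> \<le> B \<and> \<bar>Kxx t z\<bar> \<le> B \<and> \<bar>Kt t z\<bar> \<le> B"
proof -
  have c: "compact ({0..t0} \<times> \<Omega>)" by (intro compact_Times compact_Omega) auto
  obtain b1 where b1: "0 \<le> b1" "\<forall>w\<in>{0..t0} \<times> \<Omega>. \<bar>K (fst w) (snd w)\<bar> \<le> b1" using compact_abs_bound_ex[OF c K_cont] by blast
  obtain b2 where b2: "0 \<le> b2" "\<forall>w\<in>{0..t0} \<times> \<Omega>. \<bar>Kx (fst w) (snd w)\<bar> \<le> b2" using compact_abs_bound_ex[OF c Kx_cont] by blast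
  obtain b3 where b3: "0 \<le> b3" "\<forall>w\<in>{0..t0} \<times> \<Omega>. \<bar>Ky (fst w) (snd w)\<bar> \<le> b3" using compact_abs_bound_ex[OF c Ky_cont] by blast
  obtain b4 where b4: "0 \<le> b4" "\<forall>w\<in>{0..t0} \<times> \<Omega>. \<bar>Kxx (fst w) (snd w)\<bar> \<le> b4" using compact_abs_bound_ex[OF c Kxx_cont] by blast
  obtain b5 where b5: "0 \<le> b5" "\<forall>w\<in>{0..t0} \<times> \<Omega>. \<bar>Kt (fst w) (snd w)\<bar> \<le> b5" using compact_abs_bound_ex[OF c Kt_cont] by blast
  show ?thesis
  proof (rule exI[of _ "1 + b1 + b2 + b3 + b4 + b5"], rule conjI[rotated], intro ballI)
    fix t z assume "t \<in> {0..t0}" "z \<in> \<Omega>"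
    then have "(t, z) \<in> {0..t0} \<times> \<Omega>" by simp
    from bspec[OF b1(2) this] bspec[OF b2(2) this] bspec[OF b3(2) this] bspec[OF b4(2) this] bspec[OF b5(2) this]
    have h: "\<bar>K t z\<bar> \<le> b1" "\<bar>Kx t z\<bar> \<le> b2" "\<bar>Ky t z\<bar> \<le> b3" "\<bar>Kxx t z\<bar> \<le> b4" "\<bar>Kt t z\<bar> \<le> b5" by simp_all
    show "\<bar>K t z\<bar> \<le> 1 + b1 + b2 + b3 + b4 + b5 \<and> \<bar>Kx t z\<bar> \<le> 1 + b1 + b2 + b3 + b4 + b5 \<and> \<bar>Ky t z\<bar> \<le> 1 + b1 + b2 + b3 + b4 + b5
      \<and> \<bar>Kxx t z\<bar> \<le> 1 + b1 + b2 + b3 + b4 + b5 \<and> \<bar>Kt t z\<bar> \<le> 1 + b1 + b2 + b3 + b4 + b5"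
      using b1(1) b2(1) b3(1) b4(1) b5(1)
      by (intro conjI order_trans[OF h(1)] order_trans[OF h(2)] order_trans[OF h(3)] order_trans[OF h(4)] order_trans[OF h(5)]) linarith+
  qed (use b1(1) b2(1) b3(1) b4(1) b5(1) in linarith)
qed

section \<open>Integral operators of the kernel\<close>

lemma kernel_at_time:
  assumes "t \<in> {0..t0}"
  shows "continuous_on \<Omega> (K t)" "continuous_on \<Omega> (Kx t)" "continuous_on \<Omega> (Ky t)" "continuous_on \<Omega> (Kxx t)" "continuous_on \<Omega> (Kt t)"
  by (rule continuous_on_section[OF K_cont assms order_refl] continuous_on_section[OF Kx_cont assms order_refl]
      continuous_on_section[OF Ky_cont assms order_refl] continuous_on_section[OF Kxx_cont assms order_refl]
      continuous_on_section[OF Kt_cont assms order_refl])+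

lemma a_at_time: "t \<in> {0..t0} \<Longrightarrow> continuous_on {0..1} (\<lambda>x. a x t)"
  using continuous_on_section[of "{0..t0}" "{0..1}" "\<lambda>t x. a x t" t "{0..1}"] a_cont by simp

lemma low_K_deriv:
  assumes t: "t \<in> {0..t0}" and f: "continuous_on {0..1} f" and x: "x \<in> {0..1}"
  shows "(low K t f has_real_derivative K t (x, x) * f x + low Kx t f x) (at x within {0..1})"
  unfolding low_def[abs_def]
  by (rule leibniz_lower[OF kernel_at_time(1,2)[OF t] f K_x[OF t] x])

lemma low_Kx_deriv:
  assumes t: "t \<in> {0..t0}" and f: "continuous_on {0..1} f" and x: "x \<in> {0..1}"
  shows "(low Kx t f has_real_derivative Kx t (x, x) * f x + low Kxx t f x) (at x within {0..1})"
  unfolding low_def[abs_def]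
  by (rule leibniz_lower[OF kernel_at_time(2,4)[OF t] f K_xx[OF t] x])

lemma low_joint_continuous:
  assumes p: "continuous_on ({0..t0} \<times> \<Omega>) (\<lambda>w. p (fst w) (snd w))" and S: "S \<subseteq> {0..t0}"
    and u: "continuous_on (S \<times> {0..1}) (\<lambda>w. u (fst w) (snd w))"
  shows "continuous_on (S \<times> {0..1}) (\<lambda>w. low p (fst w) (u (fst w)) (snd w))"
proof -
  have "continuous_on (S \<times> \<Omega>) (\<lambda>w. p (fst w) (snd w))"
    by (rule continuous_on_subset[OF p]) (use S in auto)
  then show ?thesis
    using continuous_on_lower_integral[of S p u] u by (simp add: low_def case_prod_beta')
qed

lemma diagonal_joint_continuous:
  assumes p: "continuous_on ({0..t0} \<times> \<Omega>) (\<lambda>w. p (fst w) (snd w))" and S: "S \<subseteq> {0..t0}"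
  shows "continuous_on (S \<times> {0..1}) (\<lambda>w. p (fst w) (snd w, snd w))"
proof -
  have "continuous_on (S \<times> {0..1}) (\<lambda>w. (\<lambda>w. p (fst w) (snd w)) (fst w, (snd w, snd w)))"
    by (rule continuous_on_compose2[OF p]) (use S in \<open>auto intro!: continuous_intros simp: Omega_iff\<close>)
  then show ?thesis by simp
qed

lemma low_continuous:
  assumes p: "continuous_on ({0..t0} \<times> \<Omega>) (\<lambda>w. p (fst w) (snd w))" and t: "t \<in> {0..t0}" and f: "continuous_on {0..1} f"
  shows "continuous_on {0..1} (low p t f)"
proof -
  have "continuous_on ({t} \<times> {0..1}) (\<lambda>w. (\<lambda>_. f) (fst w) (snd w))"
    by (auto intro!: continuous_on_compose2[OF f] continuous_intros)
  from low_joint_continuous[OF p _ this] t have "continuous_on ({t} \<times> {0..1}) (\<lambda>w. low p (fst w) f (snd w))" by simp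
  then show ?thesis by (rule continuous_on_section) auto
qed

text \<open>
  For a solution \<open>u\<close> of \<open>u + K u = w\<close> the operator \<open>I + K\<close> maps \<open>u\<^sub>x\<^sub>x + a u\<close> to \<open>w\<^sub>t - K\<^sub>t u\<close>: this is
  where the kernel equations are used.
\<close>

lemma backstepping_identity:
  assumes t: "t \<in> {0..t0}" and u: "\<And>x. x \<in> {0..1} \<Longrightarrow> (u has_real_derivative ux x) (at x within {0..1})"
    and ux: "\<And>x. x \<in> {0..1} \<Longrightarrow> (ux has_real_derivative uxx x) (at x within {0..1})"
    and uxx: "continuous_on {0..1} uxx"
    and uxx_eq: "\<And>x. x \<in> {0..1} \<Longrightarrow> uxx x = wxx x - ((Kx t (x, x) + Ky t (x, x)) * u x + K t (x, x) * ux x) - (Kx t (x, x) * u x + low Kxx t u x)"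
    and w: "\<And>x. x \<in> {0..1} \<Longrightarrow> u x + low K t u x = w x" and u0: "u 0 = 0" and x: "x \<in> {0..1}"
  shows "(uxx x + a x t * u x) + low K t (\<lambda>y. uxx y + a y t * u y) x = wxx x - lam * w x - low Kt t u x"
proof -
  have uc: "continuous_on {0..1} u" by (rule DERIV_continuous_on[OF u])
  have uxc: "continuous_on {0..1} ux" by (rule DERIV_continuous_on[OF ux])
  have sub: "continuous_on {0..x} f" if "continuous_on {0..1} f" for f :: "real \<Rightarrow> real"
    by (rule continuous_on_subset[OF that]) (use x in auto)
  note [continuous_intros] = sub[OF uc] sub[OF uxc] sub[OF uxx] sub[OF a_at_time[OF t]]
    continuous_on_Omega_section_lower[OF kernel_at_time(1)[OF t] x]
    continuous_on_Omega_section_lower[OF kernel_at_time(2)[OF t] x]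
    continuous_on_Omega_section_lower[OF kernel_at_time(3)[OF t] x]
    continuous_on_Omega_section_lower[OF kernel_at_time(4)[OF t] x]
    continuous_on_Omega_section_lower[OF kernel_at_time(5)[OF t] x]
    continuous_on_Omega_section_lower[OF Kyy_cont[OF t] x]
  have om: "(x, y) \<in> \<Omega>" if "y \<in> {0..x}" for y using that x by (auto simp: Omega_iff)
  \<comment> \<open>Both space derivatives are moved from \<open>u\<close> to the kernel. The terms
    at y = 0 vanish, here by \<open>K_zero\<close> and in \<open>ibp2\<close> by
    \<open>u 0 = 0\<close>.\<close>
  have ibp1: "integral {0..x} (\<lambda>y. K t (x, y) * uxx y) = K t (x, x) * ux x - K t (x, 0) * ux 0 - integral {0..x} (\<lambda>y. Ky t (x, y) * ux y)"
    by (rule integral_by_parts_real)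
       (use x om in \<open>auto intro!: K_y[OF t] DERIV_subset[OF ux] continuous_intros\<close>)
  have ibp2: "integral {0..x} (\<lambda>y. Ky t (x, y) * ux y) = Ky t (x, x) * u x - Ky t (x, 0) * u 0 - integral {0..x} (\<lambda>y. Kyy t (x, y) * u y)"
    by (rule integral_by_parts_real)
       (use x om in \<open>auto intro!: K_yy[OF t] DERIV_subset[OF u] continuous_intros\<close>)
  have "low K t (\<lambda>y. uxx y + a y t * u y) x = integral {0..x} (\<lambda>y. K t (x, y) * uxx y + K t (x, y) * (a y t * u y))"
    by (simp add: low_def distrib_left)
  also have "\<dots> = integral {0..x} (\<lambda>y. K t (x, y) * uxx y) + integral {0..x} (\<lambda>y. K t (x, y) * (a y t * u y))"
    by (intro Henstock_Kurzweil_Integration.integral_add integrable_continuous_interval continuous_intros)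
  finally have e1: "low K t (\<lambda>y. uxx y + a y t * u y) x = K t (x, x) * ux x - Ky t (x, x) * u x
      + (integral {0..x} (\<lambda>y. Kyy t (x, y) * u y) + integral {0..x} (\<lambda>y. K t (x, y) * (a y t * u y)))"
    using ibp1 ibp2 K_zero[OF t x] u0 by simp
  have "integral {0..x} (\<lambda>y. Kyy t (x, y) * u y) + integral {0..x} (\<lambda>y. K t (x, y) * (a y t * u y))
      = integral {0..x} (\<lambda>y. Kyy t (x, y) * u y + K t (x, y) * (a y t * u y))"
    by (intro Henstock_Kurzweil_Integration.integral_add[symmetric] integrable_continuous_interval continuous_intros)
  \<comment> \<open>The kernel equation replaces \<open>Kyy\<close> and removes the integral with
    \<open>a\<close>; the resulting \<open>Kxx\<close> term cancels against the one in
    \<open>uxx_eq\<close>.\<close>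
  also have "\<dots> = integral {0..x} (\<lambda>y. (Kxx t (x, y) * u y - Kt t (x, y) * u y) - lam * (K t (x, y) * u y))"
  proof (rule integral_cong)
    fix y assume "y \<in> {0..x}"
    from K_pde[OF t om[OF this]]
    have Kyy: "Kyy t (x, y) = Kxx t (x, y) - Kt t (x, y) - (a y t + lam) * K t (x, y)" by simp
    show "Kyy t (x, y) * u y + K t (x, y) * (a y t * u y) = (Kxx t (x, y) * u y - Kt t (x, y) * u y) - lam * (K t (x, y) * u y)"
      unfolding Kyy by (simp add: algebra_simps)
  qed
  also have "\<dots> = integral {0..x} (\<lambda>y. Kxx t (x, y) * u y - Kt t (x, y) * u y) - integral {0..x} (\<lambda>y. lam * (K t (x, y) * u y))"
    by (intro Henstock_Kurzweil_Integration.integral_diff integrable_continuous_interval continuous_intros)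
  also have "integral {0..x} (\<lambda>y. Kxx t (x, y) * u y - Kt t (x, y) * u y) = low Kxx t u x - low Kt t u x"
    unfolding low_def by (intro Henstock_Kurzweil_Integration.integral_diff integrable_continuous_interval continuous_intros)
  also have "integral {0..x} (\<lambda>y. lam * (K t (x, y) * u y)) = lam * low K t u x"
    by (simp add: low_def)
  finally have e2: "integral {0..x} (\<lambda>y. Kyy t (x, y) * u y) + integral {0..x} (\<lambda>y. K t (x, y) * (a y t * u y))
    = low Kxx t u x - low Kt t u x - lam * low K t u x" .
  have lw: "low K t u x = w x - u x" using w[OF x] by simp
  \<comment> \<open>The local terms add up to minus twice \<open>Kx + Ky\<close> on the diagonal,
    which the diagonal condition balances against \<open>a + lam\<close>.\<close>
  have "(a x t + lam) * u x = 2 * (Kx t (x, x) + Ky t (x, x)) * u x"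
    using K_diag_pde[OF t x] by simp
  then show ?thesis
    unfolding e1 e2 uxx_eq[OF x] lw by (simp add: algebra_simps)
qed

text \<open>\<open>u\<close> is known only through the Volterra equation at each time, so
  differentiability in \<open>t\<close> has to be derived. The difference quotient minus the
  candidate \<open>r\<close> satisfies a Volterra equation with small right-hand side, and
  Gronwall's bound makes it small.\<close>

lemma backstepping_time_derivative:
  assumes u: "continuous_on ({0..t0} \<times> {0..1}) (\<lambda>w. u (fst w) (snd w))"
    and w: "\<And>t x. t \<in> {0..t0} \<Longrightarrow> x \<in> {0..1} \<Longrightarrow> u t x + low K t (u t) x = w t x"
    and wt: "continuous_on ({0<..} \<times> {0..1}) (\<lambda>z. wt (fst z) (snd z))"
    and wd: "\<And>t x. 0 < t \<Longrightarrow> x \<in> {0..1} \<Longrightarrow> ((\<lambda>t. w t x) has_real_derivative wt t x) (at t)"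
    and t: "t \<in> {0<..<t0}" and r: "continuous_on {0..1} r"
    and rw: "\<And>x. x \<in> {0..1} \<Longrightarrow> r x + low K t r x = wt t x - low Kt t (u t) x" and x: "x \<in> {0..1}"
  shows "((\<lambda>t. u t x) has_real_derivative r x) (at t)"
proof -
  obtain B where B: "0 < B" "\<And>t z. t \<in> {0..t0} \<Longrightarrow> z \<in> \<Omega> \<Longrightarrow> \<bar>K t z\<bar> \<le> B \<and> \<bar>Kt t z\<bar> \<le> B"
    using kernel_bound by blast
  obtain m where m: "0 \<le> m" "\<forall>w\<in>{0..t0} \<times> {0..1}. \<bar>u (fst w) (snd w)\<bar> \<le> m"
    using compact_abs_bound_ex[OF compact_Times[OF compact_Icc compact_Icc] u] by blast
  have um: "\<bar>u s y\<bar> \<le> m" if "s \<in> {0..t0}" "y \<in> {0..1}" for s y using bspec[OF m(2), of "(s, y)"] that by simp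
  have t': "t \<in> {0..t0}" "t \<in> {t/2..t0}" using t by auto
  have uc: "continuous_on {0..1} (u s)" if "s \<in> {0..t0}" for s
    by (rule continuous_on_section[OF u]) (use that in auto)
  have wt2: "continuous_on ({t/2..t0} \<times> {0..1}) (\<lambda>z. wt (fst z) (snd z))"
    by (rule continuous_on_subset[OF wt]) (use t in auto)
  have wd': "((\<lambda>s. w s x) has_real_derivative wt s x) (at s within {t/2..t0})" if "s \<in> {t/2..t0}" "x \<in> {0..1}" for s x
    by (rule has_field_derivative_at_within[OF wd]) (use that t in auto)
  have "((\<lambda>s. (u s x - u t x) / (s - t)) \<longlongrightarrow> r x) (at t within {t/2..t0})"
  proof (rule tendstoI)
    fix e :: real assume e: "0 < e"
    \<comment> \<open>Chosen so that the three errors below, amplified by the Gronwall factor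
      \<open>exp B\<close>, add up to e/2.\<close>
    define c where "c = 2 * exp B * (1 + m + B)"
    define \<eta> where "\<eta> = e / c"
    have pos: "0 < c" unfolding c_def using B(1) m(1) by (intro mult_pos_pos) auto
    have \<eta>: "0 < \<eta>" using e pos by (simp add: \<eta>_def)
    have \<eta>e: "(\<eta> + (\<eta> * m + B * \<eta>)) * exp B < e"
    proof -
      have "(\<eta> + (\<eta> * m + B * \<eta>)) * exp B = \<eta> * c / 2" by (simp add: c_def algebra_simps)
      also have "\<dots> = e / 2" using pos by (simp add: \<eta>_def)
      finally show ?thesis using e by simp
    qed
    obtain \<delta>1 where \<delta>1: "\<delta>1 > 0" "\<forall>s\<in>{t/2..t0}. \<bar>s - t\<bar> < \<delta>1 \<longrightarrow> s \<noteq> t \<longrightarrow> (\<forall>x\<in>{0..1}. \<bar>(w s x - w t x) / (s - t) - wt t x\<bar> < \<eta>)"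
      using difference_quotient_uniform[OF compact_Icc wt2 wd' t'(2) \<eta>] by blast
    obtain \<delta>2 where \<delta>2: "\<delta>2 > 0" "\<forall>s\<in>{0..t0}. \<bar>s - t\<bar> < \<delta>2 \<longrightarrow> s \<noteq> t \<longrightarrow> (\<forall>z\<in>\<Omega>. \<bar>(K s z - K t z) / (s - t) - Kt t z\<bar> < \<eta>)"
      using difference_quotient_uniform[OF compact_Omega Kt_cont K_t t'(1) \<eta>] by auto
    obtain \<delta>3 where \<delta>3: "\<delta>3 > 0" "\<forall>s\<in>{0..t0}. \<bar>s - t\<bar> < \<delta>3 \<longrightarrow> (\<forall>x\<in>{0..1}. \<bar>u s x - u t x\<bar> < \<eta>)"
      using continuous_on_uniform_in_time[OF _ u t'(1) \<eta>] by auto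
    define \<delta> where "\<delta> = min \<delta>1 (min \<delta>2 \<delta>3)"
    have "dist ((u s x - u t x) / (s - t)) (r x) < e" if s: "s \<in> {t/2..t0}" "s \<noteq> t" "dist s t < \<delta>" for s
    proof -
      have s0: "s \<in> {0..t0}" using s(1) t by auto
      have sd: "\<bar>s - t\<bar> < \<delta>1" "\<bar>s - t\<bar> < \<delta>2" "\<bar>s - t\<bar> < \<delta>3" using s(3) by (auto simp: \<delta>_def dist_real_def)
      define ee where "ee y = (u s y - u t y) / (s - t) - r y" for y
      have eec: "continuous_on {0..1} ee" unfolding ee_def[abs_def] using s(2) by (intro continuous_intros uc s0 t' r) auto
      have le: "\<bar>ee y + integral {0..y} (\<lambda>y'. K t (y, y') * ee y')\<bar> \<le> \<eta> + (\<eta> * m + B * \<eta>)" if y: "y \<in> {0..1}" for y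
      proof -
        have sub: "continuous_on {0..y} f" if "continuous_on {0..1} f" for f :: "real \<Rightarrow> real"
          by (rule continuous_on_subset[OF that]) (use y in auto)
        note [continuous_intros] = sub[OF uc[OF s0]] sub[OF uc[OF t'(1)]] sub[OF r]
          continuous_on_Omega_section_lower[OF kernel_at_time(1)[OF t'(1)] y]
          continuous_on_Omega_section_lower[OF kernel_at_time(1)[OF s0] y]
          continuous_on_Omega_section_lower[OF kernel_at_time(5)[OF t'(1)] y]
        have om: "(y, y') \<in> \<Omega>" if "y' \<in> {0..y}" for y' using that y by (auto simp: Omega_iff)
        have y'1: "y' \<in> {0..1}" if "y' \<in> {0..y}" for y' using that y by auto
        \<comment> \<open>Product rule for quotients: the quotient of the product of kernel and
          \<open>u\<close> is \<open>q\<close> times \<open>u\<close> at time \<open>s\<close>, plus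
          the kernel at time \<open>t\<close> times the quotient of \<open>u\<close>.\<close>
        define q where "q y' = (K s (y, y') - K t (y, y')) / (s - t)" for y'
        have qc: "continuous_on {0..y} q" unfolding q_def[abs_def] using s(2) by (intro continuous_intros) auto
        have "integral {0..y} (\<lambda>y'. K t (y, y') * ee y') = integral {0..y} (\<lambda>y'. (1 / (s - t)) * (K s (y, y') * u s y' - K t (y, y') * u t y') - q y' * u s y' - K t (y, y') * r y')"
          by (rule integral_cong) (simp add: ee_def q_def divide_inverse algebra_simps)
        also have "\<dots> = integral {0..y} (\<lambda>y'. (1 / (s - t)) * (K s (y, y') * u s y' - K t (y, y') * u t y') - q y' * u s y') - integral {0..y} (\<lambda>y'. K t (y, y') * r y')"
          by (intro Henstock_Kurzweil_Integration.integral_diff integrable_continuous_interval continuous_intros qc)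
        also have "integral {0..y} (\<lambda>y'. (1 / (s - t)) * (K s (y, y') * u s y' - K t (y, y') * u t y') - q y' * u s y')
            = integral {0..y} (\<lambda>y'. (1 / (s - t)) * (K s (y, y') * u s y' - K t (y, y') * u t y')) - integral {0..y} (\<lambda>y'. q y' * u s y')"
          by (intro Henstock_Kurzweil_Integration.integral_diff integrable_continuous_interval continuous_intros qc)
        also have "integral {0..y} (\<lambda>y'. (1 / (s - t)) * (K s (y, y') * u s y' - K t (y, y') * u t y'))
            = (1 / (s - t)) * integral {0..y} (\<lambda>y'. K s (y, y') * u s y' - K t (y, y') * u t y')"
          by (rule Henstock_Kurzweil_Integration.integral_mult_right)
        also have "integral {0..y} (\<lambda>y'. K s (y, y') * u s y' - K t (y, y') * u t y') = low K s (u s) y - low K t (u t) y"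
          unfolding low_def by (intro Henstock_Kurzweil_Integration.integral_diff integrable_continuous_interval continuous_intros)
        also have "low K s (u s) y - low K t (u t) y = (w s y - w t y) - (u s y - u t y)"
          using w[OF s0 y] w[OF t'(1) y] by simp
        finally have i: "integral {0..y} (\<lambda>y'. K t (y, y') * ee y') = 1 / (s - t) * ((w s y - w t y) - (u s y - u t y)) - integral {0..y} (\<lambda>y'. q y' * u s y') - low K t r y"
          by (simp add: low_def)
        have dd: "integral {0..y} (\<lambda>y'. q y' * u s y') - low Kt t (u t) y = integral {0..y} (\<lambda>y'. (q y' - Kt t (y, y')) * u s y') + integral {0..y} (\<lambda>y'. Kt t (y, y') * (u s y' - u t y'))"
        proof -
          have "integral {0..y} (\<lambda>y'. q y' * u s y') - low Kt t (u t) y = integral {0..y} (\<lambda>y'. q y' * u s y' - Kt t (y, y') * u t y')"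
            unfolding low_def by (intro Henstock_Kurzweil_Integration.integral_diff[symmetric] integrable_continuous_interval continuous_intros qc)
          also have "\<dots> = integral {0..y} (\<lambda>y'. (q y' - Kt t (y, y')) * u s y' + Kt t (y, y') * (u s y' - u t y'))"
            by (rule integral_cong) (simp add: algebra_simps)
          also have "\<dots> = integral {0..y} (\<lambda>y'. (q y' - Kt t (y, y')) * u s y') + integral {0..y} (\<lambda>y'. Kt t (y, y') * (u s y' - u t y'))"
            by (intro Henstock_Kurzweil_Integration.integral_add integrable_continuous_interval continuous_intros qc)
          finally show ?thesis .
        qed
        have b1: "\<bar>integral {0..y} (\<lambda>y'. (q y' - Kt t (y, y')) * u s y')\<bar> \<le> \<eta> * m"
        proof (rule lower_integral_abs_le)
          show "\<bar>q y' - Kt t (y, y')\<bar> \<le> \<eta>" if "y' \<in> {0..y}" for y'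
            using \<delta>2(2)[rule_format, OF s0 sd(2) s(2) om[OF that]] by (simp add: q_def)
          show "\<bar>u s y'\<bar> \<le> m" if "y' \<in> {0..y}" for y' by (rule um[OF s0 y'1[OF that]])
        qed (use y \<eta> m in \<open>auto intro!: continuous_intros qc\<close>)
        have b2: "\<bar>integral {0..y} (\<lambda>y'. Kt t (y, y') * (u s y' - u t y'))\<bar> \<le> B * \<eta>"
        proof (rule lower_integral_abs_le)
          show "\<bar>Kt t (y, y')\<bar> \<le> B" if "y' \<in> {0..y}" for y'
            using B(2)[OF t'(1) om[OF that]] by simp
          show "\<bar>u s y' - u t y'\<bar> \<le> \<eta>" if "y' \<in> {0..y}" for y'
            using \<delta>3(2)[rule_format, OF s0 sd(3) y'1[OF that]] by simp
        qed (use y \<eta> B in \<open>auto intro!: continuous_intros\<close>)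
        have b3: "\<bar>(w s y - w t y) / (s - t) - wt t y\<bar> < \<eta>"
          using \<delta>1(2)[rule_format, OF s(1) sd(1) s(2) y] .
        have "1 / (s - t) * ((w s y - w t y) - (u s y - u t y)) = (w s y - w t y) / (s - t) - (u s y - u t y) / (s - t)"
          by (simp add: diff_divide_distrib)
        then have "ee y + integral {0..y} (\<lambda>y'. K t (y, y') * ee y') = ((w s y - w t y) / (s - t) - wt t y) - (integral {0..y} (\<lambda>y'. q y' * u s y') - low Kt t (u t) y)"
          unfolding i ee_def[of y] using rw[OF y] by linarith
        then show ?thesis unfolding dd using b1 b2 b3 by linarith
      qed
      have "\<bar>ee x\<bar> \<le> (\<eta> + (\<eta> * m + B * \<eta>)) * exp B"
        by (rule Volterra_sup_bound[OF kernel_at_time(1)[OF t'(1)] _ eec le x]) (use B(2)[OF t'(1)] in auto)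
      then show ?thesis using \<eta>e by (simp add: ee_def dist_real_def)
    qed
    moreover have "\<delta> > 0" using \<delta>1(1) \<delta>2(1) \<delta>3(1) by (simp add: \<delta>_def)
    ultimately show "\<forall>\<^sub>F s in at t within {t/2..t0}. dist ((u s x - u t x) / (s - t)) (r x) < e"
      unfolding eventually_at by blast
  qed
  then have "((\<lambda>t. u t x) has_real_derivative r x) (at t within {t/2..t0})"
    by (simp add: has_field_derivative_iff)
  then show ?thesis
    using t by (subst (asm) at_within_Icc_at) auto
qed

lemma low_abs_le_L2:
  assumes p: "continuous_on \<Omega> (p t)" and B: "\<And>z. z \<in> \<Omega> \<Longrightarrow> \<bar>p t z\<bar> \<le> B" and f: "continuous_on {0..1} f"
    and x: "x \<in> {0..1}" and B0: "0 \<le> B"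
  shows "\<bar>low p t f x\<bar> \<le> B * L2_norm f"
proof -
  have ca: "continuous_on {0..1} (\<lambda>y. \<bar>f y\<bar>)" by (intro continuous_intros f)
  have sub: "continuous_on {0..x} h" if "continuous_on {0..1} h" for h :: "real \<Rightarrow> real"
    by (rule continuous_on_subset[OF that]) (use x in auto)
  have om: "(x, y) \<in> \<Omega>" if "y \<in> {0..x}" for y using that x by (auto simp: Omega_iff)
  have "norm (integral {0..x} (\<lambda>y. p t (x, y) * f y)) \<le> integral {0..x} (\<lambda>y. B * \<bar>f y\<bar>)"
  proof (rule integral_norm_bound_integral)
    show "norm (p t (x, y) * f y) \<le> B * \<bar>f y\<bar>" if "y \<in> {0..x}" for y
      using B[OF om[OF that]] by (simp add: abs_mult mult_right_mono)
  qed (intro integrable_continuous_interval continuous_on_mult continuous_on_const sub ca f continuous_on_Omega_section_lower[OF p x])+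
  also have "\<dots> \<le> integral {0..1} (\<lambda>y. B * \<bar>f y\<bar>)"
  proof (rule integral_subset_le)
    show "(\<lambda>y. B * \<bar>f y\<bar>) integrable_on {0..x}" "(\<lambda>y. B * \<bar>f y\<bar>) integrable_on {0..1}"
      by (intro integrable_continuous_interval continuous_on_mult continuous_on_const sub ca)+
  qed (use x B0 in auto)
  also have "\<dots> = B * ip (\<lambda>y. 1) (\<lambda>y. \<bar>f y\<bar>)"
    using continuous_leb_integral[OF ca] by (simp add: ip_def)
  also have "ip (\<lambda>y. 1) (\<lambda>y. \<bar>f y\<bar>) \<le> L2_norm (\<lambda>_. 1) * L2_norm (\<lambda>y. \<bar>f y\<bar>)"
    using ip_Cauchy_Schwarz[of "\<lambda>_. 1" "\<lambda>y. \<bar>f y\<bar>"] by (simp add: continuous_L2 ca)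
  also have "\<dots> = L2_norm f" by (simp add: L2_norm_const) (simp add: L2_norm_def)
  finally show ?thesis using B0 by (simp add: low_def mult_left_mono)
qed

text \<open>The constant is fixed before the initial value. The heat flow bounds \<open>w\<close>
  and \<open>wx\<close> by the derivative \<open>g\<close> of the transformed initial value, and
  Gronwall's bound together with the formula for the derivative of \<open>u = w - K u\<close> passes
  this on to \<open>u\<close> and \<open>ux\<close>.\<close>

theorem classical_solution_exists:
  assumes \<theta>: "\<theta> = 0 \<or> \<theta> = 1/2"
  shows "\<exists>M>0. \<forall>u0 u0'. continuous_on {0..1} u0 \<longrightarrow> weak_deriv u0 u0' \<longrightarrow> u0 0 = 0 \<longrightarrow> (\<theta> = 0 \<longrightarrow> u0 1 = - low K 0 u0 1) \<longrightarrow>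
    (\<exists>u ux uxx. classical_solution \<theta> u0 u0' u ux uxx \<and>
      (\<forall>t\<in>{0<..t0}. sqrt ((L2_norm (u t))\<^sup>2 + (L2_norm (ux t))\<^sup>2) \<le> M * exp (- lam * t) * sqrt ((L2_norm u0)\<^sup>2 + (L2_norm u0')\<^sup>2)))"
proof -
  obtain B where B0: "0 < B" and B: "\<And>t z. t \<in> {0..t0} \<Longrightarrow> z \<in> \<Omega> \<Longrightarrow> \<bar>K t z\<bar> \<le> B \<and> \<bar>Kx t z\<bar> \<le> B \<and> \<bar>Ky t z\<bar> \<le> B \<and> \<bar>Kxx t z\<bar> \<le> B \<and> \<bar>Kt t z\<bar> \<le> B"
    using kernel_bound by blast
  define c where "c = exp B"
  have c0: "0 < c" by (simp add: c_def)
  \<comment> \<open>The second factor bounds the norm of \<open>g\<close> by the H^1 norm of the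
    initial value. In the first factor \<open>c\<close> stems from \<open>u\<close> and
    \<open>1 + 2 * B * c\<close> from \<open>ux\<close>: 1 for \<open>wx\<close>, and
    \<open>B * c\<close> for each of the two terms of \<open>Q\<close>.\<close>
  define M where "M = (c + 1 + 2 * B * c) * (1 + 2 * B)"
  have M0: "0 < M" unfolding M_def using c0 B0 by (intro mult_pos_pos add_pos_pos) auto
  have t00: "0 \<in> {0..t0}" using t0 by simp
  have main: "\<exists>u ux uxx. classical_solution \<theta> u0 u0' u ux uxx \<and>
      (\<forall>t\<in>{0<..t0}. sqrt ((L2_norm (u t))\<^sup>2 + (L2_norm (ux t))\<^sup>2) \<le> M * exp (- lam * t) * sqrt ((L2_norm u0)\<^sup>2 + (L2_norm u0')\<^sup>2))"
    if u0c: "continuous_on {0..1} u0" and u0w: "weak_deriv u0 u0'" and u00: "u0 0 = 0"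
      and u01: "\<theta> = 0 \<Longrightarrow> u0 1 = - low K 0 u0 1" for u0 u0'
  proof -
    interpret H: heat \<theta> lam by standard (use \<theta> lam in auto)
    define Q0 where "Q0 x = K 0 (x, x) * u0 x + low Kx 0 u0 x" for x
    have Q0c: "continuous_on {0..1} Q0"
      unfolding Q0_def[abs_def]
      by (intro continuous_intros u0c continuous_on_Omega_diagonal kernel_at_time(1)[OF t00] low_continuous[OF Kx_cont t00 u0c])
    have lowc: "continuous_on {0..1} (low K 0 u0)" by (rule low_continuous[OF K_cont t00 u0c])
    define w0 where "w0 x = u0 x + low K 0 u0 x" for x
    define g where "g x = u0' x + Q0 x" for x
    have w0c: "continuous_on {0..1} w0" unfolding w0_def[abs_def] by (intro continuous_intros u0c lowc)
    have wd: "weak_deriv (low K 0 u0) Q0"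
      by (rule weak_deriv_classical[OF _ Q0c]) (use low_K_deriv[OF t00 u0c] in \<open>simp add: Q0_def\<close>)
    have wg: "weak_deriv w0 g"
      unfolding w0_def[abs_def] g_def[abs_def] by (rule weak_deriv_add[OF u0w wd])
    have w00: "w0 0 = 0" by (simp add: w0_def u00 low_def)
    have w01: "\<theta> = 0 \<Longrightarrow> w0 1 = 0" using u01 by (simp add: w0_def)
    have u0L: "u0 \<in> L2_space" "u0' \<in> L2_space" by (rule weak_deriv_L2[OF u0w])+
    have om: "(x, x) \<in> \<Omega>" if "x \<in> {0..1}" for x using that by (auto simp: Omega_iff)
    have gn: "L2_norm g \<le> (1 + 2 * B) * sqrt ((L2_norm u0)\<^sup>2 + (L2_norm u0')\<^sup>2)"
    proof -
      have kc: "continuous_on {0..1} (\<lambda>x. K 0 (x, x) * u0 x)"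
        by (intro continuous_intros u0c continuous_on_Omega_diagonal kernel_at_time(1)[OF t00])
      have lc: "continuous_on {0..1} (low Kx 0 u0)" by (rule low_continuous[OF Kx_cont t00 u0c])
      have 1: "L2_norm (\<lambda>x. K 0 (x, x) * u0 x) \<le> L2_norm (\<lambda>x. B * u0 x)"
      proof (rule L2_norm_mono)
        fix x :: real assume "x \<in> {0<..<1}"
        then have "\<bar>K 0 (x, x)\<bar> \<le> B" using B[OF t00 om[of x]] by simp
        then show "\<bar>K 0 (x, x) * u0 x\<bar> \<le> \<bar>B * u0 x\<bar>" using B0 by (simp add: abs_mult mult_right_mono)
      qed (intro continuous_L2 kc L2_cmult u0L)+
      have 2: "L2_norm (low Kx 0 u0) \<le> B * L2_norm u0"
        by (rule L2_norm_bound[OF continuous_L2[OF lc]], rule low_abs_le_L2[where p = Kx and t = 0, OF kernel_at_time(2)[OF t00] _ u0c])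
           (use B[OF t00] B0 in auto)
      have "L2_norm g \<le> L2_norm u0' + L2_norm Q0"
        unfolding g_def[abs_def] by (intro L2_norm_triangle u0L continuous_L2 Q0c)
      also have "L2_norm Q0 \<le> L2_norm (\<lambda>x. K 0 (x, x) * u0 x) + L2_norm (low Kx 0 u0)"
        unfolding Q0_def[abs_def] by (intro L2_norm_triangle continuous_L2 kc lc)
      finally have "L2_norm g \<le> L2_norm u0' + 2 * B * L2_norm u0"
        using 1 2 B0 by (simp add: L2_norm_cmult)
      also have "\<dots> \<le> sqrt ((L2_norm u0)\<^sup>2 + (L2_norm u0')\<^sup>2) + 2 * B * sqrt ((L2_norm u0)\<^sup>2 + (L2_norm u0')\<^sup>2)"
        using B0 by (intro add_mono mult_left_mono real_sqrt_sum_squares_ge1 real_sqrt_sum_squares_ge2) auto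
      finally show ?thesis by (simp add: algebra_simps)
    qed
    obtain w wx wxx E where
      wc: "continuous_on ({0..} \<times> {0..1}) (\<lambda>z. w (fst z) (snd z))"
      and wxc: "continuous_on ({0<..} \<times> {0..1}) (\<lambda>z. wx (fst z) (snd z))"
      and wxxc: "continuous_on ({0<..} \<times> {0..1}) (\<lambda>z. wxx (fst z) (snd z))"
      and wx: "\<And>t x. 0 < t \<Longrightarrow> x \<in> {0..1} \<Longrightarrow> (w t has_real_derivative wx t x) (at x within {0..1})"
      and wxx: "\<And>t x. 0 < t \<Longrightarrow> x \<in> {0..1} \<Longrightarrow> (wx t has_real_derivative wxx t x) (at x within {0..1})"
      and wt: "\<And>t x. 0 < t \<Longrightarrow> x \<in> {0..1} \<Longrightarrow> ((\<lambda>t. w t x) has_real_derivative wxx t x - lam * w t x) (at t)"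
      and w_init: "\<And>x. x \<in> {0..1} \<Longrightarrow> w 0 x = w0 x"
      and w_0: "\<And>t. 0 \<le> t \<Longrightarrow> w t 0 = 0" and w_1: "\<And>t. \<theta> = 0 \<Longrightarrow> 0 \<le> t \<Longrightarrow> w t 1 = 0" and wx_1: "\<And>t. \<theta> = 1/2 \<Longrightarrow> 0 < t \<Longrightarrow> wx t 1 = 0"
      and wxn: "\<And>t. 0 < t \<Longrightarrow> L2_norm (wx t) \<le> exp (- lam * t) * L2_norm g"
      and wx_lim: "((\<lambda>t. L2_norm (\<lambda>x. wx t x - g x)) \<longlongrightarrow> 0) (at_right 0)"
      and E: "integrable (leb 0 t0) E" "\<And>t. 0 < t \<Longrightarrow> (L2_norm (wxx t))\<^sup>2 \<le> E t"
      by (rule H.heat_solution[OF w0c wg w00 w01 t0]) (assumption, (rule that; assumption))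
    have wc': "continuous_on ({0..t0} \<times> {0..1}) (\<lambda>(t, x). w t x)"
      unfolding case_prod_beta' by (rule continuous_on_subset[OF wc]) auto
    have Kc': "continuous_on ({0..t0} \<times> \<Omega>) (\<lambda>(t, z). K t z)"
      using K_cont by (simp add: case_prod_beta')
    obtain u where uc0: "continuous_on ({0..t0} \<times> {0..1}) (\<lambda>(t, x). u t x)"
      and ueq: "\<And>t x. t \<in> {0..t0} \<Longrightarrow> x \<in> {0..1} \<Longrightarrow> u t x + integral {0..x} (\<lambda>y. K t (x, y) * u t y) = w t x"
      using Volterra_exists[OF compact_Icc Kc' wc'] by blast
    have uc: "continuous_on ({0..t0} \<times> {0..1}) (\<lambda>w. u (fst w) (snd w))"
      using uc0 by (simp add: case_prod_beta')
    have uw: "u t x + low K t (u t) x = w t x" if "t \<in> {0..t0}" "x \<in> {0..1}" for t x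
      using ueq[OF that] by (simp add: low_def)
    have ut: "continuous_on {0..1} (u t)" if "t \<in> {0..t0}" for t
      by (rule continuous_on_section[OF uc that order_refl])
    have S: "{0<..t0} \<subseteq> {0..t0}" by auto
    have uc': "continuous_on ({0<..t0} \<times> {0..1}) (\<lambda>w. u (fst w) (snd w))"
      by (rule continuous_on_subset[OF uc]) auto
    define Q where "Q t x = K t (x, x) * u t x + low Kx t (u t) x" for t x
    have Qc: "continuous_on ({0..t0} \<times> {0..1}) (\<lambda>w. Q (fst w) (snd w))"
      unfolding Q_def by (intro continuous_on_add continuous_on_mult uc diagonal_joint_continuous[OF K_cont] low_joint_continuous[OF Kx_cont] order_refl)
    \<comment> \<open>Here and in \<open>uxx\<close> the equation \<open>u = w - K u\<close> is
      differentiated formally; Leibniz's rule then shows that these are the derivatives.\<close>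
    define ux where "ux t x = wx t x - Q t x" for t x
    have uxc: "continuous_on ({0<..t0} \<times> {0..1}) (\<lambda>w. ux (fst w) (snd w))"
      unfolding ux_def by (intro continuous_on_diff continuous_on_subset[OF wxc] continuous_on_subset[OF Qc]) auto
    define uxx where "uxx t x = wxx t x - ((Kx t (x, x) + Ky t (x, x)) * u t x + K t (x, x) * ux t x) - (Kx t (x, x) * u t x + low Kxx t (u t) x)" for t x
    have uxxc: "continuous_on ({0<..t0} \<times> {0..1}) (\<lambda>w. uxx (fst w) (snd w))"
    proof -
      have "continuous_on ({0<..t0} \<times> {0..1}) (\<lambda>z. wxx (fst z) (snd z))" by (rule continuous_on_subset[OF wxxc]) auto
      then show ?thesis
        unfolding uxx_def
        by (intro continuous_on_diff continuous_on_add continuous_on_mult uc' uxc diagonal_joint_continuous[OF K_cont S]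
            diagonal_joint_continuous[OF Kx_cont S] diagonal_joint_continuous[OF Ky_cont S] low_joint_continuous[OF Kxx_cont S])
    qed
    have ud: "(u t has_real_derivative ux t x) (at x within {0..1})" if t: "t \<in> {0<..t0}" and x: "x \<in> {0..1}" for t x
    proof -
      have t': "t \<in> {0..t0}" "0 < t" using t by auto
      have "((\<lambda>x. w t x - low K t (u t) x) has_real_derivative wx t x - Q t x) (at x within {0..1})"
        unfolding Q_def by (intro DERIV_diff wx t' x low_K_deriv ut)
      then show ?thesis
        unfolding ux_def by (rule has_field_derivative_transform_within[of _ _ _ _ 1]) (use x uw[OF t'(1)] in \<open>auto simp: algebra_simps\<close>)
    qed
    have uxd: "(ux t has_real_derivative uxx t x) (at x within {0..1})" if t: "t \<in> {0<..t0}" and x: "x \<in> {0..1}" for t x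
    proof -
      have t': "t \<in> {0..t0}" "0 < t" using t by auto
      have "((\<lambda>x. wx t x - (K t (x, x) * u t x + low Kx t (u t) x)) has_real_derivative
         wxx t x - (((Kx t (x, x) + Ky t (x, x)) * u t x + ux t x * K t (x, x)) + (Kx t (x, x) * u t x + low Kxx t (u t) x))) (at x within {0..1})"
        by (intro DERIV_diff DERIV_add DERIV_mult wxx t' x low_Kx_deriv ut K_diag ud t)
      then show ?thesis
        unfolding ux_def[abs_def] Q_def uxx_def by (simp add: algebra_simps ux_def Q_def)
    qed
    have u_0: "u t 0 = 0" if "t \<in> {0..t0}" for t
      using uw[OF that, of 0] w_0[of t] that by (simp add: low_def)
    have u_init: "u 0 x = u0 x" if x: "x \<in> {0..1}" for x
    proof -
      \<comment> \<open>Uniqueness for the Volterra equation at time 0: both functions have the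
        transform \<open>w0\<close>.\<close>
      have "\<bar>u 0 x - u0 x\<bar> \<le> 0 * exp B"
      proof (rule Volterra_sup_bound[OF kernel_at_time(1)[OF t00] _ _ _ x, of _ "\<lambda>x. u 0 x - u0 x"])
        fix y :: real assume y: "y \<in> {0..1}"
        have sub: "continuous_on {0..y} f" if "continuous_on {0..1} f" for f :: "real \<Rightarrow> real"
          by (rule continuous_on_subset[OF that]) (use y in auto)
        have "integral {0..y} (\<lambda>y'. K 0 (y, y') * (u 0 y' - u0 y')) = integral {0..y} (\<lambda>y'. K 0 (y, y') * u 0 y' - K 0 (y, y') * u0 y')"
          by (simp add: right_diff_distrib)
        also have "\<dots> = low K 0 (u 0) y - low K 0 u0 y"
          unfolding low_def
          by (intro Henstock_Kurzweil_Integration.integral_diff integrable_continuous_interval continuous_intros sub ut t00 u0c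
              continuous_on_Omega_section_lower[OF kernel_at_time(1)[OF t00] y])
        finally show "\<bar>u 0 y - u0 y + integral {0..y} (\<lambda>y'. K 0 (y, y') * (u 0 y' - u0 y'))\<bar> \<le> 0"
          using uw[OF t00 y] w_init[OF y] by (simp add: w0_def)
      qed (use B[OF t00] in \<open>auto intro!: continuous_intros ut t00 u0c\<close>)
      then show ?thesis by simp
    qed
    have Q_init: "Q 0 x = Q0 x" if x: "x \<in> {0..1}" for x
    proof -
      have "low Kx 0 (u 0) x = low Kx 0 u0 x"
        unfolding low_def by (rule integral_cong) (use x u_init in auto)
      then show ?thesis using u_init[OF x] by (simp add: Q_def Q0_def)
    qed
    \<comment> \<open>A chain of bounds: \<open>w\<close> by the L2 norm of \<open>wx\<close>, as
      \<open>w\<close> vanishes at 0; then the decay of \<open>wx\<close>; then Gronwall with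
      \<open>c = exp B\<close>.\<close>
    have sup: "\<bar>u t x\<bar> \<le> (exp (- lam * t) * L2_norm g) * c" if t: "t \<in> {0<..t0}" and x: "x \<in> {0..1}" for t x
      unfolding c_def
    proof (rule Volterra_sup_bound[OF kernel_at_time(1) _ ut _ x])
      have t': "t \<in> {0..t0}" "0 < t" using t by auto
      show "t \<in> {0..t0}" "t \<in> {0..t0}" by (rule t')+
      show "\<bar>K t z\<bar> \<le> B" if "z \<in> \<Omega>" for z using B[OF t'(1) that] by simp
      fix y :: real assume y: "y \<in> {0..1}"
      have "\<bar>w t y\<bar> \<le> L2_norm (wx t)"
      proof (rule abs_le_L2_norm_deriv[OF wx[OF t'(2)] _ _ y])
        show "continuous_on {0..1} (wx t)"
          by (rule continuous_on_section[OF wxc]) (use t' in auto)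
        show "w t 0 = 0" using w_0[of t] t' by simp
      qed
      then show "\<bar>u t y + integral {0..y} (\<lambda>y'. K t (y, y') * u t y')\<bar> \<le> exp (- lam * t) * L2_norm g"
        using ueq[OF t'(1) y] wxn[OF t'(2)] by simp
    qed
    define N where "N t = exp (- lam * t) * L2_norm g" for t
    have Ng: "N t \<le> L2_norm g" if "0 < t" for t
      unfolding N_def using lam that by (intro mult_left_le_one_le) auto
    have un: "L2_norm (u t) \<le> c * N t" if t: "t \<in> {0<..t0}" for t
      using sup[OF t] t by (intro L2_norm_bound continuous_L2 ut) (auto simp: N_def mult.commute)
    have lowb: "\<bar>low p t (u t) x\<bar> \<le> B * (c * N t)"
      if t: "t \<in> {0<..t0}" and x: "x \<in> {0..1}" and p: "continuous_on \<Omega> (p t)" "\<And>z. z \<in> \<Omega> \<Longrightarrow> \<bar>p t z\<bar> \<le> B" for p t x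
    proof -
      have "\<bar>low p t (u t) x\<bar> \<le> B * L2_norm (u t)"
        using t B0 by (intro low_abs_le_L2 p ut x) auto
      also have "\<dots> \<le> B * (c * N t)" using un[OF t] B0 by (intro mult_left_mono) auto
      finally show ?thesis .
    qed
    have mulb: "\<bar>p * u t x\<bar> \<le> B * (c * N t)" if t: "t \<in> {0<..t0}" and x: "x \<in> {0..1}" and p: "\<bar>p\<bar> \<le> B" for p t x
      unfolding abs_mult using sup[OF t x] p B0 by (intro mult_mono) (auto simp: N_def mult.commute)
    have Qb: "\<bar>Q t x\<bar> \<le> 2 * B * c * N t" if t: "t \<in> {0<..t0}" and x: "x \<in> {0..1}" for t x
    proof -
      have t': "t \<in> {0..t0}" using t by auto
      have "\<bar>K t (x, x) * u t x\<bar> \<le> B * (c * N t)" by (rule mulb[OF t x]) (use B[OF t' om[OF x]] in simp)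
      moreover have "\<bar>low Kx t (u t) x\<bar> \<le> B * (c * N t)" by (rule lowb[where p = Kx, OF t x kernel_at_time(2)[OF t']]) (use B[OF t'] in simp)
      ultimately show ?thesis unfolding Q_def by (simp add: mult.assoc)
    qed
    have sec: "continuous_on {0..1} (f t)" if "continuous_on ({0<..t0} \<times> {0..1}) (\<lambda>w. f (fst w) (snd w))" "t \<in> {0<..t0}" for f :: "real \<Rightarrow> real \<Rightarrow> real" and t
      by (rule continuous_on_section[OF that order_refl])
    have wxt: "continuous_on {0..1} (wx t)" "continuous_on {0..1} (wxx t)" if "t \<in> {0<..t0}" for t
      using that by (auto intro!: continuous_on_section[OF wxc] continuous_on_section[OF wxxc])
    have Qt: "continuous_on {0..1} (Q t)" if "t \<in> {0..t0}" for t by (rule continuous_on_section[OF Qc that order_refl])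
    have uxn: "L2_norm (ux t) \<le> (1 + 2 * B * c) * N t" if t: "t \<in> {0<..t0}" for t
    proof -
      have "L2_norm (ux t) \<le> L2_norm (wx t) + L2_norm (Q t)"
        unfolding ux_def[abs_def] using t by (intro L2_norm_triangle_diff continuous_L2 wxt Qt) auto
      moreover have "L2_norm (Q t) \<le> 2 * B * c * N t"
        using Qb[OF t] t by (intro L2_norm_bound continuous_L2 Qt) auto
      moreover have "L2_norm (wx t) \<le> N t" using wxn[of t] t by (simp add: N_def)
      ultimately show ?thesis by (simp add: algebra_simps)
    qed
    \<comment> \<open>Four terms of size \<open>B * c\<close>, collected in \<open>r\<close> below,
      and the product of the kernel with \<open>ux\<close>, estimated by the bound for
      \<open>ux\<close>.\<close>
    define C where "C = 4 * (B * c) + B * (1 + 2 * B * c)"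
    have C0: "0 \<le> C" unfolding C_def using B0 c0 by (intro add_nonneg_nonneg mult_nonneg_nonneg) auto
    have uxxn: "L2_norm (uxx t) \<le> L2_norm (wxx t) + C * L2_norm g" if t: "t \<in> {0<..t0}" for t
    proof -
      have t': "t \<in> {0..t0}" "0 < t" using t by auto
      define r where "r x = (Kx t (x, x) * u t x + Ky t (x, x) * u t x) + (Kx t (x, x) * u t x + low Kxx t (u t) x)" for x
      have dc: "continuous_on {0..1} (\<lambda>x. K t (x, x))" "continuous_on {0..1} (\<lambda>x. Kx t (x, x))" "continuous_on {0..1} (\<lambda>x. Ky t (x, x))"
        using kernel_at_time[OF t'(1)] by (auto intro: continuous_on_Omega_diagonal)
      have rc: "continuous_on {0..1} r"
        unfolding r_def[abs_def] by (intro continuous_intros dc ut t' low_continuous[OF Kxx_cont])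
      have rb: "\<bar>r x\<bar> \<le> 4 * (B * (c * N t))" if x: "x \<in> {0..1}" for x
      proof -
        have "\<bar>Kx t (x, x) * u t x\<bar> \<le> B * (c * N t)" by (rule mulb[OF t x]) (use B[OF t'(1) om[OF x]] in simp)
        moreover have "\<bar>Ky t (x, x) * u t x\<bar> \<le> B * (c * N t)" by (rule mulb[OF t x]) (use B[OF t'(1) om[OF x]] in simp)
        moreover have "\<bar>low Kxx t (u t) x\<bar> \<le> B * (c * N t)" by (rule lowb[where p = Kxx, OF t x kernel_at_time(4)[OF t'(1)]]) (use B[OF t'(1)] in simp)
        ultimately show ?thesis unfolding r_def by linarith
      qed
      have uxL: "ux t \<in> L2_space" by (rule continuous_L2[OF sec[OF uxc t]])
      have kuxc: "continuous_on {0..1} (\<lambda>x. K t (x, x) * ux t x)" by (intro continuous_intros dc sec[OF uxc t])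
      have "L2_norm (\<lambda>x. K t (x, x) * ux t x) \<le> L2_norm (\<lambda>x. B * ux t x)"
      proof (rule L2_norm_mono)
        fix x :: real assume "x \<in> {0<..<1}"
        then have "\<bar>K t (x, x)\<bar> \<le> B" using B[OF t'(1) om[of x]] by simp
        then show "\<bar>K t (x, x) * ux t x\<bar> \<le> \<bar>B * ux t x\<bar>" using B0 by (simp add: abs_mult mult_right_mono)
      qed (intro continuous_L2 kuxc L2_cmult uxL)+
      also have "\<dots> = B * L2_norm (ux t)" using B0 by (simp add: L2_norm_cmult)
      also have "\<dots> \<le> B * ((1 + 2 * B * c) * N t)" using uxn[OF t] B0 by (intro mult_left_mono) auto
      finally have k: "L2_norm (\<lambda>x. K t (x, x) * ux t x) \<le> B * ((1 + 2 * B * c) * N t)" .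
      have rn: "L2_norm r \<le> 4 * (B * (c * N t))" using rb by (intro L2_norm_bound continuous_L2 rc) auto
      have "uxx t = (\<lambda>x. wxx t x - (r x + K t (x, x) * ux t x))"
        by (rule ext) (simp add: uxx_def r_def algebra_simps)
      then have "L2_norm (uxx t) \<le> L2_norm (wxx t) + L2_norm (\<lambda>x. r x + K t (x, x) * ux t x)"
        using L2_norm_triangle_diff[of "wxx t" "\<lambda>x. r x + K t (x, x) * ux t x"]
        by (simp add: continuous_L2 wxt[OF t] L2_add rc kuxc)
      also have "L2_norm (\<lambda>x. r x + K t (x, x) * ux t x) \<le> L2_norm r + L2_norm (\<lambda>x. K t (x, x) * ux t x)"
        by (intro L2_norm_triangle continuous_L2 rc kuxc)
      also have "L2_norm r + L2_norm (\<lambda>x. K t (x, x) * ux t x) \<le> C * N t"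
        using rn k by (simp add: C_def algebra_simps)
      also have "C * N t \<le> C * L2_norm g" using Ng[OF t'(2)] C0 by (rule mult_left_mono)
      finally show ?thesis by simp
    qed
    have "classical_solution \<theta> u0 u0' u ux uxx"
      unfolding classical_solution_def
    proof (intro conjI ballI impI)
      show "((\<lambda>t. u t x) has_real_derivative uxx t x + a x t * u t x) (at t)" if t: "t \<in> {0<..<t0}" and x: "x \<in> {0..1}" for t x
      proof -
        have t': "t \<in> {0..t0}" "t \<in> {0<..t0}" "0 < t" using t by auto
        have rc: "continuous_on {0..1} (\<lambda>x. uxx t x + a x t * u t x)"
          by (intro continuous_intros sec[OF uxxc] ut a_at_time t')
        have wtc: "continuous_on ({0<..} \<times> {0..1}) (\<lambda>z. wxx (fst z) (snd z) - lam * w (fst z) (snd z))"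
          by (intro continuous_intros wxxc continuous_on_subset[OF wc]) auto
        show ?thesis
        proof (rule backstepping_time_derivative[OF uc uw wtc wt t rc _ x])
          fix x :: real assume x: "x \<in> {0..1}"
          show "uxx t x + a x t * u t x + low K t (\<lambda>x. uxx t x + a x t * u t x) x = wxx t x - lam * w t x - low Kt t (u t) x"
            by (rule backstepping_identity[OF t'(1) ud[OF t'(2)] uxd[OF t'(2)] sec[OF uxxc t'(2)] uxx_def uw[OF t'(1)] u_0[OF t'(1)] x])
        qed
      qed
      show "u t 1 = - low K t (u t) 1" if "\<theta> = 0" "t \<in> {0..t0}" for t
        using uw[OF that(2), of 1] w_1[OF that(1), of t] that(2) by simp
      show "ux t 1 = - K t (1, 1) * u t 1 - low Kx t (u t) 1" if "\<theta> = 1/2" "t \<in> {0<..t0}" for t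
        using wx_1[OF that(1), of t] that(2) by (simp add: ux_def Q_def)
      \<comment> \<open>The difference splits into \<open>wx - g\<close>, which tends to 0 by strong
        continuity of the flow, and \<open>Q t - Q0\<close>, which tends to 0 uniformly.\<close>
      show "((\<lambda>t. L2_norm (\<lambda>x. ux t x - u0' x)) \<longlongrightarrow> 0) (at_right 0)"
      proof (rule tendstoI)
        fix e :: real assume e: "0 < e"
        then have e2: "0 < e / 2" by simp
        obtain \<delta> where \<delta>: "\<delta> > 0" "\<forall>s\<in>{0..t0}. \<bar>s - 0\<bar> < \<delta> \<longrightarrow> (\<forall>x\<in>{0..1}. \<bar>Q s x - Q 0 x\<bar> < e/2)"
          using continuous_on_uniform_in_time[OF compact_Icc Qc t00 e2] by blast
        have "0 < min \<delta> t0" using \<delta>(1) t0 by simp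
        then have ev: "\<forall>\<^sub>F t in at_right 0. t < min \<delta> t0"
          unfolding eventually_at_right_field by blast
        show "\<forall>\<^sub>F t in at_right 0. dist (L2_norm (\<lambda>x. ux t x - u0' x)) 0 < e"
          using order_tendstoD(2)[OF wx_lim e2] ev eventually_at_right_less[of "0::real"]
        proof eventually_elim
          case (elim t)
          then have t: "t \<in> {0<..t0}" "t \<in> {0..t0}" by auto
          have Qd: "continuous_on {0..1} (\<lambda>x. Q t x - Q0 x)" by (intro continuous_intros Qt t Q0c)
          have "ux t x - u0' x = (wx t x - g x) - (Q t x - Q0 x)" for x by (simp add: ux_def g_def)
          then have "L2_norm (\<lambda>x. ux t x - u0' x) \<le> L2_norm (\<lambda>x. wx t x - g x) + L2_norm (\<lambda>x. Q t x - Q0 x)"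
            using L2_norm_triangle_diff[of "\<lambda>x. wx t x - g x" "\<lambda>x. Q t x - Q0 x"]
            by (simp add: L2_diff continuous_L2 wxt[OF t(1)] weak_deriv_L2(2)[OF wg] Qd del: diff_diff_eq2)
          moreover have "L2_norm (\<lambda>x. Q t x - Q0 x) \<le> e/2"
          proof (rule L2_norm_bound[OF continuous_L2[OF Qd]])
            fix x :: real assume "x \<in> {0<..<1}"
            then have x: "x \<in> {0..1}" by auto
            have "\<bar>t - 0\<bar> < \<delta>" using elim by simp
            then show "\<bar>Q t x - Q0 x\<bar> \<le> e/2" using \<delta>(2) t(2) x Q_init[OF x] by fastforce
          qed
          ultimately show ?case using elim(1) by simp
        qed
      qed
      show "\<exists>E. integrable (leb 0 t0) E \<and> (\<forall>t\<in>{0<..t0}. (L2_norm (uxx t))\<^sup>2 \<le> E t)"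
      proof (intro exI conjI ballI)
        show "integrable (leb 0 t0) (\<lambda>t. 2 * E t + 2 * (C * L2_norm g)\<^sup>2)"
          by (intro Bochner_Integration.integrable_add integrable_mult_right E(1) leb_const_integrable)
        fix t assume t: "t \<in> {0<..t0}"
        have "(L2_norm (uxx t))\<^sup>2 \<le> (L2_norm (wxx t) + C * L2_norm g)\<^sup>2"
          using uxxn[OF t] by (intro power_mono) auto
        also have "\<dots> \<le> 2 * (L2_norm (wxx t))\<^sup>2 + 2 * (C * L2_norm g)\<^sup>2"
          using zero_le_power2[of "L2_norm (wxx t) - C * L2_norm g"] by (simp add: power2_sum power2_diff)
        finally show "(L2_norm (uxx t))\<^sup>2 \<le> 2 * E t + 2 * (C * L2_norm g)\<^sup>2"
          using E(2)[of t] t by auto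
      qed
    qed (use uc uxc uxxc ud uxd u_0 u_init in auto)
    moreover have "sqrt ((L2_norm (u t))\<^sup>2 + (L2_norm (ux t))\<^sup>2) \<le> M * exp (- lam * t) * sqrt ((L2_norm u0)\<^sup>2 + (L2_norm u0')\<^sup>2)"
      if t: "t \<in> {0<..t0}" for t
    proof -
      have "sqrt ((L2_norm (u t))\<^sup>2 + (L2_norm (ux t))\<^sup>2) \<le> L2_norm (u t) + L2_norm (ux t)"
        by (rule sqrt_sum_squares_le_sum) auto
      also have "\<dots> \<le> (c + 1 + 2 * B * c) * N t"
        using un[OF t] uxn[OF t] by (simp add: algebra_simps)
      also have "\<dots> \<le> (c + 1 + 2 * B * c) * (exp (- lam * t) * ((1 + 2 * B) * sqrt ((L2_norm u0)\<^sup>2 + (L2_norm u0')\<^sup>2)))"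
        unfolding N_def using gn c0 B0 by (intro mult_left_mono) auto
      finally show ?thesis by (simp add: M_def mult_ac)
    qed
    ultimately show ?thesis by blast
  qed
  show ?thesis
    by (rule exI[of _ M]) (use M0 main in simp)
qed

end

section \<open>Bochner measurability and integrals\<close>

text \<open>Rounds \<open>t\<close> up to the next multiple of \<open>T / (n + 1)\<close>. Rounding
  up keeps the sample points in \<open>(0,T]\<close> and so avoids time 0, where a solution may lack
  its derivatives.\<close>

definition grid :: "real \<Rightarrow> nat \<Rightarrow> real \<Rightarrow> real" where
  "grid T n t = T * (of_int \<lceil>real (Suc n) * t / T\<rceil> / real (Suc n))"

lemma grid_bounds:
  assumes "0 < T" "t \<in> {0<..<T}"
  shows "grid T n t \<in> {0<..T}" "\<bar>grid T n t - t\<bar> \<le> T / real (Suc n)" "\<lceil>real (Suc n) * t / T\<rceil> \<in> {1..int (Suc n)}"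
proof -
  let ?z = "real (Suc n) * t / T"
  have z: "0 < ?z" "?z < real (Suc n)" using assms by (auto simp: field_simps simp del: of_nat_Suc)
  have c: "1 \<le> \<lceil>?z\<rceil>" using z(1) by linarith
  have "\<lceil>?z\<rceil> \<le> int (Suc n)" using z(2) by (simp only: ceiling_le_iff)
  with c show i: "\<lceil>?z\<rceil> \<in> {1..int (Suc n)}" by simp
  have "0 < real_of_int \<lceil>?z\<rceil>" "real_of_int \<lceil>?z\<rceil> \<le> real (Suc n)" using i by auto
  then have "0 < of_int \<lceil>?z\<rceil> / real (Suc n)" "of_int \<lceil>?z\<rceil> / real (Suc n) \<le> 1"
    by (auto simp: field_simps simp del: of_nat_Suc)
  then have "0 < T * (of_int \<lceil>?z\<rceil> / real (Suc n))" "T * (of_int \<lceil>?z\<rceil> / real (Suc n)) \<le> T * 1"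
    using assms(1) by (intro mult_pos_pos mult_left_mono; simp)+
  then show "grid T n t \<in> {0<..T}"
    by (simp only: grid_def greaterThanAtMost_iff mult_1_right)
  have t: "t = T * (?z / real (Suc n))" using assms(1) by (simp add: field_simps del: of_nat_Suc)
  have "grid T n t - t = T * (of_int \<lceil>?z\<rceil> / real (Suc n)) - T * (?z / real (Suc n))"
    using t by (simp only: grid_def)
  also have "\<dots> = (T / real (Suc n)) * (of_int \<lceil>?z\<rceil> - ?z)"
    by (simp add: field_simps del: of_nat_Suc)
  finally have g: "grid T n t - t = (T / real (Suc n)) * (of_int \<lceil>?z\<rceil> - ?z)" .
  have "\<bar>of_int \<lceil>?z\<rceil> - ?z\<bar> \<le> 1" by linarith
  then have "(T / real (Suc n)) * \<bar>of_int \<lceil>?z\<rceil> - ?z\<bar> \<le> (T / real (Suc n)) * 1"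
    using assms(1) by (intro mult_left_mono) auto
  then show "\<bar>grid T n t - t\<bar> \<le> T / real (Suc n)"
    unfolding g using assms(1) by (simp add: abs_mult)
qed

lemma grid_simple:
  assumes "0 < T"
  shows "simple_function (leb 0 T) (\<lambda>t. f (grid T n t))"
proof -
  have "(\<lambda>t. grid T n t) \<in> borel_measurable lborel"
    unfolding grid_def by measurable
  then have "(\<lambda>t. grid T n t) \<in> borel_measurable lebesgue"
    by (rule measurable_completion)
  then have "(\<lambda>t. grid T n t) \<in> borel_measurable (leb 0 T)"
    by (rule measurable_restrict_space1)
  moreover have "finite ((\<lambda>t. grid T n t) ` space (leb 0 T))"
  proof (rule finite_subset)
    show "(\<lambda>t. grid T n t) ` space (leb 0 T) \<subseteq> (\<lambda>j. T * (of_int j / real (Suc n))) ` {1..int (Suc n)}"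
      using grid_bounds(3)[OF assms] by (auto simp: grid_def simp del: of_nat_Suc)
  qed simp
  ultimately have "simple_function (leb 0 T) (\<lambda>t. grid T n t)"
    by (rule simple_function_borel_measurable)
  then show ?thesis by (rule simple_function_compose1)
qed

text \<open>Sampling at grid points gives simple functions with values in \<open>X\<close>, and
  continuity at positive times makes them converge. The absolute value is taken because
  \<open>N\<close> is an arbitrary functional here.\<close>

lemma strongly_measurable_continuous:
  assumes T: "0 < T" and X: "\<And>t. t \<in> {0<..T} \<Longrightarrow> f t \<in> X"
    and c: "\<And>t e. t \<in> {0<..T} \<Longrightarrow> 0 < e \<Longrightarrow> \<exists>\<delta>>0. \<forall>s\<in>{0<..T}. \<bar>s - t\<bar> < \<delta> \<longrightarrow> \<bar>N (\<lambda>x. f t x - f s x)\<bar> < e"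
  shows "strongly_measurable (leb 0 T) X N f"
  unfolding strongly_measurable_def
proof (intro exI[of _ "\<lambda>n t. f (grid T n t)"] conjI allI)
  show "simple_function (leb 0 T) (\<lambda>t. f (grid T n t))" for n by (rule grid_simple[OF T])
  show "(\<lambda>t. f (grid T n t)) ` space (leb 0 T) \<subseteq> X" for n
    using grid_bounds(1)[OF T] X by auto
  show "AE t in leb 0 T. f t \<in> X \<and> (\<lambda>n. N (\<lambda>x. f t x - f (grid T n t) x)) \<longlonglongrightarrow> 0"
  proof (intro AE_I2 conjI)
    fix t assume "t \<in> space (leb 0 T)"
    then have t: "t \<in> {0<..<T}" by simp
    then have t': "t \<in> {0<..T}" by auto
    then show "f t \<in> X" by (rule X)
    show "(\<lambda>n. N (\<lambda>x. f t x - f (grid T n t) x)) \<longlonglongrightarrow> 0"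
    proof (rule tendstoI)
      fix e :: real assume "0 < e"
      from c[OF t' this] obtain \<delta> where \<delta>: "\<delta> > 0" "\<forall>s\<in>{0<..T}. \<bar>s - t\<bar> < \<delta> \<longrightarrow> \<bar>N (\<lambda>x. f t x - f s x)\<bar> < e" by blast
      have "(\<lambda>n. T / real (Suc n)) \<longlonglongrightarrow> 0"
        using LIMSEQ_Suc[OF lim_const_over_n[of T]] by simp
      then have "\<forall>\<^sub>F n in sequentially. T / real (Suc n) < \<delta>"
        using \<delta>(1) by (intro order_tendstoD)
      then show "\<forall>\<^sub>F n in sequentially. dist (N (\<lambda>x. f t x - f (grid T n t) x)) 0 < e"
      proof eventually_elim
        case (elim n)
        have "\<bar>grid T n t - t\<bar> < \<delta>" using grid_bounds(2)[OF T t, of n] elim by linarith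
        then show ?case using \<delta>(2) grid_bounds(1)[OF T t, of n] by simp
      qed
    qed
  qed
qed

text \<open>The simple functions in question take values in a space of functions. Composing them
  with a real functional \<open>F\<close>, such as evaluation at a point or a pairing, reduces their
  integrals to ordinary ones.\<close>

lemma integral_simple_function_compose:
  fixes F :: "'b \<Rightarrow> real"
  assumes M: "finite_measure M" and s: "simple_function M s"
  shows "(\<integral>t. F (s t) \<partial>M) = (\<Sum>y\<in>s ` space M. measure M (s -` {y} \<inter> space M) * F y)" "integrable M (\<lambda>t. F (s t))"
proof -
  have fin: "finite (s ` space M)" using s by (rule simple_functionD)
  have sets: "s -` {y} \<inter> space M \<in> sets M" for y using s by (rule simple_functionD)
  have eq: "F (s t) = (\<Sum>y\<in>s ` space M. indicat_real (s -` {y} \<inter> space M) t * F y)" if t: "t \<in> space M" for t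
  proof -
    have "(\<Sum>y\<in>s ` space M. indicat_real (s -` {y} \<inter> space M) t * F y) = (\<Sum>y\<in>s ` space M. if y = s t then F (s t) else 0)"
      using t by (intro sum.cong) (auto simp: indicator_def)
    also have "\<dots> = F (s t)" using fin t by simp
    finally show ?thesis by simp
  qed
  have i: "integrable M (\<lambda>t. indicat_real (s -` {y} \<inter> space M) t * F y)" for y
    using sets finite_measure.emeasure_finite[OF M]
    by (intro integrable_mult_left integrable_real_indicator) (auto simp: less_top)
  have "integrable M (\<lambda>t. \<Sum>y\<in>s ` space M. indicat_real (s -` {y} \<inter> space M) t * F y)"
    by (intro Bochner_Integration.integrable_sum i)
  then show "integrable M (\<lambda>t. F (s t))"
    by (subst Bochner_Integration.integrable_cong[OF refl eq])
  have "(\<integral>t. F (s t) \<partial>M) = (\<integral>t. (\<Sum>y\<in>s ` space M. indicat_real (s -` {y} \<inter> space M) t * F y) \<partial>M)"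
    by (rule Bochner_Integration.integral_cong[OF refl eq])
  also have "\<dots> = (\<Sum>y\<in>s ` space M. \<integral>t. indicat_real (s -` {y} \<inter> space M) t * F y \<partial>M)"
    by (rule Bochner_Integration.integral_sum[OF i])
  also have "\<dots> = (\<Sum>y\<in>s ` space M. measure M (s -` {y} \<inter> space M) * F y)"
    using sets by (intro sum.cong) auto
  finally show "(\<integral>t. F (s t) \<partial>M) = (\<Sum>y\<in>s ` space M. measure M (s -` {y} \<inter> space M) * F y)" .
qed

lemma simple_integral_in_eq:
  assumes "finite_measure M" "simple_function M s"
  shows "simple_integral_in M s x = (\<integral>t. s t x \<partial>M)"
  using integral_simple_function_compose(1)[OF assms, of "\<lambda>y. y x"] by (simp add: simple_integral_in_def)

section \<open>Functions continuous for positive times\<close>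

lemma uniform_in_time_half_open:
  fixes f :: "real \<Rightarrow> real \<Rightarrow> real"
  assumes f: "continuous_on ({0<..T} \<times> {0..1}) (\<lambda>w. f (fst w) (snd w))" and t: "t \<in> {0<..T}" and e: "0 < (e::real)"
  shows "\<exists>\<delta>>0. \<forall>s\<in>{0<..T}. \<bar>s - t\<bar> < \<delta> \<longrightarrow> (\<forall>x\<in>{0..1::real}. \<bar>f t x - f s x\<bar> < e)"
proof -
  have "continuous_on ({t/2..T} \<times> {0..1}) (\<lambda>w. f (fst w) (snd w))"
    by (rule continuous_on_subset[OF f]) (use t in auto)
  from continuous_on_uniform_in_time[OF compact_Icc this _ e, of t] t
  obtain \<delta> where \<delta>: "\<delta> > 0" "\<forall>s\<in>{t/2..T}. \<bar>s - t\<bar> < \<delta> \<longrightarrow> (\<forall>x\<in>{0..1}. \<bar>f s x - f t x\<bar> < e)" by auto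
  show ?thesis
  proof (rule exI[of _ "min \<delta> (t/2)"], intro conjI ballI impI)
    show "0 < min \<delta> (t/2)" using \<delta>(1) t by simp
    fix s x assume s: "s \<in> {0<..T}" "\<bar>s - t\<bar> < min \<delta> (t/2)" and x: "x \<in> {0..1::real}"
    then have "\<bar>s - t\<bar> < t/2" "\<bar>s - t\<bar> < \<delta>" by auto
    moreover from this(1) have "t/2 \<le> s" by linarith
    ultimately have "s \<in> {t/2..T}" "\<bar>s - t\<bar> < \<delta>" using s by auto
    then have "\<bar>f s x - f t x\<bar> < e" using \<delta>(2) x by blast
    then show "\<bar>f t x - f s x\<bar> < e" by (simp add: abs_minus_commute)
  qed
qed

lemma half_open_section:
  fixes f :: "real \<Rightarrow> real \<Rightarrow> real"
  assumes f: "continuous_on ({0<..T} \<times> {0..1}) (\<lambda>w. f (fst w) (snd w))" and t: "t \<in> {0<..T}"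
  shows "continuous_on {0..1} (f t :: real \<Rightarrow> real)"
  by (rule continuous_on_section[OF f t order_refl])

lemma L2_norm_diff_in_time:
  fixes f :: "real \<Rightarrow> real \<Rightarrow> real"
  assumes f: "continuous_on ({0<..T} \<times> {0..1}) (\<lambda>w. f (fst w) (snd w))" and t: "t \<in> {0<..T}" and e: "0 < (e::real)"
  shows "\<exists>\<delta>>0. \<forall>s\<in>{0<..T}. \<bar>s - t\<bar> < \<delta> \<longrightarrow> L2_norm (\<lambda>x. f t x - f s x) < e"
proof -
  have "0 < e / 2" using e by simp
  from uniform_in_time_half_open[OF f t this]
  obtain \<delta> where \<delta>: "\<delta> > 0" "\<forall>s\<in>{0<..T}. \<bar>s - t\<bar> < \<delta> \<longrightarrow> (\<forall>x\<in>{0..1::real}. \<bar>f t x - f s x\<bar> < e/2)" by blast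
  have "L2_norm (\<lambda>x. f t x - f s x) < e" if "s \<in> {0<..T}" "\<bar>s - t\<bar> < \<delta>" for s
  proof -
    have "L2_norm (\<lambda>x. f t x - f s x) \<le> e/2"
    proof (rule L2_norm_bound)
      show "(\<lambda>x. f t x - f s x) \<in> L2_space"
        by (intro L2_diff continuous_L2 half_open_section[OF f] t that)
      fix x :: real assume "x \<in> {0<..<1}"
      then have "x \<in> {0..1}" by auto
      then show "\<bar>f t x - f s x\<bar> \<le> e/2" using \<delta>(2) that by (meson less_imp_le)
    qed
    then show ?thesis using e by simp
  qed
  then show ?thesis using \<delta>(1) by blast
qed

lemma L2_norm_square_continuous:
  fixes f :: "real \<Rightarrow> real \<Rightarrow> real"
  assumes f: "continuous_on ({0<..T} \<times> {0..1}) (\<lambda>w. f (fst w) (snd w))"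
  shows "continuous_on {0<..<T} (\<lambda>t. (L2_norm (f t))\<^sup>2)"
proof -
  have "continuous_on ({0<..<T} \<times> {0..1}) (\<lambda>w. f (fst w) (snd w))"
    by (rule continuous_on_subset[OF f]) auto
  then have "continuous_on ({0<..<T} \<times> cbox 0 1) (\<lambda>(t, x). (f t x)\<^sup>2)"
    unfolding case_prod_beta' cbox_interval by (intro continuous_intros)
  then have "continuous_on {0<..<T} (\<lambda>t. integral (cbox 0 1) (\<lambda>x. (f t x)\<^sup>2))"
    by (rule integral_continuous_on_param)
  then show ?thesis
  proof (rule continuous_on_eq)
    fix t assume t: "t \<in> {0<..<T}"
    have c: "continuous_on {0..1} (f t)" by (rule half_open_section[OF f]) (use t in auto)
    have "(L2_norm (f t))\<^sup>2 = (\<integral>x. (f t x)\<^sup>2 \<partial>leb 0 1)" by (simp add: L2_norm_def)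
    also have "\<dots> = integral {0..1} (\<lambda>x. (f t x)\<^sup>2)"
      by (intro continuous_leb_integral continuous_intros c)
    finally show "integral (cbox 0 1) (\<lambda>x. (f t x)\<^sup>2) = (L2_norm (f t))\<^sup>2" by simp
  qed
qed

lemma L2_norm_square_integrable:
  fixes f :: "real \<Rightarrow> real \<Rightarrow> real"
  assumes f: "continuous_on ({0<..T} \<times> {0..1}) (\<lambda>w. f (fst w) (snd w))"
    and E: "integrable (leb 0 T) E" "\<And>t. t \<in> {0<..<T} \<Longrightarrow> (L2_norm (f t))\<^sup>2 \<le> E t"
  shows "integrable (leb 0 T) (\<lambda>t. (L2_norm (f t))\<^sup>2)"
proof (rule Bochner_Integration.integrable_bound[OF E(1)])
  show "(\<lambda>t. (L2_norm (f t))\<^sup>2) \<in> borel_measurable (leb 0 T)"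
    by (rule continuous_leb_measurable[OF L2_norm_square_continuous[OF f]])
  have "norm ((L2_norm (f t))\<^sup>2) \<le> norm (E t)" if "t \<in> {0<..<T}" for t
    using E(2)[OF that] by simp
  then show "AE t in leb 0 T. norm ((L2_norm (f t))\<^sup>2) \<le> norm (E t)" by (intro AE_I2) simp
qed

lemma L2_L2_continuous:
  fixes f :: "real \<Rightarrow> real \<Rightarrow> real"
  assumes T: "0 < T" and f: "continuous_on ({0<..T} \<times> {0..1}) (\<lambda>w. f (fst w) (snd w))"
    and E: "integrable (leb 0 T) E" "\<And>t. t \<in> {0<..<T} \<Longrightarrow> (L2_norm (f t))\<^sup>2 \<le> E t"
  shows "L2_L2 T f"
  unfolding L2_L2_def Bochner_L2_def
proof
  show "strongly_measurable (leb 0 T) L2_space L2_norm f"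
  proof (rule strongly_measurable_continuous[OF T])
    show "f t \<in> L2_space" if "t \<in> {0<..T}" for t by (intro continuous_L2 half_open_section[OF f that])
    show "\<exists>\<delta>>0. \<forall>s\<in>{0<..T}. \<bar>s - t\<bar> < \<delta> \<longrightarrow> \<bar>L2_norm (\<lambda>x. f t x - f s x)\<bar> < e" if "t \<in> {0<..T}" "0 < e" for t e
      using L2_norm_diff_in_time[OF f that] by simp
  qed
  show "integrable (leb 0 T) (\<lambda>t. (L2_norm (f t))\<^sup>2)" by (rule L2_norm_square_integrable[OF f E])
qed

text \<open>Uniform continuity of \<open>h\<close> up to time 0 makes the sampled simple functions
  converge uniformly, so the Bochner integral is the integral in time taken pointwise in
  \<open>x\<close>.\<close>

lemma has_Bochner_integral_in_continuous:
  assumes T: "0 < T" and h: "continuous_on ({0..T} \<times> {0..1}) (\<lambda>w. h (fst w) (snd w))"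
    and W: "\<And>x. x \<in> {0..1} \<Longrightarrow> W x = integral {0..T} (\<lambda>t. h t x)"
  shows "has_Bochner_integral_in (leb 0 T) L2_space L2_norm h W"
proof -
  have h': "continuous_on ({0<..T} \<times> {0..1}) (\<lambda>w. h (fst w) (snd w))"
    by (rule continuous_on_subset[OF h]) auto
  have ht: "continuous_on {0..1} (h t)" if "t \<in> {0..T}" for t
    by (rule continuous_on_section[OF h that order_refl])
  have hx: "continuous_on {0..T} (\<lambda>t. h t x)" if "x \<in> {0..1}" for x
    by (rule continuous_on_compose2[OF h, of _ "\<lambda>t. (t, x)", unfolded fst_conv snd_conv]) (use that in \<open>auto intro!: continuous_intros\<close>)
  have "continuous_on ({0..1} \<times> cbox 0 T) (\<lambda>(x, t). h t x)"
    unfolding case_prod_beta' cbox_interval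
    by (rule continuous_on_compose2[OF h, of _ "\<lambda>w. (snd w, fst w)", unfolded fst_conv snd_conv]) (auto intro!: continuous_intros)
  then have "continuous_on {0..1} (\<lambda>x. integral (cbox 0 T) (\<lambda>t. h t x))"
    by (rule integral_continuous_on_param)
  then have Wc: "continuous_on {0..1} W"
    by (rule continuous_on_eq) (simp add: W)
  have uc: "uniformly_continuous_on ({0..T} \<times> {0..1}) (\<lambda>w. h (fst w) (snd w))"
    by (intro compact_uniformly_continuous h compact_Times) auto
  define s where "s n t = h (grid T n t)" for n t
  have close: "\<forall>\<^sub>F n in sequentially. \<forall>t\<in>{0<..<T}. \<forall>x\<in>{0..1}. \<bar>h t x - s n t x\<bar> < e" if e: "0 < e" for e :: real
  proof -
    obtain \<delta> where \<delta>: "\<delta> > 0" "\<And>w w'. w \<in> {0..T} \<times> {0..1} \<Longrightarrow> w' \<in> {0..T} \<times> {0..1} \<Longrightarrow> dist w' w < \<delta> \<Longrightarrow> dist (h (fst w') (snd w')) (h (fst w) (snd w)) < e"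
      using uc[unfolded uniformly_continuous_on_def, THEN spec, THEN mp, OF e] by blast
    have "(\<lambda>n. T / real (Suc n)) \<longlonglongrightarrow> 0"
      using LIMSEQ_Suc[OF lim_const_over_n[of T]] by simp
    then have "\<forall>\<^sub>F n in sequentially. T / real (Suc n) < \<delta>"
      using \<delta>(1) by (intro order_tendstoD)
    then show ?thesis
    proof (eventually_elim, intro ballI)
      fix n t x assume n: "T / real (Suc n) < \<delta>" and t: "t \<in> {0<..<T}" and x: "x \<in> {0..1::real}"
      have "\<bar>grid T n t - t\<bar> < \<delta>" using grid_bounds(2)[OF T t, of n] n by linarith
      then have "dist (t, x) (grid T n t, x) < \<delta>" by (simp add: dist_Pair_Pair dist_real_def)
      then have "dist (h t x) (h (grid T n t) x) < e"
        using \<delta>(2)[of "(grid T n t, x)" "(t, x)"] grid_bounds(1)[OF T t, of n] t x by auto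
      then show "\<bar>h t x - s n t x\<bar> < e" by (simp add: s_def dist_real_def)
    qed
  qed
  have st: "continuous_on {0..1} (s n t)" if "t \<in> {0<..<T}" for n t
    unfolding s_def using grid_bounds(1)[OF T that, of n] by (intro ht) auto
  have simple: "simple_function (leb 0 T) (s n)" for n
    unfolding s_def[abs_def] by (rule grid_simple[OF T])
  have im: "s n ` space (leb 0 T) \<subseteq> L2_space" for n
    using st continuous_L2 by auto
  show ?thesis
    unfolding has_Bochner_integral_in_def
  proof (intro conjI exI[of _ s] allI simple im)
    show "strongly_measurable (leb 0 T) L2_space L2_norm h"
    proof (rule strongly_measurable_continuous[OF T])
      show "h t \<in> L2_space" if "t \<in> {0<..T}" for t by (intro continuous_L2 half_open_section[OF h' that])
      show "\<exists>\<delta>>0. \<forall>s\<in>{0<..T}. \<bar>s - t\<bar> < \<delta> \<longrightarrow> \<bar>L2_norm (\<lambda>x. h t x - h s x)\<bar> < e" if "t \<in> {0<..T}" "0 < e" for t e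
        using L2_norm_diff_in_time[OF h' that] by simp
    qed
    show "W \<in> L2_space" by (rule continuous_L2[OF Wc])
    show "(\<lambda>n. \<integral>\<^sup>+t. ennreal (L2_norm (\<lambda>x. h t x - s n t x)) \<partial>leb 0 T) \<longlonglongrightarrow> 0"
    proof (rule tendsto_zero_ennreal)
      fix r :: real assume r: "0 < r"
      \<comment> \<open>Integrated over an interval of length \<open>T\<close> this error amounts to
        r/2.\<close>
      have "0 < r / (2 * T)" using r T by simp
      from close[OF this]
      show "\<forall>\<^sub>F n in sequentially. (\<integral>\<^sup>+t. ennreal (L2_norm (\<lambda>x. h t x - s n t x)) \<partial>leb 0 T) < ennreal r"
      proof eventually_elim
        case (elim n)
        have "(\<integral>\<^sup>+t. ennreal (L2_norm (\<lambda>x. h t x - s n t x)) \<partial>leb 0 T) \<le> (\<integral>\<^sup>+t. ennreal (r / (2 * T)) \<partial>leb 0 T)"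
        proof (rule nn_integral_mono)
          fix t assume "t \<in> space (leb 0 T)"
          then have t: "t \<in> {0<..<T}" by simp
          have "L2_norm (\<lambda>x. h t x - s n t x) \<le> r / (2 * T)"
          proof (rule L2_norm_bound)
            show "(\<lambda>x. h t x - s n t x) \<in> L2_space" using t by (intro L2_diff continuous_L2 ht st) auto
            show "\<bar>h t x - s n t x\<bar> \<le> r / (2 * T)" if "x \<in> {0<..<1}" for x
              using elim[rule_format, OF t, of x] that by simp
          qed
          then show "ennreal (L2_norm (\<lambda>x. h t x - s n t x)) \<le> ennreal (r / (2 * T))" by (rule ennreal_leI)
        qed
        also have "\<dots> = ennreal (r / (2 * T)) * emeasure (leb 0 T) (space (leb 0 T))"
          by (rule nn_integral_const)
        also have "emeasure (leb 0 T) (space (leb 0 T)) = ennreal T"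
          using T by (simp add: emeasure_restrict_space)
        also have "ennreal (r / (2 * T)) * ennreal T = ennreal (r / 2)"
          using r T by (simp add: ennreal_mult[symmetric])
        also have "\<dots> < ennreal r" using r by (simp add: ennreal_lessI)
        finally show ?case .
      qed
    qed
    show "(\<lambda>n. L2_norm (\<lambda>x. simple_integral_in (leb 0 T) (s n) x - W x)) \<longlonglongrightarrow> 0"
    proof (rule tendstoI)
      fix r :: real assume r: "0 < r"
      have "0 < r / (2 * T)" using r T by simp
      from close[OF this]
      show "\<forall>\<^sub>F n in sequentially. dist (L2_norm (\<lambda>x. simple_integral_in (leb 0 T) (s n) x - W x)) 0 < r"
      proof eventually_elim
        case (elim n)
        have sc: "continuous_on {0..1} (simple_integral_in (leb 0 T) (s n))"
          unfolding simple_integral_in_def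
          by (intro continuous_on_sum continuous_on_mult continuous_on_const) (auto intro: st)
        have "L2_norm (\<lambda>x. simple_integral_in (leb 0 T) (s n) x - W x) \<le> r / 2"
        proof (rule L2_norm_bound)
          show "(\<lambda>x. simple_integral_in (leb 0 T) (s n) x - W x) \<in> L2_space"
            by (intro L2_diff continuous_L2 sc Wc)
          fix x :: real assume "x \<in> {0<..<1}"
          then have x: "x \<in> {0..1}" by auto
          have "simple_function (leb 0 T) (\<lambda>t. s n t x)"
            unfolding s_def by (rule grid_simple[OF T])
          then have "(\<lambda>t. s n t x) \<in> borel_measurable (leb 0 T)" by (rule borel_measurable_simple_function)
          moreover have hi: "integrable (leb 0 T) (\<lambda>t. h t x)" by (rule continuous_leb_integrable[OF hx[OF x]])
          ultimately have si: "integrable (leb 0 T) (\<lambda>t. s n t x)"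
          proof -
            assume m: "(\<lambda>t. s n t x) \<in> borel_measurable (leb 0 T)"
            have "integrable (leb 0 T) (\<lambda>t. \<bar>h t x\<bar> + r / (2 * T))"
              using hi by (intro Bochner_Integration.integrable_add integrable_abs leb_const_integrable)
            then show ?thesis
            proof (rule Bochner_Integration.integrable_bound[OF _ m])
              have "norm (s n t x) \<le> norm (\<bar>h t x\<bar> + r / (2 * T))" if "t \<in> {0<..<T}" for t
                using elim[rule_format, OF that x] by simp
              then show "AE t in leb 0 T. norm (s n t x) \<le> norm (\<bar>h t x\<bar> + r / (2 * T))" by (intro AE_I2) simp
            qed
          qed
          have "simple_integral_in (leb 0 T) (s n) x - W x = (\<integral>t. s n t x \<partial>leb 0 T) - (\<integral>t. h t x \<partial>leb 0 T)"
            using simple_integral_in_eq[OF finite_leb simple] W[OF x] continuous_leb_integral[OF hx[OF x]] by simp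
          also have "\<dots> = (\<integral>t. s n t x - h t x \<partial>leb 0 T)" using si hi by simp
          finally have "\<bar>simple_integral_in (leb 0 T) (s n) x - W x\<bar> \<le> (\<integral>t. \<bar>s n t x - h t x\<bar> \<partial>leb 0 T)"
            using integral_abs_bound[of "leb 0 T" "\<lambda>t. s n t x - h t x"] by simp
          also have "\<dots> \<le> (\<integral>t. r / (2 * T) \<partial>leb 0 T)"
          proof (rule integral_mono)
            show "\<bar>s n t x - h t x\<bar> \<le> r / (2 * T)" if "t \<in> space (leb 0 T)" for t
              using elim[rule_format, of t x] that x by (simp add: abs_minus_commute)
          qed (use si hi in auto)
          also have "\<dots> = r / 2" using T leb_const_integral[of 0 T "r / (2 * T)"] by simp
          finally show "\<bar>simple_integral_in (leb 0 T) (s n) x - W x\<bar> \<le> r / 2" .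
        qed
        then show ?case using r by simp
      qed
    qed
  qed
qed

context backstepping_kernel
begin

text \<open>Measurability in time follows from continuity at positive times. Square integrability
  comes from the bound \<open>D\<close> for \<open>u\<close> and \<open>ux\<close>, and from the
  integrable bound in \<open>classical_solution\<close> for \<open>uxx\<close>.\<close>

theorem classical_solution_regular:
  assumes cs: "classical_solution \<theta> u0 u0' u ux uxx" and u0w: "weak_deriv u0 u0'"
    and D: "\<And>t. t \<in> {0<..t0} \<Longrightarrow> sqrt ((L2_norm (u t))\<^sup>2 + (L2_norm (ux t))\<^sup>2) \<le> D"
  shows "C_H1 t0 u" "L2_H2 t0 u" "time_weak_deriv t0 u (\<lambda>t x. uxx t x + a x t * u t x)"
proof -
  have uc: "continuous_on ({0..t0} \<times> {0..1}) (\<lambda>w. u (fst w) (snd w))"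
    and uxc: "continuous_on ({0<..t0} \<times> {0..1}) (\<lambda>w. ux (fst w) (snd w))"
    and uxxc: "continuous_on ({0<..t0} \<times> {0..1}) (\<lambda>w. uxx (fst w) (snd w))"
    and ud: "\<And>t x. t \<in> {0<..t0} \<Longrightarrow> x \<in> {0..1} \<Longrightarrow> (u t has_real_derivative ux t x) (at x within {0..1})"
    and uxd: "\<And>t x. t \<in> {0<..t0} \<Longrightarrow> x \<in> {0..1} \<Longrightarrow> (ux t has_real_derivative uxx t x) (at x within {0..1})"
    and utd: "\<And>t x. t \<in> {0<..<t0} \<Longrightarrow> x \<in> {0..1} \<Longrightarrow> ((\<lambda>t. u t x) has_real_derivative uxx t x + a x t * u t x) (at t)"
    and ui: "\<And>x. x \<in> {0..1} \<Longrightarrow> u 0 x = u0 x"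
    and lim0: "((\<lambda>t. L2_norm (\<lambda>x. ux t x - u0' x)) \<longlongrightarrow> 0) (at_right 0)"
    and Eex: "\<exists>E. integrable (leb 0 t0) E \<and> (\<forall>t\<in>{0<..t0}. (L2_norm (uxx t))\<^sup>2 \<le> E t)"
    using cs unfolding classical_solution_def by auto
  obtain E where E: "integrable (leb 0 t0) E" "\<And>t. t \<in> {0<..t0} \<Longrightarrow> (L2_norm (uxx t))\<^sup>2 \<le> E t"
    using Eex by blast
  have uc': "continuous_on ({0<..t0} \<times> {0..1}) (\<lambda>w. u (fst w) (snd w))"
    by (rule continuous_on_subset[OF uc]) auto
  have ut: "continuous_on {0..1} (u t)" if "t \<in> {0..t0}" for t
    by (rule continuous_on_section[OF uc that order_refl])
  have w1: "weak_deriv (u t) (ux t)" if "t \<in> {0<..t0}" for t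
    by (rule weak_deriv_classical[OF ud[OF that] half_open_section[OF uxc that]])
  have w2: "weak_deriv (ux t) (uxx t)" if "t \<in> {0<..t0}" for t
    by (rule weak_deriv_classical[OF uxd[OF that] half_open_section[OF uxxc that]])
  have w0: "weak_deriv (u 0) u0'"
  proof (rule weak_deriv_AE_cong[OF u0w])
    show "AE x in leb 0 1. u0 x = u 0 x" using ui by (intro AE_I2) simp
  qed simp
  have D2: "(L2_norm (u t))\<^sup>2 + (L2_norm (ux t))\<^sup>2 \<le> D\<^sup>2" if "t \<in> {0<..t0}" for t
  proof -
    have "(sqrt ((L2_norm (u t))\<^sup>2 + (L2_norm (ux t))\<^sup>2))\<^sup>2 \<le> D\<^sup>2"
      using D[OF that] by (intro power_mono) auto
    then show ?thesis by simp
  qed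
  have un: "(L2_norm (u t))\<^sup>2 \<le> D\<^sup>2" "(L2_norm (ux t))\<^sup>2 \<le> D\<^sup>2" if "t \<in> {0<..t0}" for t
    using D2[OF that] zero_le_power2[of "L2_norm (u t)"] zero_le_power2[of "L2_norm (ux t)"] by linarith+
  show "C_H1 t0 u"
    unfolding C_H1_def
  proof (intro conjI ballI)
    fix t assume t: "t \<in> {0..t0}"
    show "u t \<in> H1_space"
    proof (cases "t = 0")
      case True then show ?thesis using w0 ut[OF t] by (auto simp: H1_space_def)
    next
      case False
      then have "t \<in> {0<..t0}" using t by auto
      then show ?thesis using w1 ut[OF t] by (auto simp: H1_space_def)
    qed
  next
    fix s assume s: "s \<in> {0..t0}"
    show "((\<lambda>t. H1_norm (\<lambda>x. u t x - u s x)) \<longlongrightarrow> 0) (at s within {0..t0})"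
    proof (rule tendstoI)
      fix e :: real assume e: "0 < e"
      then have e2: "0 < e/2" by simp
      have sq: "H1_norm f < e" if "weak_deriv f g" "L2_norm f < e/2" "L2_norm g < e/2" for f g
        unfolding H1_norm_eq[OF that(1)] using sqrt_sum_squares_le_sum[of "L2_norm f" "L2_norm g"] that(2,3) by simp
      have nn: "0 \<le> H1_norm f" for f by (simp add: H1_norm_def)
      show "\<forall>\<^sub>F t in at s within {0..t0}. dist (H1_norm (\<lambda>x. u t x - u s x)) 0 < e"
      proof (cases "s = 0")
        case False
        then have s': "s \<in> {0<..t0}" using s by auto
        obtain \<delta>1 where \<delta>1: "\<delta>1 > 0" "\<forall>t\<in>{0<..t0}. \<bar>t - s\<bar> < \<delta>1 \<longrightarrow> L2_norm (\<lambda>x. u s x - u t x) < e/2"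
          using L2_norm_diff_in_time[OF uc' s' e2] by blast
        obtain \<delta>2 where \<delta>2: "\<delta>2 > 0" "\<forall>t\<in>{0<..t0}. \<bar>t - s\<bar> < \<delta>2 \<longrightarrow> L2_norm (\<lambda>x. ux s x - ux t x) < e/2"
          using L2_norm_diff_in_time[OF uxc s' e2] by blast
        show ?thesis
          unfolding eventually_at
        proof (intro exI[of _ "min (min \<delta>1 \<delta>2) s"] conjI ballI impI)
          show "0 < min (min \<delta>1 \<delta>2) s" using \<delta>1(1) \<delta>2(1) s' by simp
          fix t assume t: "t \<in> {0..t0}" "t \<noteq> s \<and> dist t s < min (min \<delta>1 \<delta>2) s"
          then have t': "t \<in> {0<..t0}" "\<bar>t - s\<bar> < \<delta>1" "\<bar>t - s\<bar> < \<delta>2" by (auto simp: dist_real_def)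
          have "H1_norm (\<lambda>x. u t x - u s x) < e"
          proof (rule sq[OF weak_deriv_diff[OF w1[OF t'(1)] w1[OF s']]])
            show "L2_norm (\<lambda>x. u t x - u s x) < e/2"
              using \<delta>1(2) t'(1,2) by (simp add: L2_norm_minus_commute[of "u t"])
            show "L2_norm (\<lambda>x. ux t x - ux s x) < e/2"
              using \<delta>2(2) t'(1,3) by (simp add: L2_norm_minus_commute[of "ux t"])
          qed
          then show "dist (H1_norm (\<lambda>x. u t x - u s x)) 0 < e" using nn by simp
        qed
      next
        \<comment> \<open>At time 0 there is no \<open>ux\<close>; the weak derivative of the
          initial value takes its place.\<close>
        case True
        have t00: "0 \<in> {0..t0}" using t0 by simp
        have e4: "0 < e/4" using e by simp
        obtain \<delta>1 where \<delta>1: "\<delta>1 > 0" "\<forall>s\<in>{0..t0}. \<bar>s - 0\<bar> < \<delta>1 \<longrightarrow> (\<forall>x\<in>{0..1}. \<bar>u s x - u 0 x\<bar> < e/4)"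
          using continuous_on_uniform_in_time[OF compact_Icc uc t00 e4] by blast
        obtain \<delta>2 where \<delta>2: "\<delta>2 > 0" "\<forall>t>0. t < \<delta>2 \<longrightarrow> L2_norm (\<lambda>x. ux t x - u0' x) < e/2"
          using order_tendstoD(2)[OF lim0 e2] unfolding eventually_at_right_field by blast
        show ?thesis
          unfolding eventually_at
        proof (intro exI[of _ "min \<delta>1 \<delta>2"] conjI ballI impI)
          show "0 < min \<delta>1 \<delta>2" using \<delta>1(1) \<delta>2(1) by simp
          fix t assume t: "t \<in> {0..t0}" "t \<noteq> s \<and> dist t s < min \<delta>1 \<delta>2"
          then have t': "t \<in> {0<..t0}" "\<bar>t - 0\<bar> < \<delta>1" "0 < t" "t < \<delta>2" using True by (auto simp: dist_real_def)
          have "H1_norm (\<lambda>x. u t x - u 0 x) < e"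
          proof (rule sq[OF weak_deriv_diff[OF w1[OF t'(1)] w0]])
            have "L2_norm (\<lambda>x. u t x - u 0 x) \<le> e/4"
            proof (rule L2_norm_bound)
              show "(\<lambda>x. u t x - u 0 x) \<in> L2_space" by (intro L2_diff continuous_L2 ut t t00)
              fix x :: real assume "x \<in> {0<..<1}"
              then have "x \<in> {0..1}" by auto
              then show "\<bar>u t x - u 0 x\<bar> \<le> e/4" using \<delta>1(2)[rule_format, OF t(1) t'(2)] less_imp_le by blast
            qed
            then show "L2_norm (\<lambda>x. u t x - u 0 x) < e/2" using e by simp
            show "L2_norm (\<lambda>x. ux t x - u0' x) < e/2" using \<delta>2(2) t'(3,4) by blast
          qed
          then show "dist (H1_norm (\<lambda>x. u t x - u s x)) 0 < e" using nn True by simp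
        qed
      qed
    qed
  qed
  show "L2_H2 t0 u"
    unfolding L2_H2_def Bochner_L2_def
  proof
    show "strongly_measurable (leb 0 t0) H2_space H2_norm u"
    proof (rule strongly_measurable_continuous[OF t0])
      show "u t \<in> H2_space" if "t \<in> {0<..t0}" for t
        using w1[OF that] w2[OF that] half_open_section[OF uxc that] half_open_section[OF uc' that]
        by (auto simp: H2_space_def H1_space_def)
      fix t e assume t: "t \<in> {0<..t0}" and e: "0 < (e::real)"
      then have e3: "0 < e/3" by simp
      obtain \<delta>0 where \<delta>0: "\<delta>0 > 0" "\<forall>s\<in>{0<..t0}. \<bar>s - t\<bar> < \<delta>0 \<longrightarrow> L2_norm (\<lambda>x. u t x - u s x) < e/3"
        using L2_norm_diff_in_time[OF uc' t e3] by blast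
      obtain \<delta>1 where \<delta>1: "\<delta>1 > 0" "\<forall>s\<in>{0<..t0}. \<bar>s - t\<bar> < \<delta>1 \<longrightarrow> L2_norm (\<lambda>x. ux t x - ux s x) < e/3"
        using L2_norm_diff_in_time[OF uxc t e3] by blast
      obtain \<delta>2 where \<delta>2: "\<delta>2 > 0" "\<forall>s\<in>{0<..t0}. \<bar>s - t\<bar> < \<delta>2 \<longrightarrow> L2_norm (\<lambda>x. uxx t x - uxx s x) < e/3"
        using L2_norm_diff_in_time[OF uxxc t e3] by blast
      show "\<exists>\<delta>>0. \<forall>s\<in>{0<..t0}. \<bar>s - t\<bar> < \<delta> \<longrightarrow> \<bar>H2_norm (\<lambda>x. u t x - u s x)\<bar> < e"
      proof (intro exI[of _ "min \<delta>0 (min \<delta>1 \<delta>2)"] conjI ballI impI)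
        show "0 < min \<delta>0 (min \<delta>1 \<delta>2)" using \<delta>0(1) \<delta>1(1) \<delta>2(1) by simp
        fix s assume s: "s \<in> {0<..t0}" "\<bar>s - t\<bar> < min \<delta>0 (min \<delta>1 \<delta>2)"
        let ?A = "L2_norm (\<lambda>x. u t x - u s x)" and ?B = "L2_norm (\<lambda>x. ux t x - ux s x)" and ?C = "L2_norm (\<lambda>x. uxx t x - uxx s x)"
        have abc: "?A < e/3" "?B < e/3" "?C < e/3" using \<delta>0(2) \<delta>1(2) \<delta>2(2) s by auto
        have "H2_norm (\<lambda>x. u t x - u s x) = sqrt (?A\<^sup>2 + ?B\<^sup>2 + ?C\<^sup>2)"
          by (rule H2_norm_eq[OF weak_deriv_diff[OF w1[OF t] w1[OF s(1)]] weak_deriv_diff[OF w2[OF t] w2[OF s(1)]]])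
        also have "\<dots> = sqrt ((sqrt (?A\<^sup>2 + ?B\<^sup>2))\<^sup>2 + ?C\<^sup>2)" by simp
        also have "\<dots> \<le> sqrt (?A\<^sup>2 + ?B\<^sup>2) + ?C" by (rule sqrt_sum_squares_le_sum) auto
        also have "sqrt (?A\<^sup>2 + ?B\<^sup>2) \<le> ?A + ?B" by (rule sqrt_sum_squares_le_sum) auto
        finally have "H2_norm (\<lambda>x. u t x - u s x) < e" using abc by simp
        moreover have "0 \<le> H2_norm (\<lambda>x. u t x - u s x)" by (simp add: H2_norm_def)
        ultimately show "\<bar>H2_norm (\<lambda>x. u t x - u s x)\<bar> < e" by simp
      qed
    qed
    have i: "integrable (leb 0 t0) (\<lambda>t. (L2_norm (u t))\<^sup>2 + (L2_norm (ux t))\<^sup>2 + (L2_norm (uxx t))\<^sup>2)"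
      using un E by (intro Bochner_Integration.integrable_add L2_norm_square_integrable[OF uc' leb_const_integrable[of _ _ "D\<^sup>2"]]
        L2_norm_square_integrable[OF uxc leb_const_integrable[of _ _ "D\<^sup>2"]] L2_norm_square_integrable[OF uxxc E(1)]) auto
    have "(H2_norm (u t))\<^sup>2 = (L2_norm (u t))\<^sup>2 + (L2_norm (ux t))\<^sup>2 + (L2_norm (uxx t))\<^sup>2" if "t \<in> {0<..<t0}" for t
      using that by (subst H2_norm_eq[OF w1 w2]) auto
    then show "integrable (leb 0 t0) (\<lambda>t. (H2_norm (u t))\<^sup>2)"
      by (subst Bochner_Integration.integrable_cong[OF refl, where g = "\<lambda>t. (L2_norm (u t))\<^sup>2 + (L2_norm (ux t))\<^sup>2 + (L2_norm (uxx t))\<^sup>2"]) (use i in auto)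
  qed
  define v where "v t x = uxx t x + a x t * u t x" for t x
  have ac: "continuous_on ({0<..t0} \<times> {0..1}) (\<lambda>w. a (snd w) (fst w))"
    by (rule continuous_on_subset[OF a_cont]) auto
  have vc: "continuous_on ({0<..t0} \<times> {0..1}) (\<lambda>w. v (fst w) (snd w))"
    unfolding v_def by (intro continuous_on_add continuous_on_mult uxxc uc' ac)
  obtain A where A: "0 \<le> A" "\<forall>w\<in>{0..t0} \<times> {0..1}. \<bar>a (snd w) (fst w)\<bar> \<le> A"
    using compact_abs_bound_ex[OF compact_Times[OF compact_Icc compact_Icc] a_cont] by blast
  have vn: "(L2_norm (v t))\<^sup>2 \<le> 2 * E t + 2 * A\<^sup>2 * D\<^sup>2" if t: "t \<in> {0<..t0}" for t
  proof -
    have t': "t \<in> {0..t0}" using t by auto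
    have auc: "continuous_on {0..1} (\<lambda>x. a x t * u t x)" by (intro continuous_intros a_at_time ut t')
    have "L2_norm (\<lambda>x. a x t * u t x) \<le> L2_norm (\<lambda>x. A * u t x)"
    proof (rule L2_norm_mono)
      fix x :: real assume "x \<in> {0<..<1}"
      then have "\<bar>a x t\<bar> \<le> A" using bspec[OF A(2), of "(t, x)"] t' by auto
      then show "\<bar>a x t * u t x\<bar> \<le> \<bar>A * u t x\<bar>" using A(1) by (simp add: abs_mult mult_right_mono)
    qed (intro continuous_L2 auc L2_cmult ut t')+
    then have an: "L2_norm (\<lambda>x. a x t * u t x) \<le> A * L2_norm (u t)" using A(1) by (simp add: L2_norm_cmult)
    have "L2_norm (v t) \<le> L2_norm (uxx t) + L2_norm (\<lambda>x. a x t * u t x)"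
      unfolding v_def[abs_def] by (intro L2_norm_triangle continuous_L2 auc half_open_section[OF uxxc t])
    then have "L2_norm (v t) \<le> L2_norm (uxx t) + A * L2_norm (u t)" using an by linarith
    then have "(L2_norm (v t))\<^sup>2 \<le> (L2_norm (uxx t) + A * L2_norm (u t))\<^sup>2" by (intro power_mono) auto
    also have "\<dots> \<le> 2 * (L2_norm (uxx t))\<^sup>2 + 2 * (A * L2_norm (u t))\<^sup>2"
      using zero_le_power2[of "L2_norm (uxx t) - A * L2_norm (u t)"] by (simp add: power2_sum power2_diff)
    also have "(A * L2_norm (u t))\<^sup>2 = A\<^sup>2 * (L2_norm (u t))\<^sup>2" by (rule power_mult_distrib)
    also have "2 * (L2_norm (uxx t))\<^sup>2 + 2 * (A\<^sup>2 * (L2_norm (u t))\<^sup>2) \<le> 2 * E t + 2 * (A\<^sup>2 * D\<^sup>2)"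
      using E(2)[OF t] un(1)[OF t] by (intro add_mono mult_left_mono) auto
    finally show ?thesis by (simp add: mult.assoc)
  qed
  have "time_weak_deriv t0 u v"
    unfolding time_weak_deriv_def
  proof (intro conjI allI impI)
    show "L2_L2 t0 u" by (rule L2_L2_continuous[OF t0 uc' leb_const_integrable[of _ _ "D\<^sup>2"]]) (use un in auto)
    show "L2_L2 t0 v"
    proof (rule L2_L2_continuous[OF t0 vc])
      show "integrable (leb 0 t0) (\<lambda>t. 2 * E t + 2 * A\<^sup>2 * D\<^sup>2)"
        by (intro Bochner_Integration.integrable_add integrable_mult_right E(1) leb_const_integrable)
    qed (use vn in auto)
    fix \<phi> \<phi>' assume tf: "test_function 0 t0 \<phi> \<phi>'"
    have \<phi>c: "continuous_on S \<phi>" "continuous_on S \<phi>'" for S by (rule test_function_continuous[OF tf])+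
    have \<phi>d: "(\<phi> has_real_derivative \<phi>' t) (at t)" for t using tf by (simp add: test_function_def)
    obtain p q where pq: "0 < p" "q < t0" "\<And>t. t \<notin> {p..q} \<Longrightarrow> \<phi> t = 0"
      using tf by (auto simp: test_function_def)
    have \<phi>0: "\<phi> 0 = 0" "\<phi> t0 = 0" using test_function_outside[OF tf] by auto
    have \<phi>cc: "continuous_on (S \<times> {0..1}) (\<lambda>w. \<phi> (fst w))" "continuous_on (S \<times> {0..1}) (\<lambda>w. \<phi>' (fst w))" for S :: "real set"
      by (auto intro!: continuous_on_compose2[OF \<phi>c(1)[of UNIV]] continuous_on_compose2[OF \<phi>c(2)[of UNIV]] continuous_intros)
    have h1: "continuous_on ({0..t0} \<times> {0..1}) (\<lambda>w. \<phi>' (fst w) * u (fst w) (snd w))"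
      by (intro continuous_on_mult uc \<phi>cc)
    \<comment> \<open>\<open>v\<close> may be unbounded as t tends to 0, but \<open>\<phi>\<close>
      vanishes near 0, so the product is continuous up to t = 0.\<close>
    have h2: "continuous_on ({0..t0} \<times> {0..1}) (\<lambda>w. \<phi> (fst w) * v (fst w) (snd w))"
    proof -
      define p' where "p' = min p t0 / 2"
      have p': "0 < p'" "p' < p" "p' < t0" using pq(1) t0 by (auto simp: p'_def min_def)
      have c1: "continuous_on ({0..p'} \<times> {0..1}) (\<lambda>w. \<phi> (fst w) * v (fst w) (snd w))"
      proof (rule continuous_on_eq[OF continuous_on_const[of _ 0]])
        fix w assume "w \<in> {0..p'} \<times> {0..1::real}"
        then have "fst w \<notin> {p..q}" using p' by auto
        then show "0 = \<phi> (fst w) * v (fst w) (snd w)" using pq(3) by simp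
      qed
      have c2: "continuous_on ({p'..t0} \<times> {0..1}) (\<lambda>w. \<phi> (fst w) * v (fst w) (snd w))"
        by (intro continuous_on_mult \<phi>cc continuous_on_subset[OF vc]) (use p' in auto)
      have "continuous_on ({0..p'} \<times> {0..1} \<union> {p'..t0} \<times> {0..1}) (\<lambda>w. \<phi> (fst w) * v (fst w) (snd w))"
        by (intro continuous_on_closed_Un c1 c2 closed_Times) auto
      moreover have "{0..p'} \<times> {0..1} \<union> {p'..t0} \<times> {0..1} = {0..t0} \<times> {0..1::real}" using p' by auto
      ultimately show ?thesis by simp
    qed
    define W where "W x = integral {0..t0} (\<lambda>t. \<phi>' t * u t x)" for x
    have "- W x = integral {0..t0} (\<lambda>t. \<phi> t * v t x)" if x: "x \<in> {0..1}" for x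
    proof -
      have sec: "continuous_on {0..t0} (\<lambda>t. h t x)" if "continuous_on ({0..t0} \<times> {0..1}) (\<lambda>w. h (fst w) (snd w))" for h :: "real \<Rightarrow> real \<Rightarrow> real"
        by (rule continuous_on_compose2[OF that, of _ "\<lambda>t. (t, x)", unfolded fst_conv snd_conv]) (use x in \<open>auto intro!: continuous_intros\<close>)
      have "((\<lambda>t. \<phi>' t * u t x + \<phi> t * v t x) has_integral \<phi> t0 * u t0 x - \<phi> 0 * u 0 x) {0..t0}"
      \<comment> \<open>The time derivative is available on the open interval only; at the two ends
        continuity of \<open>u\<close> is enough.\<close>
      proof (rule fundamental_theorem_of_calculus_interior)
        show "continuous_on {0..t0} (\<lambda>t. \<phi> t * u t x)" by (intro continuous_on_mult \<phi>c sec[OF uc])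
        fix t assume t: "t \<in> {0<..<t0}"
        have "((\<lambda>t. \<phi> t * u t x) has_real_derivative \<phi>' t * u t x + v t x * \<phi> t) (at t)"
          unfolding v_def by (intro DERIV_mult \<phi>d utd t x)
        then show "((\<lambda>t. \<phi> t * u t x) has_vector_derivative \<phi>' t * u t x + \<phi> t * v t x) (at t)"
          by (simp add: has_real_derivative_iff_has_vector_derivative[symmetric] mult.commute)
      qed (use t0 in auto)
      then have "integral {0..t0} (\<lambda>t. \<phi>' t * u t x + \<phi> t * v t x) = 0" using \<phi>0 by (simp add: integral_unique)
      moreover have "integral {0..t0} (\<lambda>t. \<phi>' t * u t x + \<phi> t * v t x) = W x + integral {0..t0} (\<lambda>t. \<phi> t * v t x)"
        unfolding W_def using sec[of "\<lambda>t x. \<phi>' t * u t x"] sec[of "\<lambda>t x. \<phi> t * v t x"] h1 h2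
        by (intro Henstock_Kurzweil_Integration.integral_add integrable_continuous_interval) auto
      ultimately show ?thesis by simp
    qed
    then show "\<exists>w. has_Bochner_integral_in (leb 0 t0) L2_space L2_norm (\<lambda>t x. \<phi>' t * u t x) w \<and>
             has_Bochner_integral_in (leb 0 t0) L2_space L2_norm (\<lambda>t x. \<phi> t * v t x) (\<lambda>x. - w x)"
      by (intro exI[of _ W] conjI has_Bochner_integral_in_continuous[OF t0 h1] has_Bochner_integral_in_continuous[OF t0 h2]) (simp_all add: W_def)
  qed
  then show "time_weak_deriv t0 u (\<lambda>t x. uxx t x + a x t * u t x)"
    by (simp add: v_def[abs_def])
qed

end

section \<open>Uniqueness by duality\<close>

text \<open>Cauchy-Schwarz makes the pairing with \<open>p\<close> an almost everywhere limit of
  pairings of simple functions; completeness of the measure removes the exceptional set.\<close>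

lemma strongly_measurable_pairing:
  assumes f: "strongly_measurable (leb 0 T) L2_space L2_norm f" and p: "p \<in> L2_space"
  shows "(\<lambda>t. ip (f t) p) \<in> borel_measurable (leb 0 T)"
proof -
  obtain s where s: "\<And>n::nat. simple_function (leb 0 T) (s n)" "\<And>n. s n ` space (leb 0 T) \<subseteq> L2_space"
    and lim: "AE t in leb 0 T. f t \<in> L2_space \<and> (\<lambda>n. L2_norm (\<lambda>x. f t x - s n t x)) \<longlonglongrightarrow> 0"
    using f unfolding strongly_measurable_def by blast
  have sm: "(\<lambda>t. ip (s n t) p) \<in> borel_measurable (leb 0 T)" for n
    using integral_simple_function_compose(2)[OF finite_leb s(1), of "\<lambda>g. ip g p" n] by (rule borel_measurable_integrable)
  have "(\<lambda>t. lim (\<lambda>n. ip (s n t) p)) \<in> borel_measurable (leb 0 T)"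
    by (rule borel_measurable_lim_metric[OF sm])
  moreover have "AE t in leb 0 T. lim (\<lambda>n. ip (s n t) p) = ip (f t) p"
    using lim AE_space
  proof eventually_elim
    case (elim t)
    then have ft: "f t \<in> L2_space" and st: "s n t \<in> L2_space" for n
      by (simp, intro subsetD[OF s(2)[of n]] imageI)
    have "(\<lambda>n. ip (s n t) p - ip (f t) p) \<longlonglongrightarrow> 0"
    proof (rule Lim_null_comparison[where g = "\<lambda>n. L2_norm (\<lambda>x. f t x - s n t x) * L2_norm p"])
      have "norm (ip (s n t) p - ip (f t) p) \<le> L2_norm (\<lambda>x. f t x - s n t x) * L2_norm p" for n
        using ip_Cauchy_Schwarz[OF L2_diff[OF ft st[of n]] p] ip_diff_left[OF ft st[of n] p] by (simp add: abs_minus_commute)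
      then show "\<forall>\<^sub>F n in sequentially. norm (ip (s n t) p - ip (f t) p) \<le> L2_norm (\<lambda>x. f t x - s n t x) * L2_norm p"
        by (intro always_eventually allI)
      have "(\<lambda>n. L2_norm (\<lambda>x. f t x - s n t x) * L2_norm p) \<longlonglongrightarrow> 0 * L2_norm p"
        using elim by (intro tendsto_mult tendsto_const) auto
      then show "(\<lambda>n. L2_norm (\<lambda>x. f t x - s n t x) * L2_norm p) \<longlonglongrightarrow> 0" by simp
    qed
    then have "(\<lambda>n. ip (s n t) p) \<longlonglongrightarrow> ip (f t) p" by (rule LIM_zero_cancel)
    then show ?case by (rule limI)
  qed
  ultimately show ?thesis by (rule AE_leb_measurable)
qed

text \<open>Pairing with \<open>p\<close> is a bounded functional, so it commutes with the Bochner
  integral. Integrability belongs to the claim: it holds because some simple approximant is at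
  finite L1 distance.\<close>

lemma has_Bochner_integral_in_pairing:
  assumes f: "has_Bochner_integral_in (leb 0 T) L2_space L2_norm f w" and p: "p \<in> L2_space"
  shows "integrable (leb 0 T) (\<lambda>t. ip (f t) p)" "(\<integral>t. ip (f t) p \<partial>leb 0 T) = ip w p"
proof -
  have sm: "strongly_measurable (leb 0 T) L2_space L2_norm f" and wL: "w \<in> L2_space"
    using f by (auto simp: has_Bochner_integral_in_def)
  obtain s where s: "\<And>n::nat. simple_function (leb 0 T) (s n)" "\<And>n. s n ` space (leb 0 T) \<subseteq> L2_space"
    and l1: "(\<lambda>n. \<integral>\<^sup>+t. ennreal (L2_norm (\<lambda>x. f t x - s n t x)) \<partial>leb 0 T) \<longlonglongrightarrow> 0"
    and l2: "(\<lambda>n. L2_norm (\<lambda>x. simple_integral_in (leb 0 T) (s n) x - w x)) \<longlonglongrightarrow> 0"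
    using f unfolding has_Bochner_integral_in_def by blast
  have m[measurable]: "(\<lambda>t. ip (f t) p) \<in> borel_measurable (leb 0 T)" by (rule strongly_measurable_pairing[OF sm p])
  have si: "integrable (leb 0 T) (\<lambda>t. ip (s n t) p)" for n
    by (rule integral_simple_function_compose(2)[OF finite_leb s(1)])
  note [measurable] = borel_measurable_integrable[OF si]
  have fL: "AE t in leb 0 T. f t \<in> L2_space"
    using sm unfolding strongly_measurable_def by (auto elim: eventually_mono)
  \<comment> \<open>The 1 keeps \<open>c\<close> positive even if \<open>p\<close> is zero, for the
    division below.\<close>
  define c where "c = 1 + L2_norm p"
  have c: "0 < c" by (simp add: c_def add_pos_nonneg)
  \<comment> \<open>The constant is taken out on the side of the pairing, whose measurability in
    time is established, rather than on the side of the norm of the difference.\<close>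
  have le: "(\<integral>\<^sup>+t. ennreal (norm (ip (s n t) p - ip (f t) p)) \<partial>leb 0 T) \<le> ennreal c * (\<integral>\<^sup>+t. ennreal (L2_norm (\<lambda>x. f t x - s n t x)) \<partial>leb 0 T)" for n
  proof -
    have "(\<integral>\<^sup>+t. ennreal (norm (ip (s n t) p - ip (f t) p)) \<partial>leb 0 T) = (\<integral>\<^sup>+t. ennreal c * ennreal (norm (ip (s n t) p - ip (f t) p) / c) \<partial>leb 0 T)"
      using c by (intro nn_integral_cong) (simp add: ennreal_mult[symmetric])
    also have "\<dots> = ennreal c * (\<integral>\<^sup>+t. ennreal (norm (ip (s n t) p - ip (f t) p) / c) \<partial>leb 0 T)"
      by (rule nn_integral_cmult) measurable
    also have "(\<integral>\<^sup>+t. ennreal (norm (ip (s n t) p - ip (f t) p) / c) \<partial>leb 0 T) \<le> (\<integral>\<^sup>+t. ennreal (L2_norm (\<lambda>x. f t x - s n t x)) \<partial>leb 0 T)"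
    proof (rule nn_integral_mono_AE)
      show "AE t in leb 0 T. ennreal (norm (ip (s n t) p - ip (f t) p) / c) \<le> ennreal (L2_norm (\<lambda>x. f t x - s n t x))"
        using fL AE_space
      proof eventually_elim
        case (elim t)
        then have ft: "f t \<in> L2_space" and st: "s n t \<in> L2_space"
          by (simp, intro subsetD[OF s(2)[of n]] imageI)
        have "norm (ip (s n t) p - ip (f t) p) \<le> L2_norm (\<lambda>x. f t x - s n t x) * L2_norm p"
          using ip_Cauchy_Schwarz[OF L2_diff[OF ft st] p] ip_diff_left[OF ft st p] by (simp add: abs_minus_commute)
        also have "\<dots> \<le> L2_norm (\<lambda>x. f t x - s n t x) * c" by (intro mult_left_mono) (auto simp: c_def)
        finally show ?case using c by (intro ennreal_leI) (simp add: divide_le_eq)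
      qed
    qed
    finally show ?thesis by (simp add: mult_left_mono)
  qed
  have l3: "(\<lambda>n. \<integral>\<^sup>+t. ennreal (norm (ip (s n t) p - ip (f t) p)) \<partial>leb 0 T) \<longlonglongrightarrow> 0"
  proof (rule tendsto_sandwich[OF _ _ tendsto_const])
    show "(\<lambda>n. ennreal c * (\<integral>\<^sup>+t. ennreal (L2_norm (\<lambda>x. f t x - s n t x)) \<partial>leb 0 T)) \<longlonglongrightarrow> 0"
      using ennreal_tendsto_cmult[OF _ l1, of "ennreal c"] by simp
  qed (use le in auto)
  have "\<forall>\<^sub>F n in sequentially. (\<integral>\<^sup>+t. ennreal (norm (ip (s n t) p - ip (f t) p)) \<partial>leb 0 T) < 1"
    by (rule order_tendstoD(2)[OF l3]) simp
  then obtain n where n: "(\<integral>\<^sup>+t. ennreal (norm (ip (s n t) p - ip (f t) p)) \<partial>leb 0 T) < 1"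
    by (auto simp: eventually_sequentially)
  have "integrable (leb 0 T) (\<lambda>t. ip (s n t) p - ip (f t) p)"
    unfolding integrable_iff_bounded using n by (auto intro: less_trans[OF _ ennreal_one_less_top])
  from Bochner_Integration.integrable_diff[OF si[of n] this]
  show fi: "integrable (leb 0 T) (\<lambda>t. ip (f t) p)" by simp
  have "(\<lambda>n. \<integral>t. ip (s n t) p \<partial>leb 0 T) \<longlonglongrightarrow> (\<integral>t. ip (f t) p \<partial>leb 0 T)"
    by (rule tendsto_L1_int[OF si fi l3])
  moreover have "(\<lambda>n. \<integral>t. ip (s n t) p \<partial>leb 0 T) \<longlonglongrightarrow> ip w p"
  proof -
    have S: "simple_integral_in (leb 0 T) (s n) \<in> L2_space" for n
      unfolding simple_integral_in_def using s(2)[of n] by (intro L2_sum L2_cmult) auto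
    have eq: "(\<integral>t. ip (s n t) p \<partial>leb 0 T) = ip (simple_integral_in (leb 0 T) (s n)) p" for n
    proof -
      have "ip (simple_integral_in (leb 0 T) (s n)) p = (\<Sum>y\<in>s n ` space (leb 0 T). ip (\<lambda>x. measure (leb 0 T) (s n -` {y} \<inter> space (leb 0 T)) * y x) p)"
        unfolding simple_integral_in_def using s(2)[of n] by (intro ip_sum_left p L2_cmult) auto
      then show ?thesis
        using integral_simple_function_compose(1)[OF finite_leb s(1), of "\<lambda>g. ip g p" n] by simp
    qed
    have "(\<lambda>n. ip (simple_integral_in (leb 0 T) (s n)) p - ip w p) \<longlonglongrightarrow> 0"
    proof (rule Lim_null_comparison[where g = "\<lambda>n. L2_norm (\<lambda>x. simple_integral_in (leb 0 T) (s n) x - w x) * L2_norm p"])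
      have "norm (ip (simple_integral_in (leb 0 T) (s n)) p - ip w p) \<le> L2_norm (\<lambda>x. simple_integral_in (leb 0 T) (s n) x - w x) * L2_norm p" for n
        using ip_Cauchy_Schwarz[OF L2_diff[OF S wL] p, of n] ip_diff_left[OF S wL p, of n] by simp
      then show "\<forall>\<^sub>F n in sequentially. norm (ip (simple_integral_in (leb 0 T) (s n)) p - ip w p) \<le> L2_norm (\<lambda>x. simple_integral_in (leb 0 T) (s n) x - w x) * L2_norm p"
        by (intro always_eventually allI)
      have "(\<lambda>n. L2_norm (\<lambda>x. simple_integral_in (leb 0 T) (s n) x - w x) * L2_norm p) \<longlonglongrightarrow> 0 * L2_norm p"
        by (intro tendsto_mult tendsto_const l2)
      then show "(\<lambda>n. L2_norm (\<lambda>x. simple_integral_in (leb 0 T) (s n) x - w x) * L2_norm p) \<longlonglongrightarrow> 0" by simp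
    qed
    then show ?thesis unfolding eq by (rule LIM_zero_cancel)
  qed
  ultimately show "(\<integral>t. ip (f t) p \<partial>leb 0 T) = ip w p" by (rule LIMSEQ_unique)
qed

text \<open>Pairing the vector-valued identity with a fixed function of \<open>x\<close> leaves a
  scalar weak derivative.\<close>

lemma time_weak_deriv_pairing:
  assumes v: "time_weak_deriv T v v'" and tf: "test_function 0 T \<phi> \<phi>'" and p: "p \<in> L2_space"
  shows "integrable (leb 0 T) (\<lambda>t. \<phi>' t * ip (v t) p)" "integrable (leb 0 T) (\<lambda>t. \<phi> t * ip (v' t) p)"
    "(\<integral>t. \<phi>' t * ip (v t) p \<partial>leb 0 T) = - (\<integral>t. \<phi> t * ip (v' t) p \<partial>leb 0 T)"
proof -
  obtain w where w: "has_Bochner_integral_in (leb 0 T) L2_space L2_norm (\<lambda>t x. \<phi>' t * v t x) w"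
    "has_Bochner_integral_in (leb 0 T) L2_space L2_norm (\<lambda>t x. \<phi> t * v' t x) (\<lambda>x. - w x)"
    using v tf unfolding time_weak_deriv_def by blast
  show "integrable (leb 0 T) (\<lambda>t. \<phi>' t * ip (v t) p)" "integrable (leb 0 T) (\<lambda>t. \<phi> t * ip (v' t) p)"
    using has_Bochner_integral_in_pairing(1)[OF w(1) p] has_Bochner_integral_in_pairing(1)[OF w(2) p] by simp_all
  have "ip (\<lambda>x. - w x) p = - ip w p" using ip_cmult_left[of "-1" w p] by simp
  then show "(\<integral>t. \<phi>' t * ip (v t) p \<partial>leb 0 T) = - (\<integral>t. \<phi> t * ip (v' t) p \<partial>leb 0 T)"
    using has_Bochner_integral_in_pairing(2)[OF w(1) p] has_Bochner_integral_in_pairing(2)[OF w(2) p] by simp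
qed

text \<open>To be used with powers of \<open>t\<close> and with exponentials as the factor
  \<open>f\<close>.\<close>

lemma test_function_mult:
  assumes tf: "test_function c d \<phi> \<phi>'" and f: "\<And>t. (f has_real_derivative f' t) (at t)" and f': "continuous_on UNIV f'"
  shows "test_function c d (\<lambda>t. \<phi> t * f t) (\<lambda>t. \<phi>' t * f t + \<phi> t * f' t)"
proof -
  have fc: "continuous_on UNIV f" using DERIV_isCont[OF f] by (simp add: continuous_at_imp_continuous_on)
  have "((\<lambda>t. \<phi> t * f t) has_real_derivative \<phi>' t * f t + \<phi> t * f' t) (at t)" for t
    using DERIV_mult[of \<phi> "\<phi>' t" t UNIV f "f' t"] tf f by (simp add: test_function_def mult.commute)
  moreover have "continuous_on UNIV (\<lambda>t. \<phi>' t * f t + \<phi> t * f' t)"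
    by (intro continuous_intros test_function_continuous[OF tf] fc f')
  ultimately show ?thesis
    using tf by (fastforce simp: test_function_def)
qed

text \<open>The lemma of du Bois-Reymond. The difference of a ramp at \<open>\<alpha>\<close> and a
  ramp at \<open>\<beta>\<close> is a test function; its derivative is a bump at
  \<open>\<alpha>\<close> minus a bump at \<open>\<beta>\<close>, and these bumps evaluate
  \<open>G\<close> in the limit.\<close>

lemma constant_from_test_functions:
  assumes T: "0 < T" and G: "continuous_on {0..T} G"
    and z: "\<And>\<zeta> \<zeta>'. test_function 0 T \<zeta> \<zeta>' \<Longrightarrow> (\<integral>t. \<zeta>' t * G t \<partial>leb 0 T) = 0"
    and \<alpha>: "\<alpha> \<in> {0..T}" and \<beta>: "\<beta> \<in> {0..T}"
  shows "G \<alpha> = G \<beta>"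
proof -
  \<comment> \<open>Clamped so that the bumps stay between \<open>1/n\<close> and
    \<open>T - 1/n\<close>. The correction to \<open>b c n / n\<close> is of order 1/n, so the
    quotient still tends to \<open>c\<close>, also when \<open>c\<close> is an end point.\<close>
  define b where "b c n = max 1 (min (real n * c) (real n * T - 3))" for c and n :: nat
  have small: "\<forall>\<^sub>F n in sequentially. 0 < real n \<and> 4 / real n < T"
  proof -
    have "\<forall>\<^sub>F n in sequentially. 4 / real n < T" using lim_const_over_n[of 4] T by (intro order_tendstoD) auto
    then show ?thesis using eventually_gt_at_top[of 0] by eventually_elim auto
  qed
  have blim: "(\<lambda>n. b c n / real n) \<longlonglongrightarrow> c" if c: "c \<in> {0..T}" for c
  proof -
    have "(\<lambda>n. max (1 / real n) (min c (T - 3 / real n))) \<longlonglongrightarrow> max 0 (min c (T - 0))"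
      by (intro tendsto_max tendsto_min tendsto_diff tendsto_const lim_const_over_n)
    moreover have "max 0 (min c (T - 0)) = c" using c by auto
    moreover have "\<forall>\<^sub>F n in sequentially. max (1 / real n) (min c (T - 3 / real n)) = b c n / real n"
      using eventually_gt_at_top[of 0]
    proof eventually_elim
      case (elim n)
      then show ?case by (auto simp: b_def max_def min_def field_simps)
    qed
    ultimately show ?thesis by (auto intro: Lim_transform_eventually)
  qed
  have bev: "\<forall>\<^sub>F n in sequentially. 1 \<le> b c n \<and> b c n + 2 \<le> real n * T - 1" for c
    using small
  proof eventually_elim
    case (elim n)
    then have n: "0 < real n" and "4 / real n < T" by auto
    then have "4 < real n * T" by (simp add: pos_divide_less_eq[OF n] mult.commute)
    then show ?case by (auto simp: b_def)
  qed
  have bev': "\<forall>\<^sub>F n in sequentially. 0 \<le> b c n / real n \<and> (b c n + 2) / real n \<le> T" for c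
    using bev[of c] small by eventually_elim (auto simp: field_simps)
  define A where "A c n = integral {0..T} (\<lambda>x. real n * tent (real n * x - b c n) * G x)" for c n
  have Alim: "A c \<longlonglongrightarrow> G c" if "c \<in> {0..T}" for c
    unfolding A_def by (rule tent_approx[OF G that bev' blim[OF that]])
  have "\<forall>\<^sub>F n in sequentially. A \<alpha> n = A \<beta> n"
    using bev[of \<alpha>] bev[of \<beta>] small
  proof eventually_elim
    case (elim n)
    define \<zeta> where "\<zeta> x = ramp (real n * x - b \<alpha> n) - ramp (real n * x - b \<beta> n)" for x
    define \<zeta>' where "\<zeta>' x = real n * tent (real n * x - b \<alpha> n) - real n * tent (real n * x - b \<beta> n)" for x
    have tc: "continuous_on S (\<lambda>x. real n * tent (real n * x - c))" for S c
      by (intro continuous_intros continuous_on_compose2[OF tent_continuous[of UNIV]]) auto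
    have "test_function 0 T \<zeta> \<zeta>'"
      unfolding test_function_def
    proof (intro conjI allI exI impI)
      show "(\<zeta> has_real_derivative \<zeta>' x) (at x)" for x
        unfolding \<zeta>_def[abs_def] \<zeta>'_def by (intro DERIV_diff ramp_scaled_deriv)
      show "continuous_on UNIV \<zeta>'" unfolding \<zeta>'_def[abs_def] by (intro continuous_on_diff tc)
      show "0 < 1 / real n" "T - 1 / real n < T" using elim by auto
      fix x assume x: "x \<notin> {1 / real n..T - 1 / real n}"
      consider "x < 1 / real n" | "x > T - 1 / real n" using x by force
      then show "\<zeta> x = 0"
      proof cases
        case 1
        then have "real n * x < 1" using elim by (simp add: field_simps)
        then show ?thesis using elim by (simp add: \<zeta>_def ramp_0)
      next
        case 2
        then have "real n * x > real n * T - 1" using elim by (simp add: field_simps)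
        then show ?thesis using elim by (simp add: \<zeta>_def ramp_1)
      qed
    qed
    from z[OF this] have "0 = (\<integral>t. \<zeta>' t * G t \<partial>leb 0 T)" by simp
    also have "\<dots> = integral {0..T} (\<lambda>t. \<zeta>' t * G t)"
      unfolding \<zeta>'_def by (intro continuous_leb_integral continuous_on_mult continuous_on_diff tc G)
    also have "\<dots> = integral {0..T} (\<lambda>x. real n * tent (real n * x - b \<alpha> n) * G x - real n * tent (real n * x - b \<beta> n) * G x)"
      by (simp add: \<zeta>'_def left_diff_distrib)
    also have "\<dots> = A \<alpha> n - A \<beta> n"
      unfolding A_def by (intro Henstock_Kurzweil_Integration.integral_diff integrable_continuous_interval continuous_on_mult tc G)
    finally show ?case by simp
  qed
  from Lim_transform_eventually[OF Alim[OF \<alpha>] this] Alim[OF \<beta>]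
  show ?thesis by (rule LIMSEQ_unique)
qed

lemma ip_continuous: "continuous_on {0..1} f \<Longrightarrow> continuous_on {0..1} g \<Longrightarrow> ip f g = integral {0..1} (\<lambda>x. f x * g x)"
  unfolding ip_def by (intro continuous_leb_integral continuous_intros)

text \<open>Extending the kernel by its diagonal value where x < y allows the order of integration
  to be exchanged on a square. The excess introduced on either side involves the diagonal values
  only, and one integration by parts shows that the two excesses agree.\<close>

lemma triangle_Fubini:
  assumes k: "continuous_on \<Omega> k" and e: "continuous_on {0..1} e" and \<phi>: "continuous_on {0..1} \<phi>"
  shows "continuous_on {0..1} (\<lambda>y. integral {y..1} (\<lambda>x. k (x, y) * \<phi> x))"
    and "ip e (\<lambda>y. integral {y..1} (\<lambda>x. k (x, y) * \<phi> x)) = ip (\<lambda>x. integral {0..x} (\<lambda>y. k (x, y) * e y)) \<phi>"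
proof -
  define P where "P x y = k (max x y, y)" for x y
  have Pc: "continuous_on ({0..1} \<times> {0..1}) (\<lambda>z. P (fst z) (snd z))"
    unfolding P_def by (rule continuous_on_compose2[OF k]) (auto intro!: continuous_intros simp: Omega_iff)
  have Px: "continuous_on {0..1} (\<lambda>y. P x y)" if "x \<in> {0..1}" for x
    by (rule continuous_on_section[OF Pc that order_refl])
  have Py: "continuous_on {0..1} (\<lambda>x. P x y)" if "y \<in> {0..1}" for y
    by (rule continuous_on_compose2[OF Pc, of _ "\<lambda>x. (x, y)", unfolded fst_conv snd_conv]) (use that in \<open>auto intro!: continuous_intros\<close>)
  define D where "D y = k (y, y)" for y
  have Dc: "continuous_on {0..1} D" unfolding D_def[abs_def] by (rule continuous_on_Omega_diagonal[OF k])
  define \<Phi> where "\<Phi> y = integral {0..y} \<phi>" for y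
  define L where "L x = integral {x..1} (\<lambda>y. D y * e y)" for x
  have Dec: "continuous_on {0..1} (\<lambda>y. D y * e y)" by (intro continuous_intros Dc e)
  have \<Phi>d: "(\<Phi> has_real_derivative \<phi> y) (at y within {0..1})" if "y \<in> {0..1}" for y
    unfolding \<Phi>_def[abs_def] by (rule integral_has_real_derivative[OF \<phi> that])
  have Ld: "(L has_real_derivative - (D y * e y)) (at y within {0..1})" if "y \<in> {0..1}" for y
    unfolding L_def[abs_def] by (rule integral_has_real_derivative'[OF Dec that])
  have \<Phi>c: "continuous_on {0..1} \<Phi>" by (rule DERIV_continuous_on[OF \<Phi>d])
  have Lc: "continuous_on {0..1} L" by (rule DERIV_continuous_on[OF Ld])
  have up: "integral {y..1} (\<lambda>x. k (x, y) * \<phi> x) = integral {0..1} (\<lambda>x. P x y * \<phi> x) - D y * \<Phi> y" if y: "y \<in> {0..1}" for y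
  proof -
    have "integral {0..1} (\<lambda>x. P x y * \<phi> x) = integral {0..y} (\<lambda>x. P x y * \<phi> x) + integral {y..1} (\<lambda>x. P x y * \<phi> x)"
      using y by (intro Henstock_Kurzweil_Integration.integral_combine[symmetric] integrable_continuous_interval continuous_intros Py \<phi>) auto
    also have "integral {0..y} (\<lambda>x. P x y * \<phi> x) = integral {0..y} (\<lambda>x. D y * \<phi> x)"
      by (rule integral_cong) (simp add: P_def D_def max_absorb2)
    also have "\<dots> = D y * \<Phi> y" by (simp add: \<Phi>_def)
    also have "integral {y..1} (\<lambda>x. P x y * \<phi> x) = integral {y..1} (\<lambda>x. k (x, y) * \<phi> x)"
      by (rule integral_cong) (simp add: P_def max_absorb1)
    finally show ?thesis by simp
  qed
  have lo: "integral {0..x} (\<lambda>y. k (x, y) * e y) = integral {0..1} (\<lambda>y. P x y * e y) - L x" if x: "x \<in> {0..1}" for x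
  proof -
    have "integral {0..1} (\<lambda>y. P x y * e y) = integral {0..x} (\<lambda>y. P x y * e y) + integral {x..1} (\<lambda>y. P x y * e y)"
      using x by (intro Henstock_Kurzweil_Integration.integral_combine[symmetric] integrable_continuous_interval continuous_intros Px e) auto
    also have "integral {0..x} (\<lambda>y. P x y * e y) = integral {0..x} (\<lambda>y. k (x, y) * e y)"
      by (rule integral_cong) (simp add: P_def max_absorb1)
    also have "integral {x..1} (\<lambda>y. P x y * e y) = L x"
      unfolding L_def by (rule integral_cong) (simp add: P_def D_def max_absorb2)
    finally show ?thesis by simp
  qed
  have c1: "continuous_on {0..1} (\<lambda>y. integral {0..1} (\<lambda>x. P x y * \<phi> x))"
  proof -
    have "continuous_on ({0..1} \<times> cbox 0 1) (\<lambda>(y, x). P x y * \<phi> x)"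
      unfolding case_prod_beta' cbox_interval
      by (intro continuous_on_mult continuous_on_compose2[OF Pc, of _ "\<lambda>w. (snd w, fst w)", unfolded fst_conv snd_conv] continuous_on_compose2[OF \<phi>])
         (auto intro!: continuous_intros)
    from integral_continuous_on_param[OF this] show ?thesis by simp
  qed
  have c2: "continuous_on {0..1} (\<lambda>x. integral {0..1} (\<lambda>y. P x y * e y))"
  proof -
    have "continuous_on ({0..1} \<times> cbox 0 1) (\<lambda>(x, y). P x y * e y)"
      unfolding case_prod_beta' cbox_interval
      by (intro continuous_on_mult Pc continuous_on_compose2[OF e]) (auto intro!: continuous_intros)
    from integral_continuous_on_param[OF this] show ?thesis by simp
  qed
  show upc: "continuous_on {0..1} (\<lambda>y. integral {y..1} (\<lambda>x. k (x, y) * \<phi> x))"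
    by (rule continuous_on_eq[of _ "\<lambda>y. integral {0..1} (\<lambda>x. P x y * \<phi> x) - D y * \<Phi> y"]) (auto intro!: continuous_intros c1 Dc \<Phi>c simp: up)
  have loc: "continuous_on {0..1} (\<lambda>x. integral {0..x} (\<lambda>y. k (x, y) * e y))"
    by (rule continuous_on_eq[of _ "\<lambda>x. integral {0..1} (\<lambda>y. P x y * e y) - L x"]) (auto intro!: continuous_intros c2 Lc simp: lo)
  have swap: "integral {0..1} (\<lambda>y. e y * integral {0..1} (\<lambda>x. P x y * \<phi> x)) = integral {0..1} (\<lambda>x. integral {0..1} (\<lambda>y. P x y * e y) * \<phi> x)"
  proof -
    have "continuous_on (cbox (0, 0) (1, 1)) (\<lambda>(x, y). P x y * e y * \<phi> x)"
      unfolding cbox_Pair_eq unfolding case_prod_beta' cbox_interval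
      by (intro continuous_on_mult Pc continuous_on_compose2[OF e] continuous_on_compose2[OF \<phi>]) (auto intro!: continuous_intros)
    from integral_swap_continuous[OF this]
    have "integral {0..1} (\<lambda>x. integral {0..1} (\<lambda>y. P x y * e y * \<phi> x)) = integral {0..1} (\<lambda>y. integral {0..1} (\<lambda>x. P x y * e y * \<phi> x))"
      by simp
    moreover have "integral {0..1} (\<lambda>y. P x y * e y * \<phi> x) = integral {0..1} (\<lambda>y. P x y * e y) * \<phi> x" for x
      by (rule integral_mult_left)
    moreover have "integral {0..1} (\<lambda>x. P x y * e y * \<phi> x) = e y * integral {0..1} (\<lambda>x. P x y * \<phi> x)" for y
      by (subst integral_mult_right[symmetric]) (simp add: mult_ac)
    ultimately show ?thesis by simp
  qed
  have ibp: "integral {0..1} (\<lambda>x. L x * \<phi> x) = integral {0..1} (\<lambda>y. D y * e y * \<Phi> y)"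
  proof -
    have "integral {0..1} (\<lambda>x. L x * \<phi> x) = L 1 * \<Phi> 1 - L 0 * \<Phi> 0 - integral {0..1} (\<lambda>y. - (D y * e y) * \<Phi> y)"
      by (rule integral_by_parts_real[OF _ Ld \<Phi>d]) (auto intro!: continuous_intros Dc e \<phi>)
    then show ?thesis by (simp add: L_def \<Phi>_def)
  qed
  have "ip e (\<lambda>y. integral {y..1} (\<lambda>x. k (x, y) * \<phi> x)) = integral {0..1} (\<lambda>y. e y * integral {y..1} (\<lambda>x. k (x, y) * \<phi> x))"
    by (rule ip_continuous[OF e upc])
  also have "\<dots> = integral {0..1} (\<lambda>y. e y * integral {0..1} (\<lambda>x. P x y * \<phi> x) - D y * e y * \<Phi> y)"
    by (rule integral_cong, subst up) (simp_all add: algebra_simps)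
  also have "\<dots> = integral {0..1} (\<lambda>y. e y * integral {0..1} (\<lambda>x. P x y * \<phi> x)) - integral {0..1} (\<lambda>y. D y * e y * \<Phi> y)"
    by (intro Henstock_Kurzweil_Integration.integral_diff integrable_continuous_interval continuous_intros e c1 Dc \<Phi>c)
  also have "\<dots> = integral {0..1} (\<lambda>x. integral {0..1} (\<lambda>y. P x y * e y) * \<phi> x) - integral {0..1} (\<lambda>x. L x * \<phi> x)"
    by (simp only: swap ibp)
  also have "\<dots> = integral {0..1} (\<lambda>x. integral {0..1} (\<lambda>y. P x y * e y) * \<phi> x - L x * \<phi> x)"
    by (intro Henstock_Kurzweil_Integration.integral_diff[symmetric] integrable_continuous_interval continuous_intros c2 \<phi> Lc)
  also have "\<dots> = integral {0..1} (\<lambda>x. integral {0..x} (\<lambda>y. k (x, y) * e y) * \<phi> x)"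
    by (rule integral_cong) (simp only: lo left_diff_distrib)
  also have "\<dots> = ip (\<lambda>x. integral {0..x} (\<lambda>y. k (x, y) * e y)) \<phi>"
    by (rule ip_continuous[symmetric, OF loc \<phi>])
  finally show "ip e (\<lambda>y. integral {y..1} (\<lambda>x. k (x, y) * \<phi> x)) = ip (\<lambda>x. integral {0..x} (\<lambda>y. k (x, y) * e y)) \<phi>" .
qed

section \<open>The adjoint Volterra operator\<close>

definition up :: "(real \<times> real \<Rightarrow> real) \<Rightarrow> (real \<Rightarrow> real) \<Rightarrow> real \<Rightarrow> real" where
  "up p f y = integral {y..1} (\<lambda>x. p (x, y) * f x)"

lemma up_continuous: "continuous_on \<Omega> p \<Longrightarrow> continuous_on {0..1} f \<Longrightarrow> continuous_on {0..1} (up p f)"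
  unfolding up_def[abs_def] by (rule triangle_Fubini(1)[OF _ continuous_on_const])

lemma up_diff_le:
  assumes p: "continuous_on \<Omega> p" and q: "continuous_on \<Omega> q" and f: "continuous_on {0..1} f"
    and f1: "\<And>x. x \<in> {0..1} \<Longrightarrow> \<bar>f x\<bar> \<le> 1" and le: "\<And>z. z \<in> \<Omega> \<Longrightarrow> \<bar>p z - q z\<bar> \<le> \<epsilon>" and y: "y \<in> {0..1}"
  shows "\<bar>up p f y - up q f y\<bar> \<le> \<epsilon>"
proof -
  have fy: "continuous_on {y..1} f" by (rule continuous_on_subset[OF f]) (use y in auto)
  note c = continuous_on_Omega_section_upper[OF p y] continuous_on_Omega_section_upper[OF q y] fy
  have "(1, y) \<in> \<Omega>" using y by (auto simp: Omega_iff)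
  then have e0: "0 \<le> \<epsilon>" using le[of "(1, y)"] by linarith
  have "up p f y - up q f y = integral {y..1} (\<lambda>x. p (x, y) * f x - q (x, y) * f x)"
    unfolding up_def by (intro Henstock_Kurzweil_Integration.integral_diff[symmetric] integrable_continuous_interval continuous_intros c)
  also have "norm \<dots> \<le> \<epsilon> * (1 - y)"
  proof (rule integral_bound)
    show "continuous_on {y..1} (\<lambda>x. p (x, y) * f x - q (x, y) * f x)" by (intro continuous_intros c)
    fix x assume x: "x \<in> {y..1}"
    then have "\<bar>p (x, y) - q (x, y)\<bar> * \<bar>f x\<bar> \<le> \<epsilon> * 1"
      using y e0 by (intro mult_mono le f1) (auto simp: Omega_iff)
    then show "norm (p (x, y) * f x - q (x, y) * f x) \<le> \<epsilon>" by (simp add: abs_mult[symmetric] left_diff_distrib)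
  qed (use y in auto)
  also have "\<dots> \<le> \<epsilon>" using y e0 by (simp add: mult_left_le)
  finally show ?thesis by simp
qed

lemma up_sum:
  fixes p :: "nat \<Rightarrow> real \<times> real \<Rightarrow> real"
  assumes p: "\<And>n. continuous_on \<Omega> (p n)" and f: "continuous_on {0..1} f" and y: "y \<in> {0..1}"
  shows "up (\<lambda>z. \<Sum>n<m. p n z * c n) f y = (\<Sum>n<m. c n * up (p n) f y)"
proof -
  have fy: "continuous_on {y..1} f" by (rule continuous_on_subset[OF f]) (use y in auto)
  note cs = continuous_on_Omega_section_upper[OF p y] fy
  have "up (\<lambda>z. \<Sum>n<m. p n z * c n) f y = integral {y..1} (\<lambda>x. \<Sum>n<m. c n * (p n (x, y) * f x))"
    unfolding up_def by (rule integral_cong) (simp add: sum_distrib_left sum_distrib_right mult_ac)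
  also have "\<dots> = (\<Sum>n<m. integral {y..1} (\<lambda>x. c n * (p n (x, y) * f x)))"
    by (intro integral_sum integrable_continuous_interval continuous_intros cs finite_lessThan)
  finally show ?thesis by (simp add: up_def)
qed

lemma ip_diff_le:
  assumes f: "f \<in> L2_space" and p: "continuous_on {0..1} p" and q: "continuous_on {0..1} q"
    and le: "\<And>x. x \<in> {0..1} \<Longrightarrow> \<bar>p x - q x\<bar> \<le> \<epsilon>"
  shows "\<bar>ip f p - ip f q\<bar> \<le> L2_norm f * \<epsilon>"
proof -
  note L = continuous_L2[OF p] continuous_L2[OF q]
  have "L2_norm (\<lambda>x. p x - q x) \<le> \<epsilon>" by (rule L2_norm_bound[OF L2_diff[OF L]]) (use le in auto)
  then have "L2_norm f * L2_norm (\<lambda>x. p x - q x) \<le> L2_norm f * \<epsilon>" by (rule mult_left_mono) simp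
  then show ?thesis
    using ip_Cauchy_Schwarz[OF f L2_diff[OF L]] ip_diff_right[OF L f] by linarith
qed

lemma C_H1_pairing_continuous:
  assumes v: "C_H1 T v" and p: "p \<in> L2_space"
  shows "continuous_on {0..T} (\<lambda>t. ip (v t) p)" "continuous_on {0..T} (\<lambda>t. L2_norm (v t))"
proof -
  have L: "v t \<in> L2_space" if "t \<in> {0..T}" for t
    using v that by (auto simp: C_H1_def H1_space_def dest: weak_deriv_L2)
  have lim: "((\<lambda>t. L2_norm (\<lambda>x. v t x - v s x)) \<longlongrightarrow> 0) (at s within {0..T})" if s: "s \<in> {0..T}" for s
  proof (rule Lim_null_comparison[where g = "\<lambda>t. H1_norm (\<lambda>x. v t x - v s x)"])
    show "\<forall>\<^sub>F t in at s within {0..T}. norm (L2_norm (\<lambda>x. v t x - v s x)) \<le> H1_norm (\<lambda>x. v t x - v s x)"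
      by (intro always_eventually allI) (simp add: H1_norm_def real_le_rsqrt)
    show "((\<lambda>t. H1_norm (\<lambda>x. v t x - v s x)) \<longlongrightarrow> 0) (at s within {0..T})"
      using v s by (simp add: C_H1_def)
  qed
  have ev: "\<forall>\<^sub>F t in at s within {0..T}. t \<in> {0..T}" for s
    by (simp add: eventually_at_filter)
  show "continuous_on {0..T} (\<lambda>t. ip (v t) p)"
    unfolding continuous_on_def
  proof
    fix s assume s: "s \<in> {0..T}"
    have "((\<lambda>t. ip (v t) p - ip (v s) p) \<longlongrightarrow> 0) (at s within {0..T})"
    proof (rule Lim_null_comparison[where g = "\<lambda>t. L2_norm (\<lambda>x. v t x - v s x) * L2_norm p"])
      show "\<forall>\<^sub>F t in at s within {0..T}. norm (ip (v t) p - ip (v s) p) \<le> L2_norm (\<lambda>x. v t x - v s x) * L2_norm p"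
        using ev
      proof eventually_elim
        case (elim t)
        show ?case using ip_Cauchy_Schwarz[OF L2_diff[OF L[OF elim] L[OF s]] p] ip_diff_left[OF L[OF elim] L[OF s] p] by simp
      qed
      show "((\<lambda>t. L2_norm (\<lambda>x. v t x - v s x) * L2_norm p) \<longlongrightarrow> 0) (at s within {0..T})"
        by (rule tendsto_mult_left_zero[OF lim[OF s]])
    qed
    then show "((\<lambda>t. ip (v t) p) \<longlongrightarrow> ip (v s) p) (at s within {0..T})" by (rule LIM_zero_cancel)
  qed
  show "continuous_on {0..T} (\<lambda>t. L2_norm (v t))"
    unfolding continuous_on_def
  proof
    fix s assume s: "s \<in> {0..T}"
    have "((\<lambda>t. L2_norm (v t) - L2_norm (v s)) \<longlongrightarrow> 0) (at s within {0..T})"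
    proof (rule Lim_null_comparison[OF _ lim[OF s]])
      show "\<forall>\<^sub>F t in at s within {0..T}. norm (L2_norm (v t) - L2_norm (v s)) \<le> L2_norm (\<lambda>x. v t x - v s x)"
        using ev
      proof eventually_elim
        case (elim t)
        have "L2_norm (v t) \<le> L2_norm (\<lambda>x. v t x - v s x) + L2_norm (v s)"
          using L2_norm_triangle[OF L2_diff[OF L[OF elim] L[OF s]] L[OF s]] by simp
        moreover have "L2_norm (v s) \<le> L2_norm (\<lambda>x. v s x - v t x) + L2_norm (v t)"
          using L2_norm_triangle[OF L2_diff[OF L[OF s] L[OF elim]] L[OF elim]] by simp
        ultimately show ?case using L2_norm_minus_commute[of "v s" "v t"] by simp
      qed
    qed
    then show "((\<lambda>t. L2_norm (v t)) \<longlongrightarrow> L2_norm (v s)) (at s within {0..T})" by (rule LIM_zero_cancel)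
  qed
qed

context backstepping_kernel
begin

text \<open>The adjoint of \<open>I + K\<close>, applied to an eigenfunction of the target system.\<close>

lemma adjoint_identity:
  assumes t: "t \<in> {0..t0}"
    and f: "\<And>x. x \<in> {0..1} \<Longrightarrow> (f has_real_derivative f' x) (at x within {0..1})"
    and f': "\<And>x. x \<in> {0..1} \<Longrightarrow> (f' has_real_derivative - \<mu> * f x) (at x within {0..1})"
  obtains p p' p'' where "p = (\<lambda>y. f y + up (K t) f y)"
    "\<And>y. y \<in> {0..1} \<Longrightarrow> (p has_real_derivative p' y) (at y within {0..1})"
    "\<And>y. y \<in> {0..1} \<Longrightarrow> (p' has_real_derivative p'' y) (at y within {0..1})"
    "continuous_on {0..1} p''"
    "\<And>y. y \<in> {0..1} \<Longrightarrow> p'' y + a y t * p y + up (Kt t) f y = - (lam + \<mu>) * p y + Kx t (1, y) * f 1 - K t (1, y) * f' 1"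
    "p 0 = f 0" "p 1 = f 1" "p' 1 = f' 1 - K t (1, 1) * f 1"
proof -
  have fc: "continuous_on {0..1} f" by (rule DERIV_continuous_on[OF f])
  have f'c: "continuous_on {0..1} f'" by (rule DERIV_continuous_on[OF f'])
  note kc = kernel_at_time[OF t] Kyy_cont[OF t]
  define p where "p = (\<lambda>y. f y + up (K t) f y)"
  define p' where "p' = (\<lambda>y. f' y - K t (y, y) * f y + up (Ky t) f y)"
  define p'' where "p'' = (\<lambda>y. - \<mu> * f y - ((Kx t (y, y) + Ky t (y, y)) * f y + K t (y, y) * f' y) - Ky t (y, y) * f y + up (Kyy t) f y)"
  show thesis
  proof (rule that[of p p' p''])
    show "p = (\<lambda>y. f y + up (K t) f y)" by (fact p_def)
    show "(p has_real_derivative p' y) (at y within {0..1})" if y: "y \<in> {0..1}" for y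
      using DERIV_add[OF f[OF y] leibniz_upper[OF kc(1) kc(3) fc K_y[OF t] y]]
      by (simp add: p_def p'_def up_def[abs_def] algebra_simps)
    show "(p' has_real_derivative p'' y) (at y within {0..1})" if y: "y \<in> {0..1}" for y
      using DERIV_add[OF DERIV_diff[OF f'[OF y] DERIV_mult[OF K_diag[OF t y] f[OF y]]] leibniz_upper[OF kc(3) kc(6) fc K_yy[OF t] y]]
      by (simp add: p'_def p''_def up_def[abs_def] algebra_simps)
    show "continuous_on {0..1} p''"
      unfolding p''_def by (intro continuous_intros fc f'c up_continuous kc continuous_on_Omega_diagonal)
    have "up (K t) f 0 = integral {0..1::real} (\<lambda>x. 0)"
      unfolding up_def by (rule integral_cong) (use K_zero[OF t] in simp)
    then show "p 0 = f 0" by (simp add: p_def)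
    show "p 1 = f 1" "p' 1 = f' 1 - K t (1, 1) * f 1" by (simp_all add: p_def p'_def up_def)
    fix y :: real assume y: "y \<in> {0..1}"
    have sub: "continuous_on {y..1} g" if "continuous_on {0..1} g" for g :: "real \<Rightarrow> real"
      by (rule continuous_on_subset[OF that]) (use y in auto)
    note [continuous_intros] = sub[OF fc] sub[OF f'c]
      continuous_on_Omega_section_upper[OF kc(1) y] continuous_on_Omega_section_upper[OF kc(2) y]
      continuous_on_Omega_section_upper[OF kc(4) y] continuous_on_Omega_section_upper[OF kc(5) y]
    have om: "(x, y) \<in> \<Omega>" if "x \<in> {y..1}" for x using that y by (auto simp: Omega_iff)
    \<comment> \<open>The kernel equation will turn \<open>Kyy\<close> into \<open>Kxx\<close>,
      whose two derivatives are moved to \<open>f\<close> here. The terms at x = 1 survive; they are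
      what the feedback law has to balance.\<close>
    have ibp1: "integral {y..1} (\<lambda>x. f x * Kxx t (x, y)) = f 1 * Kx t (1, y) - f y * Kx t (y, y) - integral {y..1} (\<lambda>x. f' x * Kx t (x, y))"
      by (rule integral_by_parts_real)
         (use y om in \<open>auto intro!: K_xx[OF t] DERIV_subset[OF f] continuous_intros\<close>)
    have f'2: "(f' has_real_derivative - (\<mu> * f x)) (at x within {0..1})" if "x \<in> {0..1}" for x
      using f'[OF that] by simp
    have ibp2: "integral {y..1} (\<lambda>x. f' x * Kx t (x, y)) = f' 1 * K t (1, y) - f' y * K t (y, y) - integral {y..1} (\<lambda>x. - \<mu> * f x * K t (x, y))"
      by (rule integral_by_parts_real)
         (use y om in \<open>auto intro!: K_x[OF t] DERIV_subset[OF f'2] continuous_intros\<close>)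
    have i3: "integral {y..1} (\<lambda>x. - \<mu> * f x * K t (x, y)) = - \<mu> * up (K t) f y"
      unfolding up_def by (subst Henstock_Kurzweil_Integration.integral_mult_right[symmetric]) (simp add: mult_ac)
    have "up (Kyy t) f y = integral {y..1} (\<lambda>x. (f x * Kxx t (x, y) - Kt t (x, y) * f x) - (a y t + lam) * (K t (x, y) * f x))"
      unfolding up_def
    proof (rule integral_cong)
      fix x assume "x \<in> {y..1}"
      from K_pde[OF t om[OF this]]
      have Kyy: "Kyy t (x, y) = Kxx t (x, y) - Kt t (x, y) - (a y t + lam) * K t (x, y)" by simp
      show "Kyy t (x, y) * f x = (f x * Kxx t (x, y) - Kt t (x, y) * f x) - (a y t + lam) * (K t (x, y) * f x)"
        unfolding Kyy by (simp add: algebra_simps)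
    qed
    also have "\<dots> = integral {y..1} (\<lambda>x. f x * Kxx t (x, y) - Kt t (x, y) * f x) - integral {y..1} (\<lambda>x. (a y t + lam) * (K t (x, y) * f x))"
      by (intro Henstock_Kurzweil_Integration.integral_diff integrable_continuous_interval continuous_intros)
    also have "integral {y..1} (\<lambda>x. f x * Kxx t (x, y) - Kt t (x, y) * f x) = integral {y..1} (\<lambda>x. f x * Kxx t (x, y)) - up (Kt t) f y"
      unfolding up_def by (intro Henstock_Kurzweil_Integration.integral_diff integrable_continuous_interval continuous_intros)
    also have "integral {y..1} (\<lambda>x. (a y t + lam) * (K t (x, y) * f x)) = (a y t + lam) * up (K t) f y"
      by (simp add: up_def)
    finally have e: "up (Kyy t) f y = f 1 * Kx t (1, y) - f y * Kx t (y, y) - (f' 1 * K t (1, y) - f' y * K t (y, y) + \<mu> * up (K t) f y)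
        - up (Kt t) f y - (a y t + lam) * up (K t) f y"
      unfolding ibp1 ibp2 i3 by simp
    have "(a y t + lam) * f y = 2 * (Kx t (y, y) + Ky t (y, y)) * f y"
      using K_diag_pde[OF t y] by simp
    then show "p'' y + a y t * p y + up (Kt t) f y = - (lam + \<mu>) * p y + Kx t (1, y) * f 1 - K t (1, y) * f' 1"
      unfolding p_def p''_def e by (simp add: algebra_simps)
  qed
qed

text \<open>Green's formula against the adjoint eigenfunction. The hypothesis \<open>bc\<close> says
  that the boundary terms at 1 cancel and covers both laws: for Dirichlet \<open>f 1\<close> and the
  second bracket vanish, for Neumann \<open>f' 1\<close> and the first bracket.\<close>

lemma adjoint_pairing:
  assumes t: "t \<in> {0..t0}"
    and f: "\<And>x. x \<in> {0..1} \<Longrightarrow> (f has_real_derivative f' x) (at x within {0..1})"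
    and f': "\<And>x. x \<in> {0..1} \<Longrightarrow> (f' has_real_derivative - \<mu> * f x) (at x within {0..1})"
    and f0: "f 0 = 0"
    and v: "continuous_on {0..1} v" "weak_deriv v g" and g: "continuous_on {0..1} g" "weak_deriv g h" and v0: "v 0 = 0"
    and v': "v' \<in> L2_space" "AE x in leb 0 1. v' x = h x + a x t * v x"
    and bc: "f 1 * (g 1 + K t (1, 1) * v 1 + low Kx t v 1) = f' 1 * (v 1 + low K t v 1)"
  shows "ip v' (\<lambda>y. f y + up (K t) f y) + ip v (up (Kt t) f) = - (lam + \<mu>) * ip v (\<lambda>y. f y + up (K t) f y)"
proof -
  obtain p p' p'' where p_def: "p = (\<lambda>y. f y + up (K t) f y)"
    and p: "\<And>y. y \<in> {0..1} \<Longrightarrow> (p has_real_derivative p' y) (at y within {0..1})"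
    and p': "\<And>y. y \<in> {0..1} \<Longrightarrow> (p' has_real_derivative p'' y) (at y within {0..1})"
    and p''c: "continuous_on {0..1} p''"
    and eq: "\<And>y. y \<in> {0..1} \<Longrightarrow> p'' y + a y t * p y + up (Kt t) f y = - (lam + \<mu>) * p y + Kx t (1, y) * f 1 - K t (1, y) * f' 1"
    and bd: "p 0 = f 0" "p 1 = f 1" "p' 1 = f' 1 - K t (1, 1) * f 1"
    by (rule adjoint_identity[OF t f f']) (assumption | (rule that; assumption))+
  have fc: "continuous_on {0..1} f" by (rule DERIV_continuous_on[OF f])
  have pc: "continuous_on {0..1} p" by (rule DERIV_continuous_on[OF p])
  have p'c: "continuous_on {0..1} p'" by (rule DERIV_continuous_on[OF p'])
  have uc: "continuous_on {0..1} (up (Kt t) f)" by (rule up_continuous[OF kernel_at_time(5)[OF t] fc])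
  have one: "(1::real) \<in> {0..1}" by simp
  have k1: "continuous_on {0..1} (\<lambda>y. Kx t (1, y))" "continuous_on {0..1} (\<lambda>y. K t (1, y))"
    using continuous_on_Omega_section_lower[OF kernel_at_time(2)[OF t] one] continuous_on_Omega_section_lower[OF kernel_at_time(1)[OF t] one] by auto
  note ac = a_at_time[OF t]
  have hL: "h \<in> L2_space" and vL: "v \<in> L2_space" using g(2) v(2) by (auto dest: weak_deriv_L2)
  have "ip v' p = ip (\<lambda>x. h x + a x t * v x) p"
    by (rule ip_AE_cong[OF v'(1) continuous_L2[OF pc] v'(2)])
  also have "\<dots> = ip h p + ip (\<lambda>x. a x t * v x) p"
    by (rule ip_add_left[OF hL L2_continuous_mult[OF vL ac] continuous_L2[OF pc]])
  also have "ip (\<lambda>x. a x t * v x) p = ip v (\<lambda>x. a x t * p x)" by (simp add: ip_def mult_ac)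
  also have "ip h p = g 1 * p 1 - g 0 * p 0 - ip g p'"
    by (rule weak_deriv_by_parts[OF g(2,1) p p'c])
  also have "ip g p' = v 1 * p' 1 - v 0 * p' 0 - ip v p''"
    by (rule weak_deriv_by_parts[OF v(2,1) p' p''c])
  finally have e1: "ip v' p = g 1 * f 1 - v 1 * (f' 1 - K t (1, 1) * f 1) + ip v p'' + ip v (\<lambda>x. a x t * p x)"
    by (simp add: bd f0 v0)
  have "ip v p'' + ip v (\<lambda>x. a x t * p x) + ip v (up (Kt t) f) = integral {0..1} (\<lambda>y. v y * (p'' y + a y t * p y + up (Kt t) f y))"
  proof -
    have "ip v (\<lambda>y. p'' y + a y t * p y + up (Kt t) f y) = ip v (\<lambda>y. p'' y + a y t * p y) + ip v (up (Kt t) f)"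
      by (intro ip_add_right continuous_L2 continuous_intros p''c pc ac uc vL)
    moreover have "ip v (\<lambda>y. p'' y + a y t * p y) = ip v p'' + ip v (\<lambda>y. a y t * p y)"
      by (intro ip_add_right continuous_L2 continuous_intros p''c pc ac vL)
    moreover have "ip v (\<lambda>y. p'' y + a y t * p y + up (Kt t) f y) = integral {0..1} (\<lambda>y. v y * (p'' y + a y t * p y + up (Kt t) f y))"
      by (intro ip_continuous v(1) continuous_intros p''c pc ac uc)
    ultimately show ?thesis by simp
  qed
  also have "\<dots> = integral {0..1} (\<lambda>y. - (lam + \<mu>) * (v y * p y) + (f 1 * (Kx t (1, y) * v y) - f' 1 * (K t (1, y) * v y)))"
  proof (rule integral_cong)
    fix y :: real assume "y \<in> {0..1}"
    then show "v y * (p'' y + a y t * p y + up (Kt t) f y) = - (lam + \<mu>) * (v y * p y) + (f 1 * (Kx t (1, y) * v y) - f' 1 * (K t (1, y) * v y))"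
      by (simp only: eq) (simp add: algebra_simps)
  qed
  also have "\<dots> = integral {0..1} (\<lambda>y. - (lam + \<mu>) * (v y * p y)) + integral {0..1} (\<lambda>y. f 1 * (Kx t (1, y) * v y) - f' 1 * (K t (1, y) * v y))"
    by (intro Henstock_Kurzweil_Integration.integral_add integrable_continuous_interval continuous_intros v(1) pc k1)
  also have "integral {0..1} (\<lambda>y. f 1 * (Kx t (1, y) * v y) - f' 1 * (K t (1, y) * v y)) = integral {0..1} (\<lambda>y. f 1 * (Kx t (1, y) * v y)) - integral {0..1} (\<lambda>y. f' 1 * (K t (1, y) * v y))"
    by (intro Henstock_Kurzweil_Integration.integral_diff integrable_continuous_interval continuous_intros v(1) k1)
  also have "\<dots> = f 1 * low Kx t v 1 - f' 1 * low K t v 1" by (simp add: low_def)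
  also have "integral {0..1} (\<lambda>y. - (lam + \<mu>) * (v y * p y)) = - (lam + \<mu>) * integral {0..1} (\<lambda>y. v y * p y)"
    by (rule Henstock_Kurzweil_Integration.integral_mult_right)
  also have "integral {0..1} (\<lambda>y. v y * p y) = ip v p" by (rule ip_continuous[symmetric, OF v(1) pc])
  finally have "ip v p'' + ip v (\<lambda>x. a x t * p x) + ip v (up (Kt t) f) = - (lam + \<mu>) * ip v p + (f 1 * low Kx t v 1 - f' 1 * low K t v 1)" .
  moreover have "g 1 * f 1 - v 1 * (f' 1 - K t (1, 1) * f 1) + (f 1 * low Kx t v 1 - f' 1 * low K t v 1) = 0"
    using bc by (simp add: algebra_simps)
  ultimately show ?thesis using e1 unfolding p_def[symmetric] by linarith
qed

text \<open>The moment \<open>H\<close> satisfies H' = -\<gamma> H, but only weakly and with a test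
  function that moves in time. Truncating the power series of the kernel leaves finite sums of
  powers of t times functions of y, for which the weak time derivative can be used term by term. The
  truncation error is uniform in time and space.\<close>

lemma moment_evolution:
  assumes f: "continuous_on {0..1} f" and f1: "\<And>x. x \<in> {0..1} \<Longrightarrow> \<bar>f x\<bar> \<le> 1"
    and C: "C_H1 t0 v" and twd: "time_weak_deriv t0 v v'"
    and eq: "AE t in leb 0 t0. ip (v' t) (\<lambda>y. f y + up (K t) f y) + ip (v t) (up (Kt t) f) = - \<gamma> * ip (v t) (\<lambda>y. f y + up (K t) f y)"
    and t: "t \<in> {0..t0}"
  shows "exp (\<gamma> * t) * ip (v t) (\<lambda>y. f y + up (K t) f y) = ip (v 0) (\<lambda>y. f y + up (K 0) f y)"
proof -
  define p where "p n = up (Kn n) f" for n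
  define r where "r m t y = f y + (\<Sum>n<m. t ^ n * p n y)" for m t y
  define r' where "r' m t y = (\<Sum>n<m. (real n * t ^ (n - 1)) * p n y)" for m t y
  define \<psi> where "\<psi> t y = f y + up (K t) f y" for t y
  define H where "H t = ip (v t) (\<psi> t)" for t
  have pc: "continuous_on {0..1} (p n)" for n unfolding p_def by (rule up_continuous[OF Kn_cont f])
  note pL = continuous_L2[OF pc] and fL = continuous_L2[OF f]
  have rc: "continuous_on {0..1} (r m t)" for m t unfolding r_def[abs_def] by (intro continuous_intros f pc)
  have r'c: "continuous_on {0..1} (r' m t)" for m t unfolding r'_def[abs_def] by (intro continuous_intros pc)
  have \<psi>c: "continuous_on {0..1} (\<psi> t)" if "t \<in> {0..t0}" for t
    unfolding \<psi>_def[abs_def] by (intro continuous_intros f up_continuous kernel_at_time that)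
  have uc: "continuous_on {0..1} (up (Kt t) f)" if "t \<in> {0..t0}" for t
    by (intro f up_continuous kernel_at_time that)
  have vL: "v t \<in> L2_space" if "t \<in> {0..t0}" for t
    using C that by (auto simp: C_H1_def H1_space_def dest: weak_deriv_L2)
  have v2: "L2_L2 t0 v" "L2_L2 t0 v'" using twd by (auto simp: time_weak_deriv_def)
  have v'L: "AE t in leb 0 t0. v' t \<in> L2_space"
    using v2(2) unfolding L2_L2_def Bochner_L2_def strongly_measurable_def by (auto elim: eventually_mono)
  \<comment> \<open>An integrable majorant of both norms, because x \<le> 1 + x^2.\<close>
  define G where "G t = 2 + (L2_norm (v t))\<^sup>2 + (L2_norm (v' t))\<^sup>2" for t
  have Gi: "integrable (leb 0 t0) G"
    unfolding G_def[abs_def] using v2 by (intro Bochner_Integration.integrable_add leb_const_integrable) (auto simp: L2_L2_def Bochner_L2_def)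
  have sq: "x \<le> 1 + x\<^sup>2" for x :: real
    using sum_squares_ge_zero[of "x - 1" "x"] zero_le_power2[of "x - 1"] zero_le_power2[of x] by (simp add: power2_eq_square algebra_simps)
  have ip_r: "ip w (r m t) = ip w f + (\<Sum>n<m. t ^ n * ip w (p n))" if w: "w \<in> L2_space" for w m t
  proof -
    have "ip w (r m t) = ip w f + ip w (\<lambda>y. \<Sum>n<m. t ^ n * p n y)"
      unfolding r_def[abs_def] by (intro ip_add_right fL w L2_sum L2_cmult pL)
    then show ?thesis by (simp add: ip_sum_right w L2_cmult pL)
  qed
  have ip_r': "ip w (r' m t) = (\<Sum>n<m. (real n * t ^ (n - 1)) * ip w (p n))" if w: "w \<in> L2_space" for w m t
    unfolding r'_def[abs_def] by (simp add: ip_sum_right w L2_cmult pL)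
  have approx: "\<forall>\<^sub>F m in sequentially. \<forall>t\<in>{0..t0}. \<forall>y\<in>{0..1}. \<bar>r m t y - \<psi> t y\<bar> \<le> \<epsilon> \<and> \<bar>r' m t y - up (Kt t) f y\<bar> \<le> \<epsilon>" if \<epsilon>: "0 < \<epsilon>" for \<epsilon>
    using uniform_limitD[OF Kn_K \<epsilon>] uniform_limitD[OF Kn_Kt \<epsilon>]
  proof eventually_elim
    case (elim m)
    show ?case
    proof (intro ballI conjI)
      fix t y :: real assume t: "t \<in> {0..t0}" and y: "y \<in> {0..1}"
      have "\<bar>up (\<lambda>z. \<Sum>n<m. Kn n z * t ^ n) f y - up (K t) f y\<bar> \<le> \<epsilon>"
      proof (rule up_diff_le[OF _ kernel_at_time(1)[OF t] f f1 _ y])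
        show "\<bar>(\<Sum>n<m. Kn n z * t ^ n) - K t z\<bar> \<le> \<epsilon>" if "z \<in> \<Omega>" for z
          using bspec[OF elim(1), of "(t, z)"] that t by (simp add: dist_real_def)
      qed (intro continuous_intros Kn_cont)
      then show "\<bar>r m t y - \<psi> t y\<bar> \<le> \<epsilon>" by (simp add: up_sum[OF Kn_cont f y] r_def \<psi>_def p_def)
      have "\<bar>up (\<lambda>z. \<Sum>n<m. Kn n z * (real n * t ^ (n - 1))) f y - up (Kt t) f y\<bar> \<le> \<epsilon>"
      proof (rule up_diff_le[OF _ kernel_at_time(5)[OF t] f f1 _ y])
        show "\<bar>(\<Sum>n<m. Kn n z * (real n * t ^ (n - 1))) - Kt t z\<bar> \<le> \<epsilon>" if "z \<in> \<Omega>" for z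
          using bspec[OF elim(2), of "(t, z)"] that t by (simp add: dist_real_def)
      qed (intro continuous_intros Kn_cont)
      then show "\<bar>r' m t y - up (Kt t) f y\<bar> \<le> \<epsilon>" by (simp add: up_sum[OF Kn_cont f y] r'_def p_def)
    qed
  qed
  \<comment> \<open>A uniform limit of continuous functions, because the norms of \<open>v t\<close>
    are bounded on \<open>[0,t0]\<close>.\<close>
  have Hc: "continuous_on {0..t0} H"
  proof (rule uniform_limit_theorem[where f = "\<lambda>m t. ip (v t) (r m t)" and F = sequentially])
    show "\<forall>\<^sub>F m in sequentially. continuous_on {0..t0} (\<lambda>t. ip (v t) (r m t))"
    proof (intro always_eventually allI)
      fix m
      have "continuous_on {0..t0} (\<lambda>t. ip (v t) f + (\<Sum>n<m. t ^ n * ip (v t) (p n)))"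
        by (intro continuous_intros C_H1_pairing_continuous(1)[OF C] fL pL)
      then show "continuous_on {0..t0} (\<lambda>t. ip (v t) (r m t))"
        by (rule continuous_on_eq) (simp add: ip_r vL)
    qed
    obtain N where N: "0 \<le> N" "\<forall>t\<in>{0..t0}. \<bar>L2_norm (v t)\<bar> \<le> N"
      using compact_abs_bound_ex[OF compact_Icc C_H1_pairing_continuous(2)[OF C fL]] by blast
    show "uniform_limit {0..t0} (\<lambda>m t. ip (v t) (r m t)) H sequentially"
      unfolding uniform_limit_iff
    proof safe
      fix e :: real assume e: "0 < e"
      have "0 < e / (N + 1)" using e N by simp
      from approx[OF this] show "\<forall>\<^sub>F m in sequentially. \<forall>t\<in>{0..t0}. dist (ip (v t) (r m t)) (H t) < e"
      proof eventually_elim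
        case (elim m)
        show ?case
        proof
          fix t assume t: "t \<in> {0..t0}"
          have "\<bar>ip (v t) (r m t) - ip (v t) (\<psi> t)\<bar> \<le> L2_norm (v t) * (e / (N + 1))"
            using elim t by (intro ip_diff_le vL rc \<psi>c) auto
          also have "\<dots> \<le> N * (e / (N + 1))"
            using N bspec[OF N(2) t] e by (intro mult_right_mono) auto
          also have "\<dots> < e" using N e by (simp add: field_simps)
          finally show "dist (ip (v t) (r m t)) (H t) < e" by (simp add: dist_real_def H_def)
        qed
      qed
    qed
  qed simp
  \<comment> \<open>The equation H' = -\<gamma> H in weak form, tested with
    \<open>\<eta>\<close>.\<close>
  have weak: "(\<integral>t. (\<eta>' t - \<gamma> * \<eta> t) * H t \<partial>leb 0 t0) = 0" if tf: "test_function 0 t0 \<eta> \<eta>'" for \<eta> \<eta>'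
  proof -
    define F where "F t = (\<eta>' t - \<gamma> * \<eta> t) * H t" for t
    have \<eta>c: "continuous_on S \<eta>" "continuous_on S \<eta>'" for S
      using test_function_continuous[OF tf] by (auto intro: continuous_on_subset)
    have Fi: "integrable (leb 0 t0) F"
      unfolding F_def[abs_def] by (intro continuous_leb_integrable continuous_intros \<eta>c Hc)
    obtain c1 where c1: "0 \<le> c1" "\<forall>t\<in>{0..t0}. \<bar>\<eta> t\<bar> \<le> c1" using compact_abs_bound_ex[OF compact_Icc \<eta>c(1)] by blast
    obtain c2 where c2: "0 \<le> c2" "\<forall>t\<in>{0..t0}. \<bar>\<eta>' t\<bar> \<le> c2" using compact_abs_bound_ex[OF compact_Icc \<eta>c(2)] by blast
    define c where "c = c1 + c2"
    have c: "0 \<le> c" "\<bar>\<eta> t\<bar> \<le> c" "\<bar>\<eta>' t\<bar> \<le> c" if "t \<in> {0..t0}" for t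
      using c1(1) c2(1) bspec[OF c1(2) that] bspec[OF c2(2) that] by (simp_all add: c_def)
    \<comment> \<open>The weak time derivative tested with \<eta> t^n in time and paired with
      \<open>p n\<close> in space; the integral over time is 0.\<close>
    define Fn where "Fn n t = (\<eta>' t * t ^ n + \<eta> t * (real n * t ^ (n - 1))) * ip (v t) (p n) + (\<eta> t * t ^ n) * ip (v' t) (p n)" for n t
    define F0 where "F0 t = \<eta>' t * ip (v t) f + \<eta> t * ip (v' t) f" for t
    define FF where "FF m t = F0 t + (\<Sum>n<m. Fn n t)" for m t
    have Fn: "integrable (leb 0 t0) (Fn n)" "integral\<^sup>L (leb 0 t0) (Fn n) = 0" for n
    proof -
      have "test_function 0 t0 (\<lambda>t. \<eta> t * t ^ n) (\<lambda>t. \<eta>' t * t ^ n + \<eta> t * (real n * t ^ (n - 1)))"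
        by (rule test_function_mult[OF tf]) (auto intro!: derivative_eq_intros continuous_intros)
      from time_weak_deriv_pairing[OF twd this pL[of n]]
      show "integrable (leb 0 t0) (Fn n)" "integral\<^sup>L (leb 0 t0) (Fn n) = 0"
        unfolding Fn_def[abs_def] by simp_all
    qed
    have F0: "integrable (leb 0 t0) F0" "integral\<^sup>L (leb 0 t0) F0 = 0"
      using time_weak_deriv_pairing[OF twd tf fL] unfolding F0_def[abs_def] by simp_all
    have FFi: "integrable (leb 0 t0) (FF m)" and FF0: "integral\<^sup>L (leb 0 t0) (FF m) = 0" for m
      unfolding FF_def[abs_def] using F0 Fn by (simp_all add: Bochner_Integration.integral_sum)
    \<comment> \<open>The truncated integrands \<open>FF m\<close> have integral 0, so the integral
      of \<open>F\<close> is at most its L1 distance from them, which is of order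
      \<open>\<epsilon>\<close>.\<close>
    have close: "\<bar>integral\<^sup>L (leb 0 t0) F\<bar> \<le> \<epsilon> * (2 * c1 + 2 * c2) * integral\<^sup>L (leb 0 t0) G" if \<epsilon>: "0 < \<epsilon>" for \<epsilon>
    proof -
      obtain m where m: "\<forall>t\<in>{0..t0}. \<forall>y\<in>{0..1}. \<bar>r m t y - \<psi> t y\<bar> \<le> \<epsilon> \<and> \<bar>r' m t y - up (Kt t) f y\<bar> \<le> \<epsilon>"
        using eventually_happens'[OF _ approx[OF \<epsilon>]] by auto
      have "integral\<^sup>L (leb 0 t0) F = integral\<^sup>L (leb 0 t0) (\<lambda>t. F t - FF m t)"
        using FF0 by (simp add: Fi FFi)
      also have "\<bar>\<dots>\<bar> \<le> integral\<^sup>L (leb 0 t0) (\<lambda>t. \<bar>F t - FF m t\<bar>)" by (rule integral_abs_bound)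
      also have "\<dots> \<le> integral\<^sup>L (leb 0 t0) (\<lambda>t. \<epsilon> * (2 * c1 + 2 * c2) * G t)"
      proof (rule integral_mono_AE)
        show "integrable (leb 0 t0) (\<lambda>t. \<bar>F t - FF m t\<bar>)" by (intro integrable_abs Bochner_Integration.integrable_diff Fi FFi)
        show "integrable (leb 0 t0) (\<lambda>t. \<epsilon> * (2 * c1 + 2 * c2) * G t)" using Gi by simp
      next
        show "AE t in leb 0 t0. \<bar>F t - FF m t\<bar> \<le> \<epsilon> * (2 * c1 + 2 * c2) * G t"
          using v'L eq AE_space
        proof eventually_elim
          case (elim t)
          then have t: "t \<in> {0..t0}" by simp
          note vt = vL[OF t] and v't = elim(1)
          define N N' where "N = L2_norm (v t)" and "N' = L2_norm (v' t)"
          have b1: "\<bar>ip (v t) (\<psi> t) - ip (v t) (r m t)\<bar> \<le> N * \<epsilon>"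
            unfolding N_def by (rule ip_diff_le[OF vt \<psi>c[OF t] rc]) (use m t in \<open>auto simp: abs_minus_commute\<close>)
          have b2: "\<bar>ip (v t) (up (Kt t) f) - ip (v t) (r' m t)\<bar> \<le> N * \<epsilon>"
            unfolding N_def by (rule ip_diff_le[OF vt uc[OF t] r'c]) (use m t in \<open>auto simp: abs_minus_commute\<close>)
          have b3: "\<bar>ip (v' t) (\<psi> t) - ip (v' t) (r m t)\<bar> \<le> N' * \<epsilon>"
            unfolding N'_def by (rule ip_diff_le[OF v't \<psi>c[OF t] rc]) (use m t in \<open>auto simp: abs_minus_commute\<close>)
          have FF: "FF m t = \<eta>' t * ip (v t) (r m t) + \<eta> t * ip (v t) (r' m t) + \<eta> t * ip (v' t) (r m t)"
            unfolding FF_def F0_def Fn_def ip_r[OF vt] ip_r[OF v't] ip_r'[OF vt]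
            by (simp add: algebra_simps sum.distrib sum_distrib_left)
          have "- \<gamma> * ip (v t) (\<psi> t) = ip (v' t) (\<psi> t) + ip (v t) (up (Kt t) f)"
            using elim(2) by (simp add: \<psi>_def[abs_def])
          then have "\<eta> t * (- \<gamma> * ip (v t) (\<psi> t)) = \<eta> t * (ip (v' t) (\<psi> t) + ip (v t) (up (Kt t) f))"
            by (rule arg_cong)
          then have "F t = \<eta>' t * ip (v t) (\<psi> t) + \<eta> t * ip (v t) (up (Kt t) f) + \<eta> t * ip (v' t) (\<psi> t)"
            by (simp add: F_def H_def algebra_simps)
          then have "F t - FF m t = \<eta>' t * (ip (v t) (\<psi> t) - ip (v t) (r m t)) + \<eta> t * (ip (v t) (up (Kt t) f) - ip (v t) (r' m t))
              + \<eta> t * (ip (v' t) (\<psi> t) - ip (v' t) (r m t))"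
            by (simp add: FF algebra_simps)
          also have "\<bar>\<dots>\<bar> \<le> c2 * (N * \<epsilon>) + c1 * (N * \<epsilon>) + c1 * (N' * \<epsilon>)"
            using bspec[OF c1(2) t] bspec[OF c2(2) t] c1(1) c2(1) b1 b2 b3
            by (intro order_trans[OF abs_triangle_ineq] add_mono) (auto simp: abs_mult intro!: mult_mono)
          also have "\<dots> \<le> c2 * (G t * \<epsilon>) + c1 * (G t * \<epsilon>) + c1 * (G t * \<epsilon>)"
          proof -
            have "N \<le> G t" "N' \<le> G t"
              using sq[of N] sq[of N'] zero_le_power2[of N] zero_le_power2[of N'] unfolding G_def N_def[symmetric] N'_def[symmetric] by linarith+
            then show ?thesis using c1(1) c2(1) \<epsilon> by (intro add_mono mult_left_mono mult_right_mono) auto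
          qed
          also have "\<dots> \<le> \<epsilon> * (2 * c1 + 2 * c2) * G t"
          proof -
            have "0 \<le> c2 * (G t * \<epsilon>)" using c2(1) \<epsilon> by (auto simp: G_def)
            then show ?thesis by (simp add: algebra_simps)
          qed
          finally show ?case .
        qed
      qed
      finally show ?thesis by simp
    qed
    define A where "A = (2 * c1 + 2 * c2) * integral\<^sup>L (leb 0 t0) G"
    have "(\<lambda>n. 1 / real n * A) \<longlonglongrightarrow> 0 * A"
      by (intro tendsto_mult tendsto_const lim_const_over_n)
    moreover have "\<forall>\<^sub>F n in sequentially. \<bar>integral\<^sup>L (leb 0 t0) F\<bar> \<le> 1 / real n * A"
      using eventually_gt_at_top[of 0]
    proof eventually_elim
      case (elim n)
      then show ?case using close[of "1 / real n"] by (simp add: A_def)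
    qed
    ultimately have "\<bar>integral\<^sup>L (leb 0 t0) F\<bar> \<le> 0 * A"
      by (rule tendsto_lowerbound) simp
    then show ?thesis by (simp add: F_def[abs_def])
  qed
  show ?thesis
  proof -
    have "exp (\<gamma> * t) * H t = exp (\<gamma> * 0) * H 0"
    proof (rule constant_from_test_functions[where G = "\<lambda>t. exp (\<gamma> * t) * H t", OF t0])
      show "continuous_on {0..t0} (\<lambda>t. exp (\<gamma> * t) * H t)" by (intro continuous_intros Hc)
      show "(\<integral>t. \<zeta>' t * (exp (\<gamma> * t) * H t) \<partial>leb 0 t0) = 0" if z: "test_function 0 t0 \<zeta> \<zeta>'" for \<zeta> \<zeta>'
      proof -
        \<comment> \<open>For \<eta> = \<zeta> exp(\<gamma> t) the combination \<eta>' - \<gamma>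
          \<eta> reduces to \<zeta>' exp(\<gamma> t).\<close>
        have "test_function 0 t0 (\<lambda>t. \<zeta> t * exp (\<gamma> * t)) (\<lambda>t. \<zeta>' t * exp (\<gamma> * t) + \<zeta> t * (\<gamma> * exp (\<gamma> * t)))"
          by (rule test_function_mult[OF z]) (auto intro!: derivative_eq_intros continuous_intros)
        from weak[OF this] show ?thesis by (simp add: algebra_simps)
      qed
    qed (use t t0 in auto)
    then show ?thesis by (simp add: H_def \<psi>_def[abs_def])
  qed
qed

text \<open>The form in which duality uses a solution. An explicit continuous derivative
  \<open>g\<close> replaces the version chosen by \<open>wderiv\<close>, so that the Neumann law
  becomes a condition on the value \<open>g 1\<close>.\<close>

definition strong_solution :: "real \<Rightarrow> (real \<Rightarrow> real \<Rightarrow> real) \<Rightarrow> bool" where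
  "strong_solution \<theta> v \<longleftrightarrow> C_H1 t0 v \<and> (\<exists>v'. time_weak_deriv t0 v v' \<and> (AE t in leb 0 t0. \<exists>g h. weak_deriv (v t) g \<and>
     continuous_on {0..1} g \<and> weak_deriv g h \<and> v t 0 = 0 \<and> (AE x in leb 0 1. v' t x = h x + a x t * v t x) \<and>
     (\<theta> = 0 \<longrightarrow> v t 1 = - low K t (v t) 1) \<and> (\<theta> = 1/2 \<longrightarrow> g 1 = - K t (1, 1) * v t 1 - low Kx t (v t) 1)))"

text \<open>Depending on \<open>\<theta>\<close>, either \<open>f 1\<close> or \<open>f' 1\<close>
  vanishes, and the feedback law makes the complementary bracket in \<open>adjoint_pairing\<close>
  vanish.\<close>

lemma strong_solution_moment:
  fixes n :: nat
  assumes \<theta>: "\<theta> = 0 \<or> \<theta> = 1/2" and v: "strong_solution \<theta> v" and t: "t \<in> {0..t0}"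
  defines "f \<equiv> heat.Sn \<theta> n"
  shows "exp ((lam + (heat.nu \<theta> n)\<^sup>2) * t) * ip (v t) (\<lambda>y. f y + up (K t) f y) = ip (v 0) (\<lambda>y. f y + up (K 0) f y)"
proof -
  interpret heat \<theta> lam by unfold_locales (use \<theta> lam in auto)
  obtain v' where C: "C_H1 t0 v" and twd: "time_weak_deriv t0 v v'" and ae: "AE t in leb 0 t0. \<exists>g h. weak_deriv (v t) g \<and>
     continuous_on {0..1} g \<and> weak_deriv g h \<and> v t 0 = 0 \<and> (AE x in leb 0 1. v' t x = h x + a x t * v t x) \<and>
     (\<theta> = 0 \<longrightarrow> v t 1 = - low K t (v t) 1) \<and> (\<theta> = 1/2 \<longrightarrow> g 1 = - K t (1, 1) * v t 1 - low Kx t (v t) 1)"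
    using v unfolding strong_solution_def by blast
  have v'L: "AE t in leb 0 t0. v' t \<in> L2_space"
    using twd unfolding time_weak_deriv_def L2_L2_def Bochner_L2_def strongly_measurable_def by (auto elim: eventually_mono)
  define f' where "f' x = nu n * Cs n x" for x
  have f: "(f has_real_derivative f' x) (at x within {0..1})" for x
    unfolding f_def f'_def by (rule Sn_deriv)
  have f': "(f' has_real_derivative - (nu n)\<^sup>2 * f x) (at x within {0..1})" for x
    using DERIV_cmult[OF Cs_deriv[of n x "{0..1}"], of "nu n"] by (simp add: f_def f'_def[abs_def] power2_eq_square mult_ac)
  have fc: "continuous_on {0..1} f" unfolding f_def by (rule Sn_continuous)
  show ?thesis
  proof (rule moment_evolution[OF fc _ C twd _ t])
    show "\<bar>f x\<bar> \<le> 1" for x unfolding f_def by (rule Sn_abs)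
    show "AE t in leb 0 t0. ip (v' t) (\<lambda>y. f y + up (K t) f y) + ip (v t) (up (Kt t) f) = - (lam + (nu n)\<^sup>2) * ip (v t) (\<lambda>y. f y + up (K t) f y)"
      using ae v'L AE_space
    proof eventually_elim
      case (elim t)
      then have t: "t \<in> {0..t0}" by simp
      obtain g h where g: "weak_deriv (v t) g" "continuous_on {0..1} g" "weak_deriv g h" and v0: "v t 0 = 0"
        and eq: "AE x in leb 0 1. v' t x = h x + a x t * v t x"
        and D: "\<theta> = 0 \<Longrightarrow> v t 1 = - low K t (v t) 1" and N: "\<theta> = 1/2 \<Longrightarrow> g 1 = - K t (1, 1) * v t 1 - low Kx t (v t) 1"
        using elim(1) by blast
      have vc: "continuous_on {0..1} (v t)" using C t by (auto simp: C_H1_def H1_space_def)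
      show ?case
      proof (rule adjoint_pairing[OF t f f' _ vc g(1) g(2,3) v0 elim(2) eq])
        show "f 0 = 0" by (simp add: f_def Sn_def)
        show "f 1 * (g 1 + K t (1, 1) * v t 1 + low Kx t (v t) 1) = f' 1 * (v t 1 + low K t (v t) 1)"
          using \<theta>
        proof
          assume th: "\<theta> = 0"
          have "f 1 = 0" unfolding f_def by (rule Sn_one[OF th])
          then show ?thesis using D[OF th] by simp
        next
          assume th: "\<theta> = 1/2"
          have "f' 1 = 0" unfolding f'_def by (simp only: Cs_one[OF th])
          then show ?thesis using N[OF th] by simp
        qed
      qed
    qed
  qed
qed

text \<open>By the adjoint relation the moments of the difference \<open>e\<close> are the sine
  coefficients of \<open>e + K e\<close>. They vanish, so completeness gives
  \<open>e + K e = 0\<close>, and Gronwall's bound with right-hand side 0 gives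
  \<open>e = 0\<close>.\<close>

theorem strong_solution_unique:
  assumes \<theta>: "\<theta> = 0 \<or> \<theta> = 1/2" and u: "strong_solution \<theta> u" and v: "strong_solution \<theta> v"
    and init: "\<And>x. x \<in> {0..1} \<Longrightarrow> v 0 x = u 0 x" and t: "t \<in> {0..t0}" and x: "x \<in> {0..1}"
  shows "v t x = u t x"
proof -
  interpret heat \<theta> lam by unfold_locales (use \<theta> lam in auto)
  have H1: "continuous_on {0..1} (w t)" "w t \<in> L2_space" if "strong_solution \<theta> w" "t \<in> {0..t0}" for w t
    using that by (auto simp: strong_solution_def C_H1_def H1_space_def dest: weak_deriv_L2)
  define e where "e x = v t x - u t x" for x
  have ec: "continuous_on {0..1} e" unfolding e_def[abs_def] by (intro continuous_intros H1 u v t)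
  note Kc = kernel_at_time(1)[OF t]
  have lc: "continuous_on {0..1} (low K t e)" by (rule low_continuous[OF K_cont t ec])
  have z: "e x + low K t e x = 0" if x: "x \<in> {0..1}" for x
  proof (rule Sn_complete[OF _ _ x])
    show "continuous_on {0..1} (\<lambda>x. e x + low K t e x)" by (intro continuous_intros ec lc)
    fix n
    define f where "f = Sn n"
    define \<psi> where "\<psi> t y = f y + up (K t) f y" for t y
    have fc: "continuous_on {0..1} f" unfolding f_def by (rule Sn_continuous)
    have uc: "continuous_on {0..1} (up (K t) f)" by (rule up_continuous[OF Kc fc])
    have \<psi>L: "\<psi> t \<in> L2_space" unfolding \<psi>_def[abs_def] by (intro continuous_L2 continuous_intros fc uc)
    have "ip (v 0) (\<psi> 0) = ip (u 0) (\<psi> 0)"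
      unfolding ip_def by (rule Bochner_Integration.integral_cong) (use init in auto)
    then have "exp (gam n * t) * ip (v t) (\<psi> t) = exp (gam n * t) * ip (u t) (\<psi> t)"
      using strong_solution_moment[OF \<theta> u t, of n] strong_solution_moment[OF \<theta> v t, of n]
      by (simp add: \<psi>_def[abs_def] f_def gam_def)
    then have "ip (v t) (\<psi> t) = ip (u t) (\<psi> t)" by simp
    then have "ip e (\<psi> t) = 0"
      unfolding e_def[abs_def] using ip_diff_left[OF H1(2)[OF v t] H1(2)[OF u t] \<psi>L] by simp
    moreover have "ip e (\<psi> t) = ip e f + ip e (up (K t) f)"
      unfolding \<psi>_def[abs_def] by (intro ip_add_right continuous_L2 fc uc ec)
    moreover have "ip e (up (K t) f) = ip (low K t e) f"
      unfolding up_def[abs_def] low_def[abs_def] by (rule triangle_Fubini(2)[OF Kc ec fc])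
    moreover have "ip (\<lambda>x. e x + low K t e x) f = ip e f + ip (low K t e) f"
      by (intro ip_add_left continuous_L2 ec lc fc)
    ultimately show "ip (\<lambda>x. e x + low K t e x) (Sn n) = 0" by (simp add: f_def)
  qed
  obtain B where B: "\<And>z. z \<in> \<Omega> \<Longrightarrow> \<bar>K t z\<bar> \<le> B"
    using compact_abs_bound_ex[OF compact_Omega Kc] by blast
  have "\<bar>e x\<bar> \<le> 0 * exp B"
    by (rule Volterra_sup_bound[OF Kc B ec _ x]) (use z in \<open>simp_all add: low_def\<close>)
  then show ?thesis by (simp add: e_def)
qed

end

section \<open>The closed loop\<close>

definition law_angle :: "feedback \<Rightarrow> real" where
  "law_angle law = (case law of Dirichlet \<Rightarrow> 0 | Neumann \<Rightarrow> 1/2)"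

lemma law_angle_cases: "law_angle law = 0 \<or> law_angle law = 1/2"
  by (cases law) (auto simp: law_angle_def)

lemma law_angle_eq: "law_angle law = 0 \<longleftrightarrow> law = Dirichlet" "law_angle law = 1/2 \<longleftrightarrow> law = Neumann"
  by (cases law; simp add: law_angle_def)+

text \<open>A trace is the value of some continuous version of the derivative, and two continuous
  versions agree on all of \<open>[0,1]\<close>. This turns the Neumann law into the condition on
  \<open>g 1\<close>.\<close>

lemma closed_loop_strong_solution:
  assumes bk: "backstepping_kernel lam t0 a (kernel_at k) (\<lambda>t. D1 \<Omega> (kernel_at k t)) Ky Kxx Kyy Kt Kn"
    and v: "closed_loop_solution law a k t0 u0 v"
  shows "backstepping_kernel.strong_solution t0 a (kernel_at k) (\<lambda>t. D1 \<Omega> (kernel_at k t)) (law_angle law) v"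
proof -
  interpret backstepping_kernel lam t0 a "kernel_at k" "\<lambda>t. D1 \<Omega> (kernel_at k t)" Ky Kxx Kyy Kt Kn by (rule bk)
  obtain v' where C: "C_H1 t0 v" and H2: "L2_H2 t0 v" and twd: "time_weak_deriv t0 v v'"
    and eq: "AE t in leb 0 t0. AE x in leb 0 1. v' t x = wderiv (wderiv (v t)) x + a x t * v t x"
    and bc: "AE t in leb 0 t0. v t 0 = 0 \<and> feedback_law law k t (v t)"
    using v unfolding closed_loop_solution_def by blast
  have vH2: "AE t in leb 0 t0. v t \<in> H2_space"
    using H2 unfolding L2_H2_def Bochner_L2_def strongly_measurable_def by (auto elim: eventually_mono)
  show ?thesis
    unfolding strong_solution_def
  proof (intro conjI C exI[of _ v'] twd)
    show "AE t in leb 0 t0. \<exists>g h. weak_deriv (v t) g \<and>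
      continuous_on {0..1} g \<and> weak_deriv g h \<and> v t 0 = 0 \<and> (AE x in leb 0 1. v' t x = h x + a x t * v t x) \<and>
      (law_angle law = 0 \<longrightarrow> v t 1 = - low (kernel_at k) t (v t) 1) \<and>
      (law_angle law = 1/2 \<longrightarrow> g 1 = - kernel_at k t (1, 1) * v t 1 - low (\<lambda>t. D1 \<Omega> (kernel_at k t)) t (v t) 1)"
      using eq bc vH2
    proof eventually_elim
      case (elim t)
      obtain g h where g: "weak_deriv (v t) g" "continuous_on {0..1} g" "weak_deriv g h"
        using elim(3) unfolding H2_space_def H1_space_def by blast
      have AE: "AE x in leb 0 1. v' t x = h x + a x t * v t x"
        using elim(1) wderiv2_eq[OF g(1,3)] by eventually_elim simp
      have D: "law_angle law = 0 \<longrightarrow> v t 1 = - low (kernel_at k) t (v t) 1"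
        using elim(2) by (auto simp: law_angle_eq dirichlet_feedback_def low_def kernel_at_def)
      have N: "g 1 = - kernel_at k t (1, 1) * v t 1 - low (\<lambda>t. D1 \<Omega> (kernel_at k t)) t (v t) 1" if "law_angle law = 1/2"
      proof -
        have "has_trace (wderiv (v t)) 1 (neumann_feedback k t (v t))"
          using elim(2) that[THEN law_angle_eq(2)[THEN iffD1]] by simp
        then obtain g' where g': "continuous_on {0..1} g'" "AE x in leb 0 1. wderiv (v t) x = g' x" "g' 1 = neumann_feedback k t (v t)"
          unfolding has_trace_def by blast
        have "AE x in leb 0 1. g x = g' x" using g'(2) wderiv_eq(2)[OF g(1)] by eventually_elim simp
        then have "g 1 = g' 1" by (rule AE_continuous_eq[OF g(2) g'(1)]) simp
        then show ?thesis using g'(3) by (simp add: neumann_feedback_def low_def kernel_at_def)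
      qed
      show ?case using g elim(2) AE D N by blast
    qed
  qed
qed

text \<open>At positive times the classical derivatives are weak derivatives, so they can stand in
  for \<open>wderiv\<close> in the equation, in the trace and in the norm.\<close>

lemma classical_closed_loop_solution:
  assumes bk: "backstepping_kernel lam t0 a (kernel_at k) (\<lambda>t. D1 \<Omega> (kernel_at k t)) Ky Kxx Kyy Kt Kn"
    and u: "backstepping_kernel.classical_solution t0 a (kernel_at k) (\<lambda>t. D1 \<Omega> (kernel_at k t)) (law_angle law) u0 u0' u ux uxx"
    and u0: "weak_deriv u0 u0'"
    and D: "\<And>t. t \<in> {0<..t0} \<Longrightarrow> sqrt ((L2_norm (u t))\<^sup>2 + (L2_norm (ux t))\<^sup>2) \<le> D"
  shows "closed_loop_solution law a k t0 u0 u"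
    and "t \<in> {0<..t0} \<Longrightarrow> H1_norm (u t) = sqrt ((L2_norm (u t))\<^sup>2 + (L2_norm (ux t))\<^sup>2)"
proof -
  interpret backstepping_kernel lam t0 a "kernel_at k" "\<lambda>t. D1 \<Omega> (kernel_at k t)" Ky Kxx Kyy Kt Kn by (rule bk)
  have uxc: "continuous_on ({0<..t0} \<times> {0..1}) (\<lambda>w. ux (fst w) (snd w))"
    and uxxc: "continuous_on ({0<..t0} \<times> {0..1}) (\<lambda>w. uxx (fst w) (snd w))"
    and ud: "\<And>t x. t \<in> {0<..t0} \<Longrightarrow> x \<in> {0..1} \<Longrightarrow> (u t has_real_derivative ux t x) (at x within {0..1})"
    and uxd: "\<And>t x. t \<in> {0<..t0} \<Longrightarrow> x \<in> {0..1} \<Longrightarrow> (ux t has_real_derivative uxx t x) (at x within {0..1})"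
    and ui: "\<And>x. x \<in> {0..1} \<Longrightarrow> u 0 x = u0 x" and u00: "\<And>t. t \<in> {0..t0} \<Longrightarrow> u t 0 = 0"
    and uD: "\<And>t. law_angle law = 0 \<Longrightarrow> t \<in> {0..t0} \<Longrightarrow> u t 1 = - low (kernel_at k) t (u t) 1"
    and uN: "\<And>t. law_angle law = 1/2 \<Longrightarrow> t \<in> {0<..t0} \<Longrightarrow> ux t 1 = - kernel_at k t (1, 1) * u t 1 - low (\<lambda>t. D1 \<Omega> (kernel_at k t)) t (u t) 1"
    using u unfolding classical_solution_def by auto
  have c1: "continuous_on {0..1} (ux t)" and c2: "continuous_on {0..1} (uxx t)" if "t \<in> {0<..t0}" for t
    by (rule continuous_on_section[OF uxc that order_refl] continuous_on_section[OF uxxc that order_refl])+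
  have w1: "weak_deriv (u t) (ux t)" if "t \<in> {0<..t0}" for t
    by (rule weak_deriv_classical[OF ud[OF that] c1[OF that]])
  have w2: "weak_deriv (ux t) (uxx t)" if "t \<in> {0<..t0}" for t
    by (rule weak_deriv_classical[OF uxd[OF that] c2[OF that]])
  show "H1_norm (u t) = sqrt ((L2_norm (u t))\<^sup>2 + (L2_norm (ux t))\<^sup>2)" if "t \<in> {0<..t0}"
    by (rule H1_norm_eq[OF w1[OF that]])
  note reg = classical_solution_regular[OF u u0 D]
  have pde: "AE t in leb 0 t0. AE x in leb 0 1. uxx t x + a x t * u t x = wderiv (wderiv (u t)) x + a x t * u t x"
    using AE_space
  proof eventually_elim
    case (elim t)
    then have "t \<in> {0<..t0}" by simp
    from wderiv2_eq[OF w1[OF this] w2[OF this]] show ?case by eventually_elim simp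
  qed
  have bc: "AE t in leb 0 t0. u t 0 = 0 \<and> feedback_law law k t (u t)"
    using AE_space
  proof eventually_elim
    case (elim t)
    then have t: "t \<in> {0<..t0}" by simp
    have "feedback_law law k t (u t)"
    proof (cases law)
      case Dirichlet
      then have "law_angle law = 0" by (simp add: law_angle_eq)
      from uD[OF this, of t] show ?thesis using t by (simp add: Dirichlet dirichlet_feedback_def low_def kernel_at_def)
    next
      case Neumann
      then have "law_angle law = 1/2" by (rule law_angle_eq(2)[THEN iffD2])
      from uN[OF this t] have "ux t 1 = neumann_feedback k t (u t)" by (simp add: neumann_feedback_def low_def kernel_at_def)
      then show ?thesis using c1[OF t] wderiv_eq(2)[OF w1[OF t]] unfolding Neumann has_trace_def feedback_law.simps by blast
    qed
    then show ?case using u00[of t] t by simp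
  qed
  show "closed_loop_solution law a k t0 u0 u"
    unfolding closed_loop_solution_def using reg pde bc ui by blast
qed

theorem theorem2p1:
  fixes lam t\<^sub>0 :: real
    and a :: "real \<Rightarrow> real \<Rightarrow> real"
    and k :: "real \<Rightarrow> real \<Rightarrow> real \<Rightarrow> real"
    and law :: feedback
  assumes "lam > 0"
    and "analytic_coefficient a"
    and "kernel_solution lam a k"
    and "0 < t\<^sub>0" and "t\<^sub>0 < 1"
  shows "\<exists>M>0. \<forall>u\<^sub>0. u\<^sub>0 \<in> H1_space \<and> compatible law k u\<^sub>0 \<longrightarrow>
           (\<exists>u. closed_loop_solution law a k t\<^sub>0 u\<^sub>0 u \<and>
                (\<forall>v. closed_loop_solution law a k t\<^sub>0 u\<^sub>0 v \<longrightarrow>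
                   (\<forall>t\<in>{0..t\<^sub>0}. \<forall>x\<in>{0..1}. v t x = u t x)) \<and>
                (\<forall>t\<in>{0<..<t\<^sub>0}. H1_norm (u t) \<le> M * H1_norm u\<^sub>0 * exp (- lam * t)))"
proof -
  obtain Kt Kn where bk: "backstepping_kernel lam t\<^sub>0 a (kernel_at k) (\<lambda>t. D1 \<Omega> (kernel_at k t)) (\<lambda>t. D2 \<Omega> (kernel_at k t))
    (\<lambda>t. D1 \<Omega> (D1 \<Omega> (kernel_at k t))) (\<lambda>t. D2 \<Omega> (D2 \<Omega> (kernel_at k t))) Kt Kn"
    by (rule kernel_solution_backstepping_kernel[OF assms])
  interpret backstepping_kernel lam t\<^sub>0 a "kernel_at k" "\<lambda>t. D1 \<Omega> (kernel_at k t)" "\<lambda>t. D2 \<Omega> (kernel_at k t)"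
    "\<lambda>t. D1 \<Omega> (D1 \<Omega> (kernel_at k t))" "\<lambda>t. D2 \<Omega> (D2 \<Omega> (kernel_at k t))" Kt Kn by (rule bk)
  \<comment> \<open>The constant is obtained before the initial value is fixed, which is its claimed
    independence.\<close>
  obtain M where M: "0 < M" "\<And>u0 u0'. continuous_on {0..1} u0 \<Longrightarrow> weak_deriv u0 u0' \<Longrightarrow> u0 0 = 0 \<Longrightarrow>
      (law_angle law = 0 \<longrightarrow> u0 1 = - low (kernel_at k) 0 u0 1) \<Longrightarrow>
    \<exists>u ux uxx. classical_solution (law_angle law) u0 u0' u ux uxx \<and>
      (\<forall>t\<in>{0<..t\<^sub>0}. sqrt ((L2_norm (u t))\<^sup>2 + (L2_norm (ux t))\<^sup>2) \<le> M * exp (- lam * t) * sqrt ((L2_norm u0)\<^sup>2 + (L2_norm u0')\<^sup>2))"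
    using classical_solution_exists[OF law_angle_cases[of law]] by blast
  show ?thesis
  proof (intro exI[of _ M] conjI M(1) allI impI)
    fix u\<^sub>0 assume u0: "u\<^sub>0 \<in> H1_space \<and> compatible law k u\<^sub>0"
    then obtain u0' where w0: "weak_deriv u\<^sub>0 u0'" and c0: "continuous_on {0..1} u\<^sub>0" by (auto simp: H1_space_def)
    have N0: "H1_norm u\<^sub>0 = sqrt ((L2_norm u\<^sub>0)\<^sup>2 + (L2_norm u0')\<^sup>2)" by (rule H1_norm_eq[OF w0])
    have z0: "u\<^sub>0 0 = 0" using u0 by (cases law) auto
    have d0: "law_angle law = 0 \<longrightarrow> u\<^sub>0 1 = - low (kernel_at k) 0 u\<^sub>0 1"
      using u0 by (auto simp: law_angle_eq dirichlet_feedback_def low_def kernel_at_def)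
    obtain u ux uxx where cs: "classical_solution (law_angle law) u\<^sub>0 u0' u ux uxx"
      and bd: "\<And>t. t \<in> {0<..t\<^sub>0} \<Longrightarrow> sqrt ((L2_norm (u t))\<^sup>2 + (L2_norm (ux t))\<^sup>2) \<le> M * exp (- lam * t) * H1_norm u\<^sub>0"
      using M(2)[OF c0 w0 z0 d0] unfolding N0 by blast
    \<comment> \<open>A bound free of \<open>t\<close>, as the regularity result asks for.\<close>
    have D: "sqrt ((L2_norm (u t))\<^sup>2 + (L2_norm (ux t))\<^sup>2) \<le> M * H1_norm u\<^sub>0" if t: "t \<in> {0<..t\<^sub>0}" for t
    proof -
      have "M * exp (- lam * t) * H1_norm u\<^sub>0 \<le> M * 1 * H1_norm u\<^sub>0"
        using M(1) t assms(1) by (intro mult_right_mono mult_left_mono) (auto simp: H1_norm_def)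
      then show ?thesis using bd[OF t] by simp
    qed
    note sol = classical_closed_loop_solution[OF bk cs w0 D]
    have uni: "v t x = u t x" if v: "closed_loop_solution law a k t\<^sub>0 u\<^sub>0 v" and tx: "t \<in> {0..t\<^sub>0}" "x \<in> {0..1}" for v t x
    proof (rule strong_solution_unique[OF law_angle_cases closed_loop_strong_solution[OF bk sol(1)] closed_loop_strong_solution[OF bk v] _ tx])
      show "v 0 x = u 0 x" if "x \<in> {0..1}" for x
        using v sol(1) that by (simp add: closed_loop_solution_def)
    qed
    have "H1_norm (u t) \<le> M * H1_norm u\<^sub>0 * exp (- lam * t)" if "t \<in> {0<..<t\<^sub>0}" for t
      using bd[of t] sol(2)[of t] that by (simp add: mult_ac)
    then show "\<exists>u. closed_loop_solution law a k t\<^sub>0 u\<^sub>0 u \<and>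
                (\<forall>v. closed_loop_solution law a k t\<^sub>0 u\<^sub>0 v \<longrightarrow>
                   (\<forall>t\<in>{0..t\<^sub>0}. \<forall>x\<in>{0..1}. v t x = u t x)) \<and>
                (\<forall>t\<in>{0<..<t\<^sub>0}. H1_norm (u t) \<le> M * H1_norm u\<^sub>0 * exp (- lam * t))"
      using sol(1) uni by blast
  qed
qed

end
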